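(* Let $R$ be a semisimple ring and let $(A,C)$ be a Koszul pair, where $A$ is a graded, connected, left locally finite $R$-ring and $C$ is a graded, connected, left locally finite $R$-coring. Then there is an isomorphism of graded rings $$\mathscr{E}(A)=\mathrm{Ext}_A^\bullet(R,R)\;\simeq\;E({}^{*\text{-gr}}A),$$ where ${}^{*\text{-gr}}A$ is the left graded dual of $A$.
   Context: Unadorned tensor products are over $R$. An $R$-ring (resp. $R$-coring) is an algebra (resp. coalgebra) in the tensor category of $R$-bimodules. A graded $R$-ring $A=\bigoplus_{n\ge0}A^n$ is connected if $A^0=R$; a graded $R$-coring $C=\bigoplus_{n\ge0}C_n$ is connected if $C_0=R$. They are left locally finite if every homogeneous component is finitely generated as a left $R$-module. Components of multiplication and comultiplication are $\mu^{m,n}:A^m\otimes A^n\to A^{m+n}$ and $\Delta_{m,n}:C_{m+n}\to C_m\otimes C_n$, $\Delta_{m,n}(c)=\sum c_{1,m}\otimes c_{2,n}$. Put $A_+=\bigoplus_{n>0}A^n$; $A_+^{(n)}$ is its $n$-fold tensor power over $R$ (with $A_+^{(0)}=R$). Almost Koszul pair: a pair $(A,C)$ consisting of a graded, connected $R$-ring $A$ and a graded, connected $R$-coring $C$, with an isomorphism of $R$-bimodules $\theta:C_1\to A^1$ such that $\mu^{1,1}\circ(\theta\otimes\theta)\circ\Delta_{1,1}:C_2\to A^2$ is zero. Koszul pair: an almost Koszul pair for which the complex of left $A$-modules $\cdots\to A\otimes C_1\to A\otimes C_0\to R\to0$ is exact, where $d_0(a\otimes c)=\pi_A^0(a)c$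 ($\pi_A^0:A\to A^0=R$ the projection) and $d_n(a\otimes c)=\sum a\,\theta(c_{1,1})\otimes c_{2,n-1}$ for $n\ge1$. $\mathscr{E}(A)=\mathrm{Ext}^\bullet_A(R,R)$ (Ext of left $A$-modules) is the cohomology of $\mathrm{Hom}_R(\Omega_\bullet(A),R)$ (left $R$-linear maps), where $\Omega_n(A)=A_+^{(n)}$ with $d_1=0$, $d_n(a_1\otimes\cdots\otimes a_n)=\sum_{i=1}^{n-1}(-1)^{i-1}a_1\otimes\cdots\otimes a_ia_{i+1}\otimes\cdots\otimes a_n$; its cup product is induced by $(f\cup g)(a_1\otimes\cdots\otimes a_{n+m})=f\big(a_1\otimes\cdots\otimes a_n\,g(a_{n+1}\otimes\cdots\otimes a_{n+m})\big)$. Graded dual of $A$: ${}^{*\text{-gr}}A=\bigoplus_n{}^*(A^n)$, ${}^*(A^n)=\mathrm{Hom}_R({}_RA^n,{}_RR)$ (left $R$-linear maps), an $R^{op}$-bimodule via the $R$-actions $(rf)(v)=f(vr)$, $(fr)(v)=f(v)r$. It is a connected graded $R^{op}$-coring: $\Delta_{n,m}$ is the transpose of $\mu^{n,m}$ followed by the inverse of the isomorphism ${}^*(A^n)\otimes_{R^{op}}{}^*(A^m)\to{}^*(A^n\otimes A^m)$, $\alpha\otimes\beta\mapsto(v\otimes w\mapsto\alpha(v\beta(w)))$. For a connected graded $S$-coring $D$ ($S$ semisimple), $E(D)=\mathrm{Ext}_D^\bullet(S,S)$ is the cohomology of the complex with terms $\Omega^n(D)=D_+^{(n)}$ (tensor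 powers over $S$), $D_+=D/D_0$, $d^0=0$, $d^n=\sum_{i=1}^n(-1)^{i-1}\mathrm{Id}\otimes\Delta_+\otimes\mathrm{Id}$ ($\Delta_+:D_+\to D_+\otimes_SD_+$ induced by $\Delta$ and applied in position $i$); it is a connected graded $S$-ring under concatenation of tensors. Here $S=R^{op}$, $D={}^{*\text{-gr}}A$. *)

theory Defs
  imports "HOL-Algebra.Module" "HOL-Algebra.QuotRing" "HOL-Algebra.Free_Abelian_Groups"
begin

section \<open>Rings, modules and bimodules over a noncommutative ring\<close>

definition op_ring :: "('r, 'x) ring_scheme \<Rightarrow> ('r, 'x) ring_scheme" where
  "op_ring R = R\<lparr>monoid.mult := (\<lambda>r s. s \<otimes>\<^bsub>R\<^esub> r)\<rparr>"

text \<open>As for the library's record of modules, the ring fields \<open>mult\<close> and \<open>one\<close> are present in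
  every bimodule but carry meaning only for \<open>R\<close>-rings.\<close>

record ('r, 'm) bimodule = "('r, 'm) module" +
  rsmult :: "'m \<Rightarrow> 'r \<Rightarrow> 'm" (infixl \<open>\<triangleleft>\<index>\<close> 70)

text \<open>The library locale \<open>module\<close> requires a commutative ring of scalars, so modules over a
  general ring are introduced here. The library locale \<open>submodule\<close> has no such restriction.\<close>

locale left_module = R?: ring R + M?: abelian_group M
  for R :: "('r, 'x) ring_scheme" (structure) and M :: "('r, 'm, 'y) module_scheme" (structure) +
  assumes smult_closed:
      "\<lbrakk>r \<in> carrier R; x \<in> carrier M\<rbrakk> \<Longrightarrow> r \<odot>\<^bsub>M\<^esub> x \<in> carrier M"
    and smult_l_distr:
      "\<lbrakk>r \<in> carrier R; s \<in> carrier R; x \<in> carrier M\<rbrakk> \<Longrightarrow>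
        (r \<oplus>\<^bsub>R\<^esub> s) \<odot>\<^bsub>M\<^esub> x = r \<odot>\<^bsub>M\<^esub> x \<oplus>\<^bsub>M\<^esub> s \<odot>\<^bsub>M\<^esub> x"
    and smult_r_distr:
      "\<lbrakk>r \<in> carrier R; x \<in> carrier M; y \<in> carrier M\<rbrakk> \<Longrightarrow>
        r \<odot>\<^bsub>M\<^esub> (x \<oplus>\<^bsub>M\<^esub> y) = r \<odot>\<^bsub>M\<^esub> x \<oplus>\<^bsub>M\<^esub> r \<odot>\<^bsub>M\<^esub> y"
    and smult_assoc:
      "\<lbrakk>r \<in> carrier R; s \<in> carrier R; x \<in> carrier M\<rbrakk> \<Longrightarrow>
        (r \<otimes>\<^bsub>R\<^esub> s) \<odot>\<^bsub>M\<^esub> x = r \<odot>\<^bsub>M\<^esub> (s \<odot>\<^bsub>M\<^esub> x)"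
    and smult_one:
      "x \<in> carrier M \<Longrightarrow> \<one>\<^bsub>R\<^esub> \<odot>\<^bsub>M\<^esub> x = x"

locale bimodule = left_module R M
  for R :: "('r, 'x) ring_scheme" (structure) and M :: "('r, 'm, 'y) bimodule_scheme" (structure) +
  assumes rsmult_closed:
      "\<lbrakk>r \<in> carrier R; x \<in> carrier M\<rbrakk> \<Longrightarrow> x \<triangleleft>\<^bsub>M\<^esub> r \<in> carrier M"
    and rsmult_r_distr:
      "\<lbrakk>r \<in> carrier R; s \<in> carrier R; x \<in> carrier M\<rbrakk> \<Longrightarrow>
        x \<triangleleft>\<^bsub>M\<^esub> (r \<oplus>\<^bsub>R\<^esub> s) = x \<triangleleft>\<^bsub>M\<^esub> r \<oplus>\<^bsub>M\<^esub> x \<triangleleft>\<^bsub>M\<^esub> s"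
    and rsmult_l_distr:
      "\<lbrakk>r \<in> carrier R; x \<in> carrier M; y \<in> carrier M\<rbrakk> \<Longrightarrow>
        (x \<oplus>\<^bsub>M\<^esub> y) \<triangleleft>\<^bsub>M\<^esub> r = x \<triangleleft>\<^bsub>M\<^esub> r \<oplus>\<^bsub>M\<^esub> y \<triangleleft>\<^bsub>M\<^esub> r"
    and rsmult_assoc:
      "\<lbrakk>r \<in> carrier R; s \<in> carrier R; x \<in> carrier M\<rbrakk> \<Longrightarrow>
        x \<triangleleft>\<^bsub>M\<^esub> (r \<otimes>\<^bsub>R\<^esub> s) = (x \<triangleleft>\<^bsub>M\<^esub> r) \<triangleleft>\<^bsub>M\<^esub> s"
    and rsmult_one:
      "x \<in> carrier M \<Longrightarrow> x \<triangleleft>\<^bsub>M\<^esub> \<one>\<^bsub>R\<^esub> = x"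
    and smult_rsmult:
      "\<lbrakk>r \<in> carrier R; s \<in> carrier R; x \<in> carrier M\<rbrakk> \<Longrightarrow>
        (r \<odot>\<^bsub>M\<^esub> x) \<triangleleft>\<^bsub>M\<^esub> s = r \<odot>\<^bsub>M\<^esub> (x \<triangleleft>\<^bsub>M\<^esub> s)"

definition regular :: "('r, 'x) ring_scheme \<Rightarrow> ('r, 'r) bimodule" where
  "regular R = \<lparr>carrier = carrier R, monoid.mult = monoid.mult R, one = one R,
     ring.zero = ring.zero R, ring.add = ring.add R,
     smult = monoid.mult R, rsmult = monoid.mult R\<rparr>"

definition left_linear ::
  "('r, 'x) ring_scheme \<Rightarrow> ('r, 'm, 'y) module_scheme \<Rightarrow> ('r, 'n, 'z) module_scheme \<Rightarrow>
    ('m \<Rightarrow> 'n) \<Rightarrow> bool" where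
  "left_linear R M N f \<longleftrightarrow>
     f \<in> carrier M \<rightarrow> carrier N \<and>
     (\<forall>x\<in>carrier M. \<forall>y\<in>carrier M. f (x \<oplus>\<^bsub>M\<^esub> y) = f x \<oplus>\<^bsub>N\<^esub> f y) \<and>
     (\<forall>r\<in>carrier R. \<forall>x\<in>carrier M. f (r \<odot>\<^bsub>M\<^esub> x) = r \<odot>\<^bsub>N\<^esub> f x)"

definition bimodule_hom ::
  "('r, 'x) ring_scheme \<Rightarrow> ('r, 'm, 'y) bimodule_scheme \<Rightarrow> ('r, 'n, 'z) bimodule_scheme \<Rightarrow>
    ('m \<Rightarrow> 'n) \<Rightarrow> bool" where
  "bimodule_hom R M N f \<longleftrightarrow> left_linear R M N f \<and>
     (\<forall>r\<in>carrier R. \<forall>x\<in>carrier M. f (x \<triangleleft>\<^bsub>M\<^esub> r) = f x \<triangleleft>\<^bsub>N\<^esub> r)"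

definition bimodule_iso ::
  "('r, 'x) ring_scheme \<Rightarrow> ('r, 'm, 'y) bimodule_scheme \<Rightarrow> ('r, 'n, 'z) bimodule_scheme \<Rightarrow>
    ('m \<Rightarrow> 'n) \<Rightarrow> bool" where
  "bimodule_iso R M N f \<longleftrightarrow> bimodule_hom R M N f \<and> bij_betw f (carrier M) (carrier N)"

definition finitely_generated ::
  "('r, 'x) ring_scheme \<Rightarrow> ('r, 'm, 'y) module_scheme \<Rightarrow> bool" where
  "finitely_generated R M \<longleftrightarrow> (\<exists>X. finite X \<and> X \<subseteq> carrier M \<and>
     (\<forall>m\<in>carrier M. \<exists>c\<in>X \<rightarrow> carrier R. m = (\<Oplus>\<^bsub>M\<^esub>x\<in>X. c x \<odot>\<^bsub>M\<^esub> x)))"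

definition simple_submodule ::
  "('r, 'x) ring_scheme \<Rightarrow> ('r, 'm, 'y) module_scheme \<Rightarrow> 'm set \<Rightarrow> bool" where
  "simple_submodule R M N \<longleftrightarrow> submodule N R M \<and> N \<noteq> {\<zero>\<^bsub>M\<^esub>} \<and>
     (\<forall>K. submodule K R M \<and> K \<subseteq> N \<longrightarrow> K = {\<zero>\<^bsub>M\<^esub>} \<or> K = N)"

definition semisimple_module ::
  "('r, 'x) ring_scheme \<Rightarrow> ('r, 'm, 'y) module_scheme \<Rightarrow> bool" where
  "semisimple_module R M \<longleftrightarrow>
     generate (add_monoid M) (\<Union>{N. simple_submodule R M N}) = carrier M"

definition semisimple_ring :: "('r, 'x) ring_scheme \<Rightarrow> bool" where
  "semisimple_ring R \<longleftrightarrow> ring R \<and> semisimple_module R (regular R)"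

text \<open>The quotient of a bimodule by a sub-bimodule; for a coset \<open>X = N + x\<close> the set
  \<open>N + r X\<close> is the coset of \<open>r x\<close>.\<close>

definition quot_bimodule ::
  "('r, 'm, 'x) bimodule_scheme \<Rightarrow> 'm set \<Rightarrow> ('r, 'm set) bimodule" where
  "quot_bimodule M N = \<lparr>carrier = a_rcosets\<^bsub>M\<^esub> N, monoid.mult = undefined, one = undefined,
     ring.zero = N, ring.add = (\<lambda>X Y. X <+>\<^bsub>M\<^esub> Y),
     smult = (\<lambda>r X. N <+>\<^bsub>M\<^esub> (\<lambda>x. r \<odot>\<^bsub>M\<^esub> x) ` X),
     rsmult = (\<lambda>X r. N <+>\<^bsub>M\<^esub> (\<lambda>x. x \<triangleleft>\<^bsub>M\<^esub> r) ` X)\<rparr>"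

text \<open>For an \<open>R\<close>-bimodule \<open>M\<close>, the group \<open>{}\<^sup>*M = Hom\<^sub>R(\<^sub>RM, \<^sub>RR)\<close>
  with its structure of \<open>R\<^sup>o\<^sup>p\<close>-bimodule:
  the left action of \<open>s \<in> R\<^sup>o\<^sup>p\<close> is \<open>v \<mapsto> f(v) s\<close> and the right action
  is \<open>v \<mapsto> f(v s)\<close>.\<close>

definition left_dual ::
  "('r, 'x) ring_scheme \<Rightarrow> ('r, 'm, 'y) bimodule_scheme \<Rightarrow> ('r, 'm \<Rightarrow> 'r) bimodule" where
  "left_dual R M = \<lparr>carrier = {f \<in> extensional (carrier M). left_linear R M (regular R) f},
     monoid.mult = undefined, one = undefined,
     ring.zero = (\<lambda>v\<in>carrier M. \<zero>\<^bsub>R\<^esub>),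
     ring.add = (\<lambda>f g. \<lambda>v\<in>carrier M. f v \<oplus>\<^bsub>R\<^esub> g v),
     smult = (\<lambda>s f. \<lambda>v\<in>carrier M. f v \<otimes>\<^bsub>R\<^esub> s),
     rsmult = (\<lambda>f s. \<lambda>v\<in>carrier M. f (v \<triangleleft>\<^bsub>M\<^esub> s))\<rparr>"


section \<open>Tensor products\<close>

text \<open>The abelian group with generators \<open>S\<close> and relations \<open>Q\<close>, written additively.\<close>

definition presented :: "'g set \<Rightarrow> ('g \<Rightarrow>\<^sub>0 int) set \<Rightarrow> ('g \<Rightarrow>\<^sub>0 int) set ring" where
  "presented S Q =
    (let F = free_Abelian_group S Mod generate (free_Abelian_group S) Q
     in \<lparr>carrier = carrier F, monoid.mult = undefined, one = undefined,
         ring.zero = one F, ring.add = monoid.mult F\<rparr>)"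

definition presented_class ::
  "'g set \<Rightarrow> ('g \<Rightarrow>\<^sub>0 int) set \<Rightarrow> 'g \<Rightarrow> ('g \<Rightarrow>\<^sub>0 int) set" where
  "presented_class S Q g =
     generate (free_Abelian_group S) Q #>\<^bsub>free_Abelian_group S\<^esub> frag_of g"

text \<open>The homomorphism from a presented group to the abelian group \<open>G\<close> that is given by \<open>\<phi>\<close> on
  generators. The chosen representative is immaterial whenever \<open>\<phi>\<close> respects the relations.\<close>

definition presented_lift ::
  "('x, 'y) ring_scheme \<Rightarrow> ('g \<Rightarrow> 'x) \<Rightarrow> ('g \<Rightarrow>\<^sub>0 int) set \<Rightarrow> 'x" where
  "presented_lift G \<phi> X =
    (let u = (SOME u. u \<in> X)
     in \<Oplus>\<^bsub>G\<^esub>g\<in>Poly_Mapping.keys u. add_pow G (Poly_Mapping.lookup u g) (\<phi> g))"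

subsection \<open>The tensor product of two bimodules\<close>

definition tensor_rel ::
  "('r, 'x) ring_scheme \<Rightarrow> ('r, 'm, 'y) bimodule_scheme \<Rightarrow> ('r, 'n, 'z) bimodule_scheme \<Rightarrow>
    ('m \<times> 'n \<Rightarrow>\<^sub>0 int) set" where
  "tensor_rel R M N =
     {frag_of (x \<oplus>\<^bsub>M\<^esub> x', y) - frag_of (x, y) - frag_of (x', y) | x x' y.
        x \<in> carrier M \<and> x' \<in> carrier M \<and> y \<in> carrier N} \<union>
     {frag_of (x, y \<oplus>\<^bsub>N\<^esub> y') - frag_of (x, y) - frag_of (x, y') | x y y'.
        x \<in> carrier M \<and> y \<in> carrier N \<and> y' \<in> carrier N} \<union>
     {frag_of (x \<triangleleft>\<^bsub>M\<^esub> r, y) - frag_of (x, r \<odot>\<^bsub>N\<^esub> y) | x r y.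
        x \<in> carrier M \<and> r \<in> carrier R \<and> y \<in> carrier N}"

definition tensor_pure ::
  "('r, 'x) ring_scheme \<Rightarrow> ('r, 'm, 'y) bimodule_scheme \<Rightarrow> ('r, 'n, 'z) bimodule_scheme \<Rightarrow>
    'm \<Rightarrow> 'n \<Rightarrow> ('m \<times> 'n \<Rightarrow>\<^sub>0 int) set" where
  "tensor_pure R M N x y =
     presented_class (carrier M \<times> carrier N) (tensor_rel R M N) (x, y)"

definition tensor ::
  "('r, 'x) ring_scheme \<Rightarrow> ('r, 'm, 'y) bimodule_scheme \<Rightarrow> ('r, 'n, 'z) bimodule_scheme \<Rightarrow>
    ('r, ('m \<times> 'n \<Rightarrow>\<^sub>0 int) set) bimodule" where
  "tensor R M N =
    (let G = presented (carrier M \<times> carrier N) (tensor_rel R M N)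
     in \<lparr>carrier = carrier G, monoid.mult = undefined, one = undefined,
         ring.zero = ring.zero G, ring.add = ring.add G,
         smult = (\<lambda>r. presented_lift G (\<lambda>(x, y). tensor_pure R M N (r \<odot>\<^bsub>M\<^esub> x) y)),
         rsmult = (\<lambda>X r. presented_lift G (\<lambda>(x, y). tensor_pure R M N x (y \<triangleleft>\<^bsub>N\<^esub> r)) X)\<rparr>)"

subsection \<open>Tensor powers of a bimodule\<close>

text \<open>The \<open>n\<close>-fold tensor power of \<open>M\<close> over \<open>R\<close> is constructed as
  \<open>R \<otimes> M \<otimes> \<dots> \<otimes> M\<close> with \<open>n\<close> factors \<open>M\<close>, so that the case \<open>n = 0\<close>, where the tensor power is
  \<open>R\<close>, needs no separate treatment (and all tensor powers live in one type). The generator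
  \<open>(r, [x\<^sub>1, \<dots>, x\<^sub>n])\<close> stands for \<open>r x\<^sub>1 \<otimes> \<dots> \<otimes> x\<^sub>n\<close>, and for \<open>r\<close> if \<open>n = 0\<close>.\<close>

definition tpow_gens ::
  "('r, 'x) ring_scheme \<Rightarrow> ('r, 'm, 'y) bimodule_scheme \<Rightarrow> nat \<Rightarrow> ('r \<times> 'm list) set" where
  "tpow_gens R M n = {(r, xs). r \<in> carrier R \<and> set xs \<subseteq> carrier M \<and> length xs = n}"

definition tpow_rel ::
  "('r, 'x) ring_scheme \<Rightarrow> ('r, 'm, 'y) bimodule_scheme \<Rightarrow> nat \<Rightarrow> ('r \<times> 'm list \<Rightarrow>\<^sub>0 int) set" where
  "tpow_rel R M n =
     {frag_of (r \<oplus>\<^bsub>R\<^esub> s, xs) - frag_of (r, xs) - frag_of (s, xs) | r s xs.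
        (r, xs) \<in> tpow_gens R M n \<and> s \<in> carrier R} \<union>
     {frag_of (r, xs @ [x \<oplus>\<^bsub>M\<^esub> y] @ ys) - frag_of (r, xs @ [x] @ ys) - frag_of (r, xs @ [y] @ ys)
        | r xs x y ys. (r, xs @ [x] @ ys) \<in> tpow_gens R M n \<and> y \<in> carrier M} \<union>
     {frag_of (r \<otimes>\<^bsub>R\<^esub> s, x # xs) - frag_of (r, (s \<odot>\<^bsub>M\<^esub> x) # xs) | r s x xs.
        (r, x # xs) \<in> tpow_gens R M n \<and> s \<in> carrier R} \<union>
     {frag_of (r, xs @ [x \<triangleleft>\<^bsub>M\<^esub> s, y] @ ys) - frag_of (r, xs @ [x, s \<odot>\<^bsub>M\<^esub> y] @ ys)
        | r xs x s y ys. (r, xs @ [x, y] @ ys) \<in> tpow_gens R M n \<and> s \<in> carrier R}"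

definition tpow_pure ::
  "('r, 'x) ring_scheme \<Rightarrow> ('r, 'm, 'y) bimodule_scheme \<Rightarrow> 'r \<times> 'm list \<Rightarrow>
    ('r \<times> 'm list \<Rightarrow>\<^sub>0 int) set" where
  "tpow_pure R M g =
    (let n = length (snd g) in presented_class (tpow_gens R M n) (tpow_rel R M n) g)"

definition tpow_rscale ::
  "('r, 'x) ring_scheme \<Rightarrow> ('r, 'm, 'y) bimodule_scheme \<Rightarrow> 'r \<times> 'm list \<Rightarrow> 'r \<Rightarrow> 'r \<times> 'm list" where
  "tpow_rscale R M g s = (case g of (r, xs) \<Rightarrow>
     if xs = [] then (r \<otimes>\<^bsub>R\<^esub> s, []) else (r, butlast xs @ [last xs \<triangleleft>\<^bsub>M\<^esub> s]))"

definition tpow ::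
  "('r, 'x) ring_scheme \<Rightarrow> ('r, 'm, 'y) bimodule_scheme \<Rightarrow> nat \<Rightarrow>
    ('r, ('r \<times> 'm list \<Rightarrow>\<^sub>0 int) set) bimodule" where
  "tpow R M n =
    (let G = presented (tpow_gens R M n) (tpow_rel R M n)
     in \<lparr>carrier = carrier G, monoid.mult = undefined, one = undefined,
         ring.zero = ring.zero G, ring.add = ring.add G,
         smult = (\<lambda>s. presented_lift G (\<lambda>(r, xs). tpow_pure R M (s \<otimes>\<^bsub>R\<^esub> r, xs))),
         rsmult = (\<lambda>X s. presented_lift G (\<lambda>g. tpow_pure R M (tpow_rscale R M g s)) X)\<rparr>)"

text \<open>Concatenation of tensors:
  \<open>(r x\<^sub>1 \<otimes> \<dots> \<otimes> x\<^sub>n) (s y\<^sub>1 \<otimes> \<dots> \<otimes> y\<^sub>m) = r x\<^sub>1 \<otimes> \<dots> \<otimes> x\<^sub>n s \<otimes> y\<^sub>1 \<otimes> \<dots> \<otimes> y\<^sub>m\<close>.\<close>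

definition tpow_concat ::
  "('r, 'x) ring_scheme \<Rightarrow> ('r, 'm, 'y) bimodule_scheme \<Rightarrow> nat \<Rightarrow> nat \<Rightarrow>
    ('r \<times> 'm list \<Rightarrow>\<^sub>0 int) set \<Rightarrow> ('r \<times> 'm list \<Rightarrow>\<^sub>0 int) set \<Rightarrow> ('r \<times> 'm list \<Rightarrow>\<^sub>0 int) set" where
  "tpow_concat R M n m X Y =
     presented_lift (tpow R M (n + m)) (\<lambda>g.
       presented_lift (tpow R M (n + m)) (\<lambda>(s, ys).
         let (r, xs) = tpow_rscale R M g s in tpow_pure R M (r, xs @ ys)) Y) X"


section \<open>Graded rings and corings over \<open>R\<close>\<close>

record ('r, 'm) graded_bimodule = "('r, 'm) bimodule" +
  hcomp :: "nat \<Rightarrow> 'm set"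

record ('r, 'c) graded_coring = "('r, 'c) graded_bimodule" +
  comult :: "'c \<Rightarrow> ('c \<times> 'c \<Rightarrow>\<^sub>0 int) set"
  counit :: "'c \<Rightarrow> 'r"

definition hpart ::
  "('r, 'm, 'x) graded_bimodule_scheme \<Rightarrow> nat \<Rightarrow> ('r, 'm, 'x) graded_bimodule_scheme" where
  "hpart M n = M\<lparr>carrier := hcomp M n\<rparr>"

definition hdecomp ::
  "('r, 'm, 'x) graded_bimodule_scheme \<Rightarrow> 'm \<Rightarrow> (nat \<Rightarrow> 'm) \<Rightarrow> bool" where
  "hdecomp M x f \<longleftrightarrow> (\<forall>n. f n \<in> hcomp M n) \<and> finite {n. f n \<noteq> \<zero>\<^bsub>M\<^esub>} \<and>
     x = (\<Oplus>\<^bsub>M\<^esub>n\<in>{n. f n \<noteq> \<zero>\<^bsub>M\<^esub>}. f n)"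

definition hproj :: "('r, 'm, 'x) graded_bimodule_scheme \<Rightarrow> nat \<Rightarrow> 'm \<Rightarrow> 'm" where
  "hproj M n x = (THE f. hdecomp M x f) n"

definition pos_part ::
  "('r, 'm, 'x) graded_bimodule_scheme \<Rightarrow> ('r, 'm, 'x) graded_bimodule_scheme" where
  "pos_part M = M\<lparr>carrier := {\<Oplus>\<^bsub>M\<^esub>n\<in>F. f n | F f.
     finite F \<and> 0 \<notin> F \<and> (\<forall>n\<in>F. f n \<in> hcomp M n)}\<rparr>"

locale graded_bimodule = bimodule R M
  for R :: "('r, 'x) ring_scheme" (structure)
    and M :: "('r, 'm, 'y) graded_bimodule_scheme" (structure) +
  assumes hcomp_submodule: "submodule (hcomp M n) R M"
    and hcomp_rsmult: "\<lbrakk>r \<in> carrier R; x \<in> hcomp M n\<rbrakk> \<Longrightarrow> x \<triangleleft>\<^bsub>M\<^esub> r \<in> hcomp M n"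
    and hcomp_direct_sum: "x \<in> carrier M \<Longrightarrow> \<exists>!f. hdecomp M x f"

definition left_locally_finite ::
  "('r, 'x) ring_scheme \<Rightarrow> ('r, 'm, 'y) graded_bimodule_scheme \<Rightarrow> bool" where
  "left_locally_finite R M \<longleftrightarrow> (\<forall>n. finitely_generated R (hpart M n))"

text \<open>Connectedness \<open>A\<^sup>0 = R\<close> means that the unit map \<open>r \<mapsto> r 1\<close> identifies \<open>R\<close> with \<open>A\<^sup>0\<close>; dually,
  \<open>C\<^sub>0 = R\<close> means that the counit identifies \<open>C\<^sub>0\<close> with \<open>R\<close>.\<close>

locale connected_graded_rring = graded_bimodule R A + A: ring A
  for R :: "('r, 'x) ring_scheme" (structure)
    and A :: "('r, 'a, 'y) graded_bimodule_scheme" (structure) +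
  assumes smult_mult: "\<lbrakk>r \<in> carrier R; a \<in> carrier A; b \<in> carrier A\<rbrakk> \<Longrightarrow>
        r \<odot>\<^bsub>A\<^esub> (a \<otimes>\<^bsub>A\<^esub> b) = (r \<odot>\<^bsub>A\<^esub> a) \<otimes>\<^bsub>A\<^esub> b"
    and mult_rsmult: "\<lbrakk>r \<in> carrier R; a \<in> carrier A; b \<in> carrier A\<rbrakk> \<Longrightarrow>
        (a \<otimes>\<^bsub>A\<^esub> b) \<triangleleft>\<^bsub>A\<^esub> r = a \<otimes>\<^bsub>A\<^esub> (b \<triangleleft>\<^bsub>A\<^esub> r)"
    and mult_balanced: "\<lbrakk>r \<in> carrier R; a \<in> carrier A; b \<in> carrier A\<rbrakk> \<Longrightarrow>
        (a \<triangleleft>\<^bsub>A\<^esub> r) \<otimes>\<^bsub>A\<^esub> b = a \<otimes>\<^bsub>A\<^esub> (r \<odot>\<^bsub>A\<^esub> b)"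
    and one_degree: "\<one>\<^bsub>A\<^esub> \<in> hcomp A 0"
    and mult_degree: "\<lbrakk>a \<in> hcomp A m; b \<in> hcomp A n\<rbrakk> \<Longrightarrow> a \<otimes>\<^bsub>A\<^esub> b \<in> hcomp A (m + n)"
    and connected: "bij_betw (\<lambda>r. r \<odot>\<^bsub>A\<^esub> \<one>\<^bsub>A\<^esub>) (carrier R) (hcomp A 0)"

definition rring_proj0 ::
  "('r, 'x) ring_scheme \<Rightarrow> ('r, 'a, 'y) graded_bimodule_scheme \<Rightarrow> 'a \<Rightarrow> 'r" where
  "rring_proj0 R A a = inv_into (carrier R) (\<lambda>r. r \<odot>\<^bsub>A\<^esub> \<one>\<^bsub>A\<^esub>) (hproj A 0 a)"

locale connected_graded_coring = graded_bimodule R C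
  for R :: "('r, 'x) ring_scheme" (structure)
    and C :: "('r, 'c, 'y) graded_coring_scheme" (structure) +
  assumes comult_hom: "bimodule_hom R C (tensor R C C) (comult C)"
    and counit_hom: "bimodule_hom R C (regular R) (counit C)"
    and coassoc: "c \<in> carrier C \<Longrightarrow>
        presented_lift (tpow R C 3) (\<lambda>(x, y).
          presented_lift (tpow R C 3) (\<lambda>(x1, x2). tpow_pure R C (\<one>\<^bsub>R\<^esub>, [x1, x2, y]))
            (comult C x)) (comult C c) =
        presented_lift (tpow R C 3) (\<lambda>(x, y).
          presented_lift (tpow R C 3) (\<lambda>(y1, y2). tpow_pure R C (\<one>\<^bsub>R\<^esub>, [x, y1, y2]))
            (comult C y)) (comult C c)"
    and counit_left: "c \<in> carrier C \<Longrightarrow>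
        presented_lift C (\<lambda>(x, y). counit C x \<odot>\<^bsub>C\<^esub> y) (comult C c) = c"
    and counit_right: "c \<in> carrier C \<Longrightarrow>
        presented_lift C (\<lambda>(x, y). x \<triangleleft>\<^bsub>C\<^esub> counit C y) (comult C c) = c"
    and comult_degree: "c \<in> hcomp C n \<Longrightarrow>
        comult C c \<in> generate (add_monoid (tensor R C C))
          {tensor_pure R C C x y | x y p q. p + q = n \<and> x \<in> hcomp C p \<and> y \<in> hcomp C q}"
    and counit_degree: "\<lbrakk>c \<in> hcomp C n; n > 0\<rbrakk> \<Longrightarrow> counit C c = \<zero>\<^bsub>R\<^esub>"
    and connected: "bij_betw (counit C) (hcomp C 0) (carrier R)"

text \<open>The component \<open>\<Delta>\<^sub>m\<^sub>,\<^sub>n : C\<^sub>m\<^sub>+\<^sub>n \<rightarrow> C\<^sub>m \<otimes> C\<^sub>n\<close> of the comultiplication.\<close>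

definition comult_comp ::
  "('r, 'x) ring_scheme \<Rightarrow> ('r, 'c, 'y) graded_coring_scheme \<Rightarrow> nat \<Rightarrow> nat \<Rightarrow> 'c \<Rightarrow>
    ('c \<times> 'c \<Rightarrow>\<^sub>0 int) set" where
  "comult_comp R C m n c =
     presented_lift (tensor R (hpart C m) (hpart C n))
       (\<lambda>(x, y). tensor_pure R (hpart C m) (hpart C n) (hproj C m x) (hproj C n y)) (comult C c)"


section \<open>Koszul pairs\<close>

definition almost_koszul_pair ::
  "('r, 'x) ring_scheme \<Rightarrow> ('r, 'a, 'y) graded_bimodule_scheme \<Rightarrow>
    ('r, 'c, 'z) graded_coring_scheme \<Rightarrow> ('c \<Rightarrow> 'a) \<Rightarrow> bool" where
  "almost_koszul_pair R A C \<theta> \<longleftrightarrow>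
     connected_graded_rring R A \<and> connected_graded_coring R C \<and>
     bimodule_iso R (hpart C 1) (hpart A 1) \<theta> \<and>
     (\<forall>c\<in>hcomp C 2. presented_lift A (\<lambda>(x, y). \<theta> x \<otimes>\<^bsub>A\<^esub> \<theta> y) (comult_comp R C 1 1 c) = \<zero>\<^bsub>A\<^esub>)"

definition koszul_term ::
  "('r, 'x) ring_scheme \<Rightarrow> ('r, 'a, 'y) graded_bimodule_scheme \<Rightarrow>
    ('r, 'c, 'z) graded_coring_scheme \<Rightarrow> nat \<Rightarrow> ('r, ('a \<times> 'c \<Rightarrow>\<^sub>0 int) set) bimodule" where
  "koszul_term R A C n = tensor R A (hpart C n)"

definition koszul_augmentation ::
  "('r, 'x) ring_scheme \<Rightarrow> ('r, 'a, 'y) graded_bimodule_scheme \<Rightarrow>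
    ('r, 'c, 'z) graded_coring_scheme \<Rightarrow> ('a \<times> 'c \<Rightarrow>\<^sub>0 int) set \<Rightarrow> 'r" where
  "koszul_augmentation R A C =
     presented_lift R (\<lambda>(a, c). rring_proj0 R A a \<otimes>\<^bsub>R\<^esub> counit C c)"

text \<open>The differential \<open>d\<^sub>n\<^sub>+\<^sub>1 : A \<otimes> C\<^sub>n\<^sub>+\<^sub>1 \<rightarrow> A \<otimes> C\<^sub>n\<close>.\<close>

definition koszul_diff ::
  "('r, 'x) ring_scheme \<Rightarrow> ('r, 'a, 'y) graded_bimodule_scheme \<Rightarrow>
    ('r, 'c, 'z) graded_coring_scheme \<Rightarrow> ('c \<Rightarrow> 'a) \<Rightarrow> nat \<Rightarrow>
    ('a \<times> 'c \<Rightarrow>\<^sub>0 int) set \<Rightarrow> ('a \<times> 'c \<Rightarrow>\<^sub>0 int) set" where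
  "koszul_diff R A C \<theta> n =
     presented_lift (koszul_term R A C n) (\<lambda>(a, c).
       presented_lift (koszul_term R A C n)
         (\<lambda>(x, y). tensor_pure R A (hpart C n) (a \<otimes>\<^bsub>A\<^esub> \<theta> x) y) (comult_comp R C 1 n c))"

definition koszul_pair ::
  "('r, 'x) ring_scheme \<Rightarrow> ('r, 'a, 'y) graded_bimodule_scheme \<Rightarrow>
    ('r, 'c, 'z) graded_coring_scheme \<Rightarrow> ('c \<Rightarrow> 'a) \<Rightarrow> bool" where
  "koszul_pair R A C \<theta> \<longleftrightarrow>
     almost_koszul_pair R A C \<theta> \<and>
     koszul_augmentation R A C ` carrier (koszul_term R A C 0) = carrier R \<and>
     {X \<in> carrier (koszul_term R A C 0). koszul_augmentation R A C X = \<zero>\<^bsub>R\<^esub>} =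
       koszul_diff R A C \<theta> 0 ` carrier (koszul_term R A C 1) \<and>
     (\<forall>n. {X \<in> carrier (koszul_term R A C (Suc n)).
             koszul_diff R A C \<theta> n X = \<zero>\<^bsub>koszul_term R A C n\<^esub>} =
       koszul_diff R A C \<theta> (Suc n) ` carrier (koszul_term R A C (Suc (Suc n))))"


section \<open>The cohomology ring of a cochain complex with a product\<close>

record 'a graded_ring = "'a ring" +
  gcomp :: "nat \<Rightarrow> 'a set"

definition graded_ring_iso ::
  "('a, 'x) graded_ring_scheme \<Rightarrow> ('b, 'y) graded_ring_scheme \<Rightarrow> ('a \<Rightarrow> 'b) set" where
  "graded_ring_iso E F = {h \<in> ring_iso E F. \<forall>n. h ` gcomp E n = gcomp F n}"

text \<open>Here \<open>K n\<close> is the additive group of \<open>n\<close>-cochains and \<open>d n : K n \<rightarrow> K (n + 1)\<close>.\<close>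

definition cocycles ::
  "(nat \<Rightarrow> ('k, 'x) ring_scheme) \<Rightarrow> (nat \<Rightarrow> 'k \<Rightarrow> 'k) \<Rightarrow> nat \<Rightarrow> 'k set" where
  "cocycles K d n = {x \<in> carrier (K n). d n x = \<zero>\<^bsub>K (Suc n)\<^esub>}"

definition coboundaries ::
  "(nat \<Rightarrow> ('k, 'x) ring_scheme) \<Rightarrow> (nat \<Rightarrow> 'k \<Rightarrow> 'k) \<Rightarrow> nat \<Rightarrow> 'k set" where
  "coboundaries K d n = (case n of 0 \<Rightarrow> {\<zero>\<^bsub>K 0\<^esub>} | Suc m \<Rightarrow> d m ` carrier (K m))"

definition cohomology ::
  "(nat \<Rightarrow> ('k, 'x) ring_scheme) \<Rightarrow> (nat \<Rightarrow> 'k \<Rightarrow> 'k) \<Rightarrow> nat \<Rightarrow> 'k set monoid" where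
  "cohomology K d n = (K n)\<lparr>carrier := cocycles K d n\<rparr> A_Mod (coboundaries K d n)"

text \<open>The graded ring \<open>\<Oplus>\<^sub>n H\<^sup>n(K)\<close>, whose elements are finitely supported families of cohomology
  classes. The product of \<open>X \<in> H\<^sup>p\<close> and \<open>Y \<in> H\<^sup>q\<close> is the coset \<open>B\<^sup>p\<^sup>+\<^sup>q + X Y\<close>, induced by a product
  \<open>m p q : K p \<times> K q \<rightarrow> K (p + q)\<close> of cochains with unit \<open>u \<in> K 0\<close>. Note that the groups
  \<open>cohomology K d n\<close> are written multiplicatively.\<close>

definition cohomology_ring ::
  "(nat \<Rightarrow> ('k, 'x) ring_scheme) \<Rightarrow> (nat \<Rightarrow> 'k \<Rightarrow> 'k) \<Rightarrow> (nat \<Rightarrow> nat \<Rightarrow> 'k \<Rightarrow> 'k \<Rightarrow> 'k) \<Rightarrow> 'k \<Rightarrow>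
    (nat \<Rightarrow> 'k set) graded_ring" where
  "cohomology_ring K d m u =
    (let H = cohomology K d; B = coboundaries K d;
         E = {c. (\<forall>n. c n \<in> carrier (H n)) \<and> finite {n. c n \<noteq> \<one>\<^bsub>H n\<^esub>}}
     in \<lparr>carrier = E,
         monoid.mult = (\<lambda>c c' n. \<Otimes>\<^bsub>H n\<^esub>p\<in>{..n}.
                   B n <+>\<^bsub>K n\<^esub> {m p (n - p) x y | x y. x \<in> c p \<and> y \<in> c' (n - p)}),
         one = (\<lambda>n. if n = 0 then B 0 +>\<^bsub>K 0\<^esub> u else \<one>\<^bsub>H n\<^esub>),
         ring.zero = (\<lambda>n. \<one>\<^bsub>H n\<^esub>),
         ring.add = (\<lambda>c c' n. c n \<otimes>\<^bsub>H n\<^esub> c' n),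
         gcomp = (\<lambda>n. {c \<in> E. \<forall>k. k \<noteq> n \<longrightarrow> c k = \<one>\<^bsub>H k\<^esub>})\<rparr>)"


section \<open>The ring \<open>Ext\<^sub>A(R, R)\<close>\<close>

text \<open>The differential \<open>\<Omega>\<^sub>n\<^sub>+\<^sub>1(A) \<rightarrow> \<Omega>\<^sub>n(A)\<close>; positions are counted from 0.\<close>

definition bar_diff ::
  "('r, 'x) ring_scheme \<Rightarrow> ('r, 'a, 'y) graded_bimodule_scheme \<Rightarrow> nat \<Rightarrow>
    ('r \<times> 'a list \<Rightarrow>\<^sub>0 int) set \<Rightarrow> ('r \<times> 'a list \<Rightarrow>\<^sub>0 int) set" where
  "bar_diff R A n =
     presented_lift (tpow R (pos_part A) n) (\<lambda>(r, as).
       \<Oplus>\<^bsub>tpow R (pos_part A) n\<^esub>i\<in>{..<n}. add_pow (tpow R (pos_part A) n) ((-1) ^ i :: int)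
         (tpow_pure R (pos_part A)
            (r, take i as @ [as ! i \<otimes>\<^bsub>A\<^esub> as ! Suc i] @ drop (Suc (Suc i)) as)))"

definition ext_cochains ::
  "('r, 'x) ring_scheme \<Rightarrow> ('r, 'a, 'y) graded_bimodule_scheme \<Rightarrow> nat \<Rightarrow>
    ('r, ('r \<times> 'a list \<Rightarrow>\<^sub>0 int) set \<Rightarrow> 'r) bimodule" where
  "ext_cochains R A n = left_dual R (tpow R (pos_part A) n)"

definition ext_diff ::
  "('r, 'x) ring_scheme \<Rightarrow> ('r, 'a, 'y) graded_bimodule_scheme \<Rightarrow> nat \<Rightarrow>
    (('r \<times> 'a list \<Rightarrow>\<^sub>0 int) set \<Rightarrow> 'r) \<Rightarrow> (('r \<times> 'a list \<Rightarrow>\<^sub>0 int) set \<Rightarrow> 'r)" where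
  "ext_diff R A n f = (\<lambda>X\<in>carrier (tpow R (pos_part A) (Suc n)). f (bar_diff R A n X))"

definition ext_cup ::
  "('r, 'x) ring_scheme \<Rightarrow> ('r, 'a, 'y) graded_bimodule_scheme \<Rightarrow> nat \<Rightarrow> nat \<Rightarrow>
    (('r \<times> 'a list \<Rightarrow>\<^sub>0 int) set \<Rightarrow> 'r) \<Rightarrow> (('r \<times> 'a list \<Rightarrow>\<^sub>0 int) set \<Rightarrow> 'r) \<Rightarrow>
    (('r \<times> 'a list \<Rightarrow>\<^sub>0 int) set \<Rightarrow> 'r)" where
  "ext_cup R A n m f g =
     (\<lambda>X\<in>carrier (tpow R (pos_part A) (n + m)).
        presented_lift R (\<lambda>(r, as).
          f (tpow_pure R (pos_part A) (r, take n as)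
               \<triangleleft>\<^bsub>tpow R (pos_part A) n\<^esub> g (tpow_pure R (pos_part A) (\<one>\<^bsub>R\<^esub>, drop n as)))) X)"

text \<open>The unit is the identity of \<open>R\<close>, as a map \<open>\<Omega>\<^sub>0(A) = R \<rightarrow> R\<close>.\<close>

definition ext_unit ::
  "('r, 'x) ring_scheme \<Rightarrow> ('r, 'a, 'y) graded_bimodule_scheme \<Rightarrow>
    (('r \<times> 'a list \<Rightarrow>\<^sub>0 int) set \<Rightarrow> 'r)" where
  "ext_unit R A = (\<lambda>X\<in>carrier (tpow R (pos_part A) 0). presented_lift R fst X)"

definition ext_ring ::
  "('r, 'x) ring_scheme \<Rightarrow> ('r, 'a, 'y) graded_bimodule_scheme \<Rightarrow>
    (nat \<Rightarrow> (('r \<times> 'a list \<Rightarrow>\<^sub>0 int) set \<Rightarrow> 'r) set) graded_ring" where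
  "ext_ring R A = cohomology_ring (ext_cochains R A) (ext_diff R A) (ext_cup R A) (ext_unit R A)"


section \<open>The ring \<open>Ext\<^sub>D(S, S)\<close> of a connected graded \<open>S\<close>-coring \<open>D\<close>\<close>

definition coring_pos :: "('r, 'd, 'x) graded_coring_scheme \<Rightarrow> ('r, 'd set) bimodule" where
  "coring_pos D = quot_bimodule D (hcomp D 0)"

text \<open>The choice of a representative of the class \<open>X \<in> D/D\<^sub>0\<close> is immaterial, since the
  comultiplication maps \<open>D\<^sub>0\<close> into the image of \<open>D\<^sub>0 \<otimes> D\<^sub>0\<close>.\<close>

definition comult_pos ::
  "('r, 's) ring_scheme \<Rightarrow> ('r, 'd, 'x) graded_coring_scheme \<Rightarrow> 'd set \<Rightarrow>
    ('d set \<times> 'd set \<Rightarrow>\<^sub>0 int) set" where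
  "comult_pos S D X =
     presented_lift (tensor S (coring_pos D) (coring_pos D))
       (\<lambda>(x, y). tensor_pure S (coring_pos D) (coring_pos D)
          (hcomp D 0 +>\<^bsub>D\<^esub> x) (hcomp D 0 +>\<^bsub>D\<^esub> y))
       (comult D (SOME d. d \<in> X))"

definition cobar_diff ::
  "('r, 's) ring_scheme \<Rightarrow> ('r, 'd, 'x) graded_coring_scheme \<Rightarrow> nat \<Rightarrow>
    ('r \<times> 'd set list \<Rightarrow>\<^sub>0 int) set \<Rightarrow> ('r \<times> 'd set list \<Rightarrow>\<^sub>0 int) set" where
  "cobar_diff S D n =
    (let T = tpow S (coring_pos D) (Suc n)
     in presented_lift T (\<lambda>(r, xs).
          \<Oplus>\<^bsub>T\<^esub>i\<in>{..<n}. add_pow T ((-1) ^ i :: int)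
            (presented_lift T
              (\<lambda>(y, z). tpow_pure S (coring_pos D) (r, take i xs @ [y, z] @ drop (Suc i) xs))
              (comult_pos S D (xs ! i)))))"

definition coring_ext_ring ::
  "('r, 's) ring_scheme \<Rightarrow> ('r, 'd, 'x) graded_coring_scheme \<Rightarrow>
    (nat \<Rightarrow> ('r \<times> 'd set list \<Rightarrow>\<^sub>0 int) set set) graded_ring" where
  "coring_ext_ring S D =
     cohomology_ring (tpow S (coring_pos D)) (cobar_diff S D) (tpow_concat S (coring_pos D))
       (tpow_pure S (coring_pos D) (\<one>\<^bsub>S\<^esub>, []))"


section \<open>The left graded dual\<close>

text \<open>The graded dual consists of the finitely supported families of elements of the
  \<open>{}\<^sup>*(A\<^sup>n)\<close>, with componentwise operations.\<close>

definition gr_dual_incl ::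
  "('r, 'x) ring_scheme \<Rightarrow> ('r, 'a, 'y) graded_bimodule_scheme \<Rightarrow> nat \<Rightarrow> ('a \<Rightarrow> 'r) \<Rightarrow>
    (nat \<Rightarrow> 'a \<Rightarrow> 'r)" where
  "gr_dual_incl R A n \<alpha> = (\<lambda>k. if k = n then \<alpha> else \<zero>\<^bsub>left_dual R (hpart A k)\<^esub>)"

definition gr_dual_bimodule ::
  "('r, 'x) ring_scheme \<Rightarrow> ('r, 'a, 'y) graded_bimodule_scheme \<Rightarrow>
    ('r, nat \<Rightarrow> 'a \<Rightarrow> 'r) graded_bimodule" where
  "gr_dual_bimodule R A =
    (let V = (\<lambda>n. left_dual R (hpart A n))
     in \<lparr>carrier = {f. (\<forall>n. f n \<in> carrier (V n)) \<and> finite {n. f n \<noteq> \<zero>\<^bsub>V n\<^esub>}},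
         monoid.mult = undefined, one = undefined,
         ring.zero = (\<lambda>n. \<zero>\<^bsub>V n\<^esub>),
         ring.add = (\<lambda>f g n. f n \<oplus>\<^bsub>V n\<^esub> g n),
         smult = (\<lambda>s f n. s \<odot>\<^bsub>V n\<^esub> f n),
         rsmult = (\<lambda>f s n. f n \<triangleleft>\<^bsub>V n\<^esub> s),
         hcomp = (\<lambda>n. gr_dual_incl R A n ` carrier (V n))\<rparr>)"

text \<open>The map \<open>{}\<^sup>*(A\<^sup>n) \<otimes> {}\<^sup>*(A\<^sup>m) \<rightarrow> {}\<^sup>*(A\<^sup>n \<otimes> A\<^sup>m)\<close>
  that sends \<open>\<alpha> \<otimes> \<beta>\<close> to \<open>v \<otimes> w \<mapsto> \<alpha> (v \<beta>(w))\<close>; the first tensor product is over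
  \<open>R\<^sup>o\<^sup>p\<close>, the second over \<open>R\<close>.\<close>

definition dual_tensor_map ::
  "('r, 'x) ring_scheme \<Rightarrow> ('r, 'a, 'y) graded_bimodule_scheme \<Rightarrow> nat \<Rightarrow> nat \<Rightarrow>
    (('a \<Rightarrow> 'r) \<times> ('a \<Rightarrow> 'r) \<Rightarrow>\<^sub>0 int) set \<Rightarrow> (('a \<times> 'a \<Rightarrow>\<^sub>0 int) set \<Rightarrow> 'r)" where
  "dual_tensor_map R A n m =
     presented_lift (left_dual R (tensor R (hpart A n) (hpart A m)))
       (\<lambda>(\<alpha>, \<beta>). \<lambda>X\<in>carrier (tensor R (hpart A n) (hpart A m)).
          presented_lift R (\<lambda>(v, w). \<alpha> (v \<triangleleft>\<^bsub>A\<^esub> \<beta> w)) X)"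

definition mult_transpose ::
  "('r, 'x) ring_scheme \<Rightarrow> ('r, 'a, 'y) graded_bimodule_scheme \<Rightarrow> nat \<Rightarrow> nat \<Rightarrow>
    ('a \<Rightarrow> 'r) \<Rightarrow> (('a \<times> 'a \<Rightarrow>\<^sub>0 int) set \<Rightarrow> 'r)" where
  "mult_transpose R A n m f =
     (\<lambda>X\<in>carrier (tensor R (hpart A n) (hpart A m)).
        f (presented_lift A (\<lambda>(v, w). v \<otimes>\<^bsub>A\<^esub> w) X))"

definition gr_dual_comult_comp ::
  "('r, 'x) ring_scheme \<Rightarrow> ('r, 'a, 'y) graded_bimodule_scheme \<Rightarrow> nat \<Rightarrow> nat \<Rightarrow>
    ('a \<Rightarrow> 'r) \<Rightarrow> (('a \<Rightarrow> 'r) \<times> ('a \<Rightarrow> 'r) \<Rightarrow>\<^sub>0 int) set" where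
  "gr_dual_comult_comp R A n m f =
     inv_into (carrier (tensor (op_ring R) (left_dual R (hpart A n)) (left_dual R (hpart A m))))
       (dual_tensor_map R A n m) (mult_transpose R A n m f)"

definition gr_dual_comult ::
  "('r, 'x) ring_scheme \<Rightarrow> ('r, 'a, 'y) graded_bimodule_scheme \<Rightarrow> (nat \<Rightarrow> 'a \<Rightarrow> 'r) \<Rightarrow>
    ((nat \<Rightarrow> 'a \<Rightarrow> 'r) \<times> (nat \<Rightarrow> 'a \<Rightarrow> 'r) \<Rightarrow>\<^sub>0 int) set" where
  "gr_dual_comult R A f =
    (let D = gr_dual_bimodule R A; T = tensor (op_ring R) D D
     in finsum T (\<lambda>(n, m).
          presented_lift T
            (\<lambda>(\<alpha>, \<beta>). tensor_pure (op_ring R) D D (gr_dual_incl R A n \<alpha>) (gr_dual_incl R A m \<beta>))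
            (gr_dual_comult_comp R A n m (f (n + m))))
          {(n, m). f (n + m) \<noteq> \<zero>\<^bsub>left_dual R (hpart A (n + m))\<^esub>})"

definition gr_dual ::
  "('r, 'x) ring_scheme \<Rightarrow> ('r, 'a, 'y) graded_bimodule_scheme \<Rightarrow>
    ('r, nat \<Rightarrow> 'a \<Rightarrow> 'r) graded_coring" where
  "gr_dual R A = graded_bimodule.extend (gr_dual_bimodule R A)
     (graded_coring.fields (gr_dual_comult R A) (\<lambda>f. f 0 \<one>\<^bsub>A\<^esub>))"

end

theory Submission
  imports Defs
begin

text \<open>Pairing \<open>f\<^sub>1 \<otimes> \<dots> \<otimes> f\<^sub>n\<close> with \<open>a\<^sub>1 \<otimes> \<dots> \<otimes> a\<^sub>n\<close> by \<open>f\<^sub>1 (a\<^sub>1 f\<^sub>2 (a\<^sub>2 \<dots>))\<close> embeds the cobar complex of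
  the graded dual of \<open>A\<close>, compatibly with differentials and products, into the cochain complex of
  the bar complex of \<open>A\<close>. Since the \<open>A\<^sup>n\<close> have finite dual bases, the image consists of the cochains
  that vanish in all sufficiently large internal degrees. Restricting a cochain to bounded internal
  degree commutes with the differential, which gives injectivity on cohomology. For surjectivity,
  a chase along the Koszul complex shows that an \<open>n\<close>-cocycle vanishing on \<open>(A\<^sup>1)\<^sup>\<otimes>\<^sup>n\<close> is a
  coboundary; applied to the difference of a cocycle and its part of internal degree at most \<open>n\<close>,
  this represents every class by a cochain of bounded degree.\<close>

text \<open>The pairing is not onto: a cochain of the bar complex may be nonzero in infinitely many
  internal degrees, whereas a tensor over the graded dual sees only finitely many. The comparison
  must therefore be made in cohomology, and there the Koszul hypothesis enters, through the double
  complex of cochains on \<open>A_+^(p) \<otimes> A \<otimes> C_q\<close>. For fixed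
  \<open>q\<close> it is exact since \<open>A \<otimes> C_q\<close> is free over \<open>A\<close>.
  For fixed \<open>p\<close> it is exact since the Koszul complex is, and since over a semisimple
  ring a functional that kills the kernel of a Koszul differential factors through that
  differential. The chase does not split cochains by internal degree, so it treats infinitely many
  degrees at once. The cutoff for an \<open>n\<close>-cocycle is \<open>n\<close> because
  \<open>n\<close> entries of positive degree have total degree at least \<open>n\<close>, with
  equality only on \<open>(A^1)^(n)\<close>. Semisimplicity also yields the dual bases. The
  injectivity of the pairing has a second use: well-definedness and the identities of the cobar side
  are checked on values, where they become identities between scalars in \<open>R\<close>.\<close>

text \<open>The operation symbols carry the structure in brackets; \<open>x <[M] r\<close> is the right action.\<close>

abbreviation add_in (\<open>_ +[_] _\<close> [65, 0, 66] 65) where "x +[G] y \<equiv> x \<oplus>\<^bsub>G\<^esub> y"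
abbreviation minus_in (\<open>_ -[_] _\<close> [65, 0, 66] 65) where "x -[G] y \<equiv> x \<ominus>\<^bsub>G\<^esub> y"
abbreviation neg_in (\<open>-[_] _\<close> [0, 81] 80) where "-[G] x \<equiv> \<ominus>\<^bsub>G\<^esub> x"
abbreviation zero_in (\<open>0[_]\<close>) where "0[G] \<equiv> \<zero>\<^bsub>G\<^esub>"
abbreviation mult_in (\<open>_ *[_] _\<close> [70, 0, 71] 70) where "x *[G] y \<equiv> x \<otimes>\<^bsub>G\<^esub> y"
abbreviation one_in (\<open>1[_]\<close>) where "1[G] \<equiv> \<one>\<^bsub>G\<^esub>"
abbreviation smult_in (\<open>_ .[_] _\<close> [70, 0, 71] 70) where "r .[M] x \<equiv> r \<odot>\<^bsub>M\<^esub> x"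
abbreviation rsmult_in (\<open>_ <[_] _\<close> [70, 0, 71] 70) where "x <[M] r \<equiv> x \<triangleleft>\<^bsub>M\<^esub> r"

abbreviation in_carrier :: "'a \<Rightarrow> ('a, 'b) partial_object_scheme \<Rightarrow> bool" (infix \<open>.:\<close> 50)
  where "x .: G \<equiv> x \<in> carrier G"

abbreviation list_in_carrier :: "'a list \<Rightarrow> ('a, 'b) partial_object_scheme \<Rightarrow> bool" (infix \<open><:\<close> 50)
  where "xs <: G \<equiv> set xs \<subseteq> carrier G"

section \<open>Additive maps\<close>

text \<open>One notion of additive map for \<open>R\<close>, bimodules, tensor powers and cochain
  groups alike, so that sums, signs and differentials are transported by the same few facts.\<close>

definition ahom :: "('a, 'x) ring_scheme => ('b, 'y) ring_scheme => ('a => 'b) => bool" where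
  "ahom G H f \<longleftrightarrow> f \<in> carrier G \<rightarrow> carrier H \<and>
     (\<forall>x\<in>carrier G. \<forall>y\<in>carrier G. f (x +[G] y) = f x +[H] f y)"

lemma ahomI:
  assumes "\<And>x. x .: G ==> f x .: H" and "\<And>x y. x .: G ==> y .: G ==> f (x +[G] y) = f x +[H] f y"
  shows "ahom G H f"
  using assms by (auto simp: ahom_def)

lemma ahom_closed: "ahom G H f ==> x .: G ==> f x .: H" by (auto simp: ahom_def)

lemma ahom_add: "ahom G H f ==> x .: G ==> y .: G ==> f (x +[G] y) = f x +[H] f y"
  by (auto simp: ahom_def)

lemma ahom_group_hom:
  assumes "abelian_group G" "abelian_group H" "ahom G H f"
  shows "group_hom (add_monoid G) (add_monoid H) f"
  using assms
  by (auto simp: group_hom_def group_hom_axioms_def hom_def ahom_def abelian_group.a_group)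

lemma ahom_zero:
  assumes "abelian_group G" "abelian_group H" "ahom G H f"
  shows "f 0[G] = 0[H]"
  using group_hom.hom_one[OF ahom_group_hom[OF assms]] by simp

lemma ahom_neg:
  assumes "abelian_group G" "abelian_group H" "ahom G H f" "x .: G"
  shows "f (-[G] x) = -[H] f x"
  using group_hom.hom_inv[OF ahom_group_hom[OF assms(1-3)]] assms(4) by (simp add: a_inv_def)

lemma ahom_minus:
  assumes "abelian_group G" "abelian_group H" "ahom G H f" "x .: G" "y .: G"
  shows "f (x -[G] y) = f x -[H] f y"
proof -
  interpret G: abelian_group G by fact
  show ?thesis using assms by (simp add: a_minus_def ahom_neg ahom_add)
qed

lemma ahom_finsum:
  assumes G: "abelian_group G" and H: "abelian_group H" and f: "ahom G H f"
    and g: "g \<in> A \<rightarrow> carrier G"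
  shows "f (\<Oplus>\<^bsub>G\<^esub>x\<in>A. g x) = (\<Oplus>\<^bsub>H\<^esub>x\<in>A. f (g x))"
proof -
  interpret G: abelian_group G by fact
  interpret H: abelian_group H by fact
  show ?thesis using g proof (induction A rule: infinite_finite_induct)
    case (insert x F)
    then have "(\<lambda>y. f (g y)) \<in> F \<rightarrow> carrier H" "g \<in> F \<rightarrow> carrier G" "g x .: G" "f (g x) .: H"
      using ahom_closed[OF f] by (auto simp: Pi_iff)
    then show ?case using insert by (simp add: G.finsum_insert H.finsum_insert ahom_add[OF f])
  qed (simp_all add: ahom_zero[OF G H f] G.finsum_infinite H.finsum_infinite)
qed

lemma ahom_comp: "ahom G H f ==> ahom H K g ==> ahom G K (\<lambda>x. g (f x))"
  by (simp add: ahom_def Pi_iff)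

lemma ahom_zero_map: "abelian_group H ==> ahom G H (\<lambda>x. 0[H])"
  using abelian_monoid.l_zero[OF abelian_group.axioms(1), of H]
  by (auto simp: ahom_def abelian_monoid.zero_closed[OF abelian_group.axioms(1)])

lemma ahom_plus:
  assumes "abelian_group H" "ahom G H f" "ahom G H g"
  shows "ahom G H (\<lambda>x. f x +[H] g x)"
proof -
  interpret H: abelian_group H by fact
  show ?thesis using assms(2,3) by (auto simp: ahom_def Pi_iff H.a_ac)
qed

lemma ahom_uminus:
  assumes "abelian_group H" "ahom G H f"
  shows "ahom G H (\<lambda>x. -[H] f x)"
proof -
  interpret H: abelian_group H by fact
  show ?thesis using assms(2) by (auto simp: ahom_def Pi_iff H.minus_add)
qed

lemma ahom_sum:
  assumes H: "abelian_group H" and f: "\<And>i. i \<in> I ==> ahom G H (f i)"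
  shows "ahom G H (\<lambda>x. \<Oplus>\<^bsub>H\<^esub>i\<in>I. f i x)"
proof -
  interpret H: abelian_group H by fact
  show ?thesis using f proof (induction I rule: infinite_finite_induct)
    case (insert i F)
    have eq: "(\<Oplus>\<^bsub>H\<^esub>i\<in>insert i F. f i x) = f i x +[H] (\<Oplus>\<^bsub>H\<^esub>i\<in>F. f i x)" if "x .: G" for x
      using insert that by (intro H.finsum_insert) (auto simp: ahom_def)
    have 1: "ahom G H (f i)" and 2: "ahom G H (\<lambda>x. \<Oplus>\<^bsub>H\<^esub>i\<in>F. f i x)" using insert by auto
    have "ahom G H (\<lambda>x. f i x +[H] (\<Oplus>\<^bsub>H\<^esub>i\<in>F. f i x))" by (rule ahom_plus[OF H 1 2])
    moreover have "\<And>x y. x .: G ==> y .: G ==> f i (x +[G] y) = f i x +[H] f i y"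
      using 1 by (auto simp: ahom_def)
    ultimately show ?case using eq 1 2 insert.hyps insert.prems
      by (auto simp: ahom_def Pi_iff H.finsum_insert H.a_ac)
  qed (simp_all add: ahom_zero_map[OF H] H.finsum_infinite)
qed

section \<open>Alternating sums\<close>

definition altsum :: "('a, 'x) ring_scheme => nat => (nat => 'a) => 'a" where
  "altsum G n f = (\<Oplus>\<^bsub>G\<^esub>i\<in>{..<n}. add_pow G ((-1) ^ i :: int) (f i))"

definition sg :: "('a, 'x) ring_scheme => nat => 'a => 'a" where
  "sg G n x = (if even n then x else -[G] x)"

context abelian_group
begin

lemma add_pow_sign: "x .: G ==> add_pow G ((-1) ^ i :: int) x = sg G i x"
proof -
  assume x: "x .: G"
  have "add_pow G (- 1 :: int) x = \<ominus> x" 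
    using x add.int_pow_neg[of x 1] by (simp add: add.int_pow_1)
  then show ?thesis using x by (cases "even i") (simp_all add: sg_def add.int_pow_1)
qed

lemma sg_closed: "x .: G ==> sg G i x .: G" by (simp add: sg_def)

lemma sg_Suc: "x .: G ==> sg G (Suc i) x = \<ominus> (sg G i x)" by (simp add: sg_def)

lemma sg_zero: "sg G i \<zero> = \<zero>" by (simp add: sg_def)

lemma sg_add: "x .: G ==> y .: G ==> sg G i (x \<oplus> y) = sg G i x \<oplus> sg G i y"
  by (simp add: sg_def minus_add)

lemma sg_sg: "x .: G ==> sg G i (sg G j x) = sg G (i + j) x" by (auto simp: sg_def)

lemma sg_sg_same: "x .: G ==> sg G i (sg G i x) = x" by (auto simp: sg_def)

text \<open>The integer multiples in \<open>altsum\<close> are the form in which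
  \<open>bar_diff\<close> and \<open>cobar_diff\<close> write their signs. With \<open>sg\<close>
  instead, sign rules become case distinctions on parity.\<close>

lemma altsum_sg:
  assumes "\<And>i. i < n ==> f i .: G"
  shows "altsum G n f = (\<Oplus>i\<in>{..<n}. sg G i (f i))"
  unfolding altsum_def
  by (rule finsum_cong) (use assms in \<open>auto simp: add_pow_sign sg_closed simp_implies_def\<close>)

lemma altsum_closed:
  assumes "\<And>i. i < n ==> f i .: G"
  shows "altsum G n f .: G"
  using assms by (subst altsum_sg) (auto intro!: finsum_closed simp: sg_closed)

lemma altsum_cong:
  assumes "\<And>i. i < n ==> f i = g i" "\<And>i. i < n ==> g i .: G"
  shows "altsum G n f = altsum G n g"
  using assms by (simp add: altsum_sg) (rule finsum_cong, auto simp: sg_closed simp_implies_def)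

lemma altsum_0: "altsum G 0 f = \<zero>" by (simp add: altsum_def)

lemma altsum_Suc:
  assumes "\<And>i. i < Suc n ==> f i .: G"
  shows "altsum G (Suc n) f = altsum G n f \<oplus> sg G n (f n)"
proof -
  have "altsum G (Suc n) f = (\<Oplus>i\<in>insert n {..<n}. sg G i (f i))"
    using assms by (simp add: altsum_sg lessThan_Suc)
  also have "... = sg G n (f n) \<oplus> (\<Oplus>i\<in>{..<n}. sg G i (f i))"
    using assms by (intro finsum_insert) (auto simp: sg_closed)
  also have "... = altsum G n f \<oplus> sg G n (f n)"
    using assms by (simp add: altsum_sg sg_closed a_comm finsum_closed Pi_iff)
  finally show ?thesis .
qed

lemma altsum_add:
  assumes "\<And>i. i < n ==> f i .: G" "\<And>i. i < n ==> g i .: G"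
  shows "altsum G n (\<lambda>i. f i \<oplus> g i) = altsum G n f \<oplus> altsum G n g"
proof -
  have "altsum G n (\<lambda>i. f i \<oplus> g i) = (\<Oplus>i\<in>{..<n}. sg G i (f i) \<oplus> sg G i (g i))"
    using assms by (subst altsum_sg) (auto intro!: finsum_cong' simp del: finsum_addf simp: sg_add sg_closed)
  also have "... = altsum G n f \<oplus> altsum G n g"
    using assms by (simp add: altsum_sg) (rule finsum_addf, auto simp: sg_closed)
  finally show ?thesis .
qed

lemma altsum_zero:
  assumes "\<And>i. i < n ==> f i = \<zero>"
  shows "altsum G n f = \<zero>"
  using assms by (subst altsum_sg) (auto intro!: add.finprod_one_eqI simp: sg_zero)

text \<open>Source of the sign in the Leibniz rule, where the faces of a product are cut after the
  \<open>n\<close>-th.\<close>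

lemma altsum_append:
  assumes "\<And>i. i < n + m ==> f i .: G"
  shows "altsum G (n + m) f = altsum G n f \<oplus> sg G n (altsum G m (\<lambda>i. f (n + i)))"
  using assms
proof (induction m)
  case 0
  then show ?case by (simp add: altsum_0 sg_zero altsum_closed)
next
  case (Suc m)
  have c1: "altsum G n f .: G" and c2: "altsum G m (\<lambda>i. f (n + i)) .: G"
    using Suc.prems by (auto intro!: altsum_closed)
  have f: "f (n + m) .: G" using Suc.prems by simp
  have 1: "altsum G (Suc m) (\<lambda>i. f (n + i)) = altsum G m (\<lambda>i. f (n + i)) \<oplus> sg G m (f (n + m))"
    using Suc.prems by (intro altsum_Suc) auto
  have "altsum G (n + Suc m) f = altsum G (n + m) f \<oplus> sg G (n + m) (f (n + m))"
    using altsum_Suc[of "n + m" f] Suc.prems by simp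
  then show ?case using Suc c1 c2 f by (simp add: 1 sg_add sg_closed sg_sg a_assoc)
qed

text \<open>The simplicial identity makes the two kinds of terms cancel in pairs under
  \<open>(j, i) \<mapsto> (i, j - 1)\<close>.\<close>

lemma altsum_altsum_zero:
  assumes c: "\<And>i j. j \<le> n ==> i < n ==> D j i .: G"
    and D: "\<And>i j. j \<le> n ==> i < j ==> D j i = D i (j - 1)"
  shows "altsum G (Suc n) (\<lambda>j. altsum G n (D j)) = \<zero>"
  using assms
proof (induction n arbitrary: D)
  case 0
  then show ?case by (simp add: altsum_zero altsum_0)
next
  case (Suc n)
  \<comment> \<open>The last row is \<open>A\<close>, and by \<open>D\<close> the last column
    reduces to \<open>A\<close> as well; they enter with the signs of \<open>Suc n\<close> and
    \<open>n\<close> and cancel. The remaining square is the induction hypothesis.\<close>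
  define A where "A = altsum G (Suc n) (D (Suc n))"
  have c: "\<And>i j. j \<le> Suc n ==> i \<le> n ==> D j i .: G" using Suc.prems(1) by simp
  have cl: "altsum G n (D j) .: G" if "j \<le> Suc n" for j
    using that by (intro altsum_closed) (auto intro: c)
  have 1: "altsum G (Suc n) (\<lambda>j. altsum G n (D j)) = \<zero>"
    by (rule Suc.IH) (auto intro: c Suc.prems(2)[simplified])
  have 2: "altsum G (Suc n) (D j) = altsum G n (D j) \<oplus> sg G n (D j n)" if "j \<le> Suc n" for j
    using that by (intro altsum_Suc) (auto intro: c)
  have 3: "altsum G (Suc n) (\<lambda>j. sg G n (D j n)) = sg G n (altsum G (Suc n) (\<lambda>j. D j n))" proof -
    have "ahom G G (sg G n)" by (simp add: ahom_def sg_closed sg_add)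
    then have "sg G n (\<Oplus>j\<in>{..<Suc n}. sg G j (D j n)) = (\<Oplus>j\<in>{..<Suc n}. sg G n (sg G j (D j n)))"
      by (intro ahom_finsum[OF abelian_group_axioms abelian_group_axioms])
        (auto intro!: sg_closed c)
    also have "... = (\<Oplus>j\<in>{..<Suc n}. sg G j (sg G n (D j n)))"
      by (rule finsum_cong) (auto intro!: c a_inv_closed simp: sg_def simp_implies_def)
    also have "... = altsum G (Suc n) (\<lambda>j. sg G n (D j n))"
      by (rule altsum_sg[symmetric]) (auto intro!: sg_closed c)
    finally show ?thesis by (subst (2) altsum_sg) (auto intro: c)
  qed
  have 4: "altsum G (Suc n) (\<lambda>j. D j n) = A"
    unfolding A_def by (rule altsum_cong) (use Suc.prems(2)[of "Suc n"] in \<open>auto intro: c\<close>)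
  have A: "A .: G" unfolding A_def by (rule altsum_closed) (auto intro: c)
  have "altsum G (Suc (Suc n)) (\<lambda>j. altsum G (Suc n) (D j)) =
      altsum G (Suc n) (\<lambda>j. altsum G (Suc n) (D j)) \<oplus> sg G (Suc n) A"
    unfolding A_def by (rule altsum_Suc) (auto intro!: altsum_closed c)
  also have "altsum G (Suc n) (\<lambda>j. altsum G (Suc n) (D j)) =
      altsum G (Suc n) (\<lambda>j. altsum G n (D j) \<oplus> sg G n (D j n))"
    by (rule altsum_cong) (auto simp: 2 intro!: cl sg_closed c)
  also have "... = altsum G (Suc n) (\<lambda>j. altsum G n (D j)) \<oplus> altsum G (Suc n) (\<lambda>j. sg G n (D j n))"
    by (rule altsum_add) (auto intro!: cl sg_closed c)
  also have "... = sg G n A" using A by (simp add: 1 3 4 sg_closed)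
  finally show ?case using A by (simp add: sg_Suc sg_closed r_neg)
qed

end

lemma ahom_sg:
  assumes "abelian_group G" "abelian_group H" "ahom G H f" "x .: G"
  shows "f (sg G i x) = sg H i (f x)"
  using assms by (simp add: sg_def ahom_neg)

lemma ahom_altsum:
  assumes G: "abelian_group G" and H: "abelian_group H" and f: "ahom G H f"
    and g: "\<And>i. i < n ==> g i .: G"
  shows "f (altsum G n g) = altsum H n (\<lambda>i. f (g i))"
proof -
  interpret G: abelian_group G by fact
  interpret H: abelian_group H by fact
  have "f (altsum G n g) = (\<Oplus>\<^bsub>H\<^esub>i\<in>{..<n}. f (sg G i (g i)))" using g by (simp add: G.altsum_sg)
      (rule ahom_finsum[OF G H f], auto simp: G.sg_closed)
  also have "... = (\<Oplus>\<^bsub>H\<^esub>i\<in>{..<n}. sg H i (f (g i)))" using g ahom_closed[OF f]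
    by (intro H.finsum_cong) (auto simp: ahom_sg[OF G H f] H.sg_closed simp_implies_def)
  also have "... = altsum H n (\<lambda>i. f (g i))" using g ahom_closed[OF f] by (simp add: H.altsum_sg)
  finally show ?thesis .
qed

lemma ahom_sg_map:
  assumes "abelian_group H" "ahom G H f"
  shows "ahom G H (\<lambda>x. sg H i (f x))"
  using assms ahom_uminus by (cases "even i") (auto simp: sg_def)

lemma ahom_altsum_map:
  assumes H: "abelian_group H" and f: "\<And>i. i < n ==> ahom G H (f i)"
  shows "ahom G H (\<lambda>x. altsum H n (\<lambda>i. f i x))"
proof -
  interpret H: abelian_group H by fact
  have "ahom G H (\<lambda>x. \<Oplus>\<^bsub>H\<^esub>i\<in>{..<n}. sg H i (f i x))"
    by (rule ahom_sum[OF H]) (use f in \<open>auto intro!: ahom_sg_map[OF H]\<close>)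
  moreover have "altsum H n (\<lambda>i. f i x) = (\<Oplus>\<^bsub>H\<^esub>i\<in>{..<n}. sg H i (f i x))" if "x .: G" for x
    using f that by (intro H.altsum_sg) (auto simp: ahom_def)
  moreover have "altsum H n (\<lambda>i. f i (x +[G] y)) = altsum H n (\<lambda>i. f i x) +[H] altsum H n (\<lambda>i. f i y)"
    if "x .: G" "y .: G" for x y
  proof -
    have "altsum H n (\<lambda>i. f i (x +[G] y)) = altsum H n (\<lambda>i. f i x +[H] f i y)"
      using f that by (intro H.altsum_cong) (auto simp: ahom_def Pi_iff)
    also have "... = altsum H n (\<lambda>i. f i x) +[H] altsum H n (\<lambda>i. f i y)"
      using f that by (intro H.altsum_add) (auto simp: ahom_def Pi_iff)
    finally show ?thesis .
  qed
  ultimately show ?thesis by (auto simp: ahom_def)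
qed

section \<open>Presented abelian groups\<close>

text \<open>The extension of \<phi> to formal sums; \<open>presented_lift\<close> is its value at a
  chosen representative of the class.\<close>

definition frag_lift :: "('x, 'y) ring_scheme => ('g => 'x) => ('g \<Rightarrow>\<^sub>0 int) => 'x" where
  "frag_lift G \<phi> u = (\<Oplus>\<^bsub>G\<^esub>g\<in>Poly_Mapping.keys u. add_pow G (Poly_Mapping.lookup u g) (\<phi> g))"

lemma presented_lift_eq: "presented_lift G \<phi> X = frag_lift G \<phi> (SOME u. u \<in> X)"
  by (simp add: presented_lift_def frag_lift_def Let_def)

context abelian_group
begin

text \<open>The supports of \<open>u\<close>, \<open>v\<close> and \<open>u + v\<close> differ;
  additivity is proved by summing all three over one finite set that contains them.\<close>

lemma frag_lift_superset:
  assumes \<phi>: "\<phi> \<in> S \<rightarrow> carrier G" and K: "finite K" "Poly_Mapping.keys u \<subseteq> K" "K \<subseteq> S"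
  shows "frag_lift G \<phi> u = (\<Oplus>g\<in>K. add_pow G (Poly_Mapping.lookup u g) (\<phi> g))"
  unfolding frag_lift_def
proof (rule add.finprod_mono_neutral_cong_left)
  show "\<And>g. g \<in> K - Poly_Mapping.keys u ==> [Poly_Mapping.lookup u g] \<cdot> \<phi> g = \<zero>"
    by (auto simp: in_keys_iff add_pow_def)
qed (use assms in \<open>auto intro!: add.int_pow_closed\<close>)

lemma frag_lift_closed:
  assumes "\<phi> \<in> S \<rightarrow> carrier G" "Poly_Mapping.keys u \<subseteq> S"
  shows "frag_lift G \<phi> u .: G"
  unfolding frag_lift_def using assms by (intro finsum_closed) (auto intro!: add.int_pow_closed)

lemma frag_lift_add:
  assumes \<phi>: "\<phi> \<in> S \<rightarrow> carrier G" and u: "Poly_Mapping.keys u \<subseteq> S" and v: "Poly_Mapping.keys v \<subseteq> S"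
  shows "frag_lift G \<phi> (u + v) = frag_lift G \<phi> u \<oplus> frag_lift G \<phi> v"
proof -
  let ?K = "Poly_Mapping.keys u \<union> Poly_Mapping.keys v"
  let ?t = "\<lambda>u g. [Poly_Mapping.lookup u g] \<cdot> \<phi> g"
  have K: "finite ?K" "Poly_Mapping.keys (u + v) \<subseteq> ?K" "?K \<subseteq> S" using u v keys_add[of u v] by auto
  have \<phi>': "\<phi> g .: G" if "g \<in> ?K" for g using that K(3) \<phi> by auto
  have "frag_lift G \<phi> (u + v) = (\<Oplus>g\<in>?K. ?t u g \<oplus> ?t v g)"
    using \<phi>' by (subst frag_lift_superset[OF \<phi> K])
      (auto intro!: finsum_cong' simp del: finsum_addf add.finprod_multf simp: lookup_add add.int_pow_mult add.int_pow_closed)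
  also have "... = (\<Oplus>g\<in>?K. ?t u g) \<oplus> (\<Oplus>g\<in>?K. ?t v g)"
    using \<phi>' by (intro finsum_addf) (auto intro!: add.int_pow_closed)
  also have "(\<Oplus>g\<in>?K. ?t u g) = frag_lift G \<phi> u"
    using K by (intro frag_lift_superset[OF \<phi>, symmetric]) auto
  also have "(\<Oplus>g\<in>?K. ?t v g) = frag_lift G \<phi> v"
    using K by (intro frag_lift_superset[OF \<phi>, symmetric]) auto
  finally show ?thesis .
qed

lemma frag_lift_zero: "frag_lift G \<phi> 0 = \<zero>" by (simp add: frag_lift_def)

lemma frag_lift_of:
  assumes "\<phi> g .: G"
  shows "frag_lift G \<phi> (frag_of g) = \<phi> g"
  using assms by (simp add: frag_lift_def add.int_pow_1)

lemma frag_lift_uminus: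
  assumes \<phi>: "\<phi> \<in> S \<rightarrow> carrier G" and u: "Poly_Mapping.keys u \<subseteq> S"
  shows "frag_lift G \<phi> (- u) = \<ominus> frag_lift G \<phi> u"
proof -
  have "frag_lift G \<phi> (- u + u) = frag_lift G \<phi> (- u) \<oplus> frag_lift G \<phi> u"
    using u by (intro frag_lift_add[OF \<phi>]) auto
  then have "frag_lift G \<phi> (- u) \<oplus> frag_lift G \<phi> u = \<zero>" by (simp add: frag_lift_zero)
  then show ?thesis using frag_lift_closed[OF \<phi>, of u] frag_lift_closed[OF \<phi>, of "- u"] u
    by (simp add: minus_equality)
qed

lemma frag_lift_diff:
  assumes \<phi>: "\<phi> \<in> S \<rightarrow> carrier G" and u: "Poly_Mapping.keys u \<subseteq> S" and v: "Poly_Mapping.keys v \<subseteq> S"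
  shows "frag_lift G \<phi> (u - v) = frag_lift G \<phi> u \<ominus> frag_lift G \<phi> v"
  using frag_lift_add[OF \<phi> u, of "- v"] frag_lift_uminus[OF \<phi> v] v by (simp add: a_minus_def)

end

definition pcls :: "'g set => ('g \<Rightarrow>\<^sub>0 int) set => ('g \<Rightarrow>\<^sub>0 int) => ('g \<Rightarrow>\<^sub>0 int) set" where
  "pcls S Q u = generate (free_Abelian_group S) Q #>\<^bsub>free_Abelian_group S\<^esub> u"

locale presentation =
  fixes S :: "'g set" and Q :: "('g \<Rightarrow>\<^sub>0 int) set"
  assumes rel: "Q \<subseteq> carrier (free_Abelian_group S)"
begin

abbreviation "F \<equiv> free_Abelian_group S"
abbreviation "N \<equiv> generate F Q"

sublocale F: comm_group F by (rule abelian_free_Abelian_group)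

lemma N_normal: "N \<lhd> F" by (intro F.normal_iff_subgroup[THEN iffD2] F.generate_is_subgroup rel)

lemma N_subset: "N \<subseteq> carrier F" by (rule F.generate_incl[OF rel])

lemma carrier_presented: "carrier (presented S Q) = pcls S Q ` carrier F"
  by (auto simp: presented_def Let_def FactGroup_def RCOSETS_def pcls_def)

lemma pcls_add:
  assumes "u .: F" "v .: F"
  shows "pcls S Q (u + v) = pcls S Q u +[presented S Q] pcls S Q v"
  using normal.rcos_sum[OF N_normal assms]
  by (simp add: pcls_def presented_def Let_def FactGroup_def)

lemma pcls_zero: "pcls S Q 0 = 0[presented S Q]"
  using F.coset_join2[of 0 N] F.generate_is_subgroup[OF rel] subgroup.one_closed[of N F]
  by (simp add: pcls_def presented_def Let_def FactGroup_def)

lemma presented_group: "abelian_group (presented S Q)"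
proof -
  have "comm_group (F Mod N)" by (rule F.abelian_FactGroup[OF F.generate_is_subgroup[OF rel]])
  moreover have "add_monoid (presented S Q) = F Mod N"
    by (simp add: presented_def Let_def FactGroup_def)
  ultimately have "comm_group (add_monoid (presented S Q))" by simp
  then show ?thesis
    by (simp add: abelian_group_def abelian_group_axioms_def abelian_monoid_def comm_group_def)
qed

sublocale P: abelian_group "presented S Q" by (rule presented_group)

lemma pcls_hom: "u .: F ==> pcls S Q u .: (presented S Q)" by (simp add: carrier_presented)

lemma pcls_uminus:
  assumes u: "u .: F"
  shows "pcls S Q (- u) = -[presented S Q] pcls S Q u"
proof -
  have "pcls S Q (- u) +[presented S Q] pcls S Q u = 0[presented S Q]"
    using pcls_add[of "- u" u] u by (simp add: pcls_zero)
  then show ?thesis using u pcls_hom[of u] pcls_hom[of "- u"] by (simp add: P.minus_equality)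
qed

lemma pcls_rel: "q \<in> Q ==> pcls S Q q = 0[presented S Q]"
  using F.coset_join2[of q N] F.generate_is_subgroup[OF rel] generate.incl[of q Q F] rel
  by (auto simp: pcls_def presented_def Let_def FactGroup_def)

lemma class_eq: "presented_class S Q g = pcls S Q (frag_of g)"
  by (simp add: presented_class_def pcls_def)

lemma class_closed: "g \<in> S ==> presented_class S Q g .: (presented S Q)"
  by (simp add: class_eq pcls_hom)

lemma class_rel_add:
  assumes "frag_of a - frag_of b - frag_of c \<in> Q" "a \<in> S" "b \<in> S" "c \<in> S"
  shows "presented_class S Q a = presented_class S Q b +[presented S Q] presented_class S Q c"
proof -
  let ?q = "frag_of a - frag_of b - frag_of c"
  have q: "?q .: F" by (rule subsetD[OF rel assms(1)])
  have bc: "frag_of b + frag_of c .: F" using assms F.m_closed[of "frag_of b" "frag_of c"] by simp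
  have "pcls S Q (?q + (frag_of b + frag_of c)) = pcls S Q ?q +[presented S Q] pcls S Q (frag_of b + frag_of c)"
    by (rule pcls_add[OF q bc])
  moreover have "?q + (frag_of b + frag_of c) = frag_of a" by simp
  ultimately show ?thesis
    using assms pcls_add[of "frag_of b" "frag_of c"] pcls_hom[of "frag_of b"] pcls_hom[of "frag_of c"]
    by (simp add: class_eq pcls_rel)
qed

lemma class_rel_eq:
  assumes "frag_of a - frag_of b \<in> Q" "a \<in> S" "b \<in> S"
  shows "presented_class S Q a = presented_class S Q b"
proof -
  let ?q = "frag_of a - frag_of b"
  have q: "?q .: F" by (rule subsetD[OF rel assms(1)])
  have "pcls S Q (?q + frag_of b) = pcls S Q ?q +[presented S Q] pcls S Q (frag_of b)"
    by (rule pcls_add[OF q]) (simp add: assms)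
  then show ?thesis using assms pcls_hom[of "frag_of b"] by (simp add: class_eq pcls_rel)
qed

lemma presented_induct [consumes 1, case_names zero gen add neg]:
  assumes X: "X .: (presented S Q)" and zero: "P 0[presented S Q]"
    and cls: "\<And>g. g \<in> S ==> P (presented_class S Q g)"
    and add: "\<And>X Y. \<lbrakk>X .: (presented S Q); Y .: (presented S Q); P X; P Y\<rbrakk> \<Longrightarrow>
        P (X +[presented S Q] Y)"
    and neg: "\<And>X. \<lbrakk>X .: (presented S Q); P X\<rbrakk> \<Longrightarrow> P (-[presented S Q] X)"
  shows "P X"
proof -
  have "P (pcls S Q u)" if "Poly_Mapping.keys u \<subseteq> S" for u using that
  proof (rule free_Abelian_group_induct)
    fix x y
    assume xy: "Poly_Mapping.keys x \<subseteq> S" "Poly_Mapping.keys y \<subseteq> S"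
      and P: "P (pcls S Q x)" "P (pcls S Q y)"
    have eq: "pcls S Q (x - y) = pcls S Q x +[presented S Q] -[presented S Q] pcls S Q y"
      using xy pcls_add[of x "- y"] pcls_uminus[of y] by simp
    show "P (pcls S Q (x - y))"
      unfolding eq using xy P pcls_hom[of x] pcls_hom[of y] by (intro add neg) auto
  qed (use zero cls in \<open>simp_all add: pcls_zero flip: class_eq\<close>)
  then show ?thesis using X by (auto simp: carrier_presented)
qed

lemma ahom_eqI:
  assumes H: "abelian_group H" and f: "ahom (presented S Q) H f" and g: "ahom (presented S Q) H g"
    and eq: "\<And>x. x \<in> S ==> f (presented_class S Q x) = g (presented_class S Q x)"
    and X: "X .: (presented S Q)"
  shows "f X = g X"
  using X by (induction X rule: presented_induct)
    (auto simp: eq ahom_zero[OF P.abelian_group_axioms H f] ahom_zero[OF P.abelian_group_axioms H g]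
      ahom_add[OF f] ahom_add[OF g] ahom_neg[OF P.abelian_group_axioms H f] ahom_neg[OF P.abelian_group_axioms H g])

text \<open>The representative chosen in \<open>presented_lift\<close> differs from \<open>u\<close>
  by an element of \<open>N\<close>, where the extension of \<phi> vanishes because it vanishes on
  the relations that generate \<open>N\<close>.\<close>

lemma lift_pcls:
  assumes H: "abelian_group H" and \<phi>: "\<phi> \<in> S \<rightarrow> carrier H"
    and Q: "\<And>q. q \<in> Q ==> frag_lift H \<phi> q = 0[H]" and u: "u .: F"
  shows "presented_lift H \<phi> (pcls S Q u) = frag_lift H \<phi> u"
proof -
  interpret H: abelian_group H by fact
  have N: "frag_lift H \<phi> n = 0[H]" if "n \<in> N" for n using that
  proof (induction n rule: generate.induct)
    case (eng h1 h2)
    then have "h1 .: F" "h2 .: F" using subsetD[OF N_subset] by blast+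
    then show ?case using eng by (simp add: H.frag_lift_add[OF \<phi>])
  next
    case (inv h)
    then show ?case using rel by (auto simp: H.frag_lift_uminus[OF \<phi>] Q)
  qed (simp_all add: H.frag_lift_zero Q)
  define v where "v = (SOME v. v \<in> pcls S Q u)"
  have "u \<in> pcls S Q u"
    unfolding pcls_def by (rule F.rcos_self[OF u F.generate_is_subgroup[OF rel]])
  then have "v \<in> pcls S Q u" unfolding v_def by (rule someI)
  then obtain n where n: "n \<in> N" "v = n + u" by (auto simp: pcls_def r_coset_def)
  then have "n .: F" using subsetD[OF N_subset] by blast
  then show ?thesis using n u N[OF n(1)] H.frag_lift_closed[OF \<phi>, of u]
    by (simp add: presented_lift_eq flip: v_def) (simp add: H.frag_lift_add[OF \<phi>])
qed

lemma lift_ahom: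
  assumes H: "abelian_group H" and \<phi>: "\<phi> \<in> S \<rightarrow> carrier H"
    and Q: "\<And>q. q \<in> Q ==> frag_lift H \<phi> q = 0[H]"
  shows "ahom (presented S Q) H (presented_lift H \<phi>)"
proof -
  interpret H: abelian_group H by fact
  note l = lift_pcls[OF H \<phi> Q]
  show ?thesis proof (rule ahomI)
    fix X assume "X .: (presented S Q)"
    then show "presented_lift H \<phi> X .: H"
      by (auto simp: carrier_presented l H.frag_lift_closed[OF \<phi>])
  next
    fix X Y assume "X .: (presented S Q)" "Y .: (presented S Q)"
    then obtain u v where uv: "u .: F" "v .: F" "X = pcls S Q u" "Y = pcls S Q v"
      by (auto simp: carrier_presented)
    moreover have "u + v .: F" using F.m_closed[OF uv(1,2)] by simp
    ultimately show "presented_lift H \<phi> (X +[presented S Q] Y) = presented_lift H \<phi> X +[H] presented_lift H \<phi> Y"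
      using l[of "u + v"] by (simp add: l H.frag_lift_add[OF \<phi>] flip: pcls_add)
  qed
qed

lemma lift_class:
  assumes H: "abelian_group H" and \<phi>: "\<phi> \<in> S \<rightarrow> carrier H"
    and Q: "\<And>q. q \<in> Q ==> frag_lift H \<phi> q = 0[H]" and g: "g \<in> S"
  shows "presented_lift H \<phi> (presented_class S Q g) = \<phi> g"
  using lift_pcls[OF H \<phi> Q, of "frag_of g"] g \<phi> abelian_group.frag_lift_of[OF H, of \<phi> g]
  by (auto simp: class_eq)

end

text \<open>Translates a defining relation of a tensor product, which is a formal difference of
  generators, into the equation that a map on generators has to satisfy.\<close>

lemma (in abelian_group) frag_lift_rel_add:
  assumes "\<phi> a .: G" "\<phi> b .: G" "\<phi> c .: G" "\<phi> a = \<phi> b \<oplus> \<phi> c"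
  shows "frag_lift G \<phi> (frag_of a - frag_of b - frag_of c) = \<zero>"
proof -
  have \<phi>: "\<phi> \<in> {a, b, c} \<rightarrow> carrier G" using assms by auto
  have k: "Poly_Mapping.keys (frag_of a - frag_of b) \<subseteq> {a, b, c}"
    using keys_diff[of "frag_of a" "frag_of b"] by auto
  show ?thesis using assms k by (simp add: frag_lift_diff[OF \<phi>] frag_lift_of a_minus_def)
      (metis a_assoc a_closed a_inv_closed minus_add r_neg)
qed

lemma (in abelian_group) frag_lift_rel_eq:
  assumes "\<phi> a .: G" "\<phi> b .: G" "\<phi> a = \<phi> b"
  shows "frag_lift G \<phi> (frag_of a - frag_of b) = \<zero>"
proof -
  have \<phi>: "\<phi> \<in> {a, b} \<rightarrow> carrier G" using assms by auto
  show ?thesis using assms by (simp add: frag_lift_diff[OF \<phi>] frag_lift_of a_minus_def r_neg)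
qed

section \<open>Bimodules\<close>

text \<open>\<open>tensor\<close> and \<open>tpow\<close> share their additive structure with the
  presented groups without being equal to them as records; the group laws are carried over by
  this.\<close>

lemma abelian_group_cong:
  assumes "abelian_group G"
    and eq: "carrier H = carrier G" "0[H] = 0[G]" "\<And>x y. x +[H] y = x +[G] y"
  shows "abelian_group H"
proof -
  interpret G: abelian_group G by fact
  show ?thesis proof (rule abelian_groupI)
    fix x assume "x .: H"
    then show "\<exists>y\<in>carrier H. y +[H] x = 0[H]"
      unfolding eq by (intro bexI[of _ "-[G] x"]) (auto simp: G.l_neg)
  qed (unfold eq, auto simp: G.a_ac)
qed

lemma a_inv_cong:
  assumes G: "abelian_group G"
    and eq: "carrier H = carrier G" "0[H] = 0[G]" "\<And>x y. x +[H] y = x +[G] y" and x: "x .: G"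
  shows "-[H] x = -[G] x"
proof -
  have "ahom G H (\<lambda>x. x)" by (simp add: ahom_def eq)
  then show ?thesis using ahom_neg[OF G abelian_group_cong[OF G eq] _ x, of "\<lambda>x. x"] by simp
qed

lemma ring_op_ring: "ring R ==> ring (op_ring R)"
proof -
  assume "ring R"
  then interpret R: ring R .
  show "ring (op_ring R)" proof (rule ringI)
    show "abelian_group (op_ring R)"
      by (rule abelian_group_cong[OF R.abelian_group_axioms]) (simp_all add: op_ring_def)
    show "monoid (op_ring R)" by (rule monoidI) (auto simp: op_ring_def R.m_assoc)
  qed (auto simp: op_ring_def R.l_distr R.r_distr)
qed

lemma op_ring_simps [simp]:
  "carrier (op_ring R) = carrier R" "0[op_ring R] = 0[R]" "1[op_ring R] = 1[R]"
  "r +[op_ring R] s = r +[R] s" "r *[op_ring R] s = s *[R] r" by (simp_all add: op_ring_def)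

text \<open>Both sides of a bimodule law are additive in the module element, so it is enough to
  compare them on a set \<open>X\<close> that determines additive endomorphisms, which is what
  \<open>ext\<close> says. For tensor products and tensor powers \<open>X\<close> consists of the
  pure tensors.\<close>

lemma bimodule_genI:
  assumes R: "ring R" and T: "abelian_group T" and X: "X \<subseteq> carrier T"
    and ext: "\<And>f g x. ahom T T f ==> ahom T T g ==> (\<And>x. x \<in> X ==> f x = g x) ==>
        x .: T ==> f x = g x" and L: "\<And>r. r .: R ==> ahom T T (\<lambda>x. r .[T] x)"
    and L': "\<And>r. r .: R ==> ahom T T (\<lambda>x. x <[T] r)" and 1: "\<And>r s x. r .: R ==> s .: R ==> x \<in> X ==>
        (r +[R] s) .[T] x = r .[T] x +[T] s .[T] x" and 2: "\<And>r s x. r .: R ==> s .: R ==> x \<in> X ==>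
        (r *[R] s) .[T] x = r .[T] (s .[T] x)" and 3: "\<And>x. x \<in> X ==> 1[R] .[T] x = x"
    and 4: "\<And>r s x. r .: R ==> s .: R ==> x \<in> X ==>
        x <[T] (r +[R] s) = x <[T] r +[T] x <[T] s" and 5: "\<And>r s x. r .: R ==> s .: R ==> x \<in> X ==>
        x <[T] (r *[R] s) = (x <[T] r) <[T] s" and 6: "\<And>x. x \<in> X ==> x <[T] 1[R] = x"
    and 7: "\<And>r s x. r .: R ==> s .: R ==> x \<in> X ==> (r .[T] x) <[T] s = r .[T] (x <[T] s)"
  shows "bimodule R T"
proof -
  interpret R: ring R by fact
  interpret T: abelian_group T by fact
  have id: "ahom T T (\<lambda>x. x)" by (simp add: ahom_def)
  show ?thesis
  proof (intro bimodule.intro left_module.intro left_module_axioms.intro bimodule_axioms.intro R T)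
    fix r s x
    assume r: "r .: R" and s: "s .: R" and x: "x .: T"
    show "(r +[R] s) .[T] x = r .[T] x +[T] s .[T] x"
      using ext[OF L[of "r +[R] s"] ahom_plus[OF T L[OF r] L[OF s]] 1[OF r s] x] r s by simp
    show "(r *[R] s) .[T] x = r .[T] (s .[T] x)"
      using ext[OF L[of "r *[R] s"] ahom_comp[OF L[OF s] L[OF r]] 2[OF r s] x] r s by simp
    show "x <[T] (r +[R] s) = x <[T] r +[T] x <[T] s"
      using ext[OF L'[of "r +[R] s"] ahom_plus[OF T L'[OF r] L'[OF s]] 4[OF r s] x] r s by simp
    show "x <[T] (r *[R] s) = (x <[T] r) <[T] s"
      using ext[OF L'[of "r *[R] s"] ahom_comp[OF L'[OF r] L'[OF s]] 5[OF r s] x] r s by simp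
    show "(r .[T] x) <[T] s = r .[T] (x <[T] s)"
      using ext[OF ahom_comp[OF L[OF r] L'[OF s]] ahom_comp[OF L'[OF s] L[OF r]] 7[OF r s] x] .
  next
    fix x assume x: "x .: T"
    show "1[R] .[T] x = x" using ext[OF L[OF R.one_closed] id 3 x] .
    show "x <[T] 1[R] = x" using ext[OF L'[OF R.one_closed] id 6 x] .
  next
    fix r x assume r: "r .: R" and x: "x .: T"
    show "r .[T] x .: T" "x <[T] r .: T"
      using ahom_closed[OF L[OF r] x] ahom_closed[OF L'[OF r] x] by simp_all
    fix y assume y: "y .: T"
    show "r .[T] (x +[T] y) = r .[T] x +[T] r .[T] y" "(x +[T] y) <[T] r = x <[T] r +[T] y <[T] r"
      using ahom_add[OF L[OF r] x y] ahom_add[OF L'[OF r] x y] by simp_all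
  qed
qed

lemma (in abelian_group) sub_group:
  assumes N: "N \<subseteq> carrier G" and z: "\<zero> \<in> N" and add: "\<And>x y. x \<in> N ==> y \<in> N ==> x \<oplus> y \<in> N"
    and neg: "\<And>x. x \<in> N ==> \<ominus> x \<in> N"
  shows "abelian_group (G\<lparr>carrier := N\<rparr>)"
proof (rule abelian_groupI)
  fix x assume "x .: (G\<lparr>carrier := N\<rparr>)"
  then show "\<exists>y\<in>carrier (G\<lparr>carrier := N\<rparr>). y +[G\<lparr>carrier := N\<rparr>] x = 0[G\<lparr>carrier := N\<rparr>]"
    using neg[of x] N by (auto intro!: bexI[of _ "\<ominus> x"] simp: l_neg)
qed (use assms in \<open>auto simp: a_ac subset_iff\<close>)

lemma (in abelian_group) a_inv_sub:
  assumes N: "N \<subseteq> carrier G" and z: "\<zero> \<in> N" and add: "\<And>x y. x \<in> N ==> y \<in> N ==> x \<oplus> y \<in> N"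
    and neg: "\<And>x. x \<in> N ==> \<ominus> x \<in> N" and x: "x \<in> N"
  shows "-[G\<lparr>carrier := N\<rparr>] x = \<ominus> x"
proof -
  interpret N: abelian_group "G\<lparr>carrier := N\<rparr>" by (rule sub_group) fact+
  show ?thesis using x neg[OF x] N l_neg[of x] by (intro N.minus_equality) auto
qed

lemma (in abelian_group) finsum_sub:
  assumes N: "N \<subseteq> carrier G" and z: "\<zero> \<in> N" and add: "\<And>x y. x \<in> N ==> y \<in> N ==> x \<oplus> y \<in> N"
    and neg: "\<And>x. x \<in> N ==> \<ominus> x \<in> N" and f: "\<And>i. i \<in> I ==> f i \<in> N"
  shows "finsum (G\<lparr>carrier := N\<rparr>) f I = finsum G f I" "finsum G f I \<in> N"
proof -
  have sg: "abelian_group (G\<lparr>carrier := N\<rparr>)" by (rule sub_group) fact+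
  have "ahom (G\<lparr>carrier := N\<rparr>) G (\<lambda>x. x)" using N by (auto simp: ahom_def)
  from ahom_finsum[OF sg abelian_group_axioms this, of f I] f
  show 1: "finsum (G\<lparr>carrier := N\<rparr>) f I = finsum G f I" by auto
  have "finsum (G\<lparr>carrier := N\<rparr>) f I .: (G\<lparr>carrier := N\<rparr>)"
    using f by (intro abelian_monoid.finsum_closed[OF abelian_group.axioms(1)[OF sg]]) auto
  with 1 show "finsum G f I \<in> N" by simp
qed

context left_module
begin

lemma Rg: "abelian_group R" by (rule R.is_abelian_group)

lemma ahom_smult: "r .: R ==> ahom M M (\<lambda>x. r .[M] x)"
  by (simp add: ahom_def smult_closed smult_r_distr)

lemma smult_zero: "r .: R ==> r .[M] 0[M] = 0[M]"
  using ahom_zero[OF M.abelian_group_axioms M.abelian_group_axioms ahom_smult] .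

lemma ahom_smult_left: "x .: M ==> ahom R M (\<lambda>r. r .[M] x)"
  by (simp add: ahom_def smult_closed smult_l_distr)

lemma zero_smult: "x .: M ==> 0[R] .[M] x = 0[M]"
  using ahom_zero[OF R.abelian_group_axioms M.abelian_group_axioms ahom_smult_left] .

lemma smult_neg: "r .: R ==> x .: M ==> r .[M] (-[M] x) = -[M] (r .[M] x)"
  using ahom_neg[OF M.abelian_group_axioms M.abelian_group_axioms ahom_smult] .

lemma neg_smult: "r .: R ==> x .: M ==> (-[R] r) .[M] x = -[M] (r .[M] x)"
  using ahom_neg[OF R.abelian_group_axioms M.abelian_group_axioms ahom_smult_left] .

lemma smult_minus_one: "x .: M ==> (-[R] 1[R]) .[M] x = -[M] x" by (simp add: neg_smult smult_one)

end

context bimodule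
begin

lemma ahom_rsmult: "r .: R ==> ahom M M (\<lambda>x. x <[M] r)"
  by (simp add: ahom_def rsmult_closed rsmult_l_distr)

lemma zero_rsmult: "r .: R ==> 0[M] <[M] r = 0[M]"
  using ahom_zero[OF M.abelian_group_axioms M.abelian_group_axioms ahom_rsmult] .

lemma ahom_rsmult_right: "x .: M ==> ahom R M (\<lambda>r. x <[M] r)"
  by (simp add: ahom_def rsmult_closed rsmult_r_distr)

lemma sub_bimodule:
  assumes N: "N \<subseteq> carrier M" and z: "0[M] \<in> N" and add: "\<And>x y. x \<in> N ==> y \<in> N ==> x +[M] y \<in> N"
    and l: "\<And>r x. r .: R ==> x \<in> N ==> r .[M] x \<in> N"
    and r: "\<And>r x. r .: R ==> x \<in> N ==> x <[M] r \<in> N"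
  shows "bimodule R (M\<lparr>carrier := N\<rparr>)"
proof -
  \<comment> \<open>Negation is multiplication by the scalar -1, so closure under the action gives
    closure under inverses.\<close>
  have "-[M] x \<in> N" if "x \<in> N" for x
    using l[of "-[R] 1[R]" x] that N by (auto simp: smult_minus_one subset_iff)
  then have "abelian_group (M\<lparr>carrier := N\<rparr>)" using assms by (intro M.sub_group) auto
  then show ?thesis using N l r
    by (intro bimodule.intro left_module.intro left_module_axioms.intro bimodule_axioms.intro R.ring_axioms)
      (auto simp: subset_iff smult_l_distr smult_r_distr smult_assoc smult_one
        rsmult_l_distr rsmult_r_distr rsmult_assoc rsmult_one smult_rsmult)
qed

end

lemma bimodule_regular: "ring R ==> bimodule R (regular R)"
proof -
  assume "ring R"
  then interpret R: ring R .
  have "abelian_group (regular R)"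
    by (rule abelian_group_cong[OF R.abelian_group_axioms]) (simp_all add: regular_def)
  then show ?thesis
    by (intro bimodule.intro left_module.intro left_module_axioms.intro bimodule_axioms.intro R.ring_axioms)
      (auto simp: regular_def R.l_distr R.r_distr R.m_assoc)
qed

lemma regular_simps [simp]:
  "carrier (regular R) = carrier R" "0[regular R] = 0[R]" "x +[regular R] y = x +[R] y"
  "r .[regular R] x = r *[R] x" "x <[regular R] r = x *[R] r" by (simp_all add: regular_def)

lemma left_linear_ahom: "left_linear R M N f ==> ahom M N f"
  by (auto simp: left_linear_def ahom_def)

lemma left_linear_smult: "left_linear R M N f ==> r .: R ==> x .: M ==> f (r .[M] x) = r .[N] f x"
  by (auto simp: left_linear_def)

lemma left_linearI: "ahom M N f ==> (\<And>r x. r .: R ==> x .: M ==> f (r .[M] x) = r .[N] f x) ==>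
    left_linear R M N f" by (auto simp: left_linear_def ahom_def)


section \<open>Tensor products of two bimodules\<close>

text \<open>The balanced biadditive maps, on pairs because the generators of a tensor product are
  pairs: these are the maps that descend to the tensor product over \<open>R\<close>.\<close>

definition bilin ::
  "('r, 'x) ring_scheme => ('r, 'm, 'y) bimodule_scheme => ('r, 'n, 'z) bimodule_scheme =>
    ('g, 'w) ring_scheme => ('m \<times> 'n => 'g) => bool" where "bilin R M N G \<phi> \<longleftrightarrow>
     (\<forall>x\<in>carrier M. ahom N G (\<lambda>y. \<phi> (x, y))) \<and> (\<forall>y\<in>carrier N. ahom M G (\<lambda>x. \<phi> (x, y))) \<and>
     (\<forall>x\<in>carrier M. \<forall>r\<in>carrier R. \<forall>y\<in>carrier N. \<phi> (x <[M] r, y) = \<phi> (x, r .[N] y))"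

lemma bilinI:
  assumes "\<And>x. x .: M ==> ahom N G (\<lambda>y. \<phi> (x, y))" and "\<And>y. y .: N ==> ahom M G (\<lambda>x. \<phi> (x, y))"
    and "\<And>x r y. x .: M ==> r .: R ==> y .: N ==> \<phi> (x <[M] r, y) = \<phi> (x, r .[N] y)"
  shows "bilin R M N G \<phi>"
  using assms by (simp add: bilin_def)

locale bimodule_pair = M: bimodule R M + N: bimodule R N
  for R :: "('r, 'x) ring_scheme" and M :: "('r, 'm, 'y) bimodule_scheme"
    and N :: "('r, 'n, 'z) bimodule_scheme"
begin

abbreviation "T \<equiv> tensor R M N"
abbreviation "PT \<equiv> presented (carrier M \<times> carrier N) (tensor_rel R M N)"

sublocale pr: presentation "carrier M \<times> carrier N" "tensor_rel R M N"
proof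
  have k: "Poly_Mapping.keys (frag_of a - frag_of b - frag_of c) \<subseteq> {a, b, c}"
    "Poly_Mapping.keys (frag_of a - frag_of b) \<subseteq> {a, b}" for a b c :: "'m \<times> 'n"
    using keys_diff[of "frag_of a - frag_of b" "frag_of c"] keys_diff[of "frag_of a" "frag_of b"]
    by auto
  have "Poly_Mapping.keys q \<subseteq> carrier M \<times> carrier N" if q: "q \<in> tensor_rel R M N" for q
    using q unfolding tensor_rel_def
    by (elim UnE CollectE exE conjE; hypsubst; intro order_trans[OF k(1)] order_trans[OF k(2)])
      (auto simp: M.rsmult_closed N.smult_closed)
  then show "tensor_rel R M N \<subseteq> carrier (free_Abelian_group (carrier M \<times> carrier N))" by auto
qed

lemma tensor_simps: "carrier T = carrier PT" "0[T] = 0[PT]" "x +[T] y = x +[PT] y"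
  by (simp_all add: tensor_def Let_def)

lemma tensor_neg: "X .: T ==> -[T] X = -[PT] X"
  by (rule a_inv_cong[OF pr.presented_group]) (auto simp: tensor_simps)

lemma tensor_group: "abelian_group T"
  by (rule abelian_group_cong[OF pr.presented_group]) (auto simp: tensor_simps)

lemma ahom_tensor: "ahom T G f \<longleftrightarrow> ahom PT G f" by (simp add: ahom_def tensor_simps)

lemma pure_closed: "x .: M ==> y .: N ==> tensor_pure R M N x y .: T"
  by (simp add: tensor_simps tensor_pure_def pr.class_closed)

lemma pure_add_l: "x .: M ==> x' .: M ==> y .: N ==>
    tensor_pure R M N (x +[M] x') y = tensor_pure R M N x y +[T] tensor_pure R M N x' y"
  unfolding tensor_simps tensor_pure_def by (rule pr.class_rel_add) (auto simp: tensor_rel_def)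

lemma pure_add_r: "x .: M ==> y .: N ==> y' .: N ==>
    tensor_pure R M N x (y +[N] y') = tensor_pure R M N x y +[T] tensor_pure R M N x y'"
  unfolding tensor_simps tensor_pure_def by (rule pr.class_rel_add) (auto simp: tensor_rel_def)

lemma pure_balanced: "x .: M ==> r .: R ==> y .: N ==>
    tensor_pure R M N (x <[M] r) y = tensor_pure R M N x (r .[N] y)" unfolding tensor_pure_def
  by (rule pr.class_rel_eq) (auto simp: tensor_rel_def M.rsmult_closed N.smult_closed)

lemma tensor_induct [consumes 1, case_names zero pure add neg]:
  assumes X: "X .: T" and "P 0[T]" "\<And>x y. x .: M ==> y .: N ==> P (tensor_pure R M N x y)"
    and "\<And>X Y. \<lbrakk>X .: T; Y .: T; P X; P Y\<rbrakk> \<Longrightarrow> P (X +[T] Y)" and "\<And>X. \<lbrakk>X .: T; P X\<rbrakk> \<Longrightarrow> P (-[T] X)"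
  shows "P X"
  using X unfolding tensor_simps by (induction X rule: pr.presented_induct)
    (use assms in \<open>auto simp: tensor_simps tensor_neg simp flip: tensor_pure_def\<close>)

lemma tensor_eqI:
  assumes "abelian_group G" "ahom T G f" "ahom T G g"
    and "\<And>x y. x .: M ==> y .: N ==> f (tensor_pure R M N x y) = g (tensor_pure R M N x y)"
    and "X .: T"
  shows "f X = g X" by (rule pr.ahom_eqI[of G])
    (use assms in \<open>auto simp: tensor_simps ahom_tensor simp flip: tensor_pure_def\<close>)

lemma bilin_rel:
  assumes G: "abelian_group G" and \<phi>: "bilin R M N G \<phi>" and q: "q \<in> tensor_rel R M N"
  shows "frag_lift G \<phi> q = 0[G]"
proof -
  interpret G: abelian_group G by fact
  have c: "\<phi> (x, y) .: G" if "x .: M" "y .: N" for x y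
    using \<phi> that by (auto simp: bilin_def ahom_def)
  have "\<phi> (x +[M] x', y) = \<phi> (x, y) +[G] \<phi> (x', y)" if "x .: M" "x' .: M" "y .: N" for x x' y
    using \<phi> that by (auto simp: bilin_def ahom_def)
  moreover have "\<phi> (x, y +[N] y') = \<phi> (x, y) +[G] \<phi> (x, y')" if "x .: M" "y .: N" "y' .: N" for x y y'
    using \<phi> that by (auto simp: bilin_def ahom_def)
  moreover have "\<phi> (x <[M] r, y) = \<phi> (x, r .[N] y)" if "x .: M" "r .: R" "y .: N" for x r y
    using \<phi> that by (auto simp: bilin_def)
  ultimately show ?thesis using q unfolding tensor_rel_def
    by (auto intro!: G.frag_lift_rel_add G.frag_lift_rel_eq c simp: M.rsmult_closed N.smult_closed)
qed

lemma bilin_maps: "bilin R M N G \<phi> ==> \<phi> \<in> carrier M \<times> carrier N \<rightarrow> carrier G"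
  by (auto simp: bilin_def ahom_def)

lemma lift_ahom: "abelian_group G ==> bilin R M N G \<phi> ==> ahom T G (presented_lift G \<phi>)"
  unfolding ahom_tensor by (rule pr.lift_ahom[OF _ bilin_maps bilin_rel])

lemma lift_pure: "abelian_group G ==> bilin R M N G \<phi> ==> x .: M ==> y .: N ==>
    presented_lift G \<phi> (tensor_pure R M N x y) = \<phi> (x, y)"
  unfolding tensor_pure_def by (rule pr.lift_class[OF _ bilin_maps bilin_rel]) auto

text \<open>The target is the presented group and not yet \<open>tensor\<close>, since the scalar
  action of \<open>tensor\<close> is itself defined by this lift.\<close>

lemma smult_bilin:
  assumes r: "r .: R"
  shows "bilin R M N PT (\<lambda>(x, y). tensor_pure R M N (r .[M] x) y)" by (rule bilinI)
    (use r in \<open>auto simp: ahom_def pure_closed pure_add_l pure_add_r pure_balanced M.smult_closed M.smult_r_distr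
      M.smult_rsmult[symmetric] simp flip: tensor_simps\<close>)

lemma rsmult_bilin:
  assumes r: "r .: R"
  shows "bilin R M N PT (\<lambda>(x, y). tensor_pure R M N x (y <[N] r))" by (rule bilinI)
    (use r in \<open>auto simp: ahom_def pure_closed pure_add_l pure_add_r pure_balanced N.rsmult_closed N.rsmult_l_distr
      N.smult_rsmult simp flip: tensor_simps\<close>)

lemma tensor_smult: "r .[T] X = presented_lift PT (\<lambda>(x, y). tensor_pure R M N (r .[M] x) y) X"
  by (simp add: tensor_def Let_def)

lemma tensor_rsmult: "X <[T] r = presented_lift PT (\<lambda>(x, y). tensor_pure R M N x (y <[N] r)) X"
  by (simp add: tensor_def Let_def)

lemma smult_pure: "r .: R ==> x .: M ==> y .: N ==>
    r .[T] tensor_pure R M N x y = tensor_pure R M N (r .[M] x) y"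
  unfolding tensor_smult by (subst lift_pure[OF pr.presented_group smult_bilin]) auto

lemma rsmult_pure: "r .: R ==> x .: M ==> y .: N ==>
    tensor_pure R M N x y <[T] r = tensor_pure R M N x (y <[N] r)"
  unfolding tensor_rsmult by (subst lift_pure[OF pr.presented_group rsmult_bilin]) auto

lemma tensor_bimodule: "bimodule R T"
proof (rule bimodule_genI[where X = "(\<lambda>(x, y). tensor_pure R M N x y) ` (carrier M \<times> carrier N)"])
  show "ahom T T (\<lambda>X. r .[T] X)" "ahom T T (\<lambda>X. X <[T] r)" if "r .: R" for r
    unfolding tensor_smult tensor_rsmult using lift_ahom[OF pr.presented_group smult_bilin[OF that]]
      lift_ahom[OF pr.presented_group rsmult_bilin[OF that]]
    by (simp_all add: ahom_def tensor_simps)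
  show "f X = g X" if "ahom T T f" "ahom T T g" "X .: T"
      "\<And>X. X \<in> (\<lambda>(x, y). tensor_pure R M N x y) ` (carrier M \<times> carrier N) ==> f X = g X" for f g X
    by (rule tensor_eqI[OF tensor_group that(1,2) _ that(3)]) (use that(4) in force)
  show "ring R" "abelian_group T" by (simp_all add: M.R.ring_axioms tensor_group)
  show "(\<lambda>(x, y). tensor_pure R M N x y) ` (carrier M \<times> carrier N) \<subseteq> carrier T"
    by (auto simp: pure_closed)
qed (auto simp: smult_pure rsmult_pure M.smult_closed
    N.rsmult_closed M.smult_l_distr M.smult_assoc M.smult_one N.rsmult_r_distr N.rsmult_assoc N.rsmult_one
    pure_add_l pure_add_r)

end

section \<open>Tensor powers\<close>

text \<open>Besides closure, the clauses are the four families of \<open>tpow_rel\<close> read as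
  equations between values of \<open>F\<close>. Such maps on generators are exactly those that the
  universal property of the tensor power extends.\<close>

definition tmulti ::
  "('r, 'x) ring_scheme => ('r, 'm, 'y) bimodule_scheme => nat => ('g, 'w) ring_scheme =>
    ('r \<times> 'm list => 'g) => bool" where "tmulti R M n G F \<longleftrightarrow>
     (\<forall>r xs. r .: R \<and> xs <: M \<and> length xs = n --> F (r, xs) .: G) \<and>
     (\<forall>r s xs. r .: R \<and> s .: R \<and> xs <: M \<and> length xs = n -->
        F (r +[R] s, xs) = F (r, xs) +[G] F (s, xs)) \<and>
     (\<forall>r xs x y ys. r .: R \<and> xs <: M \<and> x .: M \<and> y .: M \<and>
        ys <: M \<and> Suc (length xs + length ys) = n -->
        F (r, xs @ (x +[M] y) # ys) = F (r, xs @ x # ys) +[G] F (r, xs @ y # ys)) \<and>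
     (\<forall>r s x xs. r .: R \<and> s .: R \<and> x .: M \<and> xs <: M \<and>
        Suc (length xs) = n --> F (r *[R] s, x # xs) = F (r, (s .[M] x) # xs)) \<and>
     (\<forall>r s xs x y ys. r .: R \<and> s .: R \<and> xs <: M \<and> x .: M \<and>
        y .: M \<and> ys <: M \<and> Suc (Suc (length xs + length ys)) = n -->
        F (r, xs @ (x <[M] s) # y # ys) = F (r, xs @ x # (s .[M] y) # ys))"

lemma tmultiI:
  assumes "\<And>r xs. \<lbrakk>r .: R; xs <: M; length xs = n\<rbrakk> \<Longrightarrow> F (r, xs) .: G"
    and "\<And>r s xs. \<lbrakk>r .: R; s .: R; xs <: M; length xs = n\<rbrakk> \<Longrightarrow>
        F (r +[R] s, xs) = F (r, xs) +[G] F (s, xs)"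
    and "\<And>r xs x y ys. \<lbrakk>r .: R; xs <: M; x .: M; y .: M;
        ys <: M; Suc (length xs + length ys) = n\<rbrakk> \<Longrightarrow>
        F (r, xs @ (x +[M] y) # ys) = F (r, xs @ x # ys) +[G] F (r, xs @ y # ys)"
    and "\<And>r s x xs. \<lbrakk>r .: R; s .: R; x .: M; xs <: M;
        Suc (length xs) = n\<rbrakk> \<Longrightarrow> F (r *[R] s, x # xs) = F (r, (s .[M] x) # xs)"
    and "\<And>r s xs x y ys. \<lbrakk>r .: R; s .: R; xs <: M; x .: M;
        y .: M; ys <: M; Suc (Suc (length xs + length ys)) = n\<rbrakk> \<Longrightarrow>
        F (r, xs @ (x <[M] s) # y # ys) = F (r, xs @ x # (s .[M] y) # ys)"
  shows "tmulti R M n G F"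
  using assms by (simp add: tmulti_def)

lemma tmulti_closed: "tmulti R M n G F ==> \<lbrakk>r .: R; xs <: M; length xs = n\<rbrakk> \<Longrightarrow> F (r, xs) .: G"
  by (drule tmulti_def[THEN iffD1], drule conjunct1, blast)

lemma tmulti_add: "tmulti R M n G F ==> \<lbrakk>r .: R; s .: R; xs <: M; length xs = n\<rbrakk> \<Longrightarrow>
    F (r +[R] s, xs) = F (r, xs) +[G] F (s, xs)"
  by (drule tmulti_def[THEN iffD1], drule conjunct2, drule conjunct1, blast)

lemma tmulti_slot: "tmulti R M n G F ==> \<lbrakk>r .: R; xs <: M; x .: M; y .: M;
    ys <: M; Suc (length xs + length ys) = n\<rbrakk> \<Longrightarrow>
    F (r, xs @ (x +[M] y) # ys) = F (r, xs @ x # ys) +[G] F (r, xs @ y # ys)"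
  by (drule tmulti_def[THEN iffD1], drule conjunct2, drule conjunct2, drule conjunct1, blast)

lemma tmulti_head: "tmulti R M n G F ==> \<lbrakk>r .: R; s .: R; x .: M; xs <: M;
    Suc (length xs) = n\<rbrakk> \<Longrightarrow> F (r *[R] s, x # xs) = F (r, (s .[M] x) # xs)"
  by (drule tmulti_def[THEN iffD1], drule conjunct2, drule conjunct2, drule conjunct2, drule conjunct1, blast)

lemma tmulti_bal: "tmulti R M n G F ==> \<lbrakk>r .: R; s .: R; xs <: M; x .: M;
    y .: M; ys <: M; Suc (Suc (length xs + length ys)) = n\<rbrakk> \<Longrightarrow>
    F (r, xs @ (x <[M] s) # y # ys) = F (r, xs @ x # (s .[M] y) # ys)"
  by (drule tmulti_def[THEN iffD1], drule conjunct2, drule conjunct2, drule conjunct2, drule conjunct2, blast)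

lemma tmulti_slot_ahom:
  assumes "tmulti R M n G F" "r .: R" "xs <: M" "ys <: M" "Suc (length xs + length ys) = n"
  shows "ahom M G (\<lambda>x. F (r, xs @ x # ys))"
  using assms by (auto simp: ahom_def intro!: tmulti_closed[OF assms(1)] tmulti_slot[OF assms(1)])

lemma tpow_rscale_Nil [simp]: "tpow_rscale R M (r, []) s = (r *[R] s, [])"
  and tpow_rscale_snoc [simp]: "tpow_rscale R M (r, xs @ [x]) s = (r, xs @ [x <[M] s])"
  by (simp_all add: tpow_rscale_def)

context bimodule
begin

abbreviation "TP n \<equiv> tpow R M n"
abbreviation "PTP n \<equiv> presented (tpow_gens R M n) (tpow_rel R M n)"

lemma tpow_gens_iff: "(r, xs) \<in> tpow_gens R M n \<longleftrightarrow> r .: R \<and> xs <: M \<and> length xs = n"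
  by (simp add: tpow_gens_def)

lemma tpow_presentation: "presentation (tpow_gens R M n) (tpow_rel R M n)"
proof
  have k: "Poly_Mapping.keys (frag_of a - frag_of b - frag_of c) \<subseteq> {a, b, c}"
    "Poly_Mapping.keys (frag_of a - frag_of b) \<subseteq> {a, b}" for a b c :: "'r \<times> 'm list"
    using keys_diff[of "frag_of a - frag_of b" "frag_of c"] keys_diff[of "frag_of a" "frag_of b"]
    by auto
  have "Poly_Mapping.keys q \<subseteq> tpow_gens R M n" if q: "q \<in> tpow_rel R M n" for q
    using q unfolding tpow_rel_def
    by (elim UnE CollectE exE conjE; hypsubst; intro order_trans[OF k(1)] order_trans[OF k(2)])
      (auto simp: tpow_gens_iff rsmult_closed smult_closed)
  then show "tpow_rel R M n \<subseteq> carrier (free_Abelian_group (tpow_gens R M n))" by auto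
qed

lemma tpow_simps:
  "carrier (TP n) = carrier (PTP n)" "0[TP n] = 0[PTP n]" "x +[TP n] y = x +[PTP n] y"
  by (simp_all add: tpow_def Let_def)

lemma tpow_group: "abelian_group (TP n)"
  by (rule abelian_group_cong[OF presentation.presented_group[OF tpow_presentation]])
    (auto simp: tpow_simps)

lemma tpow_neg: "X .: (TP n) ==> -[TP n] X = -[PTP n] X"
  by (rule a_inv_cong[OF presentation.presented_group[OF tpow_presentation]]) (auto simp: tpow_simps)

lemma ahom_tpow: "ahom (TP n) G f \<longleftrightarrow> ahom (PTP n) G f" by (simp add: ahom_def tpow_simps)

lemma tpow_pure_eq:
  "length xs = n ==> tpow_pure R M (r, xs) = presented_class (tpow_gens R M n) (tpow_rel R M n) (r, xs)"
  by (simp add: tpow_pure_def)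

lemma tpow_pure_closed: "r .: R ==> xs <: M ==> length xs = n ==> tpow_pure R M (r, xs) .: (TP n)"
  unfolding tpow_simps
  by (simp add: tpow_pure_eq presentation.class_closed[OF tpow_presentation] tpow_gens_iff)

lemma tpow_rel_memI:
  assumes "r .: R" "s .: R" "xs <: M" "ys <: M" "x .: M" "y .: M"
  shows "length xs = n ==> frag_of (r +[R] s, xs) - frag_of (r, xs) - frag_of (s, xs) \<in> tpow_rel R M n"
    and "Suc (length xs + length ys) = n ==> frag_of (r, xs @ (x +[M] y) # ys) -
      frag_of (r, xs @ x # ys) - frag_of (r, xs @ y # ys) \<in> tpow_rel R M n"
    and "Suc (length xs) = n ==>
      frag_of (r *[R] s, x # xs) - frag_of (r, (s .[M] x) # xs) \<in> tpow_rel R M n"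
    and "Suc (Suc (length xs + length ys)) = n ==>
      frag_of (r, xs @ (x <[M] s) # y # ys) - frag_of (r, xs @ x # (s .[M] y) # ys) \<in> tpow_rel R M n"
  subgoal unfolding tpow_rel_def
    by (intro UnI1 CollectI, rule exI[of _ r], rule exI[of _ s], rule exI[of _ xs])
      (use assms in \<open>simp add: tpow_gens_iff\<close>)
  subgoal unfolding tpow_rel_def by (rule UnI1, rule UnI1, rule UnI2, rule CollectI,
        rule exI[of _ r], rule exI[of _ xs], rule exI[of _ x], rule exI[of _ y], rule exI[of _ ys])
      (use assms in \<open>simp add: tpow_gens_iff\<close>)
  subgoal unfolding tpow_rel_def by (rule UnI1, rule UnI2, rule CollectI,
        rule exI[of _ r], rule exI[of _ s], rule exI[of _ x], rule exI[of _ xs])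
      (use assms in \<open>simp add: tpow_gens_iff\<close>)
  subgoal unfolding tpow_rel_def by (rule UnI2, rule CollectI,
        rule exI[of _ r], rule exI[of _ xs], rule exI[of _ x], rule exI[of _ s], rule exI[of _ y], rule exI[of _ ys])
      (use assms in \<open>simp add: tpow_gens_iff\<close>)
  done

text \<open>The universal case: its clauses are the rules for computing with pure tensors.\<close>

lemma tpow_pure_tmulti: "tmulti R M n (TP n) (tpow_pure R M)"
proof -
  interpret pr: presentation "tpow_gens R M n" "tpow_rel R M n" by (rule tpow_presentation)
  show ?thesis proof (rule tmultiI)
    fix r s xs
    assume "r .: R" "s .: R" "xs <: M" "length xs = n"
    then show "tpow_pure R M (r +[R] s, xs) = tpow_pure R M (r, xs) +[TP n] tpow_pure R M (s, xs)"
      unfolding tpow_simps tpow_pure_eq[OF \<open>length xs = n\<close>]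
      by (intro pr.class_rel_add tpow_rel_memI(1)) (auto simp: tpow_gens_iff)
  next
    fix r xs x y ys
    assume a: "r .: R" "xs <: M" "x .: M" "y .: M" "ys <: M" "Suc (length xs + length ys) = n"
    have l: "length (xs @ z # ys) = n" for z using a by simp
    show "tpow_pure R M (r, xs @ (x +[M] y) # ys) =
        tpow_pure R M (r, xs @ x # ys) +[TP n] tpow_pure R M (r, xs @ y # ys)"
      unfolding tpow_simps tpow_pure_eq[OF l] using a
      by (intro pr.class_rel_add tpow_rel_memI(2)) (auto simp: tpow_gens_iff)
  next
    fix r s x xs
    assume a: "r .: R" "s .: R" "x .: M" "xs <: M" "Suc (length xs) = n"
    have l: "length (z # xs) = n" for z using a by simp
    show "tpow_pure R M (r *[R] s, x # xs) = tpow_pure R M (r, (s .[M] x) # xs)"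
      unfolding tpow_pure_eq[OF l] using a
      by (intro pr.class_rel_eq tpow_rel_memI(3)) (auto simp: tpow_gens_iff smult_closed)
  next
    fix r s xs x y ys
    assume a: "r .: R" "s .: R" "xs <: M" "x .: M"
        "y .: M" "ys <: M" "Suc (Suc (length xs + length ys)) = n"
    have l: "length (xs @ z # z' # ys) = n" for z z' using a by simp
    show "tpow_pure R M (r, xs @ (x <[M] s) # y # ys) = tpow_pure R M (r, xs @ x # (s .[M] y) # ys)"
      unfolding tpow_pure_eq[OF l] using a
      by (intro pr.class_rel_eq tpow_rel_memI(4)) (auto simp: tpow_gens_iff smult_closed rsmult_closed)
  qed (rule tpow_pure_closed)
qed

lemma tpow_induct [consumes 1, case_names zero pure add neg]:
  assumes X: "X .: (TP n)" and "P 0[TP n]"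
    and pure: "\<And>r xs. r .: R ==> xs <: M ==> length xs = n ==> P (tpow_pure R M (r, xs))"
    and "\<And>X Y. \<lbrakk>X .: (TP n); Y .: (TP n); P X; P Y\<rbrakk> \<Longrightarrow> P (X +[TP n] Y)"
    and "\<And>X. \<lbrakk>X .: (TP n); P X\<rbrakk> \<Longrightarrow> P (-[TP n] X)"
  shows "P X"
  using X unfolding tpow_simps
proof (induction X rule: presentation.presented_induct[OF tpow_presentation, consumes 1, case_names zero gen add neg])
  case (gen g)
  then show ?case
    using pure[of "fst g" "snd g"] by (cases g) (auto simp: tpow_gens_iff tpow_pure_eq)
qed (use assms in \<open>auto simp: tpow_simps tpow_neg\<close>)

lemma tpow_eqI:
  assumes G: "abelian_group G" "ahom (TP n) G f" "ahom (TP n) G g"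
    and "\<And>r xs. r .: R ==> xs <: M ==> length xs = n ==>
      f (tpow_pure R M (r, xs)) = g (tpow_pure R M (r, xs))" and X: "X .: (TP n)"
  shows "f X = g X"
  using X by (induction X rule: tpow_induct)
    (auto simp: assms(4) ahom_zero[OF tpow_group G(1,2)] ahom_zero[OF tpow_group G(1,3)]
      ahom_add[OF G(2)] ahom_add[OF G(3)] ahom_neg[OF tpow_group G(1,2)] ahom_neg[OF tpow_group G(1,3)])

lemma tmulti_rel:
  assumes G: "abelian_group G" and F: "tmulti R M n G F" and q: "q \<in> tpow_rel R M n"
  shows "frag_lift G F q = 0[G]"
proof -
  interpret G: abelian_group G by fact
  note [intro!] = tmulti_closed[OF F] G.frag_lift_rel_add G.frag_lift_rel_eq
  show ?thesis using q unfolding tpow_rel_def tpow_gens_def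
    by (auto intro!: tmulti_add[OF F] tmulti_slot[OF F] tmulti_head[OF F] tmulti_bal[OF F]
        simp: rsmult_closed smult_closed)
qed

lemma tmulti_maps: "tmulti R M n G F ==> F \<in> tpow_gens R M n \<rightarrow> carrier G"
  by (auto simp: tpow_gens_def tmulti_closed)

lemma tpow_lift_ahom: "abelian_group G ==> tmulti R M n G F ==> ahom (TP n) G (presented_lift G F)"
  unfolding ahom_tpow
  by (rule presentation.lift_ahom[OF tpow_presentation _ tmulti_maps tmulti_rel])

lemma tpow_lift_pure:
  "abelian_group G ==> tmulti R M n G F ==> r .: R ==> xs <: M ==> length xs = n ==>
    presented_lift G F (tpow_pure R M (r, xs)) = F (r, xs)"
  by (simp add: tpow_pure_eq presentation.lift_class[OF tpow_presentation _ tmulti_maps tmulti_rel] tpow_gens_iff)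

lemma tmulti_PTP: "tmulti R M n (PTP m) F \<longleftrightarrow> tmulti R M n (TP m) F"
  by (simp add: tmulti_def tpow_simps)

lemma tpow_smult_tmulti:
  assumes s: "s .: R"
  shows "tmulti R M n (TP n) (\<lambda>(r, xs). tpow_pure R M (s *[R] r, xs))"
proof -
  note m = tpow_pure_tmulti[of n]
  show ?thesis using s
    by (intro tmultiI) (simp_all add: R.r_distr R.m_assoc[symmetric] tmulti_closed[OF m] tmulti_add[OF m]
        tmulti_head[OF m] tmulti_slot[OF m] tmulti_bal[OF m] smult_closed)
qed

text \<open>The scalar multiplies the last entry, or the coefficient if the list is empty. A
  relation interferes with it only when it involves that entry, hence the distinction whether
  further entries follow.\<close>

lemma tmulti_rscale:
  assumes F: "tmulti R M n G F" and s: "s .: R"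
  shows "tmulti R M n G (\<lambda>g. F (tpow_rscale R M g s))"
proof (rule tmultiI, goal_cases)
  case (1 r xs)
  then show ?case
    using s by (cases xs rule: rev_exhaust) (auto intro!: tmulti_closed[OF F] simp: rsmult_closed)
next
  case (2 r r' xs)
  then show ?case
    using s by (cases xs rule: rev_exhaust) (auto intro!: tmulti_add[OF F] simp: rsmult_closed R.l_distr)
next
  case (3 r xs x y ys)
  show ?case proof (cases ys rule: rev_exhaust)
    case Nil
    then show ?thesis
      using 3 s by (auto intro!: tmulti_slot[OF F] simp: rsmult_l_distr rsmult_closed)
  next
    case (snoc zs z)
    then have "tpow_rscale R M (r, xs @ x # ys) s = (r, xs @ x # zs @ [z <[M] s])" for x
      using tpow_rscale_snoc[of R M r "xs @ x # zs" z s] by simp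
    then show ?thesis using 3 s snoc by (auto intro!: tmulti_slot[OF F] simp: rsmult_closed)
  qed
next
  case (4 r t x xs)
  show ?case proof (cases xs rule: rev_exhaust)
    case Nil
    then show ?thesis using 4 s tpow_rscale_snoc[of R M _ "[]" _ s]
      by (auto simp: smult_rsmult rsmult_closed intro!: tmulti_head[OF F])
  next
    case (snoc zs z)
    then have "tpow_rscale R M (r, x # xs) s = (r, x # zs @ [z <[M] s])" for r x
      using tpow_rscale_snoc[of R M r "x # zs" z s] by simp
    then show ?thesis using 4 s snoc by (auto intro!: tmulti_head[OF F] simp: rsmult_closed)
  qed
next
  case (5 r t xs x y ys)
  show ?case proof (cases ys rule: rev_exhaust)
    case Nil
    have "tpow_rscale R M (r, xs @ [x, y]) s = (r, xs @ [x, y <[M] s])" for x y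
      using tpow_rscale_snoc[of R M r "xs @ [x]" y s] by simp
    then show ?thesis
      using Nil 5 s by (auto intro!: tmulti_bal[OF F] simp: smult_rsmult rsmult_closed)
  next
    case (snoc zs z)
    then have "tpow_rscale R M (r, xs @ x # y # ys) s = (r, xs @ x # y # zs @ [z <[M] s])" for x y
      using tpow_rscale_snoc[of R M r "xs @ x # y # zs" z s] by simp
    then show ?thesis using 5 s snoc by (auto intro!: tmulti_bal[OF F] simp: rsmult_closed)
  qed
qed

lemma tpow_smult: "s .[TP n] X = presented_lift (PTP n) (\<lambda>(r, xs). tpow_pure R M (s *[R] r, xs)) X"
  by (simp add: tpow_def Let_def)

lemma tpow_rsmult: "X <[TP n] s = presented_lift (PTP n) (\<lambda>g. tpow_pure R M (tpow_rscale R M g s)) X"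
  by (simp add: tpow_def Let_def)

lemma tpow_smult_pure: "s .: R ==> r .: R ==> xs <: M ==> length xs = n ==>
    s .[TP n] tpow_pure R M (r, xs) = tpow_pure R M (s *[R] r, xs)" unfolding tpow_smult
  using tpow_lift_pure[OF presentation.presented_group[OF tpow_presentation]
      tpow_smult_tmulti[folded tmulti_PTP]] by fastforce

lemma tpow_rsmult_pure: "s .: R ==> r .: R ==> xs <: M ==> length xs = n ==>
    tpow_pure R M (r, xs) <[TP n] s = tpow_pure R M (tpow_rscale R M (r, xs) s)"
  unfolding tpow_rsmult using tpow_lift_pure[OF presentation.presented_group[OF tpow_presentation]
      tmulti_rscale[OF tpow_pure_tmulti, folded tmulti_PTP]] by fastforce

lemma tpow_bimodule: "bimodule R (TP n)"
proof (rule bimodule_genI[where X = "tpow_pure R M ` tpow_gens R M n"])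
  let ?X = "tpow_pure R M ` tpow_gens R M n"
  show "ring R" "abelian_group (TP n)" by (simp_all add: R.ring_axioms tpow_group)
  show "?X \<subseteq> carrier (TP n)" by (auto simp: tpow_pure_closed tpow_gens_def)
  show "ahom (TP n) (TP n) (\<lambda>X. r .[TP n] X)" "ahom (TP n) (TP n) (\<lambda>X. X <[TP n] r)"
    if "r .: R" for r unfolding tpow_smult tpow_rsmult
    using tpow_lift_ahom[OF presentation.presented_group[OF tpow_presentation]
        tpow_smult_tmulti[OF that, folded tmulti_PTP]]
      tpow_lift_ahom[OF presentation.presented_group[OF tpow_presentation]
        tmulti_rscale[OF tpow_pure_tmulti that, folded tmulti_PTP]]
    by (simp_all add: ahom_def tpow_simps)
  show "f X = g X" if "ahom (TP n) (TP n) f" "ahom (TP n) (TP n) g" "X .: (TP n)"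
      "\<And>X. X \<in> ?X ==> f X = g X" for f g X
    by (rule tpow_eqI[OF tpow_group that(1,2) _ that(3)]) (use that(4) in \<open>force simp: tpow_gens_def\<close>)
  fix r s X assume r: "r .: R" and s: "s .: R" and "X \<in> ?X"
  then obtain q xs where X: "X = tpow_pure R M (q, xs)" "q .: R" "xs <: M" "length xs = n"
    by (auto simp: tpow_gens_def)
  note m = tpow_pure_tmulti[of n]
  show "(r +[R] s) .[TP n] X = r .[TP n] X +[TP n] s .[TP n] X"
    using X r s by (simp add: tpow_smult_pure R.l_distr tmulti_add[OF m])
  show "(r *[R] s) .[TP n] X = r .[TP n] (s .[TP n] X)"
    using X r s by (simp add: tpow_smult_pure R.m_assoc)
  show "X <[TP n] (r +[R] s) = X <[TP n] r +[TP n] X <[TP n] s"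
    using X r s by (cases xs rule: rev_exhaust)
      (auto simp: tpow_rsmult_pure R.r_distr tmulti_add[OF m] rsmult_r_distr tmulti_slot[OF m] rsmult_closed)
  show "X <[TP n] (r *[R] s) = (X <[TP n] r) <[TP n] s" using X r s by (cases xs rule: rev_exhaust)
      (auto simp: tpow_rsmult_pure R.m_assoc rsmult_assoc rsmult_closed)
  show "(r .[TP n] X) <[TP n] s = r .[TP n] (X <[TP n] s)"
    using X r s by (cases xs rule: rev_exhaust)
      (auto simp: tpow_rsmult_pure tpow_smult_pure R.m_assoc rsmult_closed)
next
  fix X assume "X \<in> tpow_pure R M ` tpow_gens R M n"
  then obtain q xs where X: "X = tpow_pure R M (q, xs)" "q .: R" "xs <: M" "length xs = n"
    by (auto simp: tpow_gens_def)
  show "1[R] .[TP n] X = X" using X by (simp add: tpow_smult_pure)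
  show "X <[TP n] 1[R] = X"
    using X by (cases xs rule: rev_exhaust) (auto simp: tpow_rsmult_pure rsmult_one)
qed

end

section \<open>Modules over a semisimple ring\<close>

lemma (in left_module) submodule_iff:
  "submodule N R M \<longleftrightarrow> N \<subseteq> carrier M \<and> 0[M] \<in> N \<and> (\<forall>x\<in>N. \<forall>y\<in>N. x +[M] y \<in> N) \<and>
     (\<forall>r\<in>carrier R. \<forall>x\<in>N. r .[M] x \<in> N)" (is "_ \<longleftrightarrow> ?rhs")
proof
  assume "submodule N R M"
  then interpret submodule N R M .
  show ?rhs using subset one_closed m_closed smult_closed by auto
next
  assume N: ?rhs
  have "-[M] x \<in> N" if x: "x \<in> N" for x proof -
    have "(-[R] 1[R]) .[M] x \<in> N" "x .: M" using N x by auto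
    then show ?thesis by (simp add: smult_minus_one)
  qed
  then show "submodule N R M"
    using N by (intro submodule.intro subgroup.intro submodule_axioms.intro) (auto simp: a_inv_def)
qed

lemma (in left_module) submodule_neg:
  assumes "submodule N R M" "x \<in> N"
  shows "-[M] x \<in> N"
proof -
  interpret submodule N R M by fact
  show ?thesis using m_inv_closed[OF assms(2)] by (simp add: a_inv_def)
qed

text \<open>Zorn gives \<open>L\<close> maximal among the submodules that meet \<open>N\<close> in
  zero. If \<open>x\<close> were outside \<open>K = N + L\<close>, then
  \<open>J = {r. r x \<in> K}\<close> would be a proper left ideal, so some simple left ideal
  \<open>I\<close> is not inside it, and \<open>I \<inter> J = 0\<close>. An element of
  \<open>N\<close> in \<open>L + I x\<close> then has its coefficient in
  \<open>I \<inter> J\<close>, hence lies in \<open>L\<close>, hence is zero. So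
  \<open>L + I x\<close> contradicts maximality.\<close>

lemma semisimple_complement:
  assumes R: "semisimple_ring R" and M: "left_module R M" and N: "submodule N R M"
  obtains L where "submodule L R M" "N \<inter> L = {0[M]}" "\<forall>x\<in>carrier M. \<exists>n\<in>N. \<exists>l\<in>L. x = n +[M] l"
proof -
  interpret left_module R M by fact
  interpret reg: bimodule R "regular R" by (rule bimodule_regular[OF R.ring_axioms])
  have N': "N \<subseteq> carrier M" "0[M] \<in> N" "\<And>x y. x \<in> N ==> y \<in> N ==> x +[M] y \<in> N"
      "\<And>r x. r .: R ==> x \<in> N ==> r .[M] x \<in> N" using N by (auto simp: submodule_iff)
  define \<A> where "\<A> = {L. submodule L R M \<and> N \<inter> L = {0[M]}}"
  have "\<exists>L\<in>\<A>. \<forall>X\<in>\<A>. L \<subseteq> X --> X = L" proof (rule subset_Zorn_nonempty)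
    have "{0[M]} \<in> \<A>" using N' by (auto simp: \<A>_def submodule_iff smult_zero)
    then show "\<A> \<noteq> {}" by auto
  next
    fix \<C> assume ne: "\<C> \<noteq> {}" and ch: "subset.chain \<A> \<C>"
    then have sub: "\<And>L. L \<in> \<C> ==> L \<in> \<A>" and lin: "\<And>L L'. L \<in> \<C> ==> L' \<in> \<C> ==> L \<subseteq> L' \<or> L' \<subseteq> L"
      by (auto simp: subset.chain_def)
    have add: "x +[M] y \<in> \<Union>\<C>" if xy: "x \<in> \<Union>\<C>" "y \<in> \<Union>\<C>" for x y proof -
      obtain L1 L2 where L12: "L1 \<in> \<C>" "x \<in> L1" "L2 \<in> \<C>" "y \<in> L2" using xy by blast
      then obtain L where "L \<in> \<C>" "x \<in> L" "y \<in> L" using lin[OF L12(1,3)] by blast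
      then show ?thesis using sub[of L] by (auto simp: \<A>_def submodule_iff)
    qed
    have "submodule (\<Union>\<C>) R M" unfolding submodule_iff proof (intro conjI ballI add)
      show "\<Union>\<C> \<subseteq> carrier M" using sub unfolding \<A>_def submodule_iff by blast
      show "0[M] \<in> \<Union>\<C>" using ne sub by (auto simp: \<A>_def submodule_iff)
      show "r .[M] x \<in> \<Union>\<C>" if "r .: R" "x \<in> \<Union>\<C>" for r x
        using sub that unfolding \<A>_def submodule_iff by blast
    qed
    moreover have "N \<inter> \<Union>\<C> = {0[M]}" proof -
      have "N \<inter> L = {0[M]}" if "L \<in> \<C>" for L using sub[OF that] by (simp add: \<A>_def)
      then show ?thesis using ne by auto
    qed
    ultimately show "\<Union>\<C> \<in> \<A>" by (simp add: \<A>_def)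
  qed
  then obtain L where L: "L \<in> \<A>" and max: "\<And>X. X \<in> \<A> ==> L \<subseteq> X ==> X = L" by blast
  then have sL: "submodule L R M" and NL: "N \<inter> L = {0[M]}" by (auto simp: \<A>_def)
  then have L': "L \<subseteq> carrier M" "0[M] \<in> L" "\<And>x y. x \<in> L ==> y \<in> L ==> x +[M] y \<in> L"
      "\<And>r x. r .: R ==> x \<in> L ==> r .[M] x \<in> L" by (auto simp: submodule_iff)
  note neg = submodule_neg
  define K where "K = {n +[M] l | n l. n \<in> N \<and> l \<in> L}"
  have KI: "n +[M] l \<in> K" if "n \<in> N" "l \<in> L" for n l using that by (auto simp: K_def)
  have Kc: "K \<subseteq> carrier M" using N'(1) L'(1) by (auto simp: K_def)
  have Kadd: "a +[M] b \<in> K" if ab: "a \<in> K" "b \<in> K" for a b proof -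
    obtain n l n' l' where e: "a = n +[M] l" "b = n' +[M] l'" "n \<in> N" "l \<in> L" "n' \<in> N" "l' \<in> L"
      using ab by (auto simp: K_def)
    then have c: "n .: M" "l .: M" "n' .: M" "l' .: M" using N'(1) L'(1) by auto
    have "a +[M] b = (n +[M] n') +[M] (l +[M] l')" using c by (simp add: e M.a_ac)
    then show ?thesis using e N'(3) L'(3) by (simp add: KI)
  qed
  have Ksm: "r .[M] a \<in> K" if ra: "r .: R" "a \<in> K" for r a proof -
    obtain n l where e: "a = n +[M] l" "n \<in> N" "l \<in> L" using ra by (auto simp: K_def)
    then have "n .: M" "l .: M" using N'(1) L'(1) by auto
    then have "r .[M] a = r .[M] n +[M] r .[M] l" using ra e by (simp add: smult_r_distr)
    then show ?thesis using e ra N'(4) L'(4) by (simp add: KI)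
  qed
  have NK: "N \<subseteq> K" and LK: "L \<subseteq> K"
    using KI[OF _ L'(2)] KI[OF N'(2)] N'(1) L'(1) by (auto simp: subset_iff)
  have sK: "submodule K R M" unfolding submodule_iff using Kc Kadd Ksm NK N'(2) by auto
  have "x \<in> K" if x: "x .: M" for x proof (rule ccontr)
    assume xK: "x \<notin> K"
    define J where "J = {r \<in> carrier R. r .[M] x \<in> K}"
    have J: "submodule J R (regular R)" using x Kadd Ksm sK[unfolded submodule_iff]
      by (auto simp: reg.submodule_iff J_def smult_l_distr smult_assoc zero_smult)
    have "\<exists>I. simple_submodule R (regular R) I \<and> \<not> I \<subseteq> J" proof (rule ccontr)
      assume "\<not> ?thesis"
      then have "\<Union>{I. simple_submodule R (regular R) I} \<subseteq> J" by auto
      then have "generate (add_monoid (regular R)) (\<Union>{I. simple_submodule R (regular R) I}) \<subseteq> J"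
        by (rule group.generate_subgroup_incl[OF reg.M.a_group _ submodule.axioms(1)[OF J]])
      then have "1[R] \<in> J" using R by (auto simp: semisimple_ring_def semisimple_module_def)
      then show False using xK x by (simp add: J_def smult_one)
    qed
    then obtain I where I: "simple_submodule R (regular R) I" and IJ: "\<not> I \<subseteq> J" by blast
    have sI: "submodule I R (regular R)" using I by (simp add: simple_submodule_def)
    then have I': "I \<subseteq> carrier R" "0[R] \<in> I" "\<And>x y. x \<in> I ==> y \<in> I ==> x +[R] y \<in> I"
      "\<And>r x. r .: R ==> x \<in> I ==> r *[R] x \<in> I" by (auto simp: reg.submodule_iff)
    have "submodule (I \<inter> J) R (regular R)" using sI J by (auto simp: reg.submodule_iff)
    then have zero: "I \<inter> J = {0[R]}" using I IJ by (auto simp: simple_submodule_def)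
    define L2 where "L2 = {l +[M] r .[M] x | l r. l \<in> L \<and> r \<in> I}"
    have L2I: "l +[M] r .[M] x \<in> L2" if "l \<in> L" "r \<in> I" for l r using that by (auto simp: L2_def)
    have L2c: "L2 \<subseteq> carrier M" using L'(1) I'(1) x by (auto simp: L2_def subset_iff smult_closed)
    have LL2: "L \<subseteq> L2" using L2I[OF _ I'(2)] L'(1) x by (auto simp: zero_smult subset_iff)
    have L2add: "a +[M] b \<in> L2" if ab: "a \<in> L2" "b \<in> L2" for a b proof -
      obtain l r l' r' where e: "a = l +[M] r .[M] x" "b = l' +[M] r' .[M] x" "l \<in> L" "r \<in> I" "l' \<in> L" "r' \<in> I"
        using ab by (auto simp: L2_def)
      then have c: "l .: M" "l' .: M" "r .: R" "r' .: R" using I'(1) L'(1) by auto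
      have "a +[M] b = (l +[M] l') +[M] (r +[R] r') .[M] x"
        using c x by (simp add: e M.a_ac smult_l_distr smult_closed)
      then show ?thesis using e I'(3) L'(3) by (simp add: L2I)
    qed
    have L2sm: "s .[M] a \<in> L2" if sa: "s .: R" "a \<in> L2" for s a proof -
      obtain l r where e: "a = l +[M] r .[M] x" "l \<in> L" "r \<in> I" using sa by (auto simp: L2_def)
      then have c: "l .: M" "r .: R" using I'(1) L'(1) by auto
      then have "s .[M] a = s .[M] l +[M] (s *[R] r) .[M] x"
        using sa x by (simp add: e smult_r_distr smult_assoc smult_closed)
      then show ?thesis using e sa I'(4) L'(4) by (simp add: L2I)
    qed
    have sL2: "submodule L2 R M" unfolding submodule_iff using L2c L2add L2sm LL2 L'(2) by auto
    have "n = 0[M]" if n: "n \<in> N" "n \<in> L2" for n proof -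
      obtain l r where e: "n = l +[M] r .[M] x" "l \<in> L" "r \<in> I" using n by (auto simp: L2_def)
      then have c: "l .: M" "r .: R" "r .[M] x .: M"
        using I'(1) L'(1) x by (auto simp: smult_closed)
      have "r .[M] x = n +[M] -[M] l" using c by (simp add: e M.a_ac M.r_neg1 M.r_neg2)
      then have "r .[M] x \<in> K" using KI[OF n(1) neg[OF sL e(2)]] by (simp only:)
      then have "r = 0[R]" using zero e c by (auto simp: J_def)
      then have "n = l" using e c x by (simp add: zero_smult)
      then show ?thesis using NL n e by auto
    qed
    then have "N \<inter> L2 = {0[M]}" using N'(2) LL2 L'(2) by auto
    then have "L2 = L" using sL2 LL2 by (intro max) (simp_all add: \<A>_def)
    obtain r where r: "r \<in> I" "r \<notin> J" using IJ by auto
    then have "r .[M] x \<in> L2"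
      using L2I[OF L'(2) r(1)] I'(1) x by (simp add: subset_iff smult_closed)
    then have "r .[M] x \<in> K" using LK \<open>L2 = L\<close> by auto
    then show False using r I'(1) by (auto simp: J_def)
  qed
  then show thesis using that[OF sL NL] unfolding K_def by blast
qed

text \<open>A linear map \<open>p\<close> is inverted on its image by composing with complements of its kernel
  and of its image.\<close>

lemma generalized_inverse:
  assumes R: "semisimple_ring R" and M: "left_module R M" and N: "left_module R N"
    and p: "left_linear R M N p"
  obtains \<sigma> where "left_linear R N M \<sigma>" "\<And>x. x .: M ==> p (\<sigma> (p x)) = p x"
proof -
  interpret M: left_module R M by fact
  interpret N: left_module R N by fact
  note pa = left_linear_ahom[OF p] and ps = left_linear_smult[OF p]
  note pc = ahom_closed[OF pa] and padd = ahom_add[OF pa]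
  note p0 = ahom_zero[OF M.M.abelian_group_axioms N.M.abelian_group_axioms pa]
  note pneg = ahom_neg[OF M.M.abelian_group_axioms N.M.abelian_group_axioms pa]
  have ker: "submodule {x \<in> carrier M. p x = 0[N]} R M"
    by (auto simp: M.submodule_iff p0 padd ps M.smult_closed N.smult_zero)
  obtain L where L: "submodule L R M" "{x \<in> carrier M. p x = 0[N]} \<inter> L = {0[M]}"
      "\<forall>x\<in>carrier M. \<exists>n\<in>{x \<in> carrier M. p x = 0[N]}. \<exists>l\<in>L. x = n +[M] l"
    by (rule semisimple_complement[OF R M ker])
  have im: "submodule (p ` carrier M) R N" unfolding N.submodule_iff proof (intro conjI ballI)
    show "p ` carrier M \<subseteq> carrier N" using pc by auto
    show "0[N] \<in> p ` carrier M" using p0 by (auto intro: image_eqI[of _ _ "0[M]"])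
  next
    fix x y assume "x \<in> p ` carrier M" "y \<in> p ` carrier M"
    then show "x +[N] y \<in> p ` carrier M" by (auto simp flip: padd)
  next
    fix r x assume "r .: R" "x \<in> p ` carrier M"
    then show "r .[N] x \<in> p ` carrier M" by (auto simp: M.smult_closed simp flip: ps)
  qed
  obtain L' where L': "submodule L' R N" "p ` carrier M \<inter> L' = {0[N]}"
      "\<forall>x\<in>carrier N. \<exists>n\<in>p ` carrier M. \<exists>l\<in>L'. x = n +[N] l"
    by (rule semisimple_complement[OF R N im])
  have Lc: "L \<subseteq> carrier M" "\<And>x y. x \<in> L ==> y \<in> L ==> x +[M] y \<in> L"
      "\<And>r x. r .: R ==> x \<in> L ==> r .[M] x \<in> L" using L(1) by (auto simp: M.submodule_iff)
  have Lc': "L' \<subseteq> carrier N" "\<And>x y. x \<in> L' ==> y \<in> L' ==> x +[N] y \<in> L'"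
      "\<And>r x. r .: R ==> x \<in> L' ==> r .[N] x \<in> L'" using L'(1) by (auto simp: N.submodule_iff)
  note neg = M.submodule_neg[OF L(1)] and neg' = N.submodule_neg[OF L'(1)]
  \<comment> \<open>\<open>P y l\<close> says that \<open>l\<close>, in the complement
    \<open>L\<close> of the kernel, is the preimage of the component of \<open>y\<close> in the
    image of \<open>p\<close>. Existence and uniqueness of \<open>l\<close> make \<sigma> a function
    and give its linearity.\<close>
  define P where "P y l \<longleftrightarrow> l \<in> L \<and> (\<exists>l'\<in>L'. y = p l +[N] l')" for y l
  have ex: "\<exists>l. P y l" if y: "y .: N" for y proof -
    obtain m l' where ml: "m .: M" "l' \<in> L'" "y = p m +[N] l'"
      using L'(3)[rule_format, OF y] by auto
    obtain n l where nl: "n .: M" "p n = 0[N]" "l \<in> L" "m = n +[M] l"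
      using L(3)[rule_format, OF ml(1)] by auto
    then have "p m = p l" using Lc(1) pc by (auto simp: padd subset_iff)
    then show ?thesis using nl ml by (auto simp: P_def)
  qed
  have uniq: "l1 = l2" if P: "P y l1" "P y l2" for y l1 l2 proof -
    obtain l1' l2' where e: "l1' \<in> L'" "l2' \<in> L'" "y = p l1 +[N] l1'" "y = p l2 +[N] l2'"
        "l1 \<in> L" "l2 \<in> L" using P by (auto simp: P_def)
    then have c: "l1 .: M" "l2 .: M" "l1' .: N" "l2' .: N" "p l1 .: N" "p l2 .: N"
      using Lc(1) Lc'(1) pc by auto
    let ?d = "l1 +[M] -[M] l2"
    have "p ?d = p l1 +[N] -[N] p l2" using c by (simp add: padd pneg)
    also have "... = l2' +[N] -[N] l1'" proof -
      have X: "l2' +[N] -[N] l1' .: N" using c by simp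
      have "p l1 = p l2 +[N] (l2' +[N] -[N] l1')"
        using c by (simp add: e(4)[symmetric] flip: N.M.a_assoc) (simp add: e(3) N.M.a_assoc N.M.r_neg)
      then have "p l1 +[N] -[N] p l2 = -[N] p l2 +[N] (p l2 +[N] (l2' +[N] -[N] l1'))"
        using c N.M.a_comm[of "p l1" "-[N] p l2"] by simp
      then show ?thesis using N.M.r_neg1[OF c(6) X] by simp
    qed
    finally have "p ?d \<in> L'" using e neg' Lc'(2) by simp
    then have "p ?d = 0[N]" using L'(2) c by auto
    then have "?d = 0[M]" using L(2) c e Lc(2) neg by blast
    then show ?thesis using c M.M.minus_equality[of l1 "-[M] l2"] by simp
  qed
  define \<sigma> where "\<sigma> y = (SOME l. P y l)" for y
  have \<sigma>: "P y (\<sigma> y)" if "y .: N" for y unfolding \<sigma>_def using ex[OF that] by (rule someI_ex)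
  have \<sigma>_eq: "\<sigma> y = l" if "P y l" "y .: N" for y l using uniq[OF \<sigma>[OF that(2)] that(1)] .
  show thesis proof (rule that)
    show "left_linear R N M \<sigma>" proof (rule left_linearI, rule ahomI)
      fix y assume "y .: N"
      then show "\<sigma> y .: M" using \<sigma> Lc(1) by (auto simp: P_def)
    next
      fix y z assume yz: "y .: N" "z .: N"
      then obtain a b where ab: "a \<in> L'" "b \<in> L'" "y = p (\<sigma> y) +[N] a" "z = p (\<sigma> z) +[N] b"
          "\<sigma> y \<in> L" "\<sigma> z \<in> L" using \<sigma>[of y] \<sigma>[of z] by (auto simp: P_def)
      then have c: "a .: N" "b .: N" "\<sigma> y .: M" "\<sigma> z .: M" "p (\<sigma> y) .: N" "p (\<sigma> z) .: N"
        using Lc(1) Lc'(1) pc by auto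
      have "y +[N] z = (p (\<sigma> y) +[N] a) +[N] (p (\<sigma> z) +[N] b)" using ab by simp
      also have "... = p (\<sigma> y +[M] \<sigma> z) +[N] (a +[N] b)" using c by (simp add: padd N.M.a_ac)
      finally have "P (y +[N] z) (\<sigma> y +[M] \<sigma> z)" unfolding P_def using ab Lc(2) Lc'(2) by blast
      then show "\<sigma> (y +[N] z) = \<sigma> y +[M] \<sigma> z" using yz by (intro \<sigma>_eq) auto
    next
      fix r y assume ry: "r .: R" "y .: N"
      then obtain a where ab: "a \<in> L'" "y = p (\<sigma> y) +[N] a" "\<sigma> y \<in> L"
        using \<sigma>[of y] by (auto simp: P_def)
      then have c: "a .: N" "\<sigma> y .: M" "p (\<sigma> y) .: N" using Lc(1) Lc'(1) pc by auto
      have "r .[N] y = r .[N] (p (\<sigma> y) +[N] a)" using ab by simp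
      also have "... = p (r .[M] \<sigma> y) +[N] r .[N] a" using c ry by (simp add: ps N.smult_r_distr)
      finally have "P (r .[N] y) (r .[M] \<sigma> y)" unfolding P_def using ab ry Lc(3) Lc'(3) by blast
      then show "\<sigma> (r .[N] y) = r .[M] \<sigma> y" using ry by (intro \<sigma>_eq) (auto simp: N.smult_closed)
    qed
  next
    fix x assume x: "x .: M"
    then obtain a where a: "a \<in> L'" "p x = p (\<sigma> (p x)) +[N] a" "\<sigma> (p x) \<in> L"
      using \<sigma>[OF pc[OF x]] by (auto simp: P_def)
    then have c: "a .: N" "\<sigma> (p x) .: M" "p (\<sigma> (p x)) .: N" using Lc(1) Lc'(1) pc by auto
    have "a = p (x +[M] -[M] \<sigma> (p x))"
      using c x a(2) pc[OF x] by (simp add: padd pneg) (metis N.M.a_comm N.M.a_inv_closed N.M.r_neg1)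
    then have "a = 0[N]" using a(1) L'(2) c x by blast
    then show "p (\<sigma> (p x)) = p x" using a c by simp
  qed
qed

section \<open>Families of finite support, free modules and dual bases\<close>

lemma bimodule_pointwise:
  assumes V: "\<And>n. bimodule R (V n)"
    and car: "carrier M = {f. (\<forall>n. f n .: (V n)) \<and> finite {n. f n \<noteq> 0[V n]}}"
    and zero: "0[M] = (\<lambda>n. 0[V n])" and add: "\<And>f g. f +[M] g = (\<lambda>n. f n +[V n] g n)"
    and l: "\<And>r f. r .[M] f = (\<lambda>n. r .[V n] f n)" and r: "\<And>r f. f <[M] r = (\<lambda>n. f n <[V n] r)"
  shows "bimodule R M"
proof -
  interpret V: bimodule R "V n" for n by (rule V)
  have fin: "f .: M" if "\<And>n. f n .: (V n)" "g .: M" "h .: M"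
    "\<And>n. g n = 0[V n] ==> h n = 0[V n] ==> f n = 0[V n]" for f g h
  proof -
    have "finite ({n. g n \<noteq> 0[V n]} \<union> {n. h n \<noteq> 0[V n]})" using that by (simp add: car)
    then have "finite {n. f n \<noteq> 0[V n]}" by (rule rev_finite_subset) (use that(4) in auto)
    then show ?thesis using that(1) by (simp add: car)
  qed
  have m: "f n .: (V n)" if "f .: M" for f n using that by (simp add: car)
  have c: "f +[M] g .: M" if "f .: M" "g .: M" for f g
    by (rule fin[OF _ that]) (simp_all add: add m that)
  have sc: "s .[M] f .: M" "f <[M] s .: M" if "s .: R" "f .: M" for s f
    by (rule fin[OF _ that(2,2)], simp_all add: l r m that V.smult_closed V.rsmult_closed V.smult_zero V.zero_rsmult)+
  have "abelian_group M" proof (rule abelian_groupI)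
    fix f assume f: "f .: M"
    have "(\<lambda>n. -[V n] f n) .: M" by (rule fin[OF _ f f]) (simp_all add: m f)
    moreover have "(\<lambda>n. -[V n] f n) +[M] f = 0[M]" by (simp add: add zero m[OF f] V.M.l_neg)
    ultimately show "\<exists>g\<in>carrier M. g +[M] f = 0[M]" by blast
  next
    fix f g assume fg: "f .: M" "g .: M"
    show "f +[M] g .: M" "f +[M] g = g +[M] f" using c fg m V.M.a_comm by (simp_all add: add)
  qed (simp_all add: add m V.M.a_assoc, simp_all add: zero car)
  then show ?thesis
    by (intro bimodule.intro left_module.intro V.ring_axioms left_module_axioms.intro bimodule_axioms.intro)
      (simp_all add: sc, simp_all add: add l r m V.smult_l_distr V.smult_r_distr V.smult_assoc V.smult_one
        V.rsmult_r_distr V.rsmult_l_distr V.rsmult_assoc V.rsmult_one V.smult_rsmult)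
qed

definition free_module :: "('r, 'x) ring_scheme => ('r, 'v => 'r) bimodule" where
  "free_module R = \<lparr>carrier = {f. (\<forall>v. f v .: R) \<and> finite {v. f v \<noteq> 0[R]}},
     monoid.mult = undefined, one = undefined, ring.zero = (\<lambda>v. 0[R]),
     ring.add = (\<lambda>f g v. f v +[R] g v), smult = (\<lambda>r f v. r *[R] f v), rsmult = (\<lambda>f r v. f v *[R] r)\<rparr>"

lemma free_module_bimodule: "ring R ==> bimodule R (free_module R)"
  by (rule bimodule_pointwise[where V = "\<lambda>_. regular R"]) (simp_all add: free_module_def bimodule_regular)

text \<open>A finitely generated module over a semisimple ring is projective: the map
  \<open>p\<close> from a free module that a generating set defines has a linear section \<sigma>,
  and the coordinates of \<sigma> are the dual functionals.\<close>

lemma dual_basis: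
  fixes V :: "('r, 'v, 'y) module_scheme"
  assumes R: "semisimple_ring R" and V: "left_module R V" and fg: "finitely_generated R V"
  obtains X c where "finite X" "X \<subseteq> carrier V" "\<And>x. x \<in> X ==> left_linear R V (regular R) (c x)"
    "\<And>v. v .: V ==> v = (\<Oplus>\<^bsub>V\<^esub>x\<in>X. c x v .[V] x)"
proof -
  interpret left_module R V by fact
  obtain X where X: "finite X" "X \<subseteq> carrier V"
    and gen: "\<And>v. v .: V ==> \<exists>c\<in>X \<rightarrow> carrier R. v = (\<Oplus>\<^bsub>V\<^esub>x\<in>X. c x .[V] x)"
    using fg by (auto simp: finitely_generated_def)
  define F where "F = (free_module R :: ('r, 'v => 'r) bimodule)"
  have FL: "left_module R F"
    unfolding F_def by (rule bimodule.axioms(1)[OF free_module_bimodule[OF R.ring_axioms]])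
  define p where "p f = (\<Oplus>\<^bsub>V\<^esub>x\<in>X. f x .[V] x)" for f
  have ev: "ahom F R (\<lambda>f. f x)" if "x \<in> X" for x
    using that by (auto simp: ahom_def F_def free_module_def)
  have pa: "ahom F V p" unfolding p_def using X
    by (intro ahom_sum[OF M.abelian_group_axioms] ahom_comp[OF ev ahom_smult_left]) auto
  have "left_linear R F V p" proof (rule left_linearI[OF pa])
    fix r f assume r: "r .: R" and f: "f .: F"
    then have c: "f x .: R" "x .: V" if "x \<in> X" for x
      using that X by (auto simp: F_def free_module_def)
    have "r .[V] p f = (\<Oplus>\<^bsub>V\<^esub>x\<in>X. r .[V] (f x .[V] x))" unfolding p_def using c
      by (intro ahom_finsum[OF M.abelian_group_axioms M.abelian_group_axioms ahom_smult[OF r]])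
        (auto simp: smult_closed)
    also have "... = p (r .[F] f)" unfolding p_def using c r
      by (intro M.finsum_cong') (auto simp: F_def free_module_def smult_assoc smult_closed)
    finally show "p (r .[F] f) = r .[V] p f" ..
  qed
  from generalized_inverse[OF R FL V this]
  obtain \<sigma> where \<sigma>: "left_linear R V F \<sigma>" and inv: "\<And>f. f .: F ==> p (\<sigma> (p f)) = p f" by metis
  show thesis proof (rule that[OF X])
    show "left_linear R V (regular R) (\<lambda>v. \<sigma> v x)" if "x \<in> X" for x
      using \<sigma> that by (auto simp: left_linear_def F_def free_module_def Pi_iff)
    fix v assume v: "v .: V"
    then obtain c where c: "c \<in> X \<rightarrow> carrier R" "v = (\<Oplus>\<^bsub>V\<^esub>x\<in>X. c x .[V] x)" using gen by blast
    \<comment> \<open>The free module is indexed by the whole type, so the coefficients are extended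
      by zero outside \<open>X\<close>; this shows that \<open>v\<close> is in the image of
      \<open>p\<close>, where \<sigma> is a section.\<close>
    let ?c = "\<lambda>v. if v \<in> X then c v else 0[R]"
    have "p ?c = v" unfolding c(2) p_def using c(1) X(2)
      by (intro M.finsum_cong') (auto intro!: smult_closed)
    moreover have fin: "finite {v. ?c v \<noteq> 0[R]}" by (rule finite_subset[OF _ X(1)]) auto
    have "?c .: F" using c(1) fin by (auto simp: F_def free_module_def)
    ultimately have "p (\<sigma> v) = v" using inv[of "?c"] by simp
    then show "v = (\<Oplus>\<^bsub>V\<^esub>x\<in>X. \<sigma> v x .[V] x)" by (simp add: p_def)
  qed
qed

section \<open>The left dual\<close>

lemma left_dual_simps:
  "carrier (left_dual R M) = {f \<in> extensional (carrier M). left_linear R M (regular R) f}"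
  "0[left_dual R M] = (\<lambda>v\<in>carrier M. 0[R])" "f +[left_dual R M] g = (\<lambda>v\<in>carrier M. f v +[R] g v)"
  "s .[left_dual R M] f = (\<lambda>v\<in>carrier M. f v *[R] s)"
  "f <[left_dual R M] s = (\<lambda>v\<in>carrier M. f (v <[M] s))" by (simp_all add: left_dual_def)

lemma left_dual_closed: "f .: (left_dual R M) ==> v .: M ==> f v .: R"
  by (auto simp: left_dual_simps left_linear_def)

lemma left_dual_add: "f .: (left_dual R M) ==> v .: M ==> w .: M ==>
    f (v +[M] w) = f v +[R] f w" by (auto simp: left_dual_simps left_linear_def)

lemma left_dual_smult: "f .: (left_dual R M) ==> v .: M ==> r .: R ==>
    f (r .[M] v) = r *[R] f v" by (auto simp: left_dual_simps left_linear_def)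

lemma left_dual_eqI: "f .: (left_dual R M) ==> g .: (left_dual R M) ==>
    (\<And>v. v .: M ==> f v = g v) ==> f = g"
  by (rule extensionalityI[of f "carrier M" g]) (simp_all add: left_dual_simps(1))

lemma left_dual_ahom: "f .: (left_dual R M) ==> ahom M R f"
  by (auto simp: ahom_def left_dual_closed left_dual_add)

lemma left_dual_memI:
  assumes "\<And>v. v .: M ==> f v .: R" "\<And>v w. v .: M ==> w .: M ==> f (v +[M] w) = f v +[R] f w"
    "\<And>r v. r .: R ==> v .: M ==> f (r .[M] v) = r *[R] f v" "left_module R M"
  shows "(\<lambda>v\<in>carrier M. f v) .: (left_dual R M)"
proof -
  interpret left_module R M by fact
  show ?thesis using assms(1-3) by (auto simp: left_dual_simps left_linear_def smult_closed)
qed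

context bimodule
begin

lemma left_dual_group: "abelian_group (left_dual R M)"
proof (rule abelian_groupI)
  note c = left_dual_closed[of _ R M] and ad = left_dual_add[of _ R M] and sm = left_dual_smult[of _ R M]
  note mem = left_dual_memI[OF _ _ _ left_module_axioms]
  fix f assume f: "f .: (left_dual R M)"
  have "(\<lambda>v\<in>carrier M. -[R] f v) .: (left_dual R M)"
    using f by (intro mem) (auto simp: c ad sm R.minus_add R.r_minus)
  moreover have "(\<lambda>v\<in>carrier M. -[R] f v) +[left_dual R M] f = 0[left_dual R M]"
    using f by (auto simp: left_dual_simps(2,3) c R.l_neg)
  ultimately show "\<exists>g\<in>carrier (left_dual R M). g +[left_dual R M] f = 0[left_dual R M]" by blast
  have "(\<lambda>v\<in>carrier M. 0[R] +[R] f v) = f"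
    using f by (auto simp: left_dual_simps(1) extensional_def fun_eq_iff left_linear_def Pi_iff)
  then show "0[left_dual R M] +[left_dual R M] f = f"
    by (simp add: left_dual_simps(2,3) cong: restrict_cong)
next
  note c = left_dual_closed[of _ R M] and ad = left_dual_add[of _ R M] and sm = left_dual_smult[of _ R M]
  note mem = left_dual_memI[OF _ _ _ left_module_axioms]
  show "0[left_dual R M] .: (left_dual R M)" unfolding left_dual_simps(2) by (intro mem) auto
  fix f g assume f: "f .: (left_dual R M)" and g: "g .: (left_dual R M)"
  show "f +[left_dual R M] g .: (left_dual R M)"
    unfolding left_dual_simps(3) using f g by (intro mem) (auto simp: c ad sm R.r_distr R.a_ac)
  show "f +[left_dual R M] g = g +[left_dual R M] f"
    unfolding left_dual_simps(3) using f g by (auto simp: c R.a_comm intro!: restrict_ext)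
  fix h assume h: "h .: (left_dual R M)"
  show "f +[left_dual R M] g +[left_dual R M] h = f +[left_dual R M] (g +[left_dual R M] h)"
    unfolding left_dual_simps(3) using f g h by (auto simp: c R.a_assoc intro!: restrict_ext)
qed

lemma left_dual_bimodule: "bimodule (op_ring R) (left_dual R M)"
proof -
  note c = left_dual_closed[of _ R M] and ad = left_dual_add[of _ R M] and sm = left_dual_smult[of _ R M]
  note mem = left_dual_memI[OF _ _ _ left_module_axioms]
  let ?D = "left_dual R M"
  have cg: "(\<lambda>v\<in>carrier M. h v) = (\<lambda>v\<in>carrier M. h' v)" if "\<And>v. v .: M ==> h v = h' v"
    for h h' :: "'m => 'r" using that by (intro restrict_ext)
  have idem: "(\<lambda>v\<in>carrier M. f v) = f" if "f .: ?D" for f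
    using that by (auto simp: left_dual_simps(1) extensional_def fun_eq_iff)
  show ?thesis
  proof (intro bimodule.intro left_module.intro left_module_axioms.intro bimodule_axioms.intro
        ring_op_ring R.ring_axioms left_dual_group; unfold op_ring_simps)
    fix r s f g
    assume r: "r .: R" and f: "f .: ?D"
    note fc = c[OF f] and fad = ad[OF f] and fsm = sm[OF f]
    show "r .[?D] f .: ?D"
      unfolding left_dual_simps(4) using r by (intro mem) (simp_all add: fc fad fsm R.l_distr R.m_assoc)
    show "f <[?D] r .: ?D" unfolding left_dual_simps(5) using r
      by (intro mem) (simp_all add: fc fad fsm rsmult_closed rsmult_l_distr smult_rsmult)
    show "(r +[R] s) .[?D] f = r .[?D] f +[?D] s .[?D] f" if "s .: R"
      unfolding left_dual_simps(3,4) using r that by (intro cg) (simp add: fc R.r_distr)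
    show "(s *[R] r) .[?D] f = r .[?D] (s .[?D] f)" if "s .: R"
      unfolding left_dual_simps(4) using r that by (intro cg) (simp add: fc R.m_assoc)
    show "f <[?D] (r +[R] s) = f <[?D] r +[?D] f <[?D] s" if "s .: R"
      unfolding left_dual_simps(3,5) using r that
      by (intro cg) (simp add: fad rsmult_r_distr rsmult_closed)
    show "f <[?D] (s *[R] r) = f <[?D] r <[?D] s" if "s .: R"
      unfolding left_dual_simps(5) using r that by (intro cg) (simp add: rsmult_assoc rsmult_closed)
    show "(r .[?D] f) <[?D] s = r .[?D] (f <[?D] s)" if "s .: R"
      unfolding left_dual_simps(4,5) using r that by (intro cg) (simp add: rsmult_closed)
    show "r .[?D] (f +[?D] g) = r .[?D] f +[?D] r .[?D] g" if "g .: ?D"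
      unfolding left_dual_simps(3,4) using r c[OF that] by (intro cg) (simp add: fc R.l_distr)
    show "(f +[?D] g) <[?D] r = f <[?D] r +[?D] g <[?D] r" if "g .: ?D"
      unfolding left_dual_simps(3,5) using r by (intro cg) (simp add: rsmult_closed)
  next
    fix f assume f: "f .: ?D"
    show "1[R] .[?D] f = f" unfolding left_dual_simps(4) using c[OF f]
      by (subst (2) idem[OF f, symmetric]) (intro cg, simp)
    show "f <[?D] 1[R] = f" unfolding left_dual_simps(5)
      by (subst (2) idem[OF f, symmetric]) (intro cg, simp add: rsmult_one)
  qed
qed

end

section \<open>Homogeneous components\<close>

context graded_bimodule
begin

lemma hcomp_props: "hcomp M n \<subseteq> carrier M" "0[M] \<in> hcomp M n"
  "x \<in> hcomp M n ==> y \<in> hcomp M n ==> x +[M] y \<in> hcomp M n"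
  "r .: R ==> x \<in> hcomp M n ==> r .[M] x \<in> hcomp M n" "x \<in> hcomp M n ==> -[M] x \<in> hcomp M n"
  using hcomp_submodule[of n] submodule_neg[OF hcomp_submodule] unfolding submodule_iff by auto

lemma hcomp_closed: "x \<in> hcomp M n ==> x .: M"
  using hcomp_props(1) by auto

lemma hdecompI:
  assumes "finite F" "\<And>n. f n \<in> hcomp M n" "\<And>n. n \<notin> F ==> f n = 0[M]" "x = (\<Oplus>\<^bsub>M\<^esub>n\<in>F. f n)"
  shows "hdecomp M x f"
proof -
  have sub: "{n. f n \<noteq> 0[M]} \<subseteq> F" using assms(3) by auto
  then have "(\<Oplus>\<^bsub>M\<^esub>n\<in>{n. f n \<noteq> 0[M]}. f n) = (\<Oplus>\<^bsub>M\<^esub>n\<in>F. f n)"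
    using assms(1,2) hcomp_closed by (intro M.add.finprod_mono_neutral_cong_left) auto
  then show ?thesis using assms sub by (auto simp: hdecomp_def intro: finite_subset)
qed

lemma hproj_eq: "x .: M ==> hdecomp M x f ==> hproj M n x = f n"
  unfolding hproj_def using the1_equality[OF hcomp_direct_sum] by metis

lemma hproj_hdecomp: "x .: M ==> hdecomp M x (\<lambda>n. hproj M n x)"
proof -
  assume x: "x .: M"
  then obtain f where f: "hdecomp M x f" using hcomp_direct_sum by blast
  then have "(\<lambda>n. hproj M n x) = f" using hproj_eq[OF x f] by auto
  with f show ?thesis by simp
qed

lemma hproj_hcomp: "x .: M ==> hproj M n x \<in> hcomp M n"
  using hproj_hdecomp by (simp add: hdecomp_def)

lemma hproj_closed: "x .: M ==> hproj M n x .: M"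
  using hproj_hcomp hcomp_closed by blast

lemma hproj_finite: "x .: M ==> finite {n. hproj M n x \<noteq> 0[M]}"
  using hproj_hdecomp by (simp add: hdecomp_def)

lemma hproj_sum:
  assumes "x .: M" "finite F" "{n. hproj M n x \<noteq> 0[M]} \<subseteq> F"
  shows "x = (\<Oplus>\<^bsub>M\<^esub>n\<in>F. hproj M n x)"
proof -
  have "x = (\<Oplus>\<^bsub>M\<^esub>n\<in>{n. hproj M n x \<noteq> 0[M]}. hproj M n x)"
    using hproj_hdecomp[OF assms(1)] by (simp add: hdecomp_def)
  also have "... = (\<Oplus>\<^bsub>M\<^esub>n\<in>F. hproj M n x)"
    using assms hproj_closed by (intro M.add.finprod_mono_neutral_cong_left) auto
  finally show ?thesis .
qed

lemma hproj_homog: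
  assumes "x \<in> hcomp M m"
  shows "hproj M n x = (if n = m then x else 0[M])"
proof (rule hproj_eq[OF hcomp_closed[OF assms]])
  show "hdecomp M x (\<lambda>n. if n = m then x else 0[M])"
    by (rule hdecompI[of "{m}"]) (use assms hcomp_closed hcomp_props(2) in auto)
qed

lemma hproj_add:
  assumes x: "x .: M" and y: "y .: M"
  shows "hproj M n (x +[M] y) = hproj M n x +[M] hproj M n y"
proof (rule hproj_eq)
  let ?F = "{n. hproj M n x \<noteq> 0[M]} \<union> {n. hproj M n y \<noteq> 0[M]}"
  have F: "finite ?F" using hproj_finite[OF x] hproj_finite[OF y] by simp
  have "(\<Oplus>\<^bsub>M\<^esub>n\<in>?F. hproj M n x +[M] hproj M n y) = (\<Oplus>\<^bsub>M\<^esub>n\<in>?F. hproj M n x) +[M] (\<Oplus>\<^bsub>M\<^esub>n\<in>?F. hproj M n y)"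
    using hproj_closed x y by (intro M.finsum_addf) auto
  also have "... = x +[M] y" using hproj_sum[OF x F] hproj_sum[OF y F] by auto
  finally show "hdecomp M (x +[M] y) (\<lambda>n. hproj M n x +[M] hproj M n y)"
    using x y by (intro hdecompI[OF F]) (auto intro: hcomp_props hproj_hcomp)
qed (use x y in simp)

lemma hproj_ahom: "ahom M M (hproj M n)" by (simp add: ahom_def hproj_closed hproj_add)

lemma hproj_zero: "hproj M n 0[M] = 0[M]"
  using hproj_homog[OF hcomp_props(2)[of n], of n] by simp

lemma hproj_neg: "x .: M ==> hproj M n (-[M] x) = -[M] hproj M n x"
  using ahom_neg[OF M.abelian_group_axioms M.abelian_group_axioms hproj_ahom] .

text \<open>The images of the components form a decomposition of \<open>f x\<close>, and
  decompositions are unique. The two scalar actions are the instances of interest.\<close>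

lemma hproj_linear:
  assumes f: "ahom M M f" and fh: "\<And>m x. x \<in> hcomp M m ==> f x \<in> hcomp M m" and x: "x .: M"
  shows "hproj M n (f x) = f (hproj M n x)"
proof (rule hproj_eq)
  let ?F = "{n. hproj M n x \<noteq> 0[M]}"
  have f0: "f 0[M] = 0[M]" using ahom_zero[OF M.abelian_group_axioms M.abelian_group_axioms f] .
  have "f x = f (\<Oplus>\<^bsub>M\<^esub>n\<in>?F. hproj M n x)" using hproj_sum[OF x hproj_finite[OF x]] by auto
  also have "... = (\<Oplus>\<^bsub>M\<^esub>n\<in>?F. f (hproj M n x))"
    using hproj_closed x by (intro ahom_finsum[OF M.abelian_group_axioms M.abelian_group_axioms f]) auto
  finally show "hdecomp M (f x) (\<lambda>n. f (hproj M n x))"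
    using x f0 by (intro hdecompI[OF hproj_finite[OF x]]) (auto intro: fh hproj_hcomp)
qed (use ahom_closed[OF f] x in simp)

lemma hproj_smult: "r .: R ==> x .: M ==> hproj M n (r .[M] x) = r .[M] hproj M n x"
  using hproj_linear[OF ahom_smult] hcomp_props(4) by blast

lemma hproj_rsmult: "r .: R ==> x .: M ==> hproj M n (x <[M] r) = hproj M n x <[M] r"
  using hproj_linear[OF ahom_rsmult] hcomp_rsmult by blast

text \<open>The premise \<open>hproj M n x = 0[M] ==> y = 0[M]\<close> remembers which degrees occur
  in \<open>x\<close>; it lets \<open>pos_induct\<close> discard degree 0.\<close>

lemma hom_induct [consumes 1, case_names homog add]:
  assumes x: "x .: M" and homog: "\<And>n y. y \<in> hcomp M n ==> (hproj M n x = 0[M] ==> y = 0[M]) ==> P y"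
    and add: "\<And>y z. \<lbrakk>y .: M; z .: M; P y; P z\<rbrakk> \<Longrightarrow> P (y +[M] z)"
  shows "P x"
proof -
  have zero: "P 0[M]" using homog[OF hcomp_props(2)] by simp
  have "(\<Oplus>\<^bsub>M\<^esub>n\<in>F. hproj M n x) .: M \<and> P (\<Oplus>\<^bsub>M\<^esub>n\<in>F. hproj M n x)" if "finite F" for F using that
  proof (induction F)
    case (insert k F)
    have "P (hproj M k x)" by (rule homog[OF hproj_hcomp[OF x]])
    then show ?case
      using insert x by (subst (1 2) M.finsum_insert) (auto simp: hproj_closed intro!: add)
  qed (simp add: zero)
  then show ?thesis using hproj_sum[OF x hproj_finite[OF x] order_refl] hproj_finite[OF x] by metis
qed

lemma hpart_bimodule: "bimodule R (hpart M n)"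
  unfolding hpart_def using hcomp_props[where n = n] hcomp_rsmult by (intro sub_bimodule) auto

lemma hpart_simps:
  "carrier (hpart M n) = hcomp M n" "0[hpart M n] = 0[M]" "x +[hpart M n] y = x +[M] y"
  "r .[hpart M n] x = r .[M] x" "x <[hpart M n] r = x <[M] r" by (simp_all add: hpart_def)

lemma hpart_finsum: "(\<And>i. i \<in> I ==> f i \<in> hcomp M n) ==> finsum (hpart M n) f I = finsum M f I"
  unfolding hpart_def using hcomp_props[where n = n] by (intro M.finsum_sub(1)) auto

text \<open>Membership becomes the vanishing of a single additive projection, which makes closure
  properties immediate.\<close>

lemma pos_carrier: "carrier (pos_part M) = {x \<in> carrier M. hproj M 0 x = 0[M]}"
proof (intro equalityI subsetI)
  fix x assume "x .: (pos_part M)"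
  then obtain F f where F: "finite F" "0 \<notin> F" "\<And>n. n \<in> F ==> f n \<in> hcomp M n" "x = (\<Oplus>\<^bsub>M\<^esub>n\<in>F. f n)"
    by (auto simp: pos_part_def)
  then have c: "f \<in> F \<rightarrow> carrier M" using hcomp_closed by auto
  have "hproj M 0 x = (\<Oplus>\<^bsub>M\<^esub>n\<in>F. hproj M 0 (f n))"
    unfolding F(4) by (rule ahom_finsum[OF M.abelian_group_axioms M.abelian_group_axioms hproj_ahom c])
  also have "... = 0[M]" proof (rule M.add.finprod_one_eqI)
    fix n assume "n \<in> F"
    then show "hproj M 0 (f n) = 0[M]" using hproj_homog[OF F(3), of n 0] F(2) by auto
  qed
  finally show "x \<in> {x \<in> carrier M. hproj M 0 x = 0[M]}" using F(4) c by (simp add: M.finsum_closed)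
next
  fix x assume x: "x \<in> {x \<in> carrier M. hproj M 0 x = 0[M]}"
  let ?F = "{n. hproj M n x \<noteq> 0[M]}"
  have "x = (\<Oplus>\<^bsub>M\<^esub>n\<in>?F. hproj M n x)" "finite ?F" "0 \<notin> ?F" "\<forall>n\<in>?F. hproj M n x \<in> hcomp M n"
    using x hproj_sum[of x ?F] hproj_finite[of x] hproj_hcomp by auto
  then show "x .: (pos_part M)" unfolding pos_part_def by simp blast
qed

lemma pos_simps: "0[pos_part M] = 0[M]" "x +[pos_part M] y = x +[M] y"
  "r .[pos_part M] x = r .[M] x" "x <[pos_part M] r = x <[M] r" by (simp_all add: pos_part_def)

lemma pos_bimodule: "bimodule R (pos_part M)"
proof -
  have eq: "pos_part M = M\<lparr>carrier := carrier (pos_part M)\<rparr>" by (simp add: pos_part_def)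
  show ?thesis by (subst eq, rule sub_bimodule)
      (auto simp: pos_carrier hproj_zero hproj_add hproj_smult hproj_rsmult smult_closed rsmult_closed
        smult_zero zero_rsmult)
qed

lemma pos_closed: "x .: (pos_part M) ==> x .: M" by (simp add: pos_carrier)

lemma hcomp_pos: "x \<in> hcomp M k ==> 0 < k ==> x .: (pos_part M)"
  using hcomp_closed by (simp add: pos_carrier hproj_homog)

lemma pos_induct [consumes 1, case_names homog add]:
  assumes x: "x .: (pos_part M)" and homog: "\<And>n y. y \<in> hcomp M n ==> 0 < n ==> P y"
    and add: "\<And>y z. \<lbrakk>y .: (pos_part M); z .: (pos_part M); P y; P z\<rbrakk> \<Longrightarrow> P (y +[M] z)"
  shows "P x"
proof -
  have "x .: M" using x pos_closed by simp
  then have "x .: (pos_part M) \<and> P x" proof (induction x rule: hom_induct)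
    case (homog n y)
    have y0: "y = 0[M]" if "n = 0" using that homog(2) x by (simp add: pos_carrier)
    show ?case proof (cases "n = 0")
      case True
      \<comment> \<open>In degree 0 only the zero element occurs, and zero may be counted as an
        element of degree 1.\<close>
      then have "y \<in> hcomp M 1" using y0 hcomp_props(2) by simp
      then show ?thesis using assms(2)[of y 1] hcomp_pos[of y 1] by simp
    qed (use homog(1) assms(2)[of y n] hcomp_pos[of y n] in simp)
  next
    case (add y z)
    then show ?case using assms(3)[of y z] by (simp add: pos_carrier hproj_add)
  qed
  then show ?thesis ..
qed

end

section \<open>The reduced bar complex\<close>

text \<open>The \<open>i\<close>-th face of the bar complex. The recursion over the index allows
  induction where the expression with \<open>take\<close>, \<open>drop\<close> and \<open>!\<close>
  in \<open>bar_diff\<close> would not.\<close>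

fun mrg :: "('a, 'x) ring_scheme => nat => 'a list => 'a list" where
  "mrg A 0 as = (hd as *[A] hd (tl as)) # tl (tl as)"
| "mrg A (Suc i) as = hd as # mrg A i (tl as)"

lemma mrg_eq:
  "Suc i < length as ==> take i as @ [as ! i *[A] as ! Suc i] @ drop (Suc (Suc i)) as = mrg A i as"
proof (induction i arbitrary: as)
  case 0
  then show ?case by (cases as rule: list.exhaust; cases "tl as") auto
next
  case (Suc i)
  then show ?case by (cases as) auto
qed

lemma length_mrg: "Suc i < length as ==> length (mrg A i as) = length as - 1"
  by (subst mrg_eq[symmetric]) auto

lemma mrg_append_left: "Suc i < length xs ==> mrg A i (xs @ ys) = mrg A i xs @ ys"
proof (induction i arbitrary: xs)
  case 0
  then show ?case by (cases xs rule: list.exhaust; cases "tl xs") auto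
next
  case (Suc i)
  then show ?case by (cases xs) auto
qed

lemma mrg_append_right: "mrg A (length xs + i) (xs @ ys) = xs @ mrg A i ys" by (induction xs) auto

context connected_graded_rring
begin

abbreviation "AP \<equiv> pos_part A"

sublocale P: bimodule R AP by (rule pos_bimodule)

lemma mult_rsmult_right: "r .: R ==> a .: A ==> b .: A ==> a *[A] (b <[A] r) = (a *[A] b) <[A] r"
  by (simp add: mult_rsmult)

lemma hproj_mult:
  assumes a: "a .: A" and b: "b \<in> hcomp A m"
  shows "hproj A n (a *[A] b) = (if m \<le> n then hproj A (n - m) a *[A] b else 0[A])"
  using a
proof (induction a rule: hom_induct)
  case (homog k y)
  then have "y *[A] b \<in> hcomp A (k + m)" using b by (intro mult_degree)
  then show ?case
    using homog hcomp_closed[OF b] hcomp_closed[OF homog(1)] by (auto simp: hproj_homog)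
next
  case (add y z)
  then show ?case using hcomp_closed[OF b] by (simp add: A.l_distr hproj_add hproj_closed)
qed

lemma mult_pos_right:
  assumes a: "a .: A" and b: "b .: AP"
  shows "a *[A] b .: AP"
  using b
proof (induction b rule: pos_induct)
  case (homog n y)
  then show ?case
    using a hproj_mult[OF a homog(1), of 0] hcomp_closed[OF homog(1)] by (simp add: pos_carrier)
next
  case (add y z)
  then show ?case using a by (simp add: A.r_distr pos_carrier hproj_add)
qed

lemma mult_pos_left:
  assumes a: "a .: AP" and b: "b .: A"
  shows "a *[A] b .: AP"
  using b
proof (induction b rule: hom_induct)
  case (homog n y)
  then show ?case
    using a hproj_mult[OF _ homog(1), of a 0] hcomp_closed[OF homog(1)] by (auto simp: pos_carrier)
next
  case (add y z)
  then show ?case using a by (simp add: A.r_distr pos_carrier hproj_add)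
qed

lemma mult_pos: "a .: AP ==> b .: AP ==> a *[A] b .: AP"
  using mult_pos_left pos_closed by blast

lemma set_mrg:
  assumes "as <: AP" "Suc i < length as"
  shows "set (mrg A i as) \<subseteq> carrier AP"
  unfolding mrg_eq[OF assms(2), symmetric] set_append
  using assms set_take_subset[of i as] set_drop_subset[of "Suc (Suc i)" as]
  by (auto intro!: mult_pos simp: nth_mem subset_iff)

text \<open>A relation concerns one entry or two adjacent ones, and the cases locate these relative
  to the merged pair. Away from the pair the same relation of \<open>F\<close> applies; next to it
  or on it one uses distributivity, the compatibility of the product with the actions, or
  \<open>mult_balanced\<close>.\<close>

lemma tmulti_mrg:
  assumes F: "tmulti R AP n G F" and i: "i < n"
  shows "tmulti R AP (Suc n) G (\<lambda>(r, as). F (r, mrg A i as))"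
proof (rule tmultiI, unfold prod.case, goal_cases)
  case (1 r xs)
  then show ?case using i by (intro tmulti_closed[OF F] set_mrg) (auto simp: length_mrg)
next
  case (2 r s xs)
  then show ?case using i by (intro tmulti_add[OF F] set_mrg) (auto simp: length_mrg)
next
  case (3 r xs x y ys)
  note a = 3
  consider "Suc i < length xs" | "Suc i = length xs" | "i = length xs" | "length xs < i" by linarith
  then show ?case proof cases
    case 1
    then show ?thesis
      using a set_mrg[of xs i] by (simp add: mrg_append_left tmulti_slot[OF F] length_mrg)
  next
    case 2
    then obtain us b where us: "xs = us @ [b]" by (cases xs rule: rev_exhaust) auto
    then have "mrg A i (xs @ z # ys) = us @ (b *[A] z) # ys" for z
      using 2 mrg_append_right[of A us 0 "b # z # ys"] by simp
    moreover have "b *[A] (x +[AP] y) = b *[A] x +[AP] b *[A] y"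
      using a us by (simp add: pos_simps pos_closed A.r_distr)
    ultimately show ?thesis using a us by (simp add: tmulti_slot[OF F] mult_pos)
  next
    case 3
    then obtain b vs where vs: "ys = b # vs" using a i by (cases ys) auto
    then have "mrg A i (xs @ z # ys) = xs @ (z *[A] b) # vs" for z
      using 3 mrg_append_right[of A xs 0 "z # b # vs"] by simp
    moreover have "(x +[AP] y) *[A] b = x *[A] b +[AP] y *[A] b"
      using a vs by (simp add: pos_simps pos_closed A.l_distr)
    ultimately show ?thesis using a vs by (simp add: tmulti_slot[OF F] mult_pos)
  next
    case 4
    obtain k where k: "i = Suc (length xs) + k" using le_Suc_ex[of "Suc (length xs)" i] 4 by auto
    then have "mrg A i (xs @ z # ys) = xs @ z # mrg A k ys" for z
      using mrg_append_right[of A "xs @ [z]" k ys] by simp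
    moreover have "Suc k < length ys" using a i k by simp
    ultimately show ?thesis using a set_mrg[of ys k] by (simp add: tmulti_slot[OF F] length_mrg)
  qed
next
  case (4 r s x xs)
  note a = 4
  show ?case proof (cases i)
    case 0
    then obtain b vs where vs: "xs = b # vs" using a i by (cases xs) auto
    have "F (r *[R] s, (x *[A] b) # vs) = F (r, (s .[AP] (x *[A] b)) # vs)"
      using a vs by (intro tmulti_head[OF F]) (auto intro: mult_pos)
    then show ?thesis using 0 a vs by (simp add: pos_simps smult_mult pos_closed)
  next
    case (Suc k)
    then show ?thesis using a i set_mrg[of xs k] by (simp add: tmulti_head[OF F] length_mrg)
  qed
next
  case (5 r s xs x y ys)
  note a = 5
  have xc: "x .: A" "y .: A" using a pos_closed by auto
  consider "Suc i < length xs" | "Suc i = length xs" | "i = length xs" | "i = Suc (length xs)" | "Suc (length xs) < i"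
    by linarith
  then show ?case proof cases
    case 1
    then show ?thesis
      using a set_mrg[of xs i] by (simp add: mrg_append_left tmulti_bal[OF F] length_mrg)
  next
    case 2
    then obtain us b where us: "xs = us @ [b]" by (cases xs rule: rev_exhaust) auto
    then have "mrg A i (xs @ z # w # ys) = us @ (b *[A] z) # w # ys" for z w
      using 2 mrg_append_right[of A us 0 "b # z # w # ys"] by simp
    moreover have "b *[A] (x <[AP] s) = (b *[A] x) <[AP] s"
      using a us xc by (simp add: pos_simps pos_closed mult_rsmult)
    ultimately show ?thesis using a us by (simp add: tmulti_bal[OF F] mult_pos)
  next
    case 3
    then have "mrg A i (xs @ z # w # ys) = xs @ (z *[A] w) # ys" for z w
      using mrg_append_right[of A xs 0 "z # w # ys"] by simp
    then show ?thesis using a xc by (simp add: pos_simps mult_balanced)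
  next
    case 4
    then obtain b vs where vs: "ys = b # vs" using a i by (cases ys) auto
    then have "mrg A i (xs @ z # w # ys) = xs @ z # (w *[A] b) # vs" for z w
      using 4 mrg_append_right[of A "xs @ [z]" 0 "w # b # vs"] by simp
    moreover have "(s .[AP] y) *[A] b = s .[AP] (y *[A] b)"
      using a vs xc by (simp add: pos_simps pos_closed smult_mult)
    ultimately show ?thesis using a vs by (simp add: tmulti_bal[OF F] mult_pos)
  next
    case 5
    obtain k where k: "i = Suc (Suc (length xs)) + k"
      using le_Suc_ex[of "Suc (Suc (length xs))" i] 5 by auto
    then have "mrg A i (xs @ z # w # ys) = xs @ z # w # mrg A k ys" for z w
      using mrg_append_right[of A "xs @ [z, w]" k ys] by simp
    moreover have "Suc k < length ys" using a i k by simp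
    ultimately show ?thesis using a set_mrg[of ys k] by (simp add: tmulti_bal[OF F] length_mrg)
  qed
qed

text \<open>The simplicial identity in the shape that \<open>altsum_altsum_zero\<close> expects.
  Associativity of the product is used for adjacent faces only.\<close>

lemma mrg_mrg:
  assumes "as <: AP" "i < j" "Suc j < length as"
  shows "mrg A i (mrg A j as) = mrg A (j - 1) (mrg A i as)"
  using assms
proof (induction j arbitrary: i as)
  case (Suc j)
  then obtain a b bs where as: "as = a # b # bs" by (cases as; cases "tl as") auto
  show ?case proof (cases i)
    case 0
    show ?thesis proof (cases j)
      case 0
      then obtain c cs where "bs = c # cs" using Suc.prems as by (cases bs) auto
      then show ?thesis using 0 \<open>i = 0\<close> as Suc.prems by (simp add: A.m_assoc pos_closed)
    next
      case (Suc k)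
      then show ?thesis using 0 as by simp
    qed
  next
    case (Suc k)
    then obtain l where l: "j = Suc l" using Suc.prems by (cases j) auto
    have "mrg A k (mrg A j (b # bs)) = mrg A (j - 1) (mrg A k (b # bs))"
      using Suc Suc.prems as by (intro Suc.IH) auto
    then show ?thesis using Suc as l by simp
  qed
qed simp

end

lemma tmulti_ahom_comp:
  assumes F: "tmulti R M n G F" and h: "ahom G H h"
  shows "tmulti R M n H (\<lambda>g. h (F g))"
proof (rule tmultiI)
  fix r xs x y ys
  assume a: "r .: R" "xs <: M" "x .: M" "y .: M" "ys <: M" "Suc (length xs + length ys) = n"
  then show "h (F (r, xs @ (x +[M] y) # ys)) = h (F (r, xs @ x # ys)) +[H] h (F (r, xs @ y # ys))"
    using tmulti_closed[OF F, of r "xs @ x # ys"] tmulti_closed[OF F, of r "xs @ y # ys"]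
    by (simp add: tmulti_slot[OF F] ahom_add[OF h])
qed (simp_all add: tmulti_closed[OF F] tmulti_add[OF F] tmulti_head[OF F] tmulti_bal[OF F]
    ahom_closed[OF h] ahom_add[OF h])

context bimodule
begin

lemma tmulti_cong:
  assumes F: "tmulti R M n G F"
    and eq: "\<And>r xs. r .: R ==> xs <: M ==> length xs = n ==> F' (r, xs) = F (r, xs)"
  shows "tmulti R M n G F'" by (rule tmultiI)
    (simp_all add: eq tmulti_closed[OF F] tmulti_add[OF F] tmulti_slot[OF F] tmulti_head[OF F]
      tmulti_bal[OF F] smult_closed rsmult_closed)

text \<open>Each \<open>F i\<close> factors through the universal \<open>tpow_pure\<close>, so the
  sum can be taken among additive maps on the tensor power and then pulled back to
  generators.\<close>

lemma tmulti_sum: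
  assumes G: "abelian_group G" and F: "\<And>i. i \<in> I ==> tmulti R M n G (F i)"
  shows "tmulti R M n G (\<lambda>g. \<Oplus>\<^bsub>G\<^esub>i\<in>I. F i g)"
proof (rule tmulti_cong[OF tmulti_ahom_comp[OF tpow_pure_tmulti ahom_sum[OF G tpow_lift_ahom[OF G F]]]])
  fix r xs assume "r .: R" "xs <: M" "length xs = n"
  then show "(\<Oplus>\<^bsub>G\<^esub>i\<in>I. F i (r, xs)) = (\<Oplus>\<^bsub>G\<^esub>i\<in>I. presented_lift G (F i) (tpow_pure R M (r, xs)))"
    using tpow_lift_pure[OF G F] tmulti_closed[OF F]
    by (intro abelian_monoid.finsum_cong'[OF abelian_group.axioms(1)[OF G]]) auto
qed

text \<open>The second hypothesis controls the relations across the cut: the scalar \<open>s\<close> may be attached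
  either to the end of the first part or to the beginning of the second.\<close>

lemma tmulti_split:
  assumes H1: "\<And>ys. ys <: M ==> length ys = m ==> tmulti R M n G (\<lambda>g. H g ys)"
    and H2: "\<And>r xs. r .: R ==> xs <: M ==> length xs = n ==>
        tmulti R M m G (\<lambda>(s, ys). H (tpow_rscale R M (r, xs) s) ys)"
  shows "tmulti R M (n + m) G (\<lambda>(r, zs). H (r, take n zs) (drop n zs))"
proof -
  \<comment> \<open>With the scalar 1 the second hypothesis also covers the relations that lie
    inside the second part.\<close>
  have sc1: "tpow_rscale R M (r, xs) 1[R] = (r, xs)" if "r .: R" "xs <: M" for r xs
    using that by (cases xs rule: rev_exhaust) (simp_all add: rsmult_one)
  note H2' = H2[THEN tmulti_slot, unfolded prod.case] H2[THEN tmulti_bal, unfolded prod.case]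
    H2[THEN tmulti_head, unfolded prod.case]
  show ?thesis proof (rule tmultiI, unfold prod.case, goal_cases)
    case (1 r zs)
    then show ?case
      using set_take_subset[of n zs] set_drop_subset[of n zs] by (intro tmulti_closed[OF H1]) auto
  next
    case (2 r s zs)
    then show ?case
      using set_take_subset[of n zs] set_drop_subset[of n zs] by (intro tmulti_add[OF H1]) auto
  next
    case (3 r xs x y ys)
    note a = 3
    show ?case proof (cases "length xs < n")
      case True
      then obtain k where k: "n = Suc (length xs) + k"
        using le_Suc_ex[of "Suc (length xs)" n] by auto
      have s: "set (take k ys) \<subseteq> carrier M" "set (drop k ys) \<subseteq> carrier M"
        using a set_take_subset[of k ys] set_drop_subset[of k ys] by auto
      show ?thesis using a k s tmulti_slot[OF H1[OF s(2)], of r xs x y "take k ys"] by simp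
    next
      case False
      have s: "set (take n xs) \<subseteq> carrier M" "set (drop n xs) \<subseteq> carrier M"
        using a set_take_subset[of n xs] set_drop_subset[of n xs] by auto
      show ?thesis
        using a False s tmulti_slot[OF H2[of r "take n xs"], of "1[R]" "drop n xs" x y ys]
        by (simp add: sc1)
    qed
  next
    case (4 r s x xs)
    note a = 4
    show ?case proof (cases n)
      case 0
      then show ?thesis
        using a tmulti_head[OF H2[of r "[]"], of "1[R]" s x xs] by (simp add: smult_closed)
    next
      case (Suc k)
      have s: "set (take k xs) \<subseteq> carrier M" "set (drop k xs) \<subseteq> carrier M"
        using a set_take_subset[of k xs] set_drop_subset[of k xs] by auto
      show ?thesis using a Suc s tmulti_head[OF H1[OF s(2)], of r s x "take k xs"] by simp
    qed
  next
    case (5 r s xs x y ys)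
    note a = 5
    consider "Suc (length xs) < n" | "n = Suc (length xs)" | "n \<le> length xs" by linarith
    then show ?case proof cases
      case 1
      then obtain k where k: "n = Suc (Suc (length xs)) + k"
        using le_Suc_ex[of "Suc (Suc (length xs))" n] by auto
      have s: "set (take k ys) \<subseteq> carrier M" "set (drop k ys) \<subseteq> carrier M"
        using a set_take_subset[of k ys] set_drop_subset[of k ys] by auto
      show ?thesis using a k s tmulti_bal[OF H1[OF s(2)], of r s xs x y "take k ys"] by simp
    next
      case 2
      have "H (tpow_rscale R M (r, xs @ [x]) (1[R] *[R] s)) (y # ys) =
          H (tpow_rscale R M (r, xs @ [x]) 1[R]) ((s .[M] y) # ys)"
        using a 2 tmulti_head[OF H2[of r "xs @ [x]"], of "1[R]" s y ys] by simp
      then show ?thesis using a 2 by (simp add: rsmult_one)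
    next
      case 3
      have s: "set (take n xs) \<subseteq> carrier M" "set (drop n xs) \<subseteq> carrier M"
        using a set_take_subset[of n xs] set_drop_subset[of n xs] by auto
      show ?thesis using a 3 s tmulti_bal[OF H2[of r "take n xs"], of "1[R]" s "drop n xs" x y ys]
        by (simp add: sc1)
    qed
  qed
qed

lemma left_dual_eval: "v .: M ==> ahom (left_dual R M) R (\<lambda>f. f v)"
  by (auto simp: ahom_def left_dual_closed left_dual_simps(3))

lemma left_dual_neg_apply: "f .: (left_dual R M) ==> v .: M ==> (-[left_dual R M] f) v = -[R] f v"
  using ahom_neg[OF left_dual_group Rg left_dual_eval] by blast

end

section \<open>The cochain complex of the reduced bar complex\<close>

context connected_graded_rring
begin

abbreviation "BT n \<equiv> tpow R AP n"
abbreviation "bt \<equiv> tpow_pure R AP"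
abbreviation "ECH n \<equiv> ext_cochains R A n"

lemma ext_cochains_eq: "ECH n = left_dual R (BT n)" by (simp add: ext_cochains_def)

lemma BT_bimodule: "bimodule R (BT n)" by (rule P.tpow_bimodule)

lemma BT_group: "abelian_group (BT n)" by (rule P.tpow_group)

lemma ECH_group: "abelian_group (ECH n)"
  unfolding ext_cochains_eq by (rule bimodule.left_dual_group[OF BT_bimodule])

lemma bar_tmulti: "tmulti R AP (Suc n) (BT n) (\<lambda>(r, as).
     \<Oplus>\<^bsub>BT n\<^esub>i\<in>{..<n}. add_pow (BT n) ((-1) ^ i :: int)
       (bt (r, take i as @ [as ! i *[A] as ! Suc i] @ drop (Suc (Suc i)) as)))"
  and bar_gen: "r .: R ==> as <: AP ==> length as = Suc n ==>
     (\<Oplus>\<^bsub>BT n\<^esub>i\<in>{..<n}. add_pow (BT n) ((-1) ^ i :: int)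
       (bt (r, take i as @ [as ! i *[A] as ! Suc i] @ drop (Suc (Suc i)) as))) =
     altsum (BT n) n (\<lambda>i. bt (r, mrg A i as))"
proof -
  interpret T: abelian_group "BT n" by (rule BT_group)
  have cl: "bt (r, mrg A i as) .: (BT n)"
    if "r .: R" "as <: AP" "length as = Suc n" "i < n" for r as i
    using that by (intro P.tpow_pure_closed set_mrg) (auto simp: length_mrg)
  have eq: "(\<Oplus>\<^bsub>BT n\<^esub>i\<in>{..<n}. add_pow (BT n) ((-1) ^ i :: int)
       (bt (r, take i as @ [as ! i *[A] as ! Suc i] @ drop (Suc (Suc i)) as))) =
     altsum (BT n) n (\<lambda>i. bt (r, mrg A i as))" if "r .: R" "as <: AP" "length as = Suc n" for r as
    unfolding altsum_def
  proof (rule T.finsum_cong')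
    show "(\<lambda>i. add_pow (BT n) ((-1) ^ i :: int) (bt (r, mrg A i as))) \<in> {..<n} \<rightarrow> carrier (BT n)"
      using cl[OF that] by (auto intro: T.add.int_pow_closed)
    show "add_pow (BT n) ((-1) ^ i :: int)
        (bt (r, take i as @ [as ! i *[A] as ! Suc i] @ drop (Suc (Suc i)) as)) =
        add_pow (BT n) ((-1) ^ i :: int) (bt (r, mrg A i as))" if "i \<in> {..<n}" for i
      using that \<open>length as = Suc n\<close> mrg_eq[of i as A] by simp
  qed simp
  have m: "tmulti R AP (Suc n) (BT n) (\<lambda>g. sg (BT n) i (case g of (r, as) => bt (r, mrg A i as)))"
    if "i < n" for i
  proof (rule tmulti_ahom_comp[OF tmulti_mrg[OF P.tpow_pure_tmulti that]])
    show "ahom (BT n) (BT n) (sg (BT n) i)" by (simp add: ahom_def T.sg_closed T.sg_add)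
  qed
  have "tmulti R AP (Suc n) (BT n) (\<lambda>g. \<Oplus>\<^bsub>BT n\<^esub>i\<in>{..<n}.
      sg (BT n) i (case g of (r, as) => bt (r, mrg A i as)))"
    by (rule P.tmulti_sum[OF BT_group m]) simp
  then show "tmulti R AP (Suc n) (BT n) (\<lambda>(r, as). \<Oplus>\<^bsub>BT n\<^esub>i\<in>{..<n}. add_pow (BT n) ((-1) ^ i :: int)
       (bt (r, take i as @ [as ! i *[A] as ! Suc i] @ drop (Suc (Suc i)) as)))"
    by (rule P.tmulti_cong) (simp only: prod.case eq T.altsum_sg[OF cl])
  show "r .: R ==> as <: AP ==> length as = Suc n ==>
     (\<Oplus>\<^bsub>BT n\<^esub>i\<in>{..<n}. add_pow (BT n) ((-1) ^ i :: int)
       (bt (r, take i as @ [as ! i *[A] as ! Suc i] @ drop (Suc (Suc i)) as))) =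
     altsum (BT n) n (\<lambda>i. bt (r, mrg A i as))" by (rule eq)
qed

lemma bar_ahom: "ahom (BT (Suc n)) (BT n) (bar_diff R A n)"
  unfolding bar_diff_def by (rule P.tpow_lift_ahom[OF BT_group bar_tmulti])

lemma bar_pure:
  assumes "r .: R" "as <: AP" "length as = Suc n"
  shows "bar_diff R A n (bt (r, as)) = altsum (BT n) n (\<lambda>i. bt (r, mrg A i as))"
  unfolding bar_diff_def P.tpow_lift_pure[OF BT_group bar_tmulti assms] prod.case by (rule bar_gen[OF assms])

lemma mrg_pure_closed: "r .: R ==> as <: AP ==> length as = Suc n ==> i < n ==>
    bt (r, mrg A i as) .: (BT n)" by (intro P.tpow_pure_closed set_mrg) (auto simp: length_mrg)

lemma bar_smult:
  assumes s: "s .: R" and X: "X .: (BT (Suc n))"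
  shows "bar_diff R A n (s .[BT (Suc n)] X) = s .[BT n] bar_diff R A n X"
proof -
  interpret T: bimodule R "BT n" by (rule BT_bimodule)
  interpret T': bimodule R "BT (Suc n)" by (rule BT_bimodule)
  note sm = T.ahom_smult[OF s]
  show ?thesis
  proof (rule P.tpow_eqI[OF BT_group ahom_comp[OF T'.ahom_smult[OF s] bar_ahom] ahom_comp[OF bar_ahom sm] _ X])
  fix r xs assume r: "r .: R" and xs: "xs <: AP" "length xs = Suc n"
  have "s .[BT n] altsum (BT n) n (\<lambda>i. bt (r, mrg A i xs)) =
      altsum (BT n) n (\<lambda>i. s .[BT n] bt (r, mrg A i xs))"
    by (rule ahom_altsum[OF BT_group BT_group sm]) (rule mrg_pure_closed[OF r xs])
  also have "... = altsum (BT n) n (\<lambda>i. bt (s *[R] r, mrg A i xs))" proof (rule T.M.altsum_cong)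
    fix i assume i: "i < n"
    show "s .[BT n] bt (r, mrg A i xs) = bt (s *[R] r, mrg A i xs)"
      using i xs r s set_mrg[OF xs(1), of i] by (intro P.tpow_smult_pure) (auto simp: length_mrg)
  qed (use mrg_pure_closed[OF _ xs] r s in auto)
  finally show "bar_diff R A n (s .[BT (Suc n)] bt (r, xs)) =
      s .[BT n] bar_diff R A n (bt (r, xs))" using r s xs by (simp add: P.tpow_smult_pure bar_pure)
  qed
qed

text \<open>Only the last face touches the scaled entry, and there the claim is
  \<open>(z w) t = z (w t)\<close>.\<close>

lemma rscale_mrg:
  assumes "as <: AP" "length as = Suc n" "i < n" "t .: R"
  shows "tpow_rscale R AP (r, mrg A i as) t = (r, mrg A i (snd (tpow_rscale R AP (r, as) t)))"
proof -
  obtain ws w where as: "as = ws @ [w]" using assms(2) by (cases as rule: rev_exhaust) auto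
  show ?thesis proof (cases "Suc i < length ws")
    case True
    then show ?thesis by (simp add: as mrg_append_left)
  next
    case False
    then obtain zs z where zs: "ws = zs @ [z]" "length zs = i"
      using assms(2,3) as by (cases ws rule: rev_exhaust) auto
    have "mrg A i (zs @ [z, v]) = zs @ [z *[A] v]" for v
      using zs mrg_append_right[of A zs 0 "[z, v]"] by simp
    moreover have "tpow_rscale R AP (r, zs @ [z, w]) t = (r, zs @ [z, w <[AP] t])"
      using tpow_rscale_snoc[of R AP r "zs @ [z]" w t] by simp
    ultimately show ?thesis using assms as zs by (simp add: pos_simps mult_rsmult pos_closed)
  qed
qed

lemma set_rscale: "as <: AP ==> t .: R ==> set (snd (tpow_rscale R AP (r, as) t)) \<subseteq> carrier AP"
  "length (snd (tpow_rscale R AP (r, as) t)) = length as"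
  "as \<noteq> [] ==> fst (tpow_rscale R AP (r, as) t) = r"
  by (cases as rule: rev_exhaust; simp add: P.rsmult_closed)+

lemma bar_rsmult:
  assumes s: "s .: R" and X: "X .: (BT (Suc n))"
  shows "bar_diff R A n (X <[BT (Suc n)] s) = bar_diff R A n X <[BT n] s"
proof -
  interpret T: bimodule R "BT n" by (rule BT_bimodule)
  interpret T': bimodule R "BT (Suc n)" by (rule BT_bimodule)
  note sm = T.ahom_rsmult[OF s]
  show ?thesis
  proof (rule P.tpow_eqI[OF BT_group ahom_comp[OF T'.ahom_rsmult[OF s] bar_ahom] ahom_comp[OF bar_ahom sm] _ X])
  fix r xs assume r: "r .: R" and xs: "xs <: AP" "length xs = Suc n"
  have "xs \<noteq> []" using xs by auto
  then obtain ys where ys: "tpow_rscale R AP (r, xs) s = (r, ys)" "ys <: AP" "length ys = Suc n"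
    using set_rscale(1)[OF xs(1) s, of r] set_rscale(2)[where as = xs and r = r and t = s]
      set_rscale(3)[where as = xs and r = r and t = s] xs(2)
    by (cases "tpow_rscale R AP (r, xs) s") simp
  have "altsum (BT n) n (\<lambda>i. bt (r, mrg A i xs)) <[BT n] s =
      altsum (BT n) n (\<lambda>i. bt (r, mrg A i xs) <[BT n] s)"
    by (rule ahom_altsum[OF BT_group BT_group sm]) (rule mrg_pure_closed[OF r xs])
  also have "... = altsum (BT n) n (\<lambda>i. bt (r, mrg A i ys))" proof (rule T.M.altsum_cong)
    fix i assume i: "i < n"
    have "bt (r, mrg A i xs) <[BT n] s = bt (tpow_rscale R AP (r, mrg A i xs) s)"
      using i xs r s set_mrg[OF xs(1), of i] by (intro P.tpow_rsmult_pure) (auto simp: length_mrg)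
    then show "bt (r, mrg A i xs) <[BT n] s = bt (r, mrg A i ys)"
      using rscale_mrg[OF xs i s, of r] ys(1) by simp
  qed (use mrg_pure_closed[OF r ys(2,3)] in auto)
  finally show "bar_diff R A n (bt (r, xs) <[BT (Suc n)] s) =
      bar_diff R A n (bt (r, xs)) <[BT n] s"
    using r s xs ys by (simp add: P.tpow_rsmult_pure bar_pure)
  qed
qed

lemma bar_bar:
  assumes X: "X \<in> carrier (BT (Suc (Suc n)))"
  shows "bar_diff R A n (bar_diff R A (Suc n) X) = 0[BT n]"
proof (rule P.tpow_eqI[OF BT_group ahom_comp[OF bar_ahom bar_ahom] ahom_zero_map[OF BT_group] _ X])
  interpret T: abelian_group "BT n" by (rule BT_group)
  fix r xs assume r: "r .: R" and xs: "xs <: AP" "length xs = Suc (Suc n)"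
  have m: "set (mrg A j xs) \<subseteq> carrier AP" "length (mrg A j xs) = Suc n" if "j < Suc n" for j
    using that xs by (auto intro!: set_mrg subsetD[OF set_mrg[OF xs(1), of j]] simp: length_mrg)
  have "bar_diff R A n (bar_diff R A (Suc n) (bt (r, xs))) =
      bar_diff R A n (altsum (BT (Suc n)) (Suc n) (\<lambda>j. bt (r, mrg A j xs)))"
    using r xs by (simp add: bar_pure)
  also have "... = altsum (BT n) (Suc n) (\<lambda>j. bar_diff R A n (bt (r, mrg A j xs)))"
    by (rule ahom_altsum[OF BT_group BT_group bar_ahom]) (rule mrg_pure_closed[OF r xs])
  also have "... = altsum (BT n) (Suc n) (\<lambda>j. altsum (BT n) n (\<lambda>i. bt (r, mrg A i (mrg A j xs))))"
  proof (rule T.altsum_cong)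
    fix j assume j: "j < Suc n"
    show "bar_diff R A n (bt (r, mrg A j xs)) =
        altsum (BT n) n (\<lambda>i. bt (r, mrg A i (mrg A j xs)))" by (rule bar_pure[OF r m[OF j]])
    show "altsum (BT n) n (\<lambda>i. bt (r, mrg A i (mrg A j xs))) .: (BT n)"
      by (rule T.altsum_closed) (rule mrg_pure_closed[OF r m[OF j]])
  qed
  also have "... = 0[BT n]" proof (rule T.altsum_altsum_zero)
    fix i j assume "j \<le> n" "i < n"
    then show "bt (r, mrg A i (mrg A j xs)) .: (BT n)" by (intro mrg_pure_closed[OF r m]) auto
  next
    fix i j assume "j \<le> n" "i < j"
    then show "bt (r, mrg A i (mrg A j xs)) = bt (r, mrg A (j - 1) (mrg A i xs))"
      using xs by (simp add: mrg_mrg)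
  qed
  finally show "bar_diff R A n (bar_diff R A (Suc n) (bt (r, xs))) = 0[BT n]" .
qed

lemma ECH_closed: "f .: (ECH n) ==> X .: (BT n) ==> f X .: R"
  unfolding ext_cochains_eq by (rule left_dual_closed)

lemma ECH_ahom: "f .: (ECH n) ==> ahom (BT n) R f"
  unfolding ext_cochains_eq by (rule left_dual_ahom)

lemma ECH_smult: "f .: (ECH n) ==> X .: (BT n) ==> r .: R ==>
    f (r .[BT n] X) = r *[R] f X" unfolding ext_cochains_eq by (rule left_dual_smult)

lemma ECH_apply: "X .: (BT n) ==> 0[ECH n] X = 0[R]"
  "X .: (BT n) ==> (f +[ECH n] g) X = f X +[R] g X"
  by (simp_all add: ext_cochains_eq left_dual_simps)

text \<open>By left linearity a cochain is known from its values at tensors with coefficient 1; from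
  here on cochains are compared in this way.\<close>

lemma ECH_eqI:
  assumes f: "f .: (ECH n)" and g: "g .: (ECH n)" and eq: "\<And>as. as <: AP ==> length as = n ==>
      f (bt (1[R], as)) = g (bt (1[R], as))"
  shows "f = g"
proof (rule left_dual_eqI[OF f[unfolded ext_cochains_eq] g[unfolded ext_cochains_eq]])
  fix X assume X: "X .: (BT n)"
  show "f X = g X" proof (rule P.tpow_eqI[OF Rg ECH_ahom[OF f] ECH_ahom[OF g] _ X])
    fix r xs assume r: "r .: R" and xs: "xs <: AP" "length xs = n"
    have p: "bt (r, xs) = r .[BT n] bt (1[R], xs)" using r xs by (simp add: P.tpow_smult_pure)
    show "f (bt (r, xs)) = g (bt (r, xs))"
      unfolding p using r xs f g by (simp add: ECH_smult P.tpow_pure_closed eq)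
  qed
qed

lemma ECH_lift:
  assumes F: "tmulti R AP n R F"
    and lin: "\<And>s r xs. s .: R ==> r .: R ==> xs <: AP ==> length xs = n ==>
      F (s *[R] r, xs) = s *[R] F (r, xs)"
  shows "(\<lambda>X\<in>carrier (BT n). presented_lift R F X) .: (ECH n)"
proof -
  note l = P.tpow_lift_ahom[OF Rg F]
  interpret T: bimodule R "BT n" by (rule BT_bimodule)
  show ?thesis unfolding ext_cochains_eq proof (rule left_dual_memI)
    fix s X assume s: "s .: R" and X: "X .: (BT n)"
    have m: "ahom R R (\<lambda>x. s *[R] x)" using s by (simp add: ahom_def R.r_distr)
    show "presented_lift R F (s .[BT n] X) = s *[R] presented_lift R F X"
      by (rule P.tpow_eqI[OF Rg ahom_comp[OF T.ahom_smult[OF s] l] ahom_comp[OF l m] _ X])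
        (use s in \<open>simp add: P.tpow_smult_pure P.tpow_lift_pure[OF Rg F] lin\<close>)
  qed (use ahom_closed[OF l] ahom_add[OF l] T.left_module_axioms in auto)
qed

lemma ext_diff_apply: "X .: (BT (Suc n)) ==> ext_diff R A n f X = f (bar_diff R A n X)"
  by (simp add: ext_diff_def)

lemma ext_diff_closed:
  assumes f: "f .: (ECH n)"
  shows "ext_diff R A n f .: (ECH (Suc n))"
proof -
  interpret T': bimodule R "BT (Suc n)" by (rule BT_bimodule)
  show ?thesis unfolding ext_cochains_eq ext_diff_def by (rule left_dual_memI)
      (use f ahom_closed[OF bar_ahom] ahom_add[OF bar_ahom] ahom_add[OF ECH_ahom[OF f]] T'.left_module_axioms in
        \<open>auto simp: ECH_closed ECH_smult bar_smult\<close>)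
qed

lemma ext_diff_ahom: "ahom (ECH n) (ECH (Suc n)) (ext_diff R A n)"
proof (rule ahomI[OF ext_diff_closed])
  interpret E: abelian_group "ECH n" by (rule ECH_group)
  interpret E': abelian_group "ECH (Suc n)" by (rule ECH_group)
  fix f g assume "f .: (ECH n)" "g .: (ECH n)"
  then show "ext_diff R A n (f +[ECH n] g) = ext_diff R A n f +[ECH (Suc n)] ext_diff R A n g"
    using ahom_closed[OF bar_ahom] P.tpow_pure_closed
    by (intro ECH_eqI[where n = "Suc n"]) (auto simp: ext_diff_closed ECH_apply ext_diff_apply)
qed

lemma ext_diff_ext_diff:
  assumes "f .: (ECH n)"
  shows "ext_diff R A (Suc n) (ext_diff R A n f) = 0[ECH (Suc (Suc n))]"
proof -
  interpret E': abelian_group "ECH (Suc (Suc n))" by (rule ECH_group)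
  have "f 0[BT n] = 0[R]" by (rule ahom_zero[OF BT_group Rg ECH_ahom[OF assms]])
  then show ?thesis using ahom_closed[OF bar_ahom] P.tpow_pure_closed assms
    by (intro ECH_eqI[where n = "Suc (Suc n)"])
      (auto simp: ext_diff_closed ECH_apply ext_diff_apply bar_bar)
qed

lemma ext_diff_pure:
  assumes f: "f .: (ECH n)" and "r .: R" "as <: AP" "length as = Suc n"
  shows "ext_diff R A n f (bt (r, as)) = altsum R n (\<lambda>i. f (bt (r, mrg A i as)))"
  using assms(2-4) by (simp add: ext_diff_apply P.tpow_pure_closed bar_pure)
    (rule ahom_altsum[OF BT_group Rg ECH_ahom[OF f]], rule mrg_pure_closed, auto)

text \<open>The relation across the cut holds because \<open>g\<close> is left linear: a scalar
  taken from the end of the first part becomes a left factor of the value of \<open>g\<close>, which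
  multiplies that same end from the right.\<close>

lemma cup_tmulti:
  assumes f: "f .: (ECH n)" and g: "g .: (ECH m)"
  shows "tmulti R AP (n + m) R (\<lambda>(r, as). f (bt (r, take n as)
      <[BT n] g (bt (1[R], drop n as))))"
proof -
  interpret T: bimodule R "BT n" by (rule BT_bimodule)
  have "tmulti R AP (n + m) R (\<lambda>(r, as). (\<lambda>x ys. f (bt x
      <[BT n] g (bt (1[R], ys)))) (r, take n as) (drop n as))"
  proof (rule P.tmulti_split)
    fix ys assume ys: "ys <: AP" "length ys = m"
    then have "g (bt (1[R], ys)) .: R" using g by (simp add: ECH_closed P.tpow_pure_closed)
    then show "tmulti R AP n R (\<lambda>x. f (bt x <[BT n] g (bt (1[R], ys))))"
      by (intro tmulti_ahom_comp[OF P.tpow_pure_tmulti] ahom_comp[OF T.ahom_rsmult ECH_ahom[OF f]])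
  next
    fix r xs assume r: "r .: R" and xs: "xs <: AP" "length xs = n"
    let ?X = "bt (r, xs)"
    have X: "?X .: (BT n)" using r xs by (rule P.tpow_pure_closed)
    have "tmulti R AP m R (\<lambda>y. f (?X <[BT n] g (bt y)))"
      by (rule tmulti_ahom_comp[OF P.tpow_pure_tmulti
            ahom_comp[OF ECH_ahom[OF g] ahom_comp[OF T.ahom_rsmult_right[OF X] ECH_ahom[OF f]]]])
    then show "tmulti R AP m R (\<lambda>(s, ys). f (bt (tpow_rscale R AP (r, xs) s)
        <[BT n] g (bt (1[R], ys))))"
    proof (rule P.tmulti_cong; unfold prod.case)
      fix s ys assume s: "s .: R" and ys: "ys <: AP" "length ys = m"
      have gy: "g (bt (1[R], ys)) .: R" using g ys by (simp add: ECH_closed P.tpow_pure_closed)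
      have "g (bt (s, ys)) = s *[R] g (bt (1[R], ys))"
        using ECH_smult[OF g P.tpow_pure_closed[OF _ ys], of "1[R]" s] s ys by (simp add: P.tpow_smult_pure)
      then show "f (bt (tpow_rscale R AP (r, xs) s) <[BT n] g (bt (1[R], ys))) =
          f (?X <[BT n] g (bt (s, ys)))"
        using s gy X r xs by (simp add: T.rsmult_assoc flip: P.tpow_rsmult_pure)
    qed
  qed
  then show ?thesis by simp
qed

lemma cup_pure:
  assumes f: "f .: (ECH n)" and g: "g .: (ECH m)" and "r .: R" "as <: AP" "length as = n + m"
  shows "ext_cup R A n m f g (bt (r, as)) =
    f (bt (r, take n as) <[BT n] g (bt (1[R], drop n as)))"
  using P.tpow_lift_pure[OF Rg cup_tmulti[OF f g] assms(3-5)]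
    P.tpow_pure_closed[OF assms(3-5)] by (simp add: ext_cup_def)

lemma cup_closed:
  assumes f: "f .: (ECH n)" and g: "g .: (ECH m)"
  shows "ext_cup R A n m f g .: (ECH (n + m))"
  unfolding ext_cup_def
proof (rule ECH_lift[OF cup_tmulti[OF f g]]; unfold prod.case)
  interpret T: bimodule R "BT n" by (rule BT_bimodule)
  fix s r xs assume s: "s .: R" and r: "r .: R" and xs: "xs <: AP" "length xs = n + m"
  have l: "set (take n xs) \<subseteq> carrier AP" "set (drop n xs) \<subseteq> carrier AP" "length (take n xs) = n" "length (drop n xs) = m"
    using xs set_take_subset[of n xs] set_drop_subset[of n xs] by auto
  have t: "g (bt (1[R], drop n xs)) .: R"
    using g l by (intro ECH_closed[OF g] P.tpow_pure_closed) auto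
  have X: "bt (r, take n xs) .: (BT n)" using r l by (intro P.tpow_pure_closed) auto
  show "f (bt (s *[R] r, take n xs) <[BT n] g (bt (1[R], drop n xs))) =
      s *[R] f (bt (r, take n xs) <[BT n] g (bt (1[R], drop n xs)))"
    using s r l t X ECH_smult[OF f T.rsmult_closed[OF t X] s]
    by (simp add: T.smult_rsmult flip: P.tpow_smult_pure)
qed

lemma cup_add_left:
  assumes f: "f .: (ECH n)" "f' .: (ECH n)" and g: "g .: (ECH m)"
  shows "ext_cup R A n m (f +[ECH n] f') g = ext_cup R A n m f g +[ECH (n + m)] ext_cup R A n m f' g"
proof -
  interpret T: bimodule R "BT n" by (rule BT_bimodule)
  interpret E: abelian_group "ECH n" by (rule ECH_group)
  interpret E': abelian_group "ECH (n + m)" by (rule ECH_group)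
  show ?thesis proof (rule ECH_eqI[where n = "n + m"])
    fix as assume as: "as <: AP" "length as = n + m"
    have l: "set (take n as) \<subseteq> carrier AP" "set (drop n as) \<subseteq> carrier AP"
      using as set_take_subset[of n as] set_drop_subset[of n as] by auto
    have t: "bt (1[R], take n as) <[BT n] g (bt (1[R], drop n as)) .: (BT n)"
      using l as by (intro T.rsmult_closed ECH_closed[OF g] P.tpow_pure_closed) auto
    show "ext_cup R A n m (f +[ECH n] f') g (bt (1[R], as)) =
        (ext_cup R A n m f g +[ECH (n + m)] ext_cup R A n m f' g) (bt (1[R], as))"
      using f g as t by (simp add: cup_pure ECH_apply P.tpow_pure_closed)
  qed (use f g in \<open>auto intro: cup_closed\<close>)
qed

lemma cup_add_right:
  assumes f: "f .: (ECH n)" and g: "g .: (ECH m)" "g' .: (ECH m)"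
  shows "ext_cup R A n m f (g +[ECH m] g') = ext_cup R A n m f g +[ECH (n + m)] ext_cup R A n m f g'"
proof -
  interpret T: bimodule R "BT n" by (rule BT_bimodule)
  interpret E: abelian_group "ECH m" by (rule ECH_group)
  interpret E': abelian_group "ECH (n + m)" by (rule ECH_group)
  show ?thesis proof (rule ECH_eqI[where n = "n + m"])
    fix as assume as: "as <: AP" "length as = n + m"
    have l: "set (take n as) \<subseteq> carrier AP" "set (drop n as) \<subseteq> carrier AP"
      using as set_take_subset[of n as] set_drop_subset[of n as] by auto
    have Y: "bt (1[R], drop n as) .: (BT m)" and X: "bt (1[R], take n as) .: (BT n)"
      using l as by (auto intro!: P.tpow_pure_closed)
    note t = ECH_closed[OF g(1) Y] ECH_closed[OF g(2) Y]
    show "ext_cup R A n m f (g +[ECH m] g') (bt (1[R], as)) =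
        (ext_cup R A n m f g +[ECH (n + m)] ext_cup R A n m f g') (bt (1[R], as))"
      using f g as X Y t T.rsmult_closed[OF t(1) X] T.rsmult_closed[OF t(2) X]
      by (simp add: cup_pure ECH_apply P.tpow_pure_closed T.rsmult_r_distr ahom_add[OF ECH_ahom[OF f]])
  qed (use f g in \<open>auto intro: cup_closed\<close>)
qed

text \<open>Among \<open>n + m + 1\<close> entries, the first \<open>n\<close> faces merge inside
  the first \<open>n + 1\<close> entries and the other \<open>m\<close> faces inside the last
  \<open>m + 1\<close>. So the alternating sum of \<open>n + m\<close> faces splits into the two
  terms, the second one beginning with the sign \<open>(-1)^n\<close>. Right linearity of the bar
  differential (\<open>bar_rsmult\<close>) is what moves it past the value of
  \<open>g\<close>.\<close>

lemma ext_Leibniz: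
  assumes f: "f .: (ECH n)" and g: "g .: (ECH m)"
  shows "ext_diff R A (n + m) (ext_cup R A n m f g) =
    ext_cup R A (Suc n) m (ext_diff R A n f) g +[ECH (Suc (n + m))]
      sg (ECH (Suc (n + m))) n (ext_cup R A n (Suc m) f (ext_diff R A m g))"
proof -
  interpret T: bimodule R "BT n" by (rule BT_bimodule)
  interpret E: abelian_group "ECH (Suc (n + m))" by (rule ECH_group)
  note df = ext_diff_closed[OF f] and dg = ext_diff_closed[OF g]
  have c1: "ext_cup R A (Suc n) m (ext_diff R A n f) g \<in> carrier (ECH (Suc (n + m)))"
    using cup_closed[OF df g] by simp
  have c2: "ext_cup R A n (Suc m) f (ext_diff R A m g) \<in> carrier (ECH (Suc (n + m)))"
    using cup_closed[OF f dg] by simp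
  show ?thesis proof (rule ECH_eqI[where n = "Suc (n + m)"])
    fix as assume as: "as <: AP" "length as = Suc (n + m)"
    let ?p = "\<lambda>as. bt (1[R], as)"
    have ev: "ahom (ECH (Suc (n + m))) R (\<lambda>f. f (?p as))" unfolding ext_cochains_eq using as
      by (intro bimodule.left_dual_eval[OF BT_bimodule] P.tpow_pure_closed) auto
    \<comment> \<open>The two ways of cutting overlap: the entry with index \<open>n\<close> is the
      last of \<open>us\<close> and the first of \<open>vs'\<close>.\<close>
    define us vs us' vs' where "us = take (Suc n) as" and "vs = drop (Suc n) as"
      and "us' = take n as" and "vs' = drop n as"
    have uv: "us <: AP" "vs <: AP" "us' <: AP" "vs' <: AP" unfolding us_def vs_def us'_def vs'_def
      using as(1) by (meson order_trans set_take_subset set_drop_subset)+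
    have luv: "length us = Suc n" "length vs = m" "length us' = n" "length vs' = Suc m"
        "as = us @ vs" "as = us' @ vs'" using as(2) by (auto simp: us_def vs_def us'_def vs'_def)
    define t where "t = g (?p vs)"
    have t: "t .: R"
      unfolding t_def using uv luv by (intro ECH_closed[OF g] P.tpow_pure_closed) auto
    have Xu: "?p us .: (BT (Suc n))" and Xu': "?p us' .: (BT n)" and Xv': "?p vs' .: (BT (Suc m))"
      using uv luv by (auto intro!: P.tpow_pure_closed)
    have h1: "ahom (BT n) R (\<lambda>X. f (X <[BT n] t))"
      by (rule ahom_comp[OF T.ahom_rsmult[OF t] ECH_ahom[OF f]])
    have h2: "ahom R R (\<lambda>s. f (?p us' <[BT n] s))"
      by (rule ahom_comp[OF T.ahom_rsmult_right[OF Xu'] ECH_ahom[OF f]])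
    have mc: "set (mrg A i as) \<subseteq> carrier AP" "length (mrg A i as) = n + m" if "i < n + m" for i
      using that as set_mrg[OF as(1), of i] by (auto simp: length_mrg)
    have cc: "ext_cup R A n m f g (?p (mrg A i as)) .: R" if "i < n + m" for i
      using mc[OF that] by (intro ECH_closed[OF cup_closed[OF f g]] P.tpow_pure_closed) auto
    have e1: "ext_cup R A n m f g (?p (mrg A i as)) = f (?p (mrg A i us) <[BT n] t)" if i: "i < n" for i
    proof -
      have "mrg A i as = mrg A i us @ vs" using i luv by (simp add: mrg_append_left)
      then show ?thesis using mc[of i] i luv by (simp add: cup_pure[OF f g] t_def length_mrg)
    qed
    have e2: "ext_cup R A n m f g (?p (mrg A (n + j) as)) = f (?p us' <[BT n] g (?p (mrg A j vs')))"
      if j: "j < m" for j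
    proof -
      have "mrg A (n + j) as = us' @ mrg A j vs'" using luv mrg_append_right[of A us' j vs'] by simp
      then show ?thesis using mc[of "n + j"] j luv by (simp add: cup_pure[OF f g])
    qed
    have s1: "altsum R n (\<lambda>i. ext_cup R A n m f g (?p (mrg A i as))) =
        ext_cup R A (Suc n) m (ext_diff R A n f) g (?p as)"
    proof -
      have "altsum R n (\<lambda>i. ext_cup R A n m f g (?p (mrg A i as))) =
          altsum R n (\<lambda>i. f (?p (mrg A i us) <[BT n] t))"
        using cc by (intro R.altsum_cong) (auto simp flip: e1)
      also have "... = f (altsum (BT n) n (\<lambda>i. ?p (mrg A i us)) <[BT n] t)"
        by (rule ahom_altsum[OF BT_group Rg h1, symmetric])
          (rule mrg_pure_closed[OF R.one_closed uv(1) luv(1)])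
      also have "... = f (bar_diff R A n (?p us) <[BT n] t)" using uv luv by (simp add: bar_pure)
      also have "... = ext_diff R A n f (?p us <[BT (Suc n)] t)"
        using bimodule.rsmult_closed[OF BT_bimodule t Xu] by (simp add: ext_diff_apply bar_rsmult t Xu)
      also have "... = ext_cup R A (Suc n) m (ext_diff R A n f) g (?p as)"
        using as by (simp add: cup_pure[OF df g] t_def us_def vs_def)
      finally show ?thesis .
    qed
    have s2: "altsum R m (\<lambda>j. ext_cup R A n m f g (?p (mrg A (n + j) as))) =
        ext_cup R A n (Suc m) f (ext_diff R A m g) (?p as)"
    proof -
      have "altsum R m (\<lambda>j. ext_cup R A n m f g (?p (mrg A (n + j) as))) =
          altsum R m (\<lambda>j. f (?p us' <[BT n] g (?p (mrg A j vs'))))"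
        using cc by (intro R.altsum_cong) (auto simp flip: e2)
      also have "... = f (?p us' <[BT n] altsum R m (\<lambda>j. g (?p (mrg A j vs'))))"
        using mrg_pure_closed[OF R.one_closed uv(4) luv(4)]
        by (intro ahom_altsum[OF Rg Rg h2, symmetric]) (rule ECH_closed[OF g])
      also have "... = f (?p us' <[BT n] ext_diff R A m g (?p vs'))"
        using uv luv by (simp add: ext_diff_pure[OF g])
      also have "... = ext_cup R A n (Suc m) f (ext_diff R A m g) (?p as)"
        using as by (simp add: cup_pure[OF f dg] us'_def vs'_def)
      finally show ?thesis .
    qed
    have "ext_diff R A (n + m) (ext_cup R A n m f g) (?p as) =
        altsum R (n + m) (\<lambda>i. ext_cup R A n m f g (?p (mrg A i as)))"
      using as by (intro ext_diff_pure[OF cup_closed[OF f g]]) auto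
    also have "... = altsum R n (\<lambda>i. ext_cup R A n m f g (?p (mrg A i as))) +[R]
        sg R n (altsum R m (\<lambda>j. ext_cup R A n m f g (?p (mrg A (n + j) as))))"
      by (rule R.altsum_append) (rule cc)
    also have "... = (ext_cup R A (Suc n) m (ext_diff R A n f) g +[ECH (Suc (n + m))]
      sg (ECH (Suc (n + m))) n (ext_cup R A n (Suc m) f (ext_diff R A m g))) (?p as)"
      using as P.tpow_pure_closed[of "1[R]" as "Suc (n + m)"]
        ahom_sg[OF ECH_group Rg ev c2, of n] by (simp add: s1 s2 ECH_apply)
    finally show "ext_diff R A (n + m) (ext_cup R A n m f g) (?p as) =
      (ext_cup R A (Suc n) m (ext_diff R A n f) g +[ECH (Suc (n + m))]
        sg (ECH (Suc (n + m))) n (ext_cup R A n (Suc m) f (ext_diff R A m g))) (?p as)" .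
  qed (use c1 c2 ext_diff_closed[OF cup_closed[OF f g]] in \<open>auto intro: E.sg_closed\<close>)
qed

lemma unit_tmulti: "tmulti R AP 0 R fst" by (rule tmultiI) auto

lemma ext_unit_closed: "ext_unit R A .: (ECH 0)"
  unfolding ext_unit_def by (rule ECH_lift[OF unit_tmulti]) auto

lemma ext_unit_pure: "r .: R ==> ext_unit R A (bt (r, [])) = r"
  using P.tpow_lift_pure[OF Rg unit_tmulti, of r "[]"] P.tpow_pure_closed[of r "[]" 0]
  by (simp add: ext_unit_def)

end

section \<open>Vanishing off the diagonal for a Koszul pair\<close>

context connected_graded_rring
begin

section \<open>Left linear functionals as functions of lists\<close>

definition APl :: "nat => 'a list set" where "APl p = {as. as <: AP \<and> length as = p}"

lemma APl_simps: "[] \<in> APl p \<longleftrightarrow> p = 0" "x # xs \<in> APl (Suc p) \<longleftrightarrow> x .: AP \<and> xs \<in> APl p"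
  "xs @ [x] \<in> APl (Suc p) \<longleftrightarrow> x .: AP \<and> xs \<in> APl p" by (auto simp: APl_def)

lemma APl_snocE:
  assumes "as \<in> APl (Suc p)"
  obtains bs b where "as = bs @ [b]" "bs \<in> APl p" "b .: AP"
  using assms by (cases as rule: rev_exhaust) (auto simp: APl_def)

lemma APl_mrg: "as \<in> APl (Suc p) ==> i < p ==> mrg A i as \<in> APl p"
  using set_mrg[of as i] by (auto simp: APl_def length_mrg)

text \<open>A left linear functional on the \<open>p\<close>-fold tensor power of
  \<open>A_+\<close>, recorded by its values at tensors with coefficient 1; the factor
  \<open>r\<close> restores the coefficient.\<close>

definition mlin :: "nat => ('a list => 'r) => bool" where
  "mlin p w \<longleftrightarrow> (\<forall>as\<in>APl p. w as .: R) \<and> tmulti R AP p R (\<lambda>(r, as). r *[R] w as)"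

lemma mlinI:
  assumes c: "\<And>as. as \<in> APl p ==> w as .: R" and slot: "\<And>xs x y ys. \<lbrakk>xs <: AP; x .: AP; y .: AP;
        ys <: AP; Suc (length xs + length ys) = p\<rbrakk> \<Longrightarrow>
        w (xs @ (x +[AP] y) # ys) = w (xs @ x # ys) +[R] w (xs @ y # ys)"
    and head: "\<And>s x xs. \<lbrakk>s .: R; x .: AP; xs <: AP; Suc (length xs) = p\<rbrakk> \<Longrightarrow>
        w ((s .[AP] x) # xs) = s *[R] w (x # xs)"
    and bal: "\<And>s xs x y ys. \<lbrakk>s .: R; xs <: AP; x .: AP;
        y .: AP; ys <: AP; Suc (Suc (length xs + length ys)) = p\<rbrakk> \<Longrightarrow>
        w (xs @ (x <[AP] s) # y # ys) = w (xs @ x # (s .[AP] y) # ys)"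
  shows "mlin p w"
proof -
  have c': "w xs .: R" if "xs <: AP" "length xs = p" for xs using c that by (simp add: APl_def)
  have "tmulti R AP p R (\<lambda>(r, as). r *[R] w as)" proof (rule tmultiI, unfold prod.case, goal_cases)
    case (1 r xs)
    then show ?case using c' by simp
  next
    case (2 r s xs)
    then show ?case using c'[of xs] by (simp add: R.l_distr)
  next
    case (3 r xs x y ys)
    then show ?case using c'[of "xs @ x # ys"] c'[of "xs @ y # ys"] by (simp add: slot R.r_distr)
  next
    case (4 r s x xs)
    then show ?case using c'[of "x # xs"] by (simp add: head R.m_assoc)
  next
    case (5 r s xs x y ys)
    then show ?case by (simp add: bal)
  qed
  then show ?thesis using c by (simp add: mlin_def)
qed

lemma mlin_closed: "mlin p w ==> as \<in> APl p ==> w as .: R" by (simp add: mlin_def)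

lemma mlin_closed': "mlin p w ==> as <: AP ==> length as = p ==> w as .: R"
  by (simp add: mlin_def APl_def)

lemma mlin_tmulti: "mlin p w ==> tmulti R AP p R (\<lambda>(r, as). r *[R] w as)" by (simp add: mlin_def)

lemma mlin_slot: "mlin p w ==> xs <: AP ==> x .: AP ==> y .: AP ==>
    ys <: AP ==> Suc (length xs + length ys) = p ==>
    w (xs @ (x +[AP] y) # ys) = w (xs @ x # ys) +[R] w (xs @ y # ys)"
  using tmulti_slot[OF mlin_tmulti, of p w "1[R]" xs x y ys]
    mlin_closed'[of p w "xs @ x # ys"] mlin_closed'[of p w "xs @ y # ys"]
    mlin_closed'[of p w "xs @ (x +[AP] y) # ys"] by simp

lemma mlin_head: "mlin p w ==> s .: R ==> x .: AP ==> xs <: AP ==> Suc (length xs) = p ==>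
    w ((s .[AP] x) # xs) = s *[R] w (x # xs)"
  using tmulti_head[OF mlin_tmulti, of p w "1[R]" s x xs]
    mlin_closed'[of p w "x # xs"] mlin_closed'[of p w "(s .[AP] x) # xs"] by (simp add: P.smult_closed)

lemma mlin_bal: "mlin p w ==> s .: R ==> xs <: AP ==> x .: AP ==> y .: AP ==>
    ys <: AP ==> Suc (Suc (length xs + length ys)) = p ==>
    w (xs @ (x <[AP] s) # y # ys) = w (xs @ x # (s .[AP] y) # ys)"
  using tmulti_bal[OF mlin_tmulti, of p w "1[R]" s xs x y ys]
    mlin_closed'[of p w "xs @ (x <[AP] s) # y # ys"] mlin_closed'[of p w "xs @ x # (s .[AP] y) # ys"]
  by (simp add: P.smult_closed P.rsmult_closed)

lemma mlin_mrg: "mlin p w ==> i < p ==> mlin (Suc p) (\<lambda>as. w (mrg A i as))"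
  using tmulti_mrg[OF mlin_tmulti, of p w i] by (auto simp: mlin_def APl_mrg)

lemma mlin_cong: "mlin p w ==> (\<And>as. as \<in> APl p ==> w' as = w as) ==> mlin p w'"
  unfolding mlin_def by (auto simp: APl_def elim!: P.tmulti_cong)

lemma mlin_ahom:
  assumes w: "mlin p w" and h: "ahom R R h" and hl: "\<And>r x. r .: R ==> x .: R ==> h (r *[R] x) = r *[R] h x"
  shows "mlin p (\<lambda>as. h (w as))"
  unfolding mlin_def
proof (intro conjI ballI)
  show "tmulti R AP p R (\<lambda>(r, as). r *[R] h (w as))"
    by (rule P.tmulti_cong[OF tmulti_ahom_comp[OF mlin_tmulti[OF w] h]])
      (simp add: hl mlin_closed'[OF w])
qed (use w ahom_closed[OF h] mlin_closed in blast)

lemma mlin_sg: "mlin p w ==> mlin p (\<lambda>as. sg R k (w as))"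
  by (rule mlin_ahom[where h = "sg R k"]) (auto simp: ahom_def R.sg_closed R.sg_add sg_def R.r_minus R.minus_add)

lemma mlin_zero: "mlin p (\<lambda>as. 0[R])" by (rule mlinI) auto

lemma mlin_add:
  assumes w: "mlin p w" and v: "mlin p v"
  shows "mlin p (\<lambda>as. w as +[R] v as)"
  unfolding mlin_def
proof (intro conjI ballI)
  have "tmulti R AP p R (\<lambda>g. \<Oplus>\<^bsub>R\<^esub>i\<in>{True, False}. (if i then \<lambda>(r, as). r *[R] w as else (\<lambda>(r, as). r *[R] v as)) g)"
    by (rule P.tmulti_sum[OF Rg]) (use w v in \<open>auto simp: mlin_tmulti\<close>)
  then show "tmulti R AP p R (\<lambda>(r, as). r *[R] (w as +[R] v as))"
    by (rule P.tmulti_cong) (simp add: R.r_distr mlin_closed'[OF w] mlin_closed'[OF v])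
qed (use mlin_closed[OF w] mlin_closed[OF v] in simp)

lemma mlin_altsum:
  assumes w: "\<And>i. i < n ==> mlin p (w i)"
  shows "mlin p (\<lambda>as. altsum R n (\<lambda>i. w i as))"
  using w
proof (induction n)
  case 0
  show ?case by (simp add: R.altsum_0 mlin_zero)
next
  case (Suc n)
  have "mlin p (\<lambda>as. altsum R n (\<lambda>i. w i as) +[R] sg R n (w n as))"
    using Suc by (intro mlin_add mlin_sg) auto
  then show ?case by (rule mlin_cong) (use Suc.prems in \<open>auto intro!: R.altsum_Suc mlin_closed\<close>)
qed

text \<open>The functional \<open>x \<mapsto> w (x r)\<close> for the right action on the tensor
  power. For the empty list the tensor power is \<open>R\<close>, and left linearity turns the value
  at \<open>r\<close> into \<open>r w(1)\<close>.\<close>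

definition rsc :: "('a list => 'r) => 'r => 'a list => 'r" where
  "rsc w r as = (if as = [] then r *[R] w [] else w (butlast as @ [last as <[A] r]))"

lemma rsc_Nil [simp]: "rsc w r [] = r *[R] w []"
  and rsc_snoc [simp]: "rsc w r (as @ [a]) = w (as @ [a <[A] r])" by (simp_all add: rsc_def)

lemma mlin_rsc:
  assumes w: "mlin p w" and t: "t .: R"
  shows "mlin p (rsc w t)"
proof (cases "p = 0")
  case True
  then show ?thesis using mlin_closed[OF w] t by (intro mlinI) (auto simp: APl_def)
next
  case False
  have eq: "(\<lambda>(r, as). r *[R] w as) (tpow_rscale R AP (r, as) t) = r *[R] rsc w t as" if "length as = p" for r as
    using that False by (cases as rule: rev_exhaust) (auto simp: pos_simps)
  have c: "rsc w t as .: R" if "as \<in> APl p" for as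
    using that False t P.rsmult_closed mlin_closed[OF w]
    by (cases as rule: rev_exhaust) (auto simp: APl_def pos_simps)
  show ?thesis unfolding mlin_def proof (intro conjI ballI c)
    show "tmulti R AP p R (\<lambda>(r, as). r *[R] rsc w t as)"
      by (rule P.tmulti_cong[OF P.tmulti_rscale[OF mlin_tmulti[OF w] t]]) (simp add: eq)
  qed
qed

end

section \<open>The free left modules in the Koszul complex\<close>

locale koszul = connected_graded_rring R A + C: connected_graded_coring R C
  for R :: "('r, 'x) ring_scheme" (structure)
    and A :: "('r, 'a, 'y) graded_bimodule_scheme" (structure)
    and C :: "('r, 'c, 'z) graded_coring_scheme" (structure) +
  fixes \<theta> :: "'c => 'a"
  assumes semisimple: "semisimple_ring R" and koszul: "koszul_pair R A C \<theta>"
begin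

declare One_nat_def [simp del]

abbreviation "KT q \<equiv> koszul_term R A C q"
abbreviation "kp q \<equiv> tensor_pure R A (hpart C q)"
abbreviation "kd q \<equiv> koszul_diff R A C \<theta> q"

lemma kpair: "bimodule_pair R A (hpart C q)"
  by (intro bimodule_pair.intro bimodule_axioms C.hpart_bimodule)

lemma KT_group: "abelian_group (KT q)"
  unfolding koszul_term_def by (rule bimodule_pair.tensor_group[OF kpair])

lemma KT_bimodule: "bimodule R (KT q)"
  unfolding koszul_term_def by (rule bimodule_pair.tensor_bimodule[OF kpair])

lemma kp_facts:
  shows kp_closed: "a .: A ==> c \<in> hcomp C q ==> kp q a c .: (KT q)"
    and kp_add_l: "a .: A ==> a' .: A ==> c \<in> hcomp C q ==>
      kp q (a +[A] a') c = kp q a c +[KT q] kp q a' c"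
    and kp_add_r: "a .: A ==> c \<in> hcomp C q ==> c' \<in> hcomp C q ==>
      kp q a (c +[C] c') = kp q a c +[KT q] kp q a c'"
    and kp_bal: "a .: A ==> r .: R ==> c \<in> hcomp C q ==>
      kp q (a <[A] r) c = kp q a (r .[C] c)" and kp_smult: "a .: A ==> r .: R ==> c \<in> hcomp C q ==>
      r .[KT q] kp q a c = kp q (r .[A] a) c"
  using bimodule_pair.pure_closed[OF kpair, of a c q] bimodule_pair.pure_add_l[OF kpair, of a a' c q]
    bimodule_pair.pure_add_r[OF kpair, of a c q c'] bimodule_pair.pure_balanced[OF kpair, of a r c q]
    bimodule_pair.smult_pure[OF kpair, of r a c q] by (simp_all add: C.hpart_simps koszul_term_def)

lemma KT_eqI:
  assumes "abelian_group G" "ahom (KT q) G f" "ahom (KT q) G g"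
    and "\<And>a c. a .: A ==> c \<in> hcomp C q ==> f (kp q a c) = g (kp q a c)" and "X .: (KT q)"
  shows "f X = g X"
  using bimodule_pair.tensor_eqI[OF kpair, of G q f g X] assms
  by (simp add: koszul_term_def C.hpart_simps)

lemma KT_bilinI:
  assumes "\<And>a. a .: A ==> ahom (hpart C q) G (\<lambda>c. \<phi> (a, c))"
    and "\<And>c. c \<in> hcomp C q ==> ahom A G (\<lambda>a. \<phi> (a, c))"
    and "\<And>a r c. a .: A ==> r .: R ==> c \<in> hcomp C q ==> \<phi> (a <[A] r, c) = \<phi> (a, r .[C] c)"
  shows "bilin R A (hpart C q) G \<phi>"
  using assms by (intro bilinI) (simp_all add: C.hpart_simps)

lemma KT_lift_ahom: "abelian_group G ==> bilin R A (hpart C q) G \<phi> ==> ahom (KT q) G (presented_lift G \<phi>)"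
  unfolding koszul_term_def by (rule bimodule_pair.lift_ahom[OF kpair])

lemma KT_lift_pure: "abelian_group G ==> bilin R A (hpart C q) G \<phi> ==> a .: A ==> c \<in> hcomp C q ==>
    presented_lift G \<phi> (kp q a c) = \<phi> (a, c)"
  by (rule bimodule_pair.lift_pure[OF kpair]) (simp_all add: C.hpart_simps)

lemma hpart_smult: "c \<in> hcomp C q ==> r .: R ==> r .[C] c \<in> hcomp C q"
  using C.hcomp_props(4) .

lemma kp_ahom_l: "c \<in> hcomp C q ==> ahom A (KT q) (\<lambda>a. kp q a c)"
  by (simp add: ahom_def kp_closed kp_add_l)

lemma kp_ahom_r: "a .: A ==> ahom (hpart C q) (KT q) (\<lambda>c. kp q a c)"
  by (simp add: ahom_def kp_closed kp_add_r C.hpart_simps)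

definition act :: "nat => 'a => ('a \<times> 'c \<Rightarrow>\<^sub>0 int) set => ('a \<times> 'c \<Rightarrow>\<^sub>0 int) set" where
  "act q a = presented_lift (KT q) (\<lambda>(b, c). kp q (a *[A] b) c)"

lemma mult_ahom_r: "a .: A ==> ahom A A (\<lambda>b. a *[A] b)" by (simp add: ahom_def A.r_distr)

lemma act_bilin: "a .: A ==> bilin R A (hpart C q) (KT q) (\<lambda>(b, c). kp q (a *[A] b) c)"
  by (rule KT_bilinI)
    (simp_all add: kp_ahom_r ahom_comp[OF mult_ahom_r kp_ahom_l] mult_rsmult_right kp_bal)

lemma act_ahom: "a .: A ==> ahom (KT q) (KT q) (act q a)"
  unfolding act_def by (rule KT_lift_ahom[OF KT_group act_bilin])

lemma act_closed: "a .: A ==> X .: (KT q) ==> act q a X .: (KT q)"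
  using ahom_closed[OF act_ahom] .

lemma act_pure: "a .: A ==> b .: A ==> c \<in> hcomp C q ==> act q a (kp q b c) = kp q (a *[A] b) c"
  unfolding act_def using KT_lift_pure[OF KT_group act_bilin] by simp

lemma KT_smult_ahom: "r .: R ==> ahom (KT q) (KT q) (\<lambda>X. r .[KT q] X)"
  using left_module.ahom_smult[OF bimodule.axioms(1)[OF KT_bimodule]] .

lemma KT_smult_closed: "r .: R ==> X .: (KT q) ==> r .[KT q] X .: (KT q)"
  using ahom_closed[OF KT_smult_ahom] .

lemma act_add_left:
  assumes "a .: A" "b .: A" "X .: (KT q)"
  shows "act q (a +[A] b) X = act q a X +[KT q] act q b X"
  by (rule KT_eqI[OF KT_group act_ahom ahom_plus[OF KT_group act_ahom act_ahom] _ assms(3)])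
    (use assms in \<open>simp_all add: act_pure A.l_distr kp_add_l\<close>)

lemma act_act:
  assumes "a .: A" "b .: A" "X .: (KT q)"
  shows "act q a (act q b X) = act q (a *[A] b) X"
  by (rule KT_eqI[OF KT_group ahom_comp[OF act_ahom act_ahom] act_ahom _ assms(3)])
    (use assms in \<open>simp_all add: act_pure A.m_assoc\<close>)

lemma act_smult:
  assumes "r .: R" "a .: A" "X .: (KT q)"
  shows "act q a (r .[KT q] X) = act q (a <[A] r) X"
  by (rule KT_eqI[OF KT_group ahom_comp[OF KT_smult_ahom act_ahom] act_ahom _ assms(3)])
    (use assms in \<open>simp_all add: act_pure kp_smult smult_closed rsmult_closed mult_balanced\<close>)

lemma smult_act:
  assumes "r .: R" "a .: A" "X .: (KT q)"
  shows "act q (r .[A] a) X = r .[KT q] act q a X"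
  by (rule KT_eqI[OF KT_group act_ahom ahom_comp[OF act_ahom KT_smult_ahom] _ assms(3)])
    (use assms in \<open>simp_all add: act_pure kp_smult smult_closed smult_mult\<close>)

subsection \<open>The Koszul complex\<close>

lemma \<theta>_facts:
  shows \<theta>_closed: "x \<in> hcomp C 1 ==> \<theta> x \<in> hcomp A 1"
    and \<theta>_add: "x \<in> hcomp C 1 ==> y \<in> hcomp C 1 ==> \<theta> (x +[C] y) = \<theta> x +[A] \<theta> y"
    and \<theta>_smult: "r .: R ==> x \<in> hcomp C 1 ==> \<theta> (r .[C] x) = r .[A] \<theta> x"
    and \<theta>_rsmult: "r .: R ==> x \<in> hcomp C 1 ==> \<theta> (x <[C] r) = \<theta> x <[A] r"
proof -
  have "bimodule_iso R (hpart C 1) (hpart A 1) \<theta>"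
    using koszul by (simp add: koszul_pair_def almost_koszul_pair_def)
  then have h: "bimodule_hom R (hpart C 1) (hpart A 1) \<theta>" by (simp add: bimodule_iso_def)
  show "x \<in> hcomp C 1 ==> \<theta> x \<in> hcomp A 1"
    "x \<in> hcomp C 1 ==> y \<in> hcomp C 1 ==> \<theta> (x +[C] y) = \<theta> x +[A] \<theta> y"
    "r .: R ==> x \<in> hcomp C 1 ==> \<theta> (r .[C] x) = r .[A] \<theta> x"
    "r .: R ==> x \<in> hcomp C 1 ==> \<theta> (x <[C] r) = \<theta> x <[A] r"
    using h unfolding bimodule_hom_def left_linear_def C.hpart_simps hpart_simps by auto
qed

abbreviation "CC n \<equiv> tensor R (hpart C 1) (hpart C n)"

lemma cpair: "bimodule_pair R (hpart C 1) (hpart C n)" "bimodule_pair R C C"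
  by (intro bimodule_pair.intro C.bimodule_axioms C.hpart_bimodule)+

lemma CC_group: "abelian_group (CC n)" by (rule bimodule_pair.tensor_group[OF cpair(1)])

lemma CC_smult_ahom: "r .: R ==> ahom (CC n) (CC n) (\<lambda>X. r .[CC n] X)"
  using left_module.ahom_smult[OF bimodule.axioms(1)[OF bimodule_pair.tensor_bimodule[OF cpair(1)]]] .

lemma CC_eqI:
  assumes "abelian_group G" "ahom (CC n) G f" "ahom (CC n) G g"
    and "\<And>x y. x \<in> hcomp C 1 ==> y \<in> hcomp C n ==>
      f (tensor_pure R (hpart C 1) (hpart C n) x y) = g (tensor_pure R (hpart C 1) (hpart C n) x y)"
    and "X .: (CC n)"
  shows "f X = g X"
  using bimodule_pair.tensor_eqI[OF cpair(1), of G n f g X] assms by (simp add: C.hpart_simps)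

lemma cc_bilin: "bilin R C C (CC n)
    (\<lambda>(x, y). tensor_pure R (hpart C 1) (hpart C n) (hproj C 1 x) (hproj C n y))"
proof (rule bilinI; unfold prod.case)
  interpret T: bimodule_pair R "hpart C 1" "hpart C n" by (rule cpair)
  note cl = C.hproj_hcomp and s = C.hpart_simps
  fix x assume x: "x .: C"
  show "ahom C (CC n) (\<lambda>y. tensor_pure R (hpart C 1) (hpart C n) (hproj C 1 x) (hproj C n y))"
    using x T.pure_closed T.pure_add_r by (auto simp: ahom_def cl s C.hproj_add)
  show "ahom C (CC n) (\<lambda>y. tensor_pure R (hpart C 1) (hpart C n) (hproj C 1 y) (hproj C n x))"
    using x T.pure_closed T.pure_add_l by (auto simp: ahom_def cl s C.hproj_add)
  fix r y assume r: "r .: R" and y: "y .: C"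
  show "tensor_pure R (hpart C 1) (hpart C n) (hproj C 1 (x <[C] r)) (hproj C n y) =
      tensor_pure R (hpart C 1) (hpart C n) (hproj C 1 x) (hproj C n (r .[C] y))"
    using x r y T.pure_balanced[of "hproj C 1 x" r "hproj C n y"]
    by (simp add: cl s C.hproj_rsmult C.hproj_smult)
qed

lemma cc_ahom: "ahom C (CC n) (comult_comp R C 1 n)"
proof -
  have "left_linear R C (tensor R C C) (comult C)"
    using C.comult_hom by (simp add: bimodule_hom_def)
  then show ?thesis unfolding comult_comp_def
    by (rule ahom_comp[OF left_linear_ahom bimodule_pair.lift_ahom[OF cpair(2) CC_group cc_bilin]])
qed

lemma cc_closed: "c \<in> hcomp C k ==> comult_comp R C 1 n c .: (CC n)"
  using ahom_closed[OF cc_ahom] C.hcomp_closed by blast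

lemma cc_smult:
  assumes r: "r .: R" and c: "c .: C"
  shows "comult_comp R C 1 n (r .[C] c) = r .[CC n] comult_comp R C 1 n c"
proof -
  interpret T: bimodule_pair R C C by (rule cpair)
  interpret T': bimodule_pair R "hpart C 1" "hpart C n" by (rule cpair)
  let ?l = "presented_lift (CC n) (\<lambda>(x, y). tensor_pure R (hpart C 1) (hpart C n) (hproj C 1 x) (hproj C n y))"
  have l: "ahom (tensor R C C) (CC n) ?l" by (rule T.lift_ahom[OF CC_group cc_bilin])
  have ll: "left_linear R C (tensor R C C) (comult C)"
    using C.comult_hom by (simp add: bimodule_hom_def)
  have sm: "ahom (tensor R C C) (tensor R C C) (\<lambda>X. r .[tensor R C C] X)"
    using left_module.ahom_smult[OF bimodule.axioms(1)[OF T.tensor_bimodule] r] .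
  have "?l (r .[tensor R C C] comult C c) = r .[CC n] ?l (comult C c)"
  proof (rule T.tensor_eqI[OF CC_group ahom_comp[OF sm l] ahom_comp[OF l CC_smult_ahom[OF r]]])
    fix x y assume "x .: C" "y .: C"
    then show "?l (r .[tensor R C C] tensor_pure R C C x y) = r .[CC n] ?l (tensor_pure R C C x y)"
      using r T'.smult_pure[of r "hproj C 1 x" "hproj C n y"]
      by (simp add: T.smult_pure T.lift_pure[OF CC_group cc_bilin] C.smult_closed C.hproj_hcomp C.hpart_simps C.hproj_smult)
  qed (use left_linear_ahom[OF ll] c in \<open>auto dest: ahom_closed\<close>)
  then show ?thesis unfolding comult_comp_def using left_linear_smult[OF ll r c] by simp
qed

text \<open>The inner lift of \<open>koszul_diff\<close>, for a fixed left factor. Isolating it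
  separates the two balancing conditions: over \<open>C_1 \<otimes> C_n\<close> for this map, and
  over \<open>A \<otimes> C_(n+1)\<close> for the differential, where a scalar moves from
  \<open>a\<close> to the coproduct of \<open>c\<close>.\<close>

definition kin :: "nat => 'a => ('c \<times> 'c \<Rightarrow>\<^sub>0 int) set => ('a \<times> 'c \<Rightarrow>\<^sub>0 int) set" where
  "kin n a = presented_lift (KT n) (\<lambda>(x, y). kp n (a *[A] \<theta> x) y)"

lemma kin_bilin:
  assumes a: "a .: A"
  shows "bilin R (hpart C 1) (hpart C n) (KT n) (\<lambda>(x, y). kp n (a *[A] \<theta> x) y)"
  using a by (intro bilinI)
    (auto simp: ahom_def C.hpart_simps kp_closed kp_add_l kp_add_r hcomp_closed[OF \<theta>_closed] \<theta>_add \<theta>_rsmult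
      A.r_distr mult_rsmult_right kp_bal)

lemma kin_ahom: "a .: A ==> ahom (CC n) (KT n) (kin n a)"
  unfolding kin_def by (rule bimodule_pair.lift_ahom[OF cpair(1) KT_group kin_bilin])

lemma kin_pure: "a .: A ==> x \<in> hcomp C 1 ==> y \<in> hcomp C n ==>
    kin n a (tensor_pure R (hpart C 1) (hpart C n) x y) = kp n (a *[A] \<theta> x) y"
  unfolding kin_def using bimodule_pair.lift_pure[OF cpair(1) KT_group kin_bilin, where x = x and y = y]
  by (simp add: C.hpart_simps)

lemma CC_smult_pure: "r .: R ==> x \<in> hcomp C 1 ==> y \<in> hcomp C n ==>
    r .[CC n] tensor_pure R (hpart C 1) (hpart C n) x y = tensor_pure R (hpart C 1) (hpart C n) (r .[C] x) y"
  using bimodule_pair.smult_pure[OF cpair(1), where r = r and x = x and y = y] by (simp add: C.hpart_simps)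

lemma kin_add:
  assumes "a .: A" "b .: A" "Z .: (CC n)"
  shows "kin n (a +[A] b) Z = kin n a Z +[KT n] kin n b Z"
  by (rule CC_eqI[OF KT_group kin_ahom ahom_plus[OF KT_group kin_ahom kin_ahom] _ assms(3)])
    (use assms in \<open>simp_all add: kin_pure A.l_distr kp_add_l hcomp_closed[OF \<theta>_closed]\<close>)

lemma kin_bal:
  assumes "a .: A" "r .: R" "Z .: (CC n)"
  shows "kin n (a <[A] r) Z = kin n a (r .[CC n] Z)"
  by (rule CC_eqI[OF KT_group kin_ahom ahom_comp[OF CC_smult_ahom kin_ahom] _ assms(3)])
    (use assms in \<open>simp_all add: kin_pure CC_smult_pure hpart_smult \<theta>_smult mult_balanced
      hcomp_closed[OF \<theta>_closed] rsmult_closed\<close>)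

lemma kin_act:
  assumes "a .: A" "b .: A" "Z .: (CC n)"
  shows "kin n (a *[A] b) Z = act n a (kin n b Z)"
  by (rule CC_eqI[OF KT_group kin_ahom ahom_comp[OF kin_ahom act_ahom] _ assms(3)])
    (use assms in \<open>simp_all add: kin_pure act_pure A.m_assoc hcomp_closed[OF \<theta>_closed]\<close>)

lemma kin_smult:
  assumes "a .: A" "r .: R" "Z .: (CC n)"
  shows "kin n (r .[A] a) Z = r .[KT n] kin n a Z"
  by (rule CC_eqI[OF KT_group kin_ahom ahom_comp[OF kin_ahom KT_smult_ahom] _ assms(3)])
    (use assms in \<open>simp_all add: kin_pure kp_smult smult_mult smult_closed hcomp_closed[OF \<theta>_closed]\<close>)

lemma kd_bilin: "bilin R A (hpart C (Suc n)) (KT n) (\<lambda>(a, c). kin n a (comult_comp R C 1 n c))"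
proof (rule KT_bilinI; unfold prod.case)
  fix a assume a: "a .: A"
  have "ahom (hpart C (Suc n)) (CC n) (comult_comp R C 1 n)"
    using cc_closed[of _ "Suc n" n] ahom_add[OF cc_ahom] by (auto simp: ahom_def C.hpart_simps C.hcomp_closed)
  then show "ahom (hpart C (Suc n)) (KT n) (\<lambda>c. kin n a (comult_comp R C 1 n c))"
    using kin_ahom[OF a] by (rule ahom_comp)
next
  fix c assume c: "c \<in> hcomp C (Suc n)"
  then show "ahom A (KT n) (\<lambda>a. kin n a (comult_comp R C 1 n c))"
    using ahom_closed[OF kin_ahom cc_closed] by (auto simp: ahom_def kin_add cc_closed)
  fix a r assume "a .: A" "r .: R"
  then show "kin n (a <[A] r) (comult_comp R C 1 n c) = kin n a (comult_comp R C 1 n (r .[C] c))"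
    using c by (simp add: kin_bal cc_closed cc_smult C.hcomp_closed)
qed

lemma kd_eq: "kd n = presented_lift (KT n) (\<lambda>(a, c). kin n a (comult_comp R C 1 n c))"
  by (simp add: koszul_diff_def kin_def)

lemma kd_ahom: "ahom (KT (Suc n)) (KT n) (kd n)"
  unfolding kd_eq by (rule KT_lift_ahom[OF KT_group kd_bilin])

lemma kd_closed: "X .: (KT (Suc n)) ==> kd n X .: (KT n)"
  using ahom_closed[OF kd_ahom] .

lemma kd_pure: "a .: A ==> c \<in> hcomp C (Suc n) ==> kd n (kp (Suc n) a c) = kin n a (comult_comp R C 1 n c)"
  unfolding kd_eq using KT_lift_pure[OF KT_group kd_bilin] by simp

lemma kd_act:
  assumes "a .: A" "X .: (KT (Suc n))"
  shows "kd n (act (Suc n) a X) = act n a (kd n X)"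
  by (rule KT_eqI[OF KT_group ahom_comp[OF act_ahom kd_ahom] ahom_comp[OF kd_ahom act_ahom] _ assms(2)])
    (use assms in \<open>simp_all add: act_pure kd_pure kin_act cc_closed\<close>)

lemma kd_smult:
  assumes "r .: R" "X .: (KT (Suc n))"
  shows "kd n (r .[KT (Suc n)] X) = r .[KT n] kd n X"
  by (rule KT_eqI[OF KT_group ahom_comp[OF KT_smult_ahom kd_ahom] ahom_comp[OF kd_ahom KT_smult_ahom] _ assms(2)])
    (use assms in \<open>simp_all add: kp_smult smult_closed kd_pure kin_smult cc_closed\<close>)

lemma kd_linear: "left_linear R (KT (Suc n)) (KT n) (kd n)"
  by (rule left_linearI[OF kd_ahom kd_smult])

lemma kd_exact:
  shows kd_kd: "X \<in> carrier (KT (Suc (Suc n))) ==> kd n (kd (Suc n) X) = 0[KT n]"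
    and kd_ker: "X .: (KT (Suc n)) ==> kd n X = 0[KT n] ==>
      \<exists>Y\<in>carrier (KT (Suc (Suc n))). X = kd (Suc n) Y"
proof -
  have e: "{X \<in> carrier (KT (Suc n)). kd n X = 0[KT n]} = kd (Suc n) ` carrier (KT (Suc (Suc n)))"
    using koszul by (simp add: koszul_pair_def)
  show "X \<in> carrier (KT (Suc (Suc n))) ==> kd n (kd (Suc n) X) = 0[KT n]"
    "X .: (KT (Suc n)) ==> kd n X = 0[KT n] ==> \<exists>Y\<in>carrier (KT (Suc (Suc n))). X = kd (Suc n) Y"
    using e by blast+
qed

end

lemma (in abelian_group) minus_eq_zero_iff:
  assumes "x .: G" "y .: G"
  shows "x \<ominus> y = \<zero> \<longleftrightarrow> x = y"
  using assms minus_equality[of x "\<ominus> y"] by (auto simp: a_minus_def r_neg)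

context connected_graded_rring
begin

text \<open>Balancedness of the product \<open>1 1\<close>. It makes the unit map a map of
  bimodules, so that degree 0 of \<open>A\<close> is \<open>R\<close> with both actions.\<close>

lemma unit_eq: "r .: R ==> 1[A] <[A] r = r .[A] 1[A]"
  using mult_balanced[of r "1[A]" "1[A]"] by (simp add: smult_closed rsmult_closed)

lemma mult_unit: "r .: R ==> a .: A ==> a *[A] (r .[A] 1[A]) = a <[A] r"
  by (simp add: unit_eq[symmetric] mult_rsmult_right)

section \<open>The projections of the ring to degree 0 and to its positive part\<close>

abbreviation "\<pi>0 \<equiv> rring_proj0 R A"

lemma \<pi>0_props:
  assumes "a .: A"
  shows "\<pi>0 a .: R" "\<pi>0 a .[A] 1[A] = hproj A 0 a"
proof -
  have "hproj A 0 a \<in> (\<lambda>r. r .[A] 1[A]) ` carrier R"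
    using connected hproj_hcomp[OF assms] by (simp add: bij_betw_def)
  then show "\<pi>0 a .: R" "\<pi>0 a .[A] 1[A] = hproj A 0 a"
    unfolding rring_proj0_def by (rule inv_into_into, rule f_inv_into_f)
qed

lemma \<pi>0_eqI: "a .: A ==> r .: R ==> hproj A 0 a = r .[A] 1[A] ==> \<pi>0 a = r"
  using \<pi>0_props[of a] connected unfolding bij_betw_def inj_on_def by auto

lemma \<pi>0_ahom: "ahom A R \<pi>0" by (intro ahomI \<pi>0_eqI) (auto simp: \<pi>0_props hproj_add smult_l_distr)

lemma \<pi>0_smult: "r .: R ==> a .: A ==> \<pi>0 (r .[A] a) = r *[R] \<pi>0 a"
  by (rule \<pi>0_eqI) (auto simp: \<pi>0_props hproj_smult smult_closed smult_assoc)

lemma \<pi>0_rsmult: "r .: R ==> a .: A ==> \<pi>0 (a <[A] r) = \<pi>0 a *[R] r"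
  using smult_rsmult[of "\<pi>0 a" r "1[A]"]
  by (intro \<pi>0_eqI) (auto simp: \<pi>0_props hproj_rsmult rsmult_closed smult_assoc unit_eq)

lemma \<pi>0_pos: "a .: AP ==> \<pi>0 a = 0[R]" by (rule \<pi>0_eqI) (auto simp: pos_carrier zero_smult)

definition pp :: "'a => 'a" where "pp a = a -[A] hproj A 0 a"

lemma pp_closed: "a .: A ==> pp a .: AP"
  by (simp add: pp_def pos_carrier a_minus_def hproj_closed hproj_add hproj_neg hproj_homog[OF hproj_hcomp] M.r_neg)

lemma pp_add: "a .: A ==> b .: A ==> pp (a +[A] b) = pp a +[AP] pp b"
  by (simp add: pp_def pos_simps a_minus_def hproj_add hproj_closed M.minus_add M.a_ac)

lemma pp_smult: "r .: R ==> a .: A ==> pp (r .[A] a) = r .[AP] pp a"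
  by (simp add: pp_def pos_simps a_minus_def hproj_smult hproj_closed smult_r_distr smult_neg)

lemma rsmult_neg: "r .: R ==> x .: A ==> (-[A] x) <[A] r = -[A] (x <[A] r)"
  using ahom_neg[OF M.abelian_group_axioms M.abelian_group_axioms ahom_rsmult] .

lemma pp_rsmult: "r .: R ==> a .: A ==> pp (a <[A] r) = pp a <[AP] r"
  by (simp add: pp_def pos_simps a_minus_def hproj_rsmult hproj_closed rsmult_l_distr rsmult_neg)

lemma pp_pos: "a .: AP ==> pp a = a" by (simp add: pp_def pos_carrier a_minus_def)

lemma pp_decomp: "a .: A ==> a = \<pi>0 a .[A] 1[A] +[A] pp a"
  by (simp add: \<pi>0_props pp_def a_minus_def hproj_closed M.a_lcomm[of "hproj A 0 a" a] M.r_neg)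

end

context koszul
begin

abbreviation "\<epsilon> \<equiv> koszul_augmentation R A C"

lemma \<epsilon>_bilin: "bilin R A (hpart C 0) R (\<lambda>(a, c). \<pi>0 a *[R] counit C c)"
proof (rule KT_bilinI; unfold prod.case)
  have l: "left_linear R C (regular R) (counit C)"
    using C.counit_hom by (simp add: bimodule_hom_def)
  then have cc: "counit C c .: R" if "c \<in> hcomp C 0" for c
    using C.hcomp_closed[OF that] by (auto simp: left_linear_def)
  note lin = left_linear_smult[OF l] ahom_add[OF left_linear_ahom[OF l]]
  {
    fix a assume a: "a .: A"
    then show "ahom (hpart C 0) R (\<lambda>c. \<pi>0 a *[R] counit C c)"
      by (auto simp: ahom_def C.hpart_simps \<pi>0_props cc lin C.hcomp_closed R.r_distr)
    fix r c assume "r .: R" "c \<in> hcomp C 0"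
    then show "\<pi>0 (a <[A] r) *[R] counit C c = \<pi>0 a *[R] counit C (r .[C] c)"
      using a by (simp add: \<pi>0_rsmult \<pi>0_props cc lin C.hcomp_closed R.m_assoc)
  next
    fix c assume c: "c \<in> hcomp C 0"
    then show "ahom A R (\<lambda>a. \<pi>0 a *[R] counit C c)"
      using ahom_add[OF \<pi>0_ahom] by (auto simp: ahom_def \<pi>0_props cc R.l_distr)
  }
qed

lemma \<epsilon>_ahom: "ahom (KT 0) R \<epsilon>"
  unfolding koszul_augmentation_def by (rule KT_lift_ahom[OF Rg \<epsilon>_bilin])

lemma counit_closed: "c \<in> hcomp C q ==> counit C c .: R"
  using C.counit_hom C.hcomp_closed by (auto simp: bimodule_hom_def left_linear_def)

lemma \<epsilon>_pure: "a .: A ==> c \<in> hcomp C 0 ==> \<epsilon> (kp 0 a c) = \<pi>0 a *[R] counit C c"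
  unfolding koszul_augmentation_def using KT_lift_pure[OF Rg \<epsilon>_bilin] by simp

lemma \<epsilon>_smult:
  assumes "r .: R" "X .: (KT 0)"
  shows "\<epsilon> (r .[KT 0] X) = r *[R] \<epsilon> X"
proof (rule KT_eqI[OF Rg ahom_comp[OF KT_smult_ahom \<epsilon>_ahom] ahom_comp[OF \<epsilon>_ahom] _ assms(2)])
  show "ahom R R (\<lambda>x. r *[R] x)" using assms by (simp add: ahom_def R.r_distr)
qed (use assms in \<open>simp_all add: kp_smult \<epsilon>_pure smult_closed \<pi>0_smult \<pi>0_props counit_closed R.m_assoc\<close>)

text \<open>\<open>A_+\<close> is an ideal on which the projection to degree 0 vanishes. Hence
  acting by \<open>A_+\<close> leads into the kernel of the augmentation, which is the image of the
  first Koszul differential.\<close>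

lemma \<epsilon>_act:
  assumes a: "a .: AP" and X: "X .: (KT 0)"
  shows "\<epsilon> (act 0 a X) = 0[R]"
  by (rule KT_eqI[OF Rg ahom_comp[OF act_ahom \<epsilon>_ahom] ahom_zero_map[OF Rg] _ X])
    (use a in \<open>simp_all add: act_pure \<epsilon>_pure pos_closed \<pi>0_pos mult_pos_left counit_closed\<close>)

lemma \<epsilon>_exact:
  shows \<epsilon>_kd: "X .: (KT 1) ==> \<epsilon> (kd 0 X) = 0[R]"
    and \<epsilon>_ker: "X .: (KT 0) ==> \<epsilon> X = 0[R] ==> \<exists>Y\<in>carrier (KT 1). X = kd 0 Y"
    and \<epsilon>_surj: "\<exists>X\<in>carrier (KT 0). \<epsilon> X = 1[R]"
proof -
  have e: "{X \<in> carrier (KT 0). \<epsilon> X = 0[R]} = kd 0 ` carrier (KT 1)"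
    and s: "\<epsilon> ` carrier (KT 0) = carrier R"
    using koszul by (simp_all add: koszul_pair_def)
  show "X .: (KT 1) ==> \<epsilon> (kd 0 X) = 0[R]"
    "X .: (KT 0) ==> \<epsilon> X = 0[R] ==> \<exists>Y\<in>carrier (KT 1). X = kd 0 Y" using e by blast+
  have "1[R] \<in> \<epsilon> ` carrier (KT 0)" using s by simp
  then show "\<exists>X\<in>carrier (KT 0). \<epsilon> X = 1[R]" by force
qed

text \<open>Cochains \<open>A\<^sub>+\<^sup>\<otimes>\<^sup>p \<otimes> A \<otimes> C\<^sub>q \<rightarrow> R\<close>, as functions of the last tensor factor and of the list of the others.\<close>

definition coch :: "nat => nat => (('a \<times> 'c \<Rightarrow>\<^sub>0 int) set => 'a list => 'r) => bool" where
  "coch p q F \<longleftrightarrow> (\<forall>X\<in>carrier (KT q). mlin p (F X)) \<and> (\<forall>as\<in>APl p. ahom (KT q) R (\<lambda>X. F X as)) \<and>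
     (\<forall>r\<in>carrier R. \<forall>X\<in>carrier (KT q). \<forall>as\<in>APl p. F (r .[KT q] X) as = rsc (F X) r as)"

text \<open>The bar coboundary with coefficients in the left module \<open>A \<otimes> C_q\<close>:
  the first \<open>p\<close> faces merge entries, and the face with index \<open>p\<close> lets the
  last entry act on \<open>X\<close>. On the left end there is no face, as \<open>A_+\<close> acts
  by zero on \<open>R\<close>.\<close>

definition kdel :: "nat => nat => (('a \<times> 'c \<Rightarrow>\<^sub>0 int) set => 'a list => 'r) =>
    (('a \<times> 'c \<Rightarrow>\<^sub>0 int) set => 'a list => 'r)" where "kdel p q F X as = altsum R (Suc p)
     (\<lambda>i. if i < p then F X (mrg A i as) else F (act q (last as) X) (butlast as))"

lemma cochD:
  assumes "coch p q F"
  shows coch_mlin: "X .: (KT q) ==> mlin p (F X)"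
    and coch_ahom: "as \<in> APl p ==> ahom (KT q) R (\<lambda>X. F X as)"
    and coch_smult: "r .: R ==> X .: (KT q) ==> as \<in> APl p ==>
      F (r .[KT q] X) as = rsc (F X) r as" using assms by (simp_all add: coch_def)

lemma coch_closed: "coch p q F ==> X .: (KT q) ==> as \<in> APl p ==> F X as .: R"
  using mlin_closed[OF coch_mlin] .

lemma coch_zero: "coch p q F ==> as \<in> APl p ==> F 0[KT q] as = 0[R]"
  using ahom_zero[OF KT_group Rg coch_ahom] .

lemma kdel_face_closed:
  assumes F: "coch p q F" and X: "X .: (KT q)" and as: "as \<in> APl (Suc p)" and i: "i < Suc p"
  shows "(if i < p then F X (mrg A i as) else F (act q (last as) X) (butlast as)) .: R"
proof -
  obtain bs b where "as = bs @ [b]" "bs \<in> APl p" "b .: AP" using as by (rule APl_snocE)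
  then show ?thesis
    using F X as APl_mrg[OF as] by (auto intro!: coch_closed act_closed simp: pos_closed)
qed

lemma kdel_snoc:
  assumes F: "coch p q F" and X: "X .: (KT q)" and bs: "bs \<in> APl p" and b: "b .: AP"
  shows "kdel p q F X (bs @ [b]) =
    altsum R p (\<lambda>i. F X (mrg A i (bs @ [b]))) +[R] sg R p (F (act q b X) bs)"
proof -
  have as: "bs @ [b] \<in> APl (Suc p)" using bs b by (simp add: APl_simps)
  have "altsum R p (\<lambda>i. if i < p then F X (mrg A i (bs @ [b])) else F (act q (last (bs @ [b])) X) (butlast (bs @ [b]))) =
      altsum R p (\<lambda>i. F X (mrg A i (bs @ [b])))"
    by (rule R.altsum_cong) (use coch_closed[OF F X APl_mrg[OF as]] in auto)
  then show ?thesis unfolding kdel_def using kdel_face_closed[OF F X as]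
    by (subst R.altsum_Suc) simp_all
qed

lemma kdel_closed: "coch p q F ==> X .: (KT q) ==> as \<in> APl (Suc p) ==> kdel p q F X as .: R"
  unfolding kdel_def by (rule R.altsum_closed) (rule kdel_face_closed)

text \<open>The last entry enters through its action on \<open>X\<close>. Relations that involve it
  become additivity of the action or the balancing clause of \<open>coch\<close>; all others are
  inherited from \<open>F\<close>.\<close>

lemma coch_act_mlin:
  assumes F: "coch p q F" and X: "X .: (KT q)"
  shows "mlin (Suc p) (\<lambda>as. F (act q (last as) X) (butlast as))"
proof (rule mlinI)
  have ac: "act q b X .: (KT q)" if "b .: AP" for b
    using that X by (intro act_closed) (auto simp: pos_closed)
  note m = coch_mlin[OF F ac]
  {
    fix as assume "as \<in> APl (Suc p)"
    then show "F (act q (last as) X) (butlast as) .: R"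
      using coch_closed[OF F ac] by (elim APl_snocE) simp
  next
    fix xs x y ys
    assume a: "xs <: AP" "x .: AP" "y .: AP" "ys <: AP" "Suc (length xs + length ys) = Suc p"
    show "F (act q (last (xs @ (x +[AP] y) # ys)) X) (butlast (xs @ (x +[AP] y) # ys)) =
      F (act q (last (xs @ x # ys)) X) (butlast (xs @ x # ys)) +[R]
      F (act q (last (xs @ y # ys)) X) (butlast (xs @ y # ys))"
    proof (cases ys rule: rev_exhaust)
      case Nil
      then have "xs \<in> APl p" using a by (simp add: APl_def)
      then show ?thesis
        using a Nil X ac ahom_add[OF coch_ahom[OF F]] by (simp add: act_add_left pos_closed pos_simps)
    next
      case (snoc zs z)
      then show ?thesis using a mlin_slot[OF m, of z xs x y zs] by (simp add: butlast_append)
    qed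
  next
    fix s x xs
    assume a: "s .: R" "x .: AP" "xs <: AP" "Suc (length xs) = Suc p"
    show "F (act q (last ((s .[AP] x) # xs)) X) (butlast ((s .[AP] x) # xs)) =
        s *[R] F (act q (last (x # xs)) X) (butlast (x # xs))"
    proof (cases xs rule: rev_exhaust)
      case Nil
      then show ?thesis using a X ac[of x] coch_smult[OF F, of s "act q x X" "[]"]
        by (simp add: smult_act pos_closed pos_simps APl_def)
    next
      case (snoc zs z)
      then show ?thesis using a mlin_head[OF m, of z s x zs] by simp
    qed
  next
    fix s xs x y ys
    assume a: "s .: R" "xs <: AP" "x .: AP" "y .: AP" "ys <: AP"
      "Suc (Suc (length xs + length ys)) = Suc p"
    show "F (act q (last (xs @ (x <[AP] s) # y # ys)) X) (butlast (xs @ (x <[AP] s) # y # ys)) =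
        F (act q (last (xs @ x # (s .[AP] y) # ys)) X) (butlast (xs @ x # (s .[AP] y) # ys))"
    proof (cases ys rule: rev_exhaust)
      case Nil
      then have "xs @ [x] \<in> APl p" using a by (simp add: APl_def)
      then show ?thesis using a Nil X ac[of y] coch_smult[OF F, of s "act q y X" "xs @ [x]"]
        by (simp add: smult_act pos_closed pos_simps butlast_append)
    next
      case (snoc zs z)
      then show ?thesis using a mlin_bal[OF m, of z s xs x y zs] by (simp add: butlast_append)
    qed
  }
qed

lemma altsum_coch: "coch p q F ==> X .: (KT q) ==> mlin (Suc p) (kdel p q F X)"
proof -
  assume F: "coch p q F" and X: "X .: (KT q)"
  have "mlin (Suc p) (\<lambda>as. altsum R (Suc p)
      (\<lambda>i. (if i < p then (\<lambda>as. F X (mrg A i as)) else (\<lambda>as. F (act q (last as) X) (butlast as))) as))"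
    by (rule mlin_altsum) (use F X coch_mlin[OF F X] in \<open>auto intro: mlin_mrg coch_act_mlin\<close>)
  moreover have "(\<lambda>as. altsum R (Suc p)
      (\<lambda>i. (if i < p then (\<lambda>as. F X (mrg A i as)) else (\<lambda>as. F (act q (last as) X) (butlast as))) as)) = kdel p q F X"
    by (rule ext) (simp add: kdel_def if_distrib[of "\<lambda>f. f _"] cong: if_cong)
  ultimately show ?thesis by simp
qed

text \<open>Again only the last face sees the scaled entry, as in \<open>rscale_mrg\<close>.\<close>

lemma rsc_mrg:
  assumes "as \<in> APl (Suc p)" "i < p" "t .: R"
  shows "rsc w t (mrg A i as) = w (mrg A i (butlast as @ [last as <[A] t]))"
proof -
  obtain ws z v where as: "as = ws @ [z, v]" and c: "z .: A" "v .: A"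
  proof -
    obtain us u where u: "as = us @ [u]" "us \<in> APl p" "u .: AP" using assms(1) by (rule APl_snocE)
    with assms(2) obtain p' where "us \<in> APl (Suc p')" by (cases p) auto
    then obtain ws z where "us = ws @ [z]" "z .: AP" by (rule APl_snocE)
    then show thesis using u that[of ws z u] by (simp add: pos_closed)
  qed
  have l: "length ws + 1 = p" using assms(1) as by (simp add: APl_def)
  show ?thesis proof (cases "i < length ws")
    case True
    then have "mrg A i (ws @ [z, x]) = mrg A i (ws @ [z]) @ [x]" for x
      using mrg_append_left[of i "ws @ [z]" A "[x]"] by simp
    then show ?thesis by (simp add: as butlast_append)
  next
    case False
    then have "i = length ws" using l assms(2) by simp
    then have "mrg A i (ws @ [z, x]) = ws @ [z *[A] x]" for x
      using mrg_append_right[of A ws 0 "[z, x]"] by simp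
    then show ?thesis using c assms(3) by (simp add: as butlast_append mult_rsmult)
  qed
qed

lemma kdel_coch: 
  assumes F: "coch p q F"
  shows "coch (Suc p) q (kdel p q F)"
  unfolding coch_def
proof (intro conjI ballI)
  show "mlin (Suc p) (kdel p q F X)" if "X .: (KT q)" for X using F that by (rule altsum_coch)
next
  fix as assume as: "as \<in> APl (Suc p)"
  then obtain bs b where b: "as = bs @ [b]" "bs \<in> APl p" "b .: AP" by (rule APl_snocE)
  have "ahom (KT q) R (\<lambda>X. if i < p then F X (mrg A i as) else F (act q (last as) X) (butlast as))" if "i < Suc p" for i
    using that b ahom_comp[OF act_ahom coch_ahom[OF F]] coch_ahom[OF F APl_mrg[OF as]]
    by (cases "i < p") (simp_all add: pos_closed)
  then show "ahom (KT q) R (\<lambda>X. kdel p q F X as)"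
    unfolding kdel_def by (rule ahom_altsum_map[OF Rg])
  fix r X assume r: "r .: R" and X: "X .: (KT q)"
  have br: "b <[A] r .: AP" using P.rsmult_closed[OF r b(3)] by (simp add: pos_simps)
  have "kdel p q F (r .[KT q] X) as = kdel p q F X (bs @ [b <[A] r])" unfolding kdel_def
  proof (rule R.altsum_cong)
    have as': "bs @ [b <[A] r] \<in> APl (Suc p)" using b br by (simp add: APl_simps)
    fix i assume i: "i < Suc p"
    show "(if i < p then F X (mrg A i (bs @ [b <[A] r]))
        else F (act q (last (bs @ [b <[A] r])) X) (butlast (bs @ [b <[A] r]))) .: R"
      by (rule kdel_face_closed[OF F X as' i])
    show "(if i < p then F (r .[KT q] X) (mrg A i as) else F (act q (last as) (r .[KT q] X)) (butlast as)) =
        (if i < p then F X (mrg A i (bs @ [b <[A] r]))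
        else F (act q (last (bs @ [b <[A] r])) X) (butlast (bs @ [b <[A] r])))"
      using coch_smult[OF F r X APl_mrg[OF as]] rsc_mrg[OF as _ r] b r X
      by (simp add: act_smult pos_closed)
  qed
  then show "kdel p q F (r .[KT q] X) as = rsc (kdel p q F X) r as" by (simp add: b)
qed

text \<open>The simplicial identity with one additional kind of face. Beyond \<open>mrg_mrg\<close>
  the new input is associativity of the action, for the last two faces.\<close>

lemma kdel_kdel:
  assumes F: "coch p q F" and X: "X .: (KT q)" and as: "as \<in> APl (Suc (Suc p))"
  shows "kdel (Suc p) q (kdel p q F) X as = 0[R]"
proof -
  obtain us b where u: "as = us @ [b]" "us \<in> APl (Suc p)" "b .: AP" using as by (rule APl_snocE)
  obtain vs a where v: "us = vs @ [a]" "vs \<in> APl p" "a .: AP" using u(2) by (rule APl_snocE)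
  have lus: "length us = Suc p" "length vs = p" using u(2) v(2) by (simp_all add: APl_def)
  have bX: "act q b X .: (KT q)" using u X by (intro act_closed) (auto simp: pos_closed)
  \<comment> \<open>Face \<open>i\<close> of face \<open>j\<close>, written out so that acting by
    the last entry \<open>b\<close> counts as the face with index \<open>Suc p\<close>.\<close>
  define D where "D j i = (if j < Suc p
      then (if i < p then F X (mrg A i (mrg A j as)) else F (act q (last (mrg A j as)) X) (butlast (mrg A j as)))
      else (if i < p then F (act q b X) (mrg A i us) else F (act q (last us) (act q b X)) (butlast us)))" for j i
  have c: "D j i .: R" if "j \<le> Suc p" "i < Suc p" for j i
    using kdel_face_closed[OF F X APl_mrg[OF as] that(2)] kdel_face_closed[OF F bX u(2) that(2)]
    by (simp add: D_def)
  have "kdel (Suc p) q (kdel p q F) X as = altsum R (Suc (Suc p)) (\<lambda>j. altsum R (Suc p) (D j))"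
    unfolding kdel_def[of "Suc p"]
  proof (rule R.altsum_cong)
    fix j assume "j < Suc (Suc p)"
    then show "altsum R (Suc p) (D j) .: R" by (intro R.altsum_closed c) auto
    show "(if j < Suc p then kdel p q F X (mrg A j as) else kdel p q F (act q (last as) X) (butlast as)) =
        altsum R (Suc p) (D j)" by (simp add: kdel_def D_def[abs_def] u(1) cong: if_cong)
  qed
  also have "... = 0[R]" proof (rule R.altsum_altsum_zero[OF c])
    fix i j assume j: "j \<le> Suc p" and ij: "i < j"
    have sas: "as <: AP" "length as = Suc (Suc p)" using as by (auto simp: APl_def)
    show "D j i = D i (j - 1)" proof (cases "j < Suc p")
      case True
      then have "i < p" "j - 1 < p" using ij by arith+
      then show ?thesis using True ij mrg_mrg[OF sas(1) ij] sas by (simp add: D_def)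
    next
      case False
      then have jp: "j = Suc p" using j by simp
      show ?thesis proof (cases "i < p")
        case True
        then have "mrg A i as = mrg A i us @ [b]" using lus u(1) by (simp add: mrg_append_left)
        then show ?thesis using jp ij True by (simp add: D_def)
      next
        case False
        then have ip: "i = p" using jp ij by simp
        have "mrg A p as = vs @ [a *[A] b]"
          using mrg_append_right[of A vs 0 "[a, b]"] lus by (simp add: u(1) v(1))
        then show ?thesis using jp ip u v X by (simp add: D_def act_act pos_closed)
      qed
    qed
  qed simp_all
  finally show ?thesis .
qed

lemma coch_comp_kd:
  assumes G: "coch p q G"
  shows "coch p (Suc q) (\<lambda>X. G (kd q X))"
  unfolding coch_def
proof (intro conjI ballI)
  show "mlin p (G (kd q X))" if "X .: (KT (Suc q))" for X using coch_mlin[OF G kd_closed[OF that]] .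
  show "ahom (KT (Suc q)) R (\<lambda>X. G (kd q X) as)" if "as \<in> APl p" for as
    using ahom_comp[OF kd_ahom coch_ahom[OF G that]] .
  show "G (kd q (r .[KT (Suc q)] X)) as = rsc (G (kd q X)) r as"
    if "r .: R" "X .: (KT (Suc q))" "as \<in> APl p" for r X as
    using that coch_smult[OF G _ kd_closed] by (simp add: kd_smult)
qed

text \<open>The Koszul differential is linear over \<open>A\<close>, so it passes through the face
  in which the last entry acts: the two differentials of the double complex commute.\<close>

lemma kdel_comp_kd:
  assumes G: "coch p q G" and X: "X .: (KT (Suc q))" and as: "as \<in> APl (Suc p)"
  shows "kdel p (Suc q) (\<lambda>X. G (kd q X)) X as = kdel p q G (kd q X) as"
proof -
  obtain bs b where b: "as = bs @ [b]" "bs \<in> APl p" "b .: AP" using as by (rule APl_snocE)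
  show ?thesis unfolding kdel_def using b X by (simp add: kd_act pos_closed cong: if_cong)
qed

text \<open>Since \<open>A \<otimes> C\<^sub>q\<close> is a free \<open>A\<close>-module, the complex of cochains with values in it is exact:
  a cocycle \<open>H\<close> is the coboundary of \<open>(as, a \<otimes> c) \<mapsto> \<plusminus>H (as, a\<^sub>+, 1 \<otimes> c)\<close>, where \<open>a\<^sub>+\<close> is the component of
  \<open>a\<close> in \<open>A\<^sub>+\<close>.\<close>

lemma row_exact:
  assumes H: "coch (Suc p) q H"
    and cocycle: "\<And>X as. X .: (KT q) ==> as \<in> APl (Suc (Suc p)) ==> kdel (Suc p) q H X as = 0[R]"
  obtains g where "coch p q g"
    "\<And>X as. X .: (KT q) ==> as \<in> APl (Suc p) ==> kdel p q g X as = H X as"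
    "\<And>a c as. a .: A ==> c \<in> hcomp C q ==> as \<in> APl p ==>
      g (kp q a c) as = sg R p (H (kp q 1[A] c) (as @ [pp a]))"
proof -
  let ?u = "\<lambda>c. kp q 1[A] c"
  \<comment> \<open>The contracting homotopy on pure tensors. The sign is that of the face with
    index \<open>p\<close>, so that in \<open>kdel p q g\<close> this face appears with coefficient
    1.\<close>
  define \<phi> where "\<phi> as = (\<lambda>(a, c). sg R p (H (?u c) (as @ [pp a])))" for as
  define g where "g X as = presented_lift R (\<phi> as) X" for X as
  have uc: "?u c .: (KT q)" if "c \<in> hcomp C q" for c using that by (simp add: kp_closed)
  have al: "as @ [pp a] \<in> APl (Suc p)" if "as \<in> APl p" "a .: A" for as a
    using that by (simp add: APl_simps pp_closed)
  have Hc: "H (?u c) (as @ [pp a]) .: R" if "as \<in> APl p" "a .: A" "c \<in> hcomp C q" for as a c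
    using coch_closed[OF H uc al] that by simp
  have Hm: "mlin (Suc p) (H (?u c))" if "c \<in> hcomp C q" for c using coch_mlin[OF H uc[OF that]] .
  have Hslot: "H (?u c) (as @ [x +[AP] y]) = H (?u c) (as @ [x]) +[R] H (?u c) (as @ [y])"
    if "c \<in> hcomp C q" "as \<in> APl p" "x .: AP" "y .: AP" for c as x y
    using mlin_slot[OF Hm, of c as x y "[]"] that by (simp add: APl_def)
  have Hrs: "H (?u (r .[C] c)) (as @ [x]) = H (?u c) (as @ [x <[AP] r])"
    if "c \<in> hcomp C q" "as \<in> APl p" "x .: AP" "r .: R" for c as x r
  proof -
    have "?u (r .[C] c) = r .[KT q] ?u c"
      using that by (simp add: kp_smult kp_bal[symmetric] unit_eq)
    then show ?thesis
      using that uc coch_smult[OF H, of r "?u c" "as @ [x]"] by (simp add: APl_simps pos_simps)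
  qed
  have bil: "bilin R A (hpart C q) R (\<phi> as)" if as: "as \<in> APl p" for as
  proof (rule KT_bilinI; unfold \<phi>_def prod.case)
    fix a assume a: "a .: A"
    have "ahom (hpart C q) R (\<lambda>c. H (?u c) (as @ [pp a]))"
      by (rule ahom_comp[OF kp_ahom_r coch_ahom[OF H al[OF as a]]]) simp
    then show "ahom (hpart C q) R (\<lambda>c. sg R p (H (?u c) (as @ [pp a])))"
      by (rule ahom_sg_map[OF Rg])
  next
    fix c assume c: "c \<in> hcomp C q"
    have "ahom A R (\<lambda>a. H (?u c) (as @ [pp a]))"
      using as c Hc by (intro ahomI) (auto simp: pp_add Hslot pp_closed)
    then show "ahom A R (\<lambda>a. sg R p (H (?u c) (as @ [pp a])))" by (rule ahom_sg_map[OF Rg])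
    fix a r assume "a .: A" "r .: R"
    then show "sg R p (H (?u c) (as @ [pp (a <[A] r)])) = sg R p (H (?u (r .[C] c)) (as @ [pp a]))"
      using as c by (simp add: pp_rsmult Hrs pp_closed)
  qed
  have ga: "ahom (KT q) R (\<lambda>X. g X as)" if "as \<in> APl p" for as
    unfolding g_def by (rule KT_lift_ahom[OF Rg bil[OF that]])
  have gp: "g (kp q a c) as = sg R p (H (?u c) (as @ [pp a]))"
    if "a .: A" "c \<in> hcomp C q" "as \<in> APl p" for a c as
    unfolding g_def using KT_lift_pure[OF Rg bil[OF that(3)] that(1,2)] by (simp add: \<phi>_def)
  have pm: "mlin p (\<lambda>as. H (?u c) (as @ [x]))" if c: "c \<in> hcomp C q" and x: "x .: AP" for c x
  proof (rule mlinI, goal_cases)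
    case (1 as)
    then show ?case using x by (intro coch_closed[OF H uc[OF c]]) (simp add: APl_simps)
  qed (use x mlin_slot[OF Hm[OF c], of _ _ _ "_ @ [x]"] mlin_head[OF Hm[OF c], of _ _ "_ @ [x]"]
        mlin_bal[OF Hm[OF c], of _ _ _ _ "_ @ [x]"] in \<open>simp_all\<close>)
  have gm: "mlin p (g X)" if X: "X .: (KT q)" for X using X unfolding koszul_term_def
  proof (induction X rule: bimodule_pair.tensor_induct[OF kpair, consumes 1, case_names zero pure add neg])
    case zero
    show ?case by (rule mlin_cong[OF mlin_zero])
        (use ahom_zero[OF KT_group Rg ga] in \<open>simp add: koszul_term_def\<close>)
  next
    case (pure a c)
    then have ac: "a .: A" "c \<in> hcomp C q" by (simp_all add: C.hpart_simps)
    show ?case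
      by (rule mlin_cong[OF mlin_sg[OF pm[OF ac(2) pp_closed[OF ac(1)]]]]) (use gp ac in simp)
  next
    case (add X Y)
    show ?case by (rule mlin_cong[OF mlin_add[OF add(3,4)]])
        (use ahom_add[OF ga, unfolded koszul_term_def] add in simp)
  next
    case (neg X)
    show ?case by (rule mlin_cong[OF mlin_sg[OF neg(2), of 1]])
        (use ahom_neg[OF KT_group Rg ga, unfolded koszul_term_def] neg in \<open>simp add: sg_def\<close>)
  qed
  have gsm: "g (r .[KT q] X) as = rsc (g X) r as"
    if r: "r .: R" and X: "X .: (KT q)" and as: "as \<in> APl p" for r X as
  proof (cases as rule: rev_exhaust)
    case Nil
    then have p0: "p = 0" using as by (simp add: APl_def)
    have m: "ahom R R (\<lambda>x. r *[R] x)" using r by (simp add: ahom_def R.r_distr)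
    have "g (r .[KT q] X) [] = r *[R] g X []"
    proof (rule KT_eqI[OF Rg ahom_comp[OF KT_smult_ahom[OF r] ga] ahom_comp[OF ga m] _ X])
      fix a c assume a: "a .: A" and c: "c \<in> hcomp C q"
      then show "g (r .[KT q] kp q a c) [] = r *[R] g (kp q a c) []"
        using r p0 mlin_head[OF Hm[OF c], of r "pp a" "[]"] pp_closed[OF a]
        by (simp add: kp_smult gp smult_closed pp_smult APl_def sg_def)
    qed (use as Nil in simp_all)
    then show ?thesis using Nil by simp
  next
    case (snoc bs b)
    then have b: "b .: AP" "bs <: AP" "length bs + 1 = p" using as by (auto simp: APl_def)
    then have as': "bs @ [b <[A] r] \<in> APl p"
      using r P.rsmult_closed[of r b] by (simp add: APl_def pos_simps)
    have "g (r .[KT q] X) as = g X (bs @ [b <[A] r])"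
    proof (rule KT_eqI[OF Rg ahom_comp[OF KT_smult_ahom[OF r] ga[OF as]] ga[OF as'] _ X])
      fix a c assume a: "a .: A" and c: "c \<in> hcomp C q"
      then show "g (r .[KT q] kp q a c) as = g (kp q a c) (bs @ [b <[A] r])"
        using r as as' snoc b mlin_bal[OF Hm[OF c], of r bs b "pp a" "[]"] pp_closed[OF a]
        by (simp add: kp_smult gp smult_closed pp_smult pos_simps One_nat_def)
    qed
    then show ?thesis using snoc by simp
  qed
  have gcoch: "coch p q g" using gm ga gsm by (simp add: coch_def)
  moreover have "kdel p q g X as = H X as" if X: "X .: (KT q)" and as: "as \<in> APl (Suc p)" for X as
  proof (rule KT_eqI[OF Rg coch_ahom[OF kdel_coch[OF gcoch] as] coch_ahom[OF H as] _ X])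
    fix a c assume a: "a .: A" and c: "c \<in> hcomp C q"
    obtain bs b where b: "as = bs @ [b]" "bs \<in> APl p" "b .: AP" using as by (rule APl_snocE)
    have pa: "pp a .: AP" "pp a .: A" and bA: "b .: A" using pp_closed[OF a] b(3) pos_closed by auto
    let ?S = "altsum R p (\<lambda>i. H (?u c) (mrg A i as @ [pp a]))"
    have S: "?S .: R" using a c by (intro R.altsum_closed Hc APl_mrg[OF as])
    have t: "H (?u c) (bs @ [x]) .: R" if "x .: AP" for x
      using b that by (intro coch_closed[OF H uc[OF c]]) (simp add: APl_simps)
    have bp: "b *[A] pp a .: AP" "b *[A] a .: AP" "b <[AP] \<pi>0 a .: AP"
      using b pa a by (auto intro: mult_pos mult_pos_left P.rsmult_closed \<pi>0_props)
    have as2: "as @ [pp a] \<in> APl (Suc (Suc p))" using as pa by (simp add: APl_simps)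
    have h2: "H (kp q (pp a) c) as .: R"
      using as pa c by (intro coch_closed[OF H]) (auto simp: kp_closed)
    have 1: "kdel p q g (kp q a c) as = sg R p ?S +[R] H (?u c) (bs @ [b *[A] a])" proof -
      have "altsum R p (\<lambda>i. g (kp q a c) (mrg A i as)) = sg R p ?S" proof -
        have "sg R p ?S = altsum R p (\<lambda>i. sg R p (H (?u c) (mrg A i as @ [pp a])))"
          by (rule ahom_altsum[OF Rg Rg])
            (use Hc[OF APl_mrg[OF as] a c] in \<open>auto simp: ahom_def R.sg_closed R.sg_add\<close>)
        also have "... = altsum R p (\<lambda>i. g (kp q a c) (mrg A i as))"
          using gp[OF a c APl_mrg[OF as]] coch_closed[OF gcoch kp_closed[OF a c] APl_mrg[OF as]]
          by (intro R.altsum_cong) auto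
        finally show ?thesis ..
      qed
      moreover have "sg R p (g (act q b (kp q a c)) bs) = H (?u c) (bs @ [b *[A] a])"
        using a c bA b(2) t[OF bp(2)] by (simp add: act_pure gp pp_pos[OF bp(2)] R.sg_sg_same)
      ultimately show ?thesis using kdel_snoc[OF gcoch kp_closed[OF a c] b(2,3)] b(1) by simp
    qed
    \<comment> \<open>The cocycle condition at the list \<open>as @ [pp a]\<close>, solved for its
      last face, where \<open>pp a\<close> acts on \<open>1 \<otimes> c\<close>.\<close>
    have 2: "H (kp q (pp a) c) as = sg R p ?S +[R] H (?u c) (bs @ [b *[A] pp a])" proof -
      have "0[R] = kdel (Suc p) q H (?u c) (as @ [pp a])" using cocycle[OF uc[OF c] as2] by simp
      also have "... = altsum R (Suc p) (\<lambda>i. H (?u c) (mrg A i (as @ [pp a]))) +[R]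
          sg R (Suc p) (H (kp q (pp a) c) as)"
        using kdel_snoc[OF H uc[OF c] as pa(1)] pa c by (simp add: act_pure)
      also have "altsum R (Suc p) (\<lambda>i. H (?u c) (mrg A i (as @ [pp a]))) =
          altsum R p (\<lambda>i. H (?u c) (mrg A i (as @ [pp a]))) +[R] sg R p (H (?u c) (mrg A p (as @ [pp a])))"
        using APl_mrg[OF as2] by (intro R.altsum_Suc coch_closed[OF H uc[OF c]])
      also have "altsum R p (\<lambda>i. H (?u c) (mrg A i (as @ [pp a]))) = ?S" proof (rule R.altsum_cong)
        fix i assume "i < p"
        then show "H (?u c) (mrg A i (as @ [pp a])) = H (?u c) (mrg A i as @ [pp a])"
          using as by (simp add: mrg_append_left APl_def)
      qed (use Hc[OF APl_mrg[OF as] a c] in simp)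
      also have "mrg A p (as @ [pp a]) = bs @ [b *[A] pp a]"
        using b mrg_append_right[of A bs 0 "[b, pp a]"] by (simp add: APl_def)
      finally have e: "?S +[R] sg R p (H (?u c) (bs @ [b *[A] pp a])) +[R]
          sg R (Suc p) (H (kp q (pp a) c) as) = 0[R]" ..
      let ?x = "H (?u c) (bs @ [b *[A] pp a])" and ?y = "H (kp q (pp a) c) as"
      have "?S +[R] sg R p ?x = sg R p ?y"
        using R.minus_equality[OF e] S t[OF bp(1)] h2 by (simp add: R.sg_Suc R.sg_closed)
      then have "sg R p (?S +[R] sg R p ?x) = sg R p (sg R p ?y)" by simp
      then show ?thesis using S t[OF bp(1)] h2 by (simp add: R.sg_add R.sg_sg_same R.sg_closed)
    qed
    \<comment> \<open>Splitting \<open>a\<close> into its scalar part and its positive part. The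
      scalar part is what 2 does not see; by 4 it moves from the entry \<open>b\<close> back to the
      tensor factor.\<close>
    have 3: "H (?u c) (bs @ [b *[A] a]) =
        H (?u c) (bs @ [b <[AP] \<pi>0 a]) +[R] H (?u c) (bs @ [b *[A] pp a])"
    proof -
      have "b *[A] a = b *[A] (\<pi>0 a .[A] 1[A] +[A] pp a)" using pp_decomp[OF a] by simp
      also have "... = b <[AP] \<pi>0 a +[AP] b *[A] pp a"
        using bA pa \<pi>0_props(1)[OF a] by (simp add: A.r_distr smult_closed mult_unit pos_simps)
      finally show ?thesis using Hslot[OF c b(2) bp(3,1)] by simp
    qed
    have 4: "H (?u c) (bs @ [b <[AP] \<pi>0 a]) = H (kp q (\<pi>0 a .[A] 1[A]) c) as"
      using coch_smult[OF H \<pi>0_props(1)[OF a] uc[OF c] as] c \<pi>0_props(1)[OF a] b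
      by (simp add: kp_smult pos_simps)
    have h1: "H (kp q (\<pi>0 a .[A] 1[A]) c) as .: R"
      using as c \<pi>0_props(1)[OF a] by (intro coch_closed[OF H]) (auto simp: kp_closed smult_closed)
    have "H (kp q a c) as = H (kp q (\<pi>0 a .[A] 1[A] +[A] pp a) c) as" using pp_decomp[OF a] by simp
    also have "... = H (kp q (\<pi>0 a .[A] 1[A]) c) as +[R] H (kp q (pp a) c) as"
      using pa c \<pi>0_props(1)[OF a] ahom_add[OF coch_ahom[OF H as]]
      by (simp add: kp_add_l smult_closed kp_closed)
    also have "... = kdel p q g (kp q a c) as"
      using S t[OF bp(1)] h1 by (simp add: 1 2 3 4 R.sg_closed R.a_ac)
    finally show "kdel p q g (kp q a c) as = H (kp q a c) as" ..
  qed
  ultimately show thesis using gp that by blast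
qed

section \<open>The chase through the double complex\<close>

lemma \<theta>_pos: "x \<in> hcomp C 1 ==> \<theta> x .: AP"
  using hcomp_pos[OF \<theta>_closed] by simp

lemma kd_unit: "c \<in> hcomp C (Suc q) ==> kd q (kp (Suc q) 1[A] c) = kin q 1[A] (comult_comp R C 1 q c)"
  by (simp add: kd_pure)

definition A1l :: "nat => 'a list set" where "A1l p = {as. set as \<subseteq> hcomp A 1 \<and> length as = p}"

lemma A1l_APl: "as \<in> A1l p ==> as \<in> APl p"
  using hcomp_pos[of _ 1] by (auto simp: A1l_def APl_def)

text \<open>Carries the vanishing on lists of degree-one entries to the next Koszul degree: the
  differential of \<open>1 \<otimes> c\<close> is a sum of terms
  \<open>\<theta>(x) \<otimes> y\<close>, and appending \<theta>(x) to such a list gives another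
  one, where \<open>H\<close> vanishes.\<close>

lemma row_exact_unit:
  assumes gp: "\<And>a c as. a .: A ==> c \<in> hcomp C q ==> as \<in> APl p ==>
      g (kp q a c) as = sg R p (H (kp q 1[A] c) (as @ [pp a]))" and g: "coch p q g"
    and H: "\<And>c as. c \<in> hcomp C q ==> as \<in> A1l (Suc p) ==> H (kp q 1[A] c) as = 0[R]"
    and c: "c \<in> hcomp C (Suc q)" and as: "as \<in> A1l p"
  shows "g (kd q (kp (Suc q) 1[A] c)) as = 0[R]"
  unfolding kd_unit[OF c]
proof (rule CC_eqI[OF Rg ahom_comp[OF kin_ahom coch_ahom[OF g A1l_APl[OF as]]]
      ahom_zero_map[OF Rg] _ cc_closed[OF c]])
  fix x y assume xy: "x \<in> hcomp C 1" "y \<in> hcomp C q"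
  have "as @ [\<theta> x] \<in> A1l (Suc p)" using as \<theta>_closed[OF xy(1)] by (simp add: A1l_def)
  then show "g (kin q 1[A] (tensor_pure R (hpart C 1) (hpart C q) x y)) as = 0[R]"
    using xy \<theta>_closed[OF xy(1)] \<theta>_pos[OF xy(1)]
    by (simp add: kin_pure hcomp_closed gp A1l_APl[OF as] pp_pos H R.sg_zero)
qed simp

text \<open>The chase along the Koszul complex: up by row exactness, down by factoring through the
  differential with a generalized inverse.\<close>

lemma koszul_chase:
  assumes "coch p q G"
    and "\<And>c as. c \<in> hcomp C (Suc q) ==> as \<in> A1l p ==> G (kd q (kp (Suc q) 1[A] c)) as = 0[R]"
    and "\<And>X as. X .: (KT (Suc q)) ==> as \<in> APl (Suc p) ==> kdel p q G (kd q X) as = 0[R]"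
  obtains G' where "coch p q G'" "\<And>X as. X .: (KT (Suc q)) ==> as \<in> APl p ==> G' (kd q X) as = 0[R]"
    "\<And>X as. X .: (KT q) ==> as \<in> APl (Suc p) ==> kdel p q G' X as = kdel p q G X as"
proof -
  have "\<exists>G'. coch p q G' \<and> (\<forall>X\<in>carrier (KT (Suc q)). \<forall>as\<in>APl p. G' (kd q X) as = 0[R]) \<and>
      (\<forall>X\<in>carrier (KT q). \<forall>as\<in>APl (Suc p). kdel p q G' X as = kdel p q G X as)" using assms
  proof (induction p arbitrary: q G)
    case 0
    note G = 0(1) and V = 0(2) and Z = 0(3)
    have nil: "[] \<in> APl 0" "[] \<in> A1l 0" by (auto simp: APl_def A1l_def)
    note H = coch_comp_kd[OF G]
    \<comment> \<open>In the last column \<open>G\<close> itself already kills the image of the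
      differential. Write \<open>a \<otimes> c\<close> as a scalar multiple of
      \<open>1 \<otimes> c\<close>, killed by \<open>V\<close>, plus the action of an element of
      \<open>A_+\<close> on \<open>1 \<otimes> c\<close>, killed by \<open>Z\<close>, which for
      \<open>p = 0\<close> says that \<open>G\<close> vanishes on such actions.\<close>
    have z: "G (kd q X) [] = 0[R]" if X: "X .: (KT (Suc q))" for X
    proof (rule KT_eqI[OF Rg coch_ahom[OF H nil(1)] ahom_zero_map[OF Rg] _ X])
      fix a c assume a: "a .: A" and c: "c \<in> hcomp C (Suc q)"
      let ?u = "kp (Suc q) 1[A] c"
      have uc: "?u .: (KT (Suc q))" using c by (simp add: kp_closed)
      have pa: "pp a .: AP" "pp a .: A" using pp_closed[OF a] pos_closed by auto
      have "kp (Suc q) a c = kp (Suc q) (\<pi>0 a .[A] 1[A] +[A] pp a) c" using pp_decomp[OF a] by simp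
      also have "... = \<pi>0 a .[KT (Suc q)] ?u +[KT (Suc q)] act (Suc q) (pp a) ?u"
        using \<pi>0_props(1)[OF a] pa c by (simp add: kp_add_l smult_closed kp_smult act_pure)
      finally have e: "kp (Suc q) a c = \<pi>0 a .[KT (Suc q)] ?u +[KT (Suc q)] act (Suc q) (pp a) ?u" .
      have "G (kd q (\<pi>0 a .[KT (Suc q)] ?u)) [] = 0[R]"
        using coch_smult[OF H \<pi>0_props(1)[OF a] uc nil(1)] V[OF c nil(2)] \<pi>0_props(1)[OF a] by simp
      moreover have "G (kd q (act (Suc q) (pp a) ?u)) [] = 0[R]" proof -
        have "[pp a] \<in> APl (Suc 0)" using pa by (simp add: APl_def)
        then have "kdel 0 q G (kd q ?u) [pp a] = 0[R]" using Z[OF uc] by simp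
        moreover have "G (act q (pp a) (kd q ?u)) [] .: R"
          using pa uc nil(1) by (intro coch_closed[OF G] act_closed kd_closed)
        ultimately show ?thesis using kdel_snoc[OF G kd_closed[OF uc] nil(1) pa(1)] pa uc
          by (simp add: R.altsum_0 sg_def kd_act)
      qed
      moreover have "\<pi>0 a .[KT (Suc q)] ?u .: (KT (Suc q))" "act (Suc q) (pp a) ?u .: (KT (Suc q))"
        using \<pi>0_props(1)[OF a] pa uc by (auto intro: KT_smult_closed act_closed)
      ultimately show "G (kd q (kp (Suc q) a c)) [] = 0[R]"
        unfolding e using ahom_add[OF coch_ahom[OF H nil(1)]] by simp
    qed
    have "as = []" if "as \<in> APl 0" for as using that by (simp add: APl_def)
    then show ?case using G z by (intro exI[of _ G]) auto
  next
    case (Suc p)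
    note G = Suc(2) and V = Suc(3) and Z = Suc(4)
    note H = coch_comp_kd[OF G]
    \<comment> \<open>By \<open>Z\<close>, composing \<open>G\<close> with the differential gives a
      cocycle of the row \<open>Suc q\<close>, so it is the coboundary of some \<open>g\<close> with
      one entry less.\<close>
    obtain g where g: "coch p (Suc q) g"
      and dg: "\<And>X as. X .: (KT (Suc q)) ==> as \<in> APl (Suc p) ==> kdel p (Suc q) g X as = G (kd q X) as"
      and gp: "\<And>a c as. a .: A ==> c \<in> hcomp C (Suc q) ==> as \<in> APl p ==>
        g (kp (Suc q) a c) as = sg R p (G (kd q (kp (Suc q) 1[A] c)) (as @ [pp a]))"
      by (rule row_exact[OF H]) (use Z in \<open>auto simp: kdel_comp_kd[OF G]\<close>)
    have Vg: "g (kd (Suc q) (kp (Suc (Suc q)) 1[A] c)) as = 0[R]"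
      if "c \<in> hcomp C (Suc (Suc q))" "as \<in> A1l p" for c as
      by (rule row_exact_unit[where H = "\<lambda>X. G (kd q X)", OF gp g V that])
    have Zg: "kdel p (Suc q) g (kd (Suc q) X) as = 0[R]"
      if "X \<in> carrier (KT (Suc (Suc q)))" "as \<in> APl (Suc p)" for X as
      using that by (simp add: dg kd_closed kd_kd coch_zero[OF G])
    \<comment> \<open>The induction hypothesis, one Koszul degree higher, corrects \<open>g\<close>
      without changing its coboundary so that it kills the image of the next differential, that is,
      the kernel of \<open>kd q\<close>.\<close>
    obtain g' where g': "coch p (Suc q) g'"
      and g'0: "\<And>X as. X \<in> carrier (KT (Suc (Suc q))) ==> as \<in> APl p ==> g' (kd (Suc q) X) as = 0[R]"
      and dg': "\<And>X as. X .: (KT (Suc q)) ==> as \<in> APl (Suc p) ==>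
        kdel p (Suc q) g' X as = kdel p (Suc q) g X as" using Suc.IH[OF g Vg Zg] by blast
    interpret K: bimodule R "KT q" by (rule KT_bimodule)
    interpret K': bimodule R "KT (Suc q)" by (rule KT_bimodule)
    \<comment> \<open>A functional that kills the kernel of \<open>kd q\<close> factors through
      \<open>kd q\<close>; composing with a generalized inverse gives the factor \<open>E\<close>,
      defined on all of \<open>KT q\<close> and still balanced because \<sigma> is left
      linear.\<close>
    obtain \<sigma> where \<sigma>: "left_linear R (KT q) (KT (Suc q)) \<sigma>"
      and inv: "\<And>X. X .: (KT (Suc q)) ==> kd q (\<sigma> (kd q X)) = kd q X"
      by (rule generalized_inverse[OF semisimple K'.left_module_axioms K.left_module_axioms kd_linear]) blast
    note \<sigma>c = ahom_closed[OF left_linear_ahom[OF \<sigma>]]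
    define E where "E X = g' (\<sigma> X)" for X
    have E: "coch p q E" unfolding coch_def E_def proof (intro conjI ballI)
      show "mlin p (g' (\<sigma> X))" if "X .: (KT q)" for X using coch_mlin[OF g' \<sigma>c[OF that]] .
      show "ahom (KT q) R (\<lambda>X. g' (\<sigma> X) as)" if "as \<in> APl p" for as
        using ahom_comp[OF left_linear_ahom[OF \<sigma>] coch_ahom[OF g' that]] .
      show "g' (\<sigma> (r .[KT q] X)) as = rsc (g' (\<sigma> X)) r as"
        if "r .: R" "X .: (KT q)" "as \<in> APl p" for r X as
        using that coch_smult[OF g' _ \<sigma>c] left_linear_smult[OF \<sigma>] by simp
    qed
    have Ed: "E (kd q X) as = g' X as" if X: "X .: (KT (Suc q))" and as: "as \<in> APl p" for X as
    proof -
      have c: "\<sigma> (kd q X) .: (KT (Suc q))" using \<sigma>c kd_closed[OF X] by simp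
      have d: "\<sigma> (kd q X) -[KT (Suc q)] X .: (KT (Suc q))" using c X by (simp add: a_minus_def)
      have "kd q (\<sigma> (kd q X) -[KT (Suc q)] X) = 0[KT q]"
        using ahom_minus[OF KT_group KT_group kd_ahom c X] inv[OF X] kd_closed[OF X]
        by (simp add: a_minus_def K.M.r_neg)
      then obtain Y where "Y \<in> carrier (KT (Suc (Suc q)))" "\<sigma> (kd q X) -[KT (Suc q)] X = kd (Suc q) Y"
        using kd_ker[OF d] by blast
      then have "g' (\<sigma> (kd q X)) as -[R] g' X as = 0[R]"
        using g'0[OF _ as] ahom_minus[OF KT_group Rg coch_ahom[OF g' as] c X] by simp
      then show ?thesis
        using coch_closed[OF g' c as] coch_closed[OF g' X as] by (simp add: E_def R.minus_eq_zero_iff)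
    qed
    have dE: "coch (Suc p) q (kdel p q E)" by (rule kdel_coch[OF E])
    have dEd: "kdel p q E (kd q X) as = G (kd q X) as" if X: "X .: (KT (Suc q))" and as: "as \<in> APl (Suc p)" for X as
    proof -
      obtain bs b where b: "as = bs @ [b]" "bs \<in> APl p" "b .: AP" using as by (rule APl_snocE)
      have "kdel p q E (kd q X) as = kdel p (Suc q) (\<lambda>X. E (kd q X)) X as"
        using kdel_comp_kd[OF E X as] by simp
      also have "... = kdel p (Suc q) g' X as" unfolding kdel_def proof (rule R.altsum_cong)
        fix i assume i: "i < Suc p"
        show "(if i < p then g' X (mrg A i as) else g' (act (Suc q) (last as) X) (butlast as)) .: R"
          by (rule kdel_face_closed[OF g' X as i])
        show "(if i < p then E (kd q X) (mrg A i as) else E (kd q (act (Suc q) (last as) X)) (butlast as)) =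
            (if i < p then g' X (mrg A i as) else g' (act (Suc q) (last as) X) (butlast as))"
          using Ed[OF X APl_mrg[OF as]] Ed[OF act_closed[OF _ X] b(2), of b] b by (simp add: pos_closed)
      qed
      finally show ?thesis using dg'[OF X as] dg[OF X as] by simp
    qed
    \<comment> \<open>On the image of \<open>kd q\<close> the coboundary of \<open>E\<close> equals
      \<open>G\<close>, so the difference vanishes there; subtracting a coboundary leaves the
      coboundary of \<open>G\<close> as it was.\<close>
    define G' where "G' X as = G X as -[R] kdel p q E X as" for X as
    have Gc: "coch (Suc p) q G'" unfolding coch_def proof (intro conjI ballI)
      fix X assume X: "X .: (KT q)"
      have "mlin (Suc p) (\<lambda>as. G X as +[R] sg R 1 (kdel p q E X as))"
        by (intro mlin_add mlin_sg coch_mlin[OF G X] coch_mlin[OF dE X])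
      then show "mlin (Suc p) (G' X)" by (simp add: G'_def[abs_def] a_minus_def sg_def)
    next
      fix as assume as: "as \<in> APl (Suc p)"
      show "ahom (KT q) R (\<lambda>X. G' X as)" unfolding G'_def a_minus_def
        by (intro ahom_plus[OF Rg] ahom_uminus[OF Rg]
            coch_ahom[OF G as] coch_ahom[OF dE as])
      fix r X assume r: "r .: R" and X: "X .: (KT q)"
      show "G' (r .[KT q] X) as = rsc (G' X) r as"
        using coch_smult[OF G r X as] coch_smult[OF dE r X as] as
        by (elim APl_snocE) (simp add: G'_def)
    qed
    moreover have "G' (kd q X) as = 0[R]" if "X .: (KT (Suc q))" "as \<in> APl (Suc p)" for X as
      using dEd[OF that] coch_closed[OF G kd_closed[OF that(1)] that(2)] by (simp add: G'_def R.minus_eq_zero_iff)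
    moreover have "kdel (Suc p) q G' X as = kdel (Suc p) q G X as"
      if X: "X .: (KT q)" and as: "as \<in> APl (Suc (Suc p))" for X as
    proof -
      let ?f = "\<lambda>F i. if i < Suc p then F X (mrg A i as) else F (act q (last as) X) (butlast as)"
      have cG: "?f G i .: R" and cE: "?f (kdel p q E) i .: R" if "i < Suc (Suc p)" for i
        using kdel_face_closed[OF G X as that] kdel_face_closed[OF dE X as that] by simp_all
      have "kdel (Suc p) q G' X as = altsum R (Suc (Suc p)) (\<lambda>i. ?f G i +[R] -[R] ?f (kdel p q E) i)"
        unfolding kdel_def[of "Suc p"]
        by (rule R.altsum_cong) (use cG cE in \<open>auto simp: G'_def a_minus_def\<close>)
      also have "... = kdel (Suc p) q G X as +[R] altsum R (Suc (Suc p)) (\<lambda>i. -[R] ?f (kdel p q E) i)"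
        unfolding kdel_def[of "Suc p" q G] by (rule R.altsum_add) (use cG cE in auto)
      also have "altsum R (Suc (Suc p)) (\<lambda>i. -[R] ?f (kdel p q E) i) = -[R] kdel (Suc p) q (kdel p q E) X as"
        unfolding kdel_def[of "Suc p"] by (rule ahom_altsum[OF Rg Rg, symmetric])
          (use cE in \<open>auto simp: ahom_def R.minus_add\<close>)
      finally show ?thesis using kdel_kdel[OF E X as] kdel_closed[OF G X as] by simp
    qed
    ultimately show ?case by (intro exI[of _ G']) blast
  qed
  then show thesis using that by blast
qed

text \<open>Pull \<open>w\<close> back along the augmentation
  \<open>\<epsilon> : A \<otimes> C_0 \<rightarrow> R\<close>. Row exactness makes the pull-back the
  coboundary of some \<open>g\<close>, and the chase makes \<open>g\<close> kill the kernel of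
  \<epsilon>. So \<open>g\<close> descends along \<epsilon> to a functional on the
  \<open>p\<close>-fold tensor power of \<open>A_+\<close>, whose coboundary is \<open>w\<close>.
  The hypothesis on lists of degree-one entries starts the chase.\<close>

lemma mlin_cocycle_exact:
  assumes w: "mlin (Suc p) w"
    and cocycle: "\<And>as. as \<in> APl (Suc (Suc p)) ==> altsum R (Suc p) (\<lambda>i. w (mrg A i as)) = 0[R]"
    and van: "\<And>as. as \<in> A1l (Suc p) ==> w as = 0[R]"
  obtains v where "mlin p v" "\<And>as. as \<in> APl (Suc p) ==> altsum R p (\<lambda>i. v (mrg A i as)) = w as"
proof -
  define H where "H X = rsc w (\<epsilon> X)" for X
  note \<epsilon>c = ahom_closed[OF \<epsilon>_ahom]
  have bs: "b <[A] r .: AP" if "b .: AP" "r .: R" for b r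
    using P.rsmult_closed that by (simp add: pos_simps)
  have H: "coch (Suc p) 0 H" unfolding coch_def H_def proof (intro conjI ballI)
    show "mlin (Suc p) (rsc w (\<epsilon> X))" if "X .: (KT 0)" for X by (rule mlin_rsc[OF w \<epsilon>c[OF that]])
    fix as assume as: "as \<in> APl (Suc p)"
    then obtain us b where b: "as = us @ [b]" "us \<in> APl p" "b .: AP" by (rule APl_snocE)
    have "ahom R R (\<lambda>r. w (us @ [b <[A] r]))" proof (rule ahomI)
      fix r s assume r: "r .: R"
      show "w (us @ [b <[A] r]) .: R"
        using b r bs by (intro mlin_closed[OF w]) (simp add: APl_simps)
      assume s: "s .: R"
      have "b <[A] (r +[R] s) = b <[A] r +[AP] b <[A] s"
        using b r s by (simp add: pos_simps rsmult_r_distr pos_closed)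
      then show "w (us @ [b <[A] (r +[R] s)]) = w (us @ [b <[A] r]) +[R] w (us @ [b <[A] s])"
        using mlin_slot[OF w, of us "b <[A] r" "b <[A] s" "[]"] b bs r s by (simp add: APl_def)
    qed
    then show "ahom (KT 0) R (\<lambda>X. rsc w (\<epsilon> X) as)"
      unfolding b rsc_snoc by (rule ahom_comp[OF \<epsilon>_ahom])
    fix r X assume r: "r .: R" and X: "X .: (KT 0)"
    then show "rsc w (\<epsilon> (r .[KT 0] X)) as = rsc (rsc w (\<epsilon> X)) r as"
      using b \<epsilon>c[OF X] by (simp add: \<epsilon>_smult rsmult_assoc pos_closed)
  qed
  have w0: "rsc w 0[R] as = 0[R]" if as: "as \<in> APl (Suc p)" for as
    using coch_zero[OF H as] ahom_zero[OF KT_group Rg \<epsilon>_ahom] by (simp add: H_def)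
  have "kdel (Suc p) 0 H X as = 0[R]" if X: "X .: (KT 0)" and as: "as \<in> APl (Suc (Suc p))" for X as
  proof -
    obtain us b where b: "as = us @ [b]" "us \<in> APl (Suc p)" "b .: AP" using as by (rule APl_snocE)
    have as': "us @ [b <[A] \<epsilon> X] \<in> APl (Suc (Suc p))" using b bs \<epsilon>c[OF X] by (simp add: APl_simps)
    have "altsum R (Suc p) (\<lambda>i. H X (mrg A i as)) = altsum R (Suc p) (\<lambda>i. w (mrg A i (us @ [b <[A] \<epsilon> X])))"
      by (rule R.altsum_cong)
        (use rsc_mrg[OF as _ \<epsilon>c[OF X]] mlin_closed[OF w APl_mrg[OF as']] b in \<open>auto simp: H_def\<close>)
    then have 1: "altsum R (Suc p) (\<lambda>i. H X (mrg A i (us @ [b]))) = 0[R]"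
      using cocycle[OF as'] b by simp
    have 2: "H (act 0 b X) us = 0[R]" using w0[OF b(2)] \<epsilon>_act[OF b(3) X] by (simp add: H_def)
    show ?thesis unfolding b(1) kdel_snoc[OF H X b(2,3)] 1 2 by (simp add: R.sg_zero)
  qed
  then obtain g where g: "coch p 0 g"
    and dg: "\<And>X as. X .: (KT 0) ==> as \<in> APl (Suc p) ==> kdel p 0 g X as = H X as"
    and gp: "\<And>a c as. a .: A ==> c \<in> hcomp C 0 ==> as \<in> APl p ==>
      g (kp 0 a c) as = sg R p (H (kp 0 1[A] c) (as @ [pp a]))" using row_exact[OF H] by metis
  \<comment> \<open>The pull-back keeps the vanishing on lists of degree-one entries, because the
    augmentation only multiplies the last entry by a scalar.\<close>
  have V: "g (kd 0 (kp (Suc 0) 1[A] c)) as = 0[R]" if c: "c \<in> hcomp C (Suc 0)" and as: "as \<in> A1l p" for c as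
  proof (rule row_exact_unit[OF gp g _ c as])
    fix c as assume c: "c \<in> hcomp C 0" and as: "as \<in> A1l (Suc p)"
    then obtain us b where b: "as = us @ [b]" "set us \<subseteq> hcomp A 1" "b \<in> hcomp A 1" "length us = p"
      by (cases as rule: rev_exhaust) (auto simp: A1l_def)
    have "b <[A] \<epsilon> (kp 0 1[A] c) \<in> hcomp A 1" using b c by (intro hcomp_rsmult \<epsilon>c kp_closed) auto
    then show "H (kp 0 1[A] c) as = 0[R]"
      using van[of "us @ [b <[A] \<epsilon> (kp 0 1[A] c)]"] b by (simp add: H_def A1l_def)
  qed
  have Z: "kdel p 0 g (kd 0 X) as = 0[R]" if "X .: (KT (Suc 0))" "as \<in> APl (Suc p)" for X as
    using that \<epsilon>_kd[of X] w0 by (simp add: dg kd_closed H_def One_nat_def)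
  obtain g' where g': "coch p 0 g'"
    and g'0: "\<And>X as. X .: (KT (Suc 0)) ==> as \<in> APl p ==> g' (kd 0 X) as = 0[R]"
    and dg': "\<And>X as. X .: (KT 0) ==> as \<in> APl (Suc p) ==> kdel p 0 g' X as = kdel p 0 g X as"
    using koszul_chase[OF g V Z] by metis
  \<comment> \<open>Descending along \<epsilon> means evaluating at an \<open>X\<close> over 1. The
    surplus face of \<open>kdel\<close> is the value at \<open>b X\<close>, which lies in the kernel
    of \<epsilon> and is killed.\<close>
  obtain X where X: "X .: (KT 0)" "\<epsilon> X = 1[R]" using \<epsilon>_surj by blast
  show thesis proof (rule that[of "g' X"])
    show "mlin p (g' X)" by (rule coch_mlin[OF g' X(1)])
    fix as assume as: "as \<in> APl (Suc p)"
    then obtain us b where b: "as = us @ [b]" "us \<in> APl p" "b .: AP" by (rule APl_snocE)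
    have bX: "act 0 b X .: (KT 0)" using b X by (intro act_closed) (auto simp: pos_closed)
    then obtain Y where "Y .: (KT (Suc 0))" "act 0 b X = kd 0 Y"
      using \<epsilon>_ker[OF bX \<epsilon>_act[OF b(3) X(1)]] by (auto simp: One_nat_def)
    then have "g' (act 0 b X) us = 0[R]" using g'0 b by simp
    moreover have "altsum R p (\<lambda>i. g' X (mrg A i as)) .: R"
      by (rule R.altsum_closed) (rule coch_closed[OF g' X(1) APl_mrg[OF as]])
    ultimately have "kdel p 0 g' X as = altsum R p (\<lambda>i. g' X (mrg A i as))"
      using kdel_snoc[OF g' X(1) b(2,3)] b by (simp add: R.sg_zero)
    moreover have "kdel p 0 g' X as = w as"
      using dg'[OF X(1) as] dg[OF X(1) as] b by (simp add: H_def X(2) rsmult_one pos_closed)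
    ultimately show "altsum R p (\<lambda>i. g' X (mrg A i as)) = w as" by simp
  qed
qed

end

section \<open>Comparison of cohomology rings\<close>

text \<open>The product has to respect cocycles and coboundaries. For the bar complex this comes
  from the Leibniz rule; for the cobar complex it is transported from the bar complex along the
  pairing.\<close>

locale cochain_ring =
  fixes K :: "nat => ('k, 'x) ring_scheme" and d :: "nat => 'k => 'k"
    and m :: "nat => nat => 'k => 'k => 'k" and u :: 'k
  assumes K: "abelian_group (K n)" and d_ahom: "ahom (K n) (K (Suc n)) (d n)"
    and d_d: "x .: (K n) ==> d (Suc n) (d n x) = 0[K (Suc (Suc n))]"
    and m_closed: "x .: (K p) ==> y .: (K q) ==> m p q x y .: (K (p + q))"
    and m_add_left: "x .: (K p) ==> x' .: (K p) ==> y .: (K q) ==>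
      m p q (x +[K p] x') y = m p q x y +[K (p + q)] m p q x' y"
    and m_add_right: "x .: (K p) ==> y .: (K q) ==> y' .: (K q) ==>
      m p q x (y +[K q] y') = m p q x y +[K (p + q)] m p q x y'"
    and m_ZZ: "x \<in> cocycles K d p ==> y \<in> cocycles K d q ==> m p q x y \<in> cocycles K d (p + q)"
    and m_BZ: "x \<in> coboundaries K d p ==> y \<in> cocycles K d q ==> m p q x y \<in> coboundaries K d (p + q)"
    and m_ZB: "x \<in> cocycles K d p ==> y \<in> coboundaries K d q ==> m p q x y \<in> coboundaries K d (p + q)"
    and u_Z: "u \<in> cocycles K d 0"
begin

abbreviation "Z \<equiv> cocycles K d"
abbreviation "B \<equiv> coboundaries K d"
abbreviation "H \<equiv> cohomology K d"

definition cls :: "nat => 'k => 'k set" where "cls n z = B n +>\<^bsub>K n\<^esub> z"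

lemma Z_props: "Z n \<subseteq> carrier (K n)" "0[K n] \<in> Z n"
  "x \<in> Z n ==> y \<in> Z n ==> x +[K n] y \<in> Z n" "x \<in> Z n ==> -[K n] x \<in> Z n"
proof -
  interpret Kn: abelian_group "K n" by (rule K)
  interpret Ks: abelian_group "K (Suc n)" by (rule K)
  show "Z n \<subseteq> carrier (K n)" "0[K n] \<in> Z n"
    "x \<in> Z n ==> y \<in> Z n ==> x +[K n] y \<in> Z n" "x \<in> Z n ==> -[K n] x \<in> Z n"
    by (auto simp: cocycles_def ahom_zero[OF K K d_ahom] ahom_add[OF d_ahom] ahom_neg[OF K K d_ahom])
qed

lemma Z_closed: "x \<in> Z n ==> x .: (K n)"
  using Z_props(1) by auto

lemma B_props: "B n \<subseteq> Z n" "0[K n] \<in> B n"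
  "x \<in> B n ==> y \<in> B n ==> x +[K n] y \<in> B n" "x \<in> B n ==> -[K n] x \<in> B n"
proof -
  interpret Kn: abelian_group "K n" by (rule K)
  have "B n \<subseteq> Z n \<and> 0[K n] \<in> B n \<and> (\<forall>x\<in>B n. \<forall>y\<in>B n. x +[K n] y \<in> B n) \<and> (\<forall>x\<in>B n. -[K n] x \<in> B n)"
  proof (cases n)
    case 0
    then show ?thesis
      using Z_props(2)[of n] Kn.l_zero[OF Kn.zero_closed] Kn.minus_equality[OF Kn.l_zero[OF Kn.zero_closed] Kn.zero_closed Kn.zero_closed]
      by (simp add: coboundaries_def)
  next
    case (Suc k)
    interpret Kk: abelian_group "K k" by (rule K)
    have b: "B n = d k ` carrier (K k)" by (simp add: coboundaries_def Suc)
    show ?thesis unfolding b proof (intro conjI ballI)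
      show "d k ` carrier (K k) \<subseteq> Z n"
        using ahom_closed[OF d_ahom] d_d by (auto simp: cocycles_def Suc)
      show "0[K n] \<in> d k ` carrier (K k)"
        using ahom_zero[OF K K d_ahom, of k] by (auto simp: Suc intro!: image_eqI[of _ _ "0[K k]"])
      show "x +[K n] y \<in> d k ` carrier (K k)" if "x \<in> d k ` carrier (K k)" "y \<in> d k ` carrier (K k)" for x y
        using that ahom_add[OF d_ahom, symmetric] by (auto simp: Suc)
      show "-[K n] x \<in> d k ` carrier (K k)" if "x \<in> d k ` carrier (K k)" for x
        using that ahom_neg[OF K K d_ahom, symmetric] by (auto simp: Suc)
    qed
  qed
  then show "B n \<subseteq> Z n" "0[K n] \<in> B n"
    "x \<in> B n ==> y \<in> B n ==> x +[K n] y \<in> B n" "x \<in> B n ==> -[K n] x \<in> B n" by auto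
qed

lemma B_closed: "x \<in> B n ==> x .: (K n)"
  using B_props(1) Z_props(1) by blast

abbreviation "ZG n \<equiv> (K n)\<lparr>carrier := Z n\<rparr>"

lemma ZG: "abelian_group (ZG n)"
  using Z_props[where n = n] by (intro abelian_group.sub_group[OF K]) auto

lemma B_subgroup: "subgroup (B n) (add_monoid (ZG n))"
proof (rule subgroup.intro)
  fix x assume x: "x \<in> B n"
  have "-[ZG n] x = -[K n] x"
    using Z_props[where n = n] subsetD[OF B_props(1) x] by (intro abelian_group.a_inv_sub[OF K]) auto
  then show "inv\<^bsub>add_monoid (ZG n)\<^esub> x \<in> B n" using B_props(4)[OF x] by (simp add: a_inv_def)
qed (use B_props(1,2,3) in auto)

lemma H_simps: "carrier (H n) = cls n ` Z n" "X *[H n] Y = X <+>\<^bsub>K n\<^esub> Y" "1[H n] = B n"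
  by (auto simp: cohomology_def A_FactGroup_def FactGroup_def RCOSETS_def cls_def a_r_coset_def r_coset_def
      set_add_def set_mult_def)

lemma H_group: "comm_group (H n)"
  unfolding cohomology_def A_FactGroup_def
  by (rule comm_group.abelian_FactGroup[OF abelian_group.a_comm_group[OF ZG] B_subgroup])

lemma cls_mem: "w \<in> cls n z \<longleftrightarrow> (\<exists>b\<in>B n. w = b +[K n] z)"
  by (auto simp: cls_def a_r_coset_def r_coset_def)

lemma cls_self: "z \<in> Z n ==> z \<in> cls n z"
  unfolding cls_mem
  by (rule bexI[OF _ B_props(2)]) (simp add: Z_closed abelian_monoid.l_zero[OF abelian_group.axioms(1)[OF K]])

lemma cls_iff:
  assumes z: "z \<in> Z n" and w: "w \<in> Z n"
  shows "w \<in> cls n z \<longleftrightarrow> w -[K n] z \<in> B n"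
proof -
  interpret Kn: abelian_group "K n" by (rule K)
  have c: "z .: (K n)" "w .: (K n)" using z w Z_closed by auto
  show ?thesis proof
    assume "w \<in> cls n z"
    then obtain b where b: "b \<in> B n" "w = b +[K n] z" by (auto simp: cls_mem)
    then show "w -[K n] z \<in> B n"
      using c B_closed[OF b(1)] by (simp add: a_minus_def Kn.a_assoc Kn.r_neg)
  next
    assume "w -[K n] z \<in> B n"
    moreover have "w = (w -[K n] z) +[K n] z" using c by (simp add: a_minus_def Kn.a_assoc Kn.l_neg)
    ultimately show "w \<in> cls n z" unfolding cls_mem by blast
  qed
qed

lemma cls_sub_Z: "z \<in> Z n ==> cls n z \<subseteq> Z n"
  using Z_props(3)[OF subsetD[OF B_props(1)]] by (auto simp: cls_mem)

lemma cls_eqI: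
  assumes z: "z \<in> Z n" and w: "w \<in> Z n" and zw: "w -[K n] z \<in> B n"
  shows "cls n z = cls n w"
proof -
  interpret Kn: abelian_group "K n" by (rule K)
  have c: "z .: (K n)" "w .: (K n)" using z w Z_closed by auto
  have "v -[K n] z \<in> B n \<longleftrightarrow> v -[K n] w \<in> B n" if v: "v \<in> Z n" for v proof -
    have vc: "v .: (K n)" using v Z_closed by auto
    have "v -[K n] z = (v -[K n] w) +[K n] (w -[K n] z)"
      using c vc by (simp add: a_minus_def Kn.a_assoc) (simp add: Kn.r_neg1)
    moreover have "v -[K n] w = (v -[K n] z) +[K n] -[K n] (w -[K n] z)"
      using c vc by (simp add: a_minus_def Kn.a_assoc Kn.minus_add) (simp add: Kn.a_comm Kn.r_neg2 Kn.r_neg1)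
    ultimately show ?thesis using B_props(3)[of "v -[K n] w" n "w -[K n] z"]
        B_props(3)[of "v -[K n] z" n "-[K n] (w -[K n] z)"] B_props(4)[OF zw] zw by metis
  qed
  then have "v \<in> cls n z \<longleftrightarrow> v \<in> cls n w" for v
    using cls_iff[OF z] cls_iff[OF w] cls_sub_Z[OF z] cls_sub_Z[OF w] by blast
  then show ?thesis by blast
qed

lemma cls_eq_iff: "z \<in> Z n ==> w \<in> Z n ==> cls n z = cls n w \<longleftrightarrow> w -[K n] z \<in> B n"
  using cls_eqI[of z n w] cls_self[of w n] cls_iff[of z n w] by blast

lemma cls_zero: "cls n 0[K n] = B n"
proof -
  interpret Kn: abelian_group "K n" by (rule K)
  have "w \<in> cls n 0[K n] \<longleftrightarrow> w \<in> B n" for w unfolding cls_mem using B_closed by fastforce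
  then show ?thesis by blast
qed

lemma cls_add:
  assumes z: "z \<in> Z n" and w: "w \<in> Z n"
  shows "cls n z *[H n] cls n w = cls n (z +[K n] w)"
  using normal.rcos_sum[OF comm_group.subgroup_imp_normal[OF abelian_group.a_comm_group[OF ZG] B_subgroup], of z n w]
    z w
  by (simp add: H_simps(2)) (simp add: cls_def a_r_coset_def r_coset_def set_add_def set_mult_def)

lemma cls_finsum:
  assumes f: "\<And>i. i \<in> I ==> f i \<in> Z n"
  shows "(\<Otimes>\<^bsub>H n\<^esub>i\<in>I. cls n (f i)) = cls n (\<Oplus>\<^bsub>K n\<^esub>i\<in>I. f i)" "(\<Oplus>\<^bsub>K n\<^esub>i\<in>I. f i) \<in> Z n"
proof -
  interpret H: comm_group "H n" by (rule H_group)
  interpret Kn: abelian_group "K n" by (rule K)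
  have "(\<Otimes>\<^bsub>H n\<^esub>i\<in>I. cls n (f i)) = cls n (\<Oplus>\<^bsub>K n\<^esub>i\<in>I. f i) \<and> (\<Oplus>\<^bsub>K n\<^esub>i\<in>I. f i) \<in> Z n" using f
  proof (induction I rule: infinite_finite_induct)
    case (insert i I)
    have "(\<lambda>i. cls n (f i)) \<in> I \<rightarrow> carrier (H n)" "cls n (f i) .: (H n)"
      using insert by (auto simp: H_simps(1))
    moreover have "f \<in> I \<rightarrow> carrier (K n)" "f i .: (K n)" using insert Z_closed by auto
    ultimately show ?case using insert Z_props(3) by (simp add: Kn.finsum_insert cls_add)
  qed (use Z_props(2) in \<open>simp_all add: cls_zero H_simps(3)\<close>)
  then show "(\<Otimes>\<^bsub>H n\<^esub>i\<in>I. cls n (f i)) = cls n (\<Oplus>\<^bsub>K n\<^esub>i\<in>I. f i)" "(\<Oplus>\<^bsub>K n\<^esub>i\<in>I. f i) \<in> Z n" by auto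
qed

text \<open>Replacing representatives by \<open>a = a' + x\<close> and \<open>b = b' + y\<close>
  with coboundaries \<open>a'\<close> and \<open>b'\<close> changes the product by
  \<open>m a b' + m a' y\<close>, again a coboundary. So the coset in the definition of
  \<open>cohomology_ring\<close> is a single class.\<close>

lemma cls_mult:
  assumes x: "x \<in> Z p" and y: "y \<in> Z q"
  shows "B (p + q) <+>\<^bsub>K (p + q)\<^esub> {m p q a b | a b. a \<in> cls p x \<and> b \<in> cls q y} = cls (p + q) (m p q x y)"
    (is "?L = ?R")
proof -
  interpret Kp: abelian_group "K p" by (rule K)
  interpret Kq: abelian_group "K q" by (rule K)
  interpret Kn: abelian_group "K (p + q)" by (rule K)
  have *: "\<exists>b'\<in>B (p + q). m p q a b = b' +[K (p + q)] m p q x y" if a: "a \<in> cls p x" and b: "b \<in> cls q y" for a b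
  proof -
    obtain a' where a': "a' \<in> B p" "a = a' +[K p] x" using a by (auto simp: cls_mem)
    obtain b' where b': "b' \<in> B q" "b = b' +[K q] y" using b by (auto simp: cls_mem)
    have c: "a' .: (K p)" "x .: (K p)" "b' .: (K q)" "y .: (K q)"
      using a' b' x y B_closed Z_closed by auto
    have aZ: "a \<in> Z p" using a cls_sub_Z[OF x] by auto
    have e1: "m p q a b' \<in> B (p + q)" and e2: "m p q a' y \<in> B (p + q)"
      using m_ZB[OF aZ b'(1)] m_BZ[OF a'(1) y] by auto
    have "m p q a b = m p q a b' +[K (p + q)] m p q a y"
      using b' c Z_closed[OF aZ] by (simp add: m_add_right)
    also have "m p q a y = m p q a' y +[K (p + q)] m p q x y" using a' c by (simp add: m_add_left)
    also have "m p q a b' +[K (p + q)] (m p q a' y +[K (p + q)] m p q x y) =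
        (m p q a b' +[K (p + q)] m p q a' y) +[K (p + q)] m p q x y"
      using e1 e2 B_closed m_closed[OF c(2,4)] by (simp add: Kn.a_assoc)
    finally show ?thesis using B_props(3)[OF e1 e2] by blast
  qed
  have mc: "m p q x y .: (K (p + q))" using m_closed x y Z_closed by auto
  show ?thesis proof (intro equalityI subsetI)
    fix w assume "w \<in> ?L"
    then obtain b0 a b where w: "b0 \<in> B (p + q)" "a \<in> cls p x" "b \<in> cls q y" "w = b0 +[K (p + q)] m p q a b"
      by (auto simp: set_add_def set_mult_def)
    then obtain b' where b': "b' \<in> B (p + q)" "m p q a b = b' +[K (p + q)] m p q x y"
      using * by blast
    then have "w = (b0 +[K (p + q)] b') +[K (p + q)] m p q x y"
      using w B_closed mc by (simp add: Kn.a_assoc)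
    then show "w \<in> ?R" using B_props(3)[OF w(1) b'(1)] by (auto simp: cls_mem)
  next
    fix w assume "w \<in> ?R"
    then obtain b where "b \<in> B (p + q)" "w = b +[K (p + q)] m p q x y" by (auto simp: cls_mem)
    then show "w \<in> ?L" using cls_self[OF x] cls_self[OF y] by (auto simp: set_add_def set_mult_def)
  qed
qed

lemma ring_mult:
  assumes x: "\<And>p. x p \<in> Z p" and y: "\<And>p. y p \<in> Z p"
  shows "(\<Otimes>\<^bsub>H n\<^esub>p\<in>{..n}. B n <+>\<^bsub>K n\<^esub> {m p (n - p) a b | a b. a \<in> cls p (x p) \<and> b \<in> cls (n - p) (y (n - p))}) =
    cls n (\<Oplus>\<^bsub>K n\<^esub>p\<in>{..n}. m p (n - p) (x p) (y (n - p)))"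
    "(\<Oplus>\<^bsub>K n\<^esub>p\<in>{..n}. m p (n - p) (x p) (y (n - p))) \<in> Z n"
proof -
  interpret H: comm_group "H n" by (rule H_group)
  have mZ: "m p (n - p) (x p) (y (n - p)) \<in> Z n" if "p \<in> {..n}" for p
    using that m_ZZ[OF x[of p] y[of "n - p"]] by simp
  have e: "B n <+>\<^bsub>K n\<^esub> {m p (n - p) a b | a b. a \<in> cls p (x p) \<and> b \<in> cls (n - p) (y (n - p))} =
      cls n (m p (n - p) (x p) (y (n - p)))" if "p \<in> {..n}" for p
    using that cls_mult[OF x[of p] y[of "n - p"]] by simp
  have "(\<Otimes>\<^bsub>H n\<^esub>p\<in>{..n}. B n <+>\<^bsub>K n\<^esub> {m p (n - p) a b | a b. a \<in> cls p (x p) \<and> b \<in> cls (n - p) (y (n - p))}) =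
      (\<Otimes>\<^bsub>H n\<^esub>p\<in>{..n}. cls n (m p (n - p) (x p) (y (n - p))))"
    by (rule H.finprod_cong') (use e mZ in \<open>auto simp: H_simps(1)\<close>)
  also have "... = cls n (\<Oplus>\<^bsub>K n\<^esub>p\<in>{..n}. m p (n - p) (x p) (y (n - p)))"
    by (rule cls_finsum(1)[OF mZ])
  finally show "(\<Otimes>\<^bsub>H n\<^esub>p\<in>{..n}. B n <+>\<^bsub>K n\<^esub> {m p (n - p) a b | a b. a \<in> cls p (x p) \<and> b \<in> cls (n - p) (y (n - p))}) =
    cls n (\<Oplus>\<^bsub>K n\<^esub>p\<in>{..n}. m p (n - p) (x p) (y (n - p)))" .
  show "(\<Oplus>\<^bsub>K n\<^esub>p\<in>{..n}. m p (n - p) (x p) (y (n - p))) \<in> Z n" by (rule cls_finsum(2)[OF mZ])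
qed

end

text \<open>The usual consequence of the Leibniz rule: if \<open>y\<close> is a cocycle, then
  \<open>(d e) y = d (e y)\<close>, and likewise on the other side up to the sign
  \<open>(-1)^p\<close>.\<close>

lemma cochain_ring_Leibniz:
  assumes K: "\<And>n. abelian_group (K n)" and d_ahom: "\<And>n. ahom (K n) (K (Suc n)) (d n)"
    and d_d: "\<And>n x. x .: (K n) ==> d (Suc n) (d n x) = 0[K (Suc (Suc n))]"
    and m_closed: "\<And>p q x y. x .: (K p) ==> y .: (K q) ==> m p q x y .: (K (p + q))"
    and m_add_left: "\<And>p q x x' y. x .: (K p) ==> x' .: (K p) ==> y .: (K q) ==>
      m p q (x +[K p] x') y = m p q x y +[K (p + q)] m p q x' y"
    and m_add_right: "\<And>p q x y y'. x .: (K p) ==> y .: (K q) ==> y' .: (K q) ==>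
      m p q x (y +[K q] y') = m p q x y +[K (p + q)] m p q x y'"
    and Leibniz: "\<And>p q x y. x .: (K p) ==> y .: (K q) ==>
      d (p + q) (m p q x y) = m (Suc p) q (d p x) y +[K (Suc (p + q))] sg (K (Suc (p + q))) p (m p (Suc q) x (d q y))"
    and u_Z: "u \<in> cocycles K d 0"
  shows "cochain_ring K d m u"
proof -
  have ml: "m p q 0[K p] y = 0[K (p + q)]" if "y .: (K q)" for p q y
    by (rule ahom_zero[OF K K, of p "p + q" "\<lambda>x. m p q x y"]) (use that in \<open>simp add: ahom_def m_closed m_add_left\<close>)
  have mr: "m p q x 0[K q] = 0[K (p + q)]" if "x .: (K p)" for p q x
    by (rule ahom_zero[OF K K, of q "p + q" "\<lambda>y. m p q x y"]) (use that in \<open>simp add: ahom_def m_closed m_add_right\<close>)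
  have z: "0[K n] .: (K n)" for n
    using abelian_monoid.zero_closed[OF abelian_group.axioms(1)[OF K]] .
  have dz: "d n 0[K n] = 0[K (Suc n)]" for n by (rule ahom_zero[OF K K d_ahom])
  show ?thesis proof (rule cochain_ring.intro[OF K d_ahom d_d m_closed m_add_left m_add_right])
    fix p q x y assume x: "x \<in> cocycles K d p" and y: "y \<in> cocycles K d q"
    interpret G: abelian_group "K (Suc (p + q))" by (rule K)
    show "m p q x y \<in> cocycles K d (p + q)"
      using x y Leibniz[of x p y q] ml[of y q "Suc p"] mr[of x p "Suc q"]
      by (simp add: cocycles_def m_closed G.sg_zero)
  next
    fix p q x y assume x: "x \<in> coboundaries K d p" and y: "y \<in> cocycles K d q"
    show "m p q x y \<in> coboundaries K d (p + q)" proof (cases p)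
      \<comment> \<open>Zero is the only coboundary in degree 0, so the product is zero, which is a
        coboundary in every degree.\<close>
      case 0
      then show ?thesis using x y ml[of y q 0] z[of q] dz
        by (cases q) (auto simp: coboundaries_def cocycles_def intro!: image_eqI[OF _ z])
    next
      case (Suc k)
      interpret G: abelian_group "K (Suc (k + q))" by (rule K)
      obtain e where e: "e .: (K k)" "x = d k e" using x Suc by (auto simp: coboundaries_def)
      have "d (k + q) (m k q e y) = m p q x y"
        using e y Suc Leibniz[of e k y q] mr[OF e(1), of "Suc q"] m_closed[OF ahom_closed[OF d_ahom e(1)], of y q]
        by (simp add: cocycles_def G.sg_zero)
      then show ?thesis
        using e y Suc m_closed[of e k y q] by (auto simp: coboundaries_def cocycles_def intro!: image_eqI[of _ _ "m k q e y"])
    qed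
  next
    fix p q x y assume x: "x \<in> cocycles K d p" and y: "y \<in> coboundaries K d q"
    show "m p q x y \<in> coboundaries K d (p + q)" proof (cases q)
      case 0
      then show ?thesis using x y mr[of x p 0] z[of p] dz
        by (cases p) (auto simp: coboundaries_def cocycles_def intro!: image_eqI[OF _ z])
    next
      case (Suc k)
      interpret G: abelian_group "K (Suc (p + k))" by (rule K)
      interpret G': abelian_group "K (p + k)" by (rule K)
      obtain e where e: "e .: (K k)" "y = d k e" using y Suc by (auto simp: coboundaries_def)
      have me: "m p k x e .: (K (p + k))" and mxy: "m p q x y \<in> carrier (K (Suc (p + k)))"
        using x e Suc m_closed[of x p e k] m_closed[of x p y "Suc k"] ahom_closed[OF d_ahom e(1)]
        by (auto simp: cocycles_def)
      have "d (p + k) (m p k x e) = sg (K (Suc (p + k))) p (m p q x y)"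
        using e x Suc Leibniz[of x p e k] ml[OF e(1), of "Suc p"] mxy
        by (simp add: cocycles_def G.sg_closed)
      \<comment> \<open>The sign \<open>(-1)^p\<close> is moved into the preimage.\<close>
      then have "d (p + k) (sg (K (p + k)) p (m p k x e)) = m p q x y"
        using ahom_sg[OF K K d_ahom me] mxy by (simp add: G.sg_sg_same)
      then show ?thesis
        using G'.sg_closed[OF me] Suc by (auto simp: coboundaries_def intro!: image_eqI[of _ _ "sg (K (p + k)) p (m p k x e)"])
    qed
  qed (simp_all add: u_Z)
qed

text \<open>\<Phi> is an injective map of complexes that need not be onto;
  \<open>\<Phi>_surj\<close> and \<open>\<Phi>_B\<close> say that it is onto and injective in
  cohomology. The laws of the source, from \<open>d d = 0\<close> to biadditivity of the product,
  are derived by applying the injective \<Phi> and computing in \<open>K'\<close>.\<close>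

locale cochain_ring_comparison = K': cochain_ring K' d' m' u'
  for K' :: "nat => ('l, 'y) ring_scheme" and d' m' u' +
  fixes K :: "nat => ('k, 'x) ring_scheme" and d :: "nat => 'k => 'k"
    and m :: "nat => nat => 'k => 'k => 'k" and u :: 'k and \<Phi> :: "nat => 'k => 'l"
  assumes Kg: "abelian_group (K n)" and da: "ahom (K n) (K (Suc n)) (d n)"
    and \<Phi>_ahom: "ahom (K n) (K' n) (\<Phi> n)" and \<Phi>_inj: "x .: (K n) ==> \<Phi> n x = 0[K' n] ==> x = 0[K n]"
    and \<Phi>_d: "x .: (K n) ==> \<Phi> (Suc n) (d n x) = d' n (\<Phi> n x)"
    and mc: "x .: (K p) ==> y .: (K q) ==> m p q x y .: (K (p + q))"
    and \<Phi>_m: "x .: (K p) ==> y .: (K q) ==> \<Phi> (p + q) (m p q x y) = m' p q (\<Phi> p x) (\<Phi> q y)"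
    and uc: "u .: (K 0)" and \<Phi>_u: "\<Phi> 0 u = u'" and \<Phi>_surj: "z' \<in> cocycles K' d' n ==>
      \<exists>z\<in>carrier (K n). \<exists>b\<in>coboundaries K' d' n. z' = b +[K' n] \<Phi> n z"
    and \<Phi>_B: "z \<in> cocycles K d n ==> \<Phi> n z \<in> coboundaries K' d' n ==> z \<in> coboundaries K d n"
begin

lemma \<Phi>c: "x .: (K n) ==> \<Phi> n x .: (K' n)"
  using ahom_closed[OF \<Phi>_ahom] .

lemma \<Phi>_eqD:
  assumes "x .: (K n)" "y .: (K n)" "\<Phi> n x = \<Phi> n y"
  shows "x = y"
proof -
  interpret G: abelian_group "K n" by (rule Kg)
  interpret G': abelian_group "K' n" by (rule K'.K)
  have "\<Phi> n (x -[K n] y) = 0[K' n]"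
    using ahom_minus[OF Kg K'.K \<Phi>_ahom assms(1,2)] assms \<Phi>c by (simp add: a_minus_def G'.r_neg)
  then have "x -[K n] y = 0[K n]" using assms by (intro \<Phi>_inj) (auto simp: a_minus_def)
  then show ?thesis using assms by (simp add: G.minus_eq_zero_iff)
qed

lemma \<Phi>_zero: "\<Phi> n 0[K n] = 0[K' n]" by (rule ahom_zero[OF Kg K'.K \<Phi>_ahom])

lemma Kzero: "0[K n] .: (K n)"
  using abelian_monoid.zero_closed[OF abelian_group.axioms(1)[OF Kg]] .

lemma \<Phi>_Z: "x .: (K n) ==> \<Phi> n x \<in> K'.Z n \<longleftrightarrow> x \<in> cocycles K d n"
  using \<Phi>_d[of x n] \<Phi>_inj[of "d n x" "Suc n"] ahom_closed[OF da, of x n] \<Phi>c[of x n]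
  by (auto simp: cocycles_def \<Phi>_zero)

lemma \<Phi>_B': "z \<in> coboundaries K d n ==> \<Phi> n z \<in> K'.B n"
proof (cases n)
  case (Suc k)
  assume "z \<in> coboundaries K d n"
  then obtain e where "e .: (K k)" "z = d k e" using Suc by (auto simp: coboundaries_def)
  then show ?thesis using Suc \<Phi>_d[of e k] \<Phi>c[of e k] by (auto simp: coboundaries_def)
qed (auto simp: coboundaries_def \<Phi>_zero)

lemma B_sub_carrier: "z \<in> coboundaries K d n ==> z .: (K n)"
  using Kzero ahom_closed[OF da] by (cases n) (auto simp: coboundaries_def)

lemma Z_sub_carrier: "z \<in> cocycles K d n ==> z .: (K n)" by (simp add: cocycles_def)

sublocale K: cochain_ring K d m u
proof (rule cochain_ring.intro[OF Kg da _ mc])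
  fix n x assume x: "x .: (K n)"
  show "d (Suc n) (d n x) = 0[K (Suc (Suc n))]"
    using x ahom_closed[OF da] by (intro \<Phi>_inj) (simp_all add: \<Phi>_d \<Phi>c K'.d_d)
next
  fix x p x' y q
  assume a: "x .: (K p)" "x' .: (K p)" "y .: (K q)"
  interpret G: abelian_group "K p" by (rule Kg)
  interpret G': abelian_group "K (p + q)" by (rule Kg)
  show "m p q (x +[K p] x') y = m p q x y +[K (p + q)] m p q x' y"
    by (rule \<Phi>_eqD[of _ "p + q"]) (use a in \<open>simp_all add: mc \<Phi>_m ahom_add[OF \<Phi>_ahom] \<Phi>c K'.m_add_left\<close>)
next
  fix x p y q y'
  assume a: "x .: (K p)" "y .: (K q)" "y' .: (K q)"
  interpret G: abelian_group "K q" by (rule Kg)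
  interpret G': abelian_group "K (p + q)" by (rule Kg)
  show "m p q x (y +[K q] y') = m p q x y +[K (p + q)] m p q x y'"
    by (rule \<Phi>_eqD[of _ "p + q"]) (use a in \<open>simp_all add: mc \<Phi>_m ahom_add[OF \<Phi>_ahom] \<Phi>c K'.m_add_right\<close>)
next
  fix x p y q assume x: "x \<in> cocycles K d p" and y: "y \<in> cocycles K d q"
  then have c: "x .: (K p)" "y .: (K q)" by (auto intro: Z_sub_carrier)
  have "m' p q (\<Phi> p x) (\<Phi> q y) \<in> K'.Z (p + q)" using x y c by (intro K'.m_ZZ) (simp_all add: \<Phi>_Z)
  then show "m p q x y \<in> cocycles K d (p + q)" using \<Phi>_Z[OF mc[OF c]] \<Phi>_m[OF c] by simp
next
  fix x p y q assume x: "x \<in> coboundaries K d p" and y: "y \<in> cocycles K d q"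
  then have c: "x .: (K p)" "y .: (K q)" by (auto intro: Z_sub_carrier B_sub_carrier)
  have "m' p q (\<Phi> p x) (\<Phi> q y) \<in> K'.B (p + q)"
    using x y c by (intro K'.m_BZ \<Phi>_B') (simp_all add: \<Phi>_Z)
  then have *: "\<Phi> (p + q) (m p q x y) \<in> K'.B (p + q)" using c by (simp add: \<Phi>_m)
  then have "m p q x y \<in> cocycles K d (p + q)" using K'.B_props(1) \<Phi>_Z[OF mc[OF c]] by blast
  then show "m p q x y \<in> coboundaries K d (p + q)" using * by (rule \<Phi>_B)
next
  fix x p y q assume x: "x \<in> cocycles K d p" and y: "y \<in> coboundaries K d q"
  then have c: "x .: (K p)" "y .: (K q)" by (auto intro: Z_sub_carrier B_sub_carrier)
  have "m' p q (\<Phi> p x) (\<Phi> q y) \<in> K'.B (p + q)"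
    using x y c by (intro K'.m_ZB \<Phi>_B') (simp_all add: \<Phi>_Z)
  then have *: "\<Phi> (p + q) (m p q x y) \<in> K'.B (p + q)" using c by (simp add: \<Phi>_m)
  then have "m p q x y \<in> cocycles K d (p + q)" using K'.B_props(1) \<Phi>_Z[OF mc[OF c]] by blast
  then show "m p q x y \<in> coboundaries K d (p + q)" using * by (rule \<Phi>_B)
next
  show "u \<in> cocycles K d 0" using K'.u_Z \<Phi>_Z[OF uc] by (simp add: \<Phi>_u)
qed simp_all

text \<open>The inverse of the map that \<Phi> induces in cohomology. As a preimage it sends a class
  to a class without a choice of representatives, and it has the direction that the final
  isomorphism asks for.\<close>

definition pull :: "nat => 'l set => 'k set" where "pull n X = {z \<in> K.Z n. \<Phi> n z \<in> X}"

lemma \<Phi>Z: "z \<in> K.Z n ==> \<Phi> n z \<in> K'.Z n"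
  using \<Phi>_Z Z_sub_carrier by blast

lemma cls'_\<Phi>_eq_iff:
  assumes z: "z \<in> K.Z n" and w: "w \<in> K.Z n"
  shows "K'.cls n (\<Phi> n z) = K'.cls n (\<Phi> n w) \<longleftrightarrow> K.cls n z = K.cls n w"
proof -
  interpret G: abelian_group "K n" by (rule Kg)
  have c: "w -[K n] z \<in> K.Z n" using z w K.Z_props by (simp add: a_minus_def)
  have "\<Phi> n w -[K' n] \<Phi> n z = \<Phi> n (w -[K n] z)"
    using z w Z_sub_carrier by (simp add: ahom_minus[OF Kg K'.K \<Phi>_ahom])
  then show ?thesis using z w \<Phi>_B[OF c] \<Phi>_B' by (auto simp: K'.cls_eq_iff K.cls_eq_iff \<Phi>Z)
qed

lemma pull_cls:
  assumes z: "z \<in> K.Z n"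
  shows "pull n (K'.cls n (\<Phi> n z)) = K.cls n z"
proof -
  have "w \<in> pull n (K'.cls n (\<Phi> n z)) \<longleftrightarrow> w \<in> K.cls n z" for w proof (cases "w \<in> K.Z n")
    case True
    have "\<Phi> n w \<in> K'.cls n (\<Phi> n z) \<longleftrightarrow> K'.cls n (\<Phi> n z) = K'.cls n (\<Phi> n w)"
      using K'.cls_iff[OF \<Phi>Z[OF z] \<Phi>Z[OF True]] K'.cls_eq_iff[OF \<Phi>Z[OF z] \<Phi>Z[OF True]] by simp
    also have "... \<longleftrightarrow> K.cls n z = K.cls n w" by (rule cls'_\<Phi>_eq_iff[OF z True])
    also have "... \<longleftrightarrow> w \<in> K.cls n z" using K.cls_iff[OF z True] K.cls_eq_iff[OF z True] by simp
    finally show ?thesis using True by (simp add: pull_def)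
  qed (use K.cls_sub_Z[OF z] in \<open>auto simp: pull_def\<close>)
  then show ?thesis by blast
qed

lemma H'_rep:
  assumes "X .: (K'.H n)"
  obtains z where "z \<in> K.Z n" "X = K'.cls n (\<Phi> n z)"
proof -
  interpret G': abelian_group "K' n" by (rule K'.K)
  obtain z' where z': "z' \<in> K'.Z n" "X = K'.cls n z'" using assms by (auto simp: K'.H_simps(1))
  obtain z b where z: "z .: (K n)" "b \<in> K'.B n" "z' = b +[K' n] \<Phi> n z"
    using \<Phi>_surj[OF z'(1)] by blast
  have c: "b .: (K' n)" "\<Phi> n z .: (K' n)" using z K'.B_closed \<Phi>c by auto
  have "\<Phi> n z = -[K' n] b +[K' n] z'" using c by (simp add: z(3) G'.r_neg1)
  then have Z: "\<Phi> n z \<in> K'.Z n"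
    using K'.Z_props(3)[OF _ z'(1)] K'.B_props(1)[of n] z(2) K'.B_props(4)[OF z(2)] by auto
  have "z' -[K' n] \<Phi> n z \<in> K'.B n" using z c by (simp add: a_minus_def G'.a_assoc G'.r_neg)
  then have "X = K'.cls n (\<Phi> n z)" using K'.cls_eq_iff[OF Z z'(1)] z'(2) by simp
  then show thesis using that Z \<Phi>_Z[OF z(1)] by blast
qed

lemma pull_bij: "bij_betw (pull n) (carrier (K'.H n)) (carrier (K.H n))"
proof (rule bij_betw_imageI)
  show "inj_on (pull n) (carrier (K'.H n))" proof (rule inj_onI)
    fix X Y assume X: "X .: (K'.H n)" and Y: "Y .: (K'.H n)" and eq: "pull n X = pull n Y"
    obtain z where z: "z \<in> K.Z n" "X = K'.cls n (\<Phi> n z)" using X by (rule H'_rep)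
    obtain w where w: "w \<in> K.Z n" "Y = K'.cls n (\<Phi> n w)" using Y by (rule H'_rep)
    show "X = Y" using eq z w by (simp add: pull_cls cls'_\<Phi>_eq_iff)
  qed
  have "X .: (K.H n)" if "X \<in> pull n ` carrier (K'.H n)" for X
    using that by (elim imageE H'_rep) (auto simp: pull_cls K.H_simps(1))
  moreover have "X \<in> pull n ` carrier (K'.H n)" if X: "X .: (K.H n)" for X proof -
    obtain z where z: "z \<in> K.Z n" "X = K.cls n z" using X by (auto simp: K.H_simps(1))
    then have "X = pull n (K'.cls n (\<Phi> n z))" "K'.cls n (\<Phi> n z) .: (K'.H n)"
      using \<Phi>Z by (auto simp: pull_cls K'.H_simps(1))
    then show ?thesis by blast
  qed
  ultimately show "pull n ` carrier (K'.H n) = carrier (K.H n)" by blast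
qed

lemma pull_one: "pull n 1[K'.H n] = 1[K.H n]"
  using pull_cls[OF K.Z_props(2)[of n]] by (simp add: \<Phi>_zero K.cls_zero K'.cls_zero K.H_simps(3) K'.H_simps(3))

lemma pull_add:
  assumes "X .: (K'.H n)" "Y .: (K'.H n)"
  shows "pull n (X *[K'.H n] Y) = pull n X *[K.H n] pull n Y"
proof -
  obtain z where z: "z \<in> K.Z n" "X = K'.cls n (\<Phi> n z)" using assms(1) by (rule H'_rep)
  obtain w where w: "w \<in> K.Z n" "Y = K'.cls n (\<Phi> n w)" using assms(2) by (rule H'_rep)
  have "X *[K'.H n] Y = K'.cls n (\<Phi> n (z +[K n] w))"
    using z w \<Phi>Z Z_sub_carrier by (simp add: K'.cls_add ahom_add[OF \<Phi>_ahom])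
  then show ?thesis using z w K.Z_props(3)[OF z(1) w(1)] by (simp add: pull_cls K.cls_add)
qed

text \<open>\<open>pull\<close> is applied in each degree. It preserves finite support because only
  the zero class is sent to zero, and it is multiplicative because every class on the side of
  \<open>K'\<close> has a representative in the image of \<Phi>, where \<Phi> respects
  products.\<close>

theorem cohomology_ring_iso:
  "\<exists>\<phi>. \<phi> \<in> graded_ring_iso (cohomology_ring K' d' m' u') (cohomology_ring K d m u)"
proof -
  define h where "h c = (\<lambda>n. pull n (c n))" for c :: "nat => 'l set"
  let ?E' = "{c. (\<forall>n. c n .: (K'.H n)) \<and> finite {n. c n \<noteq> 1[K'.H n]}}"
  let ?E = "{c. (\<forall>n. c n .: (K.H n)) \<and> finite {n. c n \<noteq> 1[K.H n]}}"
  have one': "1[K'.H n] .: (K'.H n)" for n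
    using comm_group.axioms(2)[OF K'.H_group, of n] by (simp add: group.is_monoid monoid.one_closed)
  have pc: "pull n X .: (K.H n)" if "X .: (K'.H n)" for n X
    using bij_betwE[OF pull_bij] that by blast
  have pone: "pull n X = 1[K.H n] \<longleftrightarrow> X = 1[K'.H n]" if "X .: (K'.H n)" for n X
    using inj_on_eq_iff[OF bij_betw_imp_inj_on[OF pull_bij] that one'] pull_one by metis
  have sup: "{n. h c n \<noteq> 1[K.H n]} = {n. c n \<noteq> 1[K'.H n]}" if "\<forall>n. c n .: (K'.H n)" for c
    using pone that by (simp add: h_def)
  have hc: "h c \<in> ?E" if "c \<in> ?E'" for c using that sup[of c] pc by (simp add: h_def)
  have h_inj: "inj_on h ?E'" proof (rule inj_onI)
    fix c e assume c: "c \<in> ?E'" and e: "e \<in> ?E'" and heq: "h c = h e"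
    have "c n = e n" for n proof (rule inj_onD[OF bij_betw_imp_inj_on[OF pull_bij[of n]]])
      show "pull n (c n) = pull n (e n)" using fun_cong[OF heq, of n] by (simp add: h_def)
    qed (use c e in simp_all)
    then show "c = e" ..
  qed
  have h_surj: "\<exists>c\<in>?E'. e = h c" if e: "e \<in> ?E" for e proof -
    have "\<forall>n. \<exists>X\<in>carrier (K'.H n). e n = pull n X"
      using e bij_betw_imp_surj_on[OF pull_bij] by blast
    then obtain c where c: "\<And>n. c n .: (K'.H n)" "\<And>n. e n = pull n (c n)" by metis
    then have "e = h c" by (auto simp: h_def)
    moreover have "c \<in> ?E'" using c(1) e sup[of c] \<open>e = h c\<close> by simp
    ultimately show ?thesis by blast
  qed
  let ?R' = "cohomology_ring K' d' m' u'" and ?R = "cohomology_ring K d m u"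
  have car: "carrier ?R' = ?E'" "carrier ?R = ?E" by (simp_all add: cohomology_ring_def Let_def)
  have hmult: "h (c *[?R'] e) = h c *[?R] h e" if c: "c \<in> ?E'" and e: "e \<in> ?E'" for c e proof
    fix n
    have "\<forall>n. \<exists>z. z \<in> K.Z n \<and> c n = K'.cls n (\<Phi> n z)" if "\<forall>n. c n .: (K'.H n)" for c
      using H'_rep[OF spec[OF that]] by (intro allI) (metis (no_types))
    from choice[OF this] have rep: "\<exists>x. \<forall>n. x n \<in> K.Z n \<and> c n = K'.cls n (\<Phi> n (x n))"
      if "\<forall>n. c n .: (K'.H n)" for c using that .
    from rep[of c] rep[of e] c e obtain x y where x': "\<forall>n. x n \<in> K.Z n \<and> c n = K'.cls n (\<Phi> n (x n))"
        and y': "\<forall>n. y n \<in> K.Z n \<and> e n = K'.cls n (\<Phi> n (y n))" by blast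
    note x = conjunct1[OF spec[OF x']] conjunct2[OF spec[OF x']]
      and y = conjunct1[OF spec[OF y']] conjunct2[OF spec[OF y']]
    let ?s = "\<Oplus>\<^bsub>K n\<^esub>p\<in>{..n}. m p (n - p) (x p) (y (n - p))"
    have mk: "m p (n - p) (x p) (y (n - p)) .: (K n)" if "p \<in> {..n}" for p
      using that mc[OF Z_sub_carrier[OF x(1)] Z_sub_carrier[OF y(1)], of p "n - p"] by simp
    interpret G': abelian_group "K' n" by (rule K'.K)
    have "\<Phi> n ?s = (\<Oplus>\<^bsub>K' n\<^esub>p\<in>{..n}. \<Phi> n (m p (n - p) (x p) (y (n - p))))"
      using mk by (intro ahom_finsum[OF Kg K'.K \<Phi>_ahom]) auto
    also have "... = (\<Oplus>\<^bsub>K' n\<^esub>p\<in>{..n}. m' p (n - p) (\<Phi> p (x p)) (\<Phi> (n - p) (y (n - p))))"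
    proof (rule G'.finsum_cong')
      have e: "\<Phi> n (m p (n - p) (x p) (y (n - p))) = m' p (n - p) (\<Phi> p (x p)) (\<Phi> (n - p) (y (n - p)))"
        if "p \<in> {..n}" for p
        using that \<Phi>_m[OF Z_sub_carrier[OF x(1)] Z_sub_carrier[OF y(1)], of p "n - p"] by simp
      then show "\<Phi> n (m p (n - p) (x p) (y (n - p))) = m' p (n - p) (\<Phi> p (x p)) (\<Phi> (n - p) (y (n - p)))"
        if "p \<in> {..n}" for p using that .
      show "(\<lambda>p. m' p (n - p) (\<Phi> p (x p)) (\<Phi> (n - p) (y (n - p)))) \<in> {..n} \<rightarrow> carrier (K' n)"
        using \<Phi>c[OF mk] e by auto
    qed simp
    finally have "\<Phi> n ?s = (\<Oplus>\<^bsub>K' n\<^esub>p\<in>{..n}. m' p (n - p) (\<Phi> p (x p)) (\<Phi> (n - p) (y (n - p))))" .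
    then have "(c *[?R'] e) n = K'.cls n (\<Phi> n ?s)"
      using K'.ring_mult(1)[of "\<lambda>p. \<Phi> p (x p)" "\<lambda>p. \<Phi> p (y p)" n] \<Phi>Z[OF x(1)] \<Phi>Z[OF y(1)]
      by (simp add: cohomology_ring_def Let_def x(2) y(2))
    then have "h (c *[?R'] e) n = K.cls n ?s"
      using K.ring_mult(2)[OF x(1) y(1)] by (simp add: h_def pull_cls)
    also have "... = (h c *[?R] h e) n" using K.ring_mult(1)[OF x(1) y(1), of n] x(1) y(1)
      by (simp add: cohomology_ring_def Let_def h_def x(2) y(2) pull_cls)
    finally show "h (c *[?R'] e) n = (h c *[?R] h e) n" .
  qed
  have hadd: "h (c +[?R'] e) = h c +[?R] h e" if c: "c \<in> ?E'" and e: "e \<in> ?E'" for c e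
    using c e by (simp add: cohomology_ring_def Let_def h_def pull_add)
  have hone: "h 1[?R'] = 1[?R]" proof
    fix n
    show "h 1[?R'] n = 1[?R] n" using pull_cls[OF K.u_Z] pull_one[of n]
      by (cases "n = 0") (simp_all add: cohomology_ring_def Let_def h_def \<Phi>_u flip: K.cls_def K'.cls_def)
  qed
  have "h \<in> ring_iso ?R' ?R" unfolding ring_iso_def ring_hom_def proof (intro CollectI conjI ballI)
    show "h \<in> carrier ?R' \<rightarrow> carrier ?R" unfolding car using hc by blast
    show "bij_betw h (carrier ?R') (carrier ?R)" unfolding car
    proof (rule bij_betw_imageI[OF h_inj])
      show "h ` ?E' = ?E" using hc h_surj by blast
    qed
  qed (use hmult hadd hone car in auto)
  moreover have "h ` gcomp ?R' n = gcomp ?R n" for n proof -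
    have g: "gcomp ?R' n = {c \<in> ?E'. \<forall>k. k \<noteq> n --> c k = 1[K'.H k]}"
      "gcomp ?R n = {c \<in> ?E. \<forall>k. k \<noteq> n --> c k = 1[K.H k]}"
      by (simp_all add: cohomology_ring_def Let_def)
    have iff: "h c k = 1[K.H k] \<longleftrightarrow> c k = 1[K'.H k]" if "c \<in> ?E'" for c k
      using that pone by (simp add: h_def)
    show ?thesis proof (intro equalityI subsetI)
      fix e assume "e \<in> h ` gcomp ?R' n"
      then obtain c where c: "c \<in> ?E'" "\<forall>k. k \<noteq> n --> c k = 1[K'.H k]" "e = h c"
        unfolding g by blast
      then show "e \<in> gcomp ?R n" unfolding g using hc[OF c(1)] iff[OF c(1)] by blast
    next
      fix e assume e: "e \<in> gcomp ?R n"
      then obtain c where c: "c \<in> ?E'" "e = h c" using h_surj[of e] unfolding g by blast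
      then have "c \<in> gcomp ?R' n" using e iff[OF c(1)] unfolding g by blast
      then show "e \<in> h ` gcomp ?R' n" using c(2) by blast
    qed
  qed
  ultimately show ?thesis unfolding graded_ring_iso_def by blast
qed

end

section \<open>Pairings of tensor powers\<close>

text \<open>The head index is summed innermost: in a nested value
  \<open>f_1 (a_1 f_2 (a_2 ...))\<close> the scalar that multiplies the head depends on the indices
  of the tail.\<close>

primrec fsum_lists :: "('g, 'w) ring_scheme => 'i set => nat => ('i list => 'g) => 'g" where
  "fsum_lists G J 0 g = g []"
| "fsum_lists G J (Suc n) g = fsum_lists G J n (\<lambda>is. \<Oplus>\<^bsub>G\<^esub>j\<in>J. g (j # is))"

definition lists_of :: "'i set => nat => 'i list set" where
  "lists_of J n = {is. set is \<subseteq> J \<and> length is = n}"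

lemma lists_of_simps [simp]: "[] \<in> lists_of J 0"
  "j # is \<in> lists_of J (Suc n) \<longleftrightarrow> j \<in> J \<and> is \<in> lists_of J n" by (auto simp: lists_of_def)

lemma (in abelian_group) fsum_lists_cong:
  "(\<And>is. is \<in> lists_of J n ==> g is = g' is) ==> (\<And>is. is \<in> lists_of J n ==> g' is .: G) ==>
    fsum_lists G J n g = fsum_lists G J n g'"
proof (induction n arbitrary: g g')
  case 0
  then show ?case by simp
next
  case (Suc n)
  have "fsum_lists G J n (\<lambda>is. \<Oplus>j\<in>J. g (j # is)) = fsum_lists G J n (\<lambda>is. \<Oplus>j\<in>J. g' (j # is))"
  proof (rule Suc.IH)
    show "(\<Oplus>j\<in>J. g (j # is)) = (\<Oplus>j\<in>J. g' (j # is))" if "is \<in> lists_of J n" for "is"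
      using Suc.prems that by (intro finsum_cong') auto
    show "(\<Oplus>j\<in>J. g' (j # is)) .: G" if "is \<in> lists_of J n" for "is"
      using Suc.prems that by (intro finsum_closed) auto
  qed
  then show ?case by simp
qed

lemma (in abelian_group) fsum_lists_closed:
  "(\<And>is. is \<in> lists_of J n ==> g is .: G) ==> fsum_lists G J n g .: G"
  by (induction n arbitrary: g) (auto intro!: finsum_closed)

lemma ahom_fsum_lists:
  assumes G: "abelian_group G" and H: "abelian_group H" and f: "ahom G H f"
  shows "(\<And>is. is \<in> lists_of J n ==> g is .: G) ==>
    f (fsum_lists G J n g) = fsum_lists H J n (\<lambda>is. f (g is))"
proof (induction n arbitrary: g)
  case 0
  then show ?case by simp
next
  case (Suc n)
  have "f (fsum_lists G J n (\<lambda>is. \<Oplus>\<^bsub>G\<^esub>j\<in>J. g (j # is))) = fsum_lists H J n (\<lambda>is. f (\<Oplus>\<^bsub>G\<^esub>j\<in>J. g (j # is)))"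
    using Suc.prems by (intro Suc.IH abelian_monoid.finsum_closed[OF abelian_group.axioms(1)[OF G]]) auto
  also have "... = fsum_lists H J n (\<lambda>is. \<Oplus>\<^bsub>H\<^esub>j\<in>J. f (g (j # is)))"
  proof (rule abelian_group.fsum_lists_cong[OF H])
    show "f (\<Oplus>\<^bsub>G\<^esub>j\<in>J. g (j # is)) = (\<Oplus>\<^bsub>H\<^esub>j\<in>J. f (g (j # is)))" if "is \<in> lists_of J n" for "is"
      using Suc.prems that by (intro ahom_finsum[OF G H f]) auto
    show "(\<Oplus>\<^bsub>H\<^esub>j\<in>J. f (g (j # is))) .: H" if "is \<in> lists_of J n" for "is"
      using Suc.prems that ahom_closed[OF f]
      by (intro abelian_monoid.finsum_closed[OF abelian_group.axioms(1)[OF H]]) auto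
  qed
  finally show ?case by simp
qed

text \<open>What is needed of \<open>A_+\<close> and of the positive part of its graded dual. No
  single finite family is dual on all of \<open>E\<close>, so there is a growing sequence of index
  sets, and each \<open>X\<close> is reproduced from some level on. That level must serve all
  multiples \<open>X c\<close>, because scalars from the tail of a tensor are absorbed into the head
  before it is expanded.\<close>

locale paired = P: bimodule R P + E: bimodule "op_ring R" E
  for R :: "('r, 'x) ring_scheme" and P :: "('r, 'p, 'y) bimodule_scheme"
    and E :: "('r, 'e, 'z) bimodule_scheme" +
  fixes e :: "'e => 'p => 'r" and I :: "nat => 'i set" and p :: "'i => 'p" and q :: "'i => 'e"
  assumes e_left: "v .: P ==> ahom E R (\<lambda>X. e X v)" and e_right: "X .: E ==> ahom P R (e X)"
    and e_smult: "s .: R ==> X .: E ==> v .: P ==> e (s .[E] X) v = e X v *[R] s"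
    and e_rsmult: "s .: R ==> X .: E ==> v .: P ==> e (X <[E] s) v = e X (v <[P] s)"
    and e_linear: "r .: R ==> X .: E ==> v .: P ==> e X (r .[P] v) = r *[R] e X v"
    and p_closed: "i \<in> I N ==> p i .: P" and q_closed: "i \<in> I N ==> q i .: E"
    and dual_bases: "X .: E ==> \<exists>N0. \<forall>N\<ge>N0. \<forall>c\<in>carrier R.
      X <[E] c = (\<Oplus>\<^bsub>E\<^esub>i\<in>I N. e X (p i <[P] c) .[E] q i)"
begin

abbreviation "TE n \<equiv> tpow (op_ring R) E n"
abbreviation "tp \<equiv> tpow_pure (op_ring R) E"

lemma e_closed: "X .: E ==> v .: P ==> e X v .: R"
  using ahom_closed[OF e_right] .

text \<open>The nested value \<open>f_1 (a_1 f_2 (... f_n (a_n t)))\<close>. The scalar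
  \<open>t\<close> at the end makes room for the value of a further block, so that concatenation
  becomes composition; the pairing proper is the case \<open>t = 1\<close>.\<close>

fun pr :: "'e list => 'p list => 'r => 'r" where "pr (f # fs) (a # as) t = e f (a <[P] pr fs as t)"
| "pr _ _ t = t"

lemma pr_closed: "fs <: E ==> as <: P ==> t .: R ==> pr fs as t .: R"
  by (induction fs as t rule: pr.induct) (auto intro: e_closed P.rsmult_closed)

lemma pr_append: "length fs = length as ==> pr (fs @ gs) (as @ bs) t = pr fs as (pr gs bs t)"
  by (induction fs as rule: list_induct2) simp_all

lemma pr_ahom: "length fs = length as ==> fs <: E ==> as <: P ==> ahom R R (pr fs as)"
proof (induction fs as rule: list_induct2)
  case (Cons f fs a as)
  then have "ahom P R (e f)" "ahom R P (\<lambda>t. a <[P] t)" "ahom R R (pr fs as)"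
    using e_right P.ahom_rsmult_right by auto
  then show ?case
    using ahom_comp[OF ahom_comp[of R R "pr fs as" P "\<lambda>t. a <[P] t"], of R "e f"] by simp
qed (simp add: ahom_def)

lemma splitE:
  assumes "length as = n + m"
  obtains bs cs where "as = bs @ cs" "length bs = n" "length cs = m" 
  using assms that[of "take n as" "drop n as"] by simp

text \<open>A scalar of the opposite ring on the left of a tensor multiplies its values from the
  right; this is where the coefficient \<open>r\<close> goes.\<close>

lemma pr_tmulti:
  assumes as: "as <: P" "length as = n" and t: "t .: R"
  shows "tmulti (op_ring R) E n R (\<lambda>(r, fs). pr fs as t *[R] r)"
proof (rule tmultiI, unfold prod.case op_ring_simps, goal_cases)
  case (1 r fs)
  show ?case using 1 as t pr_closed by simp
next
  case (2 r s fs)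
  show ?case using 2 as t pr_closed by (simp add: P.r_distr)
next
  case (3 r xs x y ys)
  show ?case proof -
    obtain bs b where b: "as = bs @ b" "length bs = length xs" "length b = Suc (length ys)"
      using as(2) 3 by (metis add_Suc_right splitE)
    then obtain a cs where a: "b = a # cs" by (cases b) auto
    have c: "a .: P" "bs <: P" "cs <: P" using as a b by auto
    have u: "a <[P] pr ys cs t .: P" using c 3 t pr_closed P.rsmult_closed by simp
    have "pr xs bs (e (x +[E] y) (a <[P] pr ys cs t)) =
        pr xs bs (e x (a <[P] pr ys cs t)) +[R] pr xs bs (e y (a <[P] pr ys cs t))"
      using ahom_add[OF e_left[OF u] 3(3,4)] ahom_add[OF pr_ahom, of xs bs] b c 3 e_closed u by simp
    then show ?thesis using b a c 3 pr_closed e_closed u by (simp add: pr_append P.l_distr)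
  qed
next
  case (4 r s x xs)
  show ?case proof -
    obtain a cs where a: "as = a # cs" using as(2) 4 by (cases as) auto
    show ?thesis using a 4 as t pr_closed e_closed P.rsmult_closed by (simp add: e_smult P.m_assoc)
  qed
next
  case (5 r s xs x y ys)
  show ?case proof -
    obtain bs b where b: "as = bs @ b" "length bs = length xs" "length b = Suc (Suc (length ys))"
      using as(2) 5 by (metis add_Suc_right splitE)
    then obtain a a' cs where a: "b = a # a' # cs" by (cases b; cases "tl b") auto
    have c: "a .: P" "a' .: P" "cs <: P" using as a b by auto
    have u: "a' <[P] pr ys cs t .: P" using c 5 t pr_closed P.rsmult_closed by simp
    show ?thesis using b a c 5 u e_closed P.rsmult_closed
      by (simp add: pr_append e_smult e_rsmult P.rsmult_assoc)
  qed
qed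

lemma pr_tmulti_right:
  assumes fs: "fs <: E" "length fs = n"
  shows "tmulti R P n R (\<lambda>(r, as). r *[R] pr fs as 1[R])"
proof (rule tmultiI, unfold prod.case, goal_cases)
  case (1 r as)
  show ?case using 1 fs pr_closed by simp
next
  case (2 r s as)
  show ?case using 2 fs pr_closed by (simp add: P.l_distr)
next
  case (3 r xs x y ys)
  show ?case proof -
    obtain bs b where b: "fs = bs @ b" "length bs = length xs" "length b = Suc (length ys)"
      using fs(2) 3 by (metis add_Suc_right splitE)
    then obtain f cs where f: "b = f # cs" by (cases b) auto
    have c: "f .: E" "bs <: E" "cs <: E" using fs f b by auto
    have u: "pr cs ys 1[R] .: R" using c 3 pr_closed by simp
    have "pr bs xs (e f ((x +[P] y) <[P] pr cs ys 1[R])) =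
        pr bs xs (e f (x <[P] pr cs ys 1[R])) +[R] pr bs xs (e f (y <[P] pr cs ys 1[R]))"
      using ahom_add[OF e_right[OF c(1)]] ahom_add[OF pr_ahom, of bs xs] b c 3 e_closed u
      by (simp add: P.rsmult_l_distr P.rsmult_closed)
    then show ?thesis
      using b f c 3 pr_closed e_closed u by (simp add: pr_append P.r_distr P.rsmult_closed)
  qed
next
  case (4 r s x xs)
  show ?case proof -
    obtain f cs where f: "fs = f # cs" using fs(2) 4 by (cases fs) auto
    show ?thesis
      using f 4 fs pr_closed e_closed by (simp add: e_linear P.m_assoc P.smult_rsmult P.rsmult_closed)
  qed
next
  case (5 r s xs x y ys)
  show ?case proof -
    obtain bs b where b: "fs = bs @ b" "length bs = length xs" "length b = Suc (Suc (length ys))"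
      using fs(2) 5 by (metis add_Suc_right splitE)
    then obtain f g cs where f: "b = f # g # cs" by (cases b; cases "tl b") auto
    have c: "f .: E" "g .: E" "cs <: E" using fs f b by auto
    have u: "pr cs ys 1[R] .: R" using c 5 pr_closed by simp
    show ?thesis using b f c 5 u e_closed P.rsmult_closed
      by (simp add: pr_append e_linear P.smult_rsmult flip: P.rsmult_assoc)
  qed
qed

definition evt :: "('r \<times> 'e list \<Rightarrow>\<^sub>0 int) set => 'p list => 'r => 'r" where
  "evt X as t = presented_lift R (\<lambda>(r, fs). pr fs as t *[R] r) X"

abbreviation "ev X as \<equiv> evt X as 1[R]"

lemma Rg: "abelian_group R"
  using P.R.is_abelian_group .

lemma evt_pure:
  assumes "r .: R" "fs <: E" "as <: P" "length fs = length as" "t .: R"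
  shows "evt (tp (r, fs)) as t = pr fs as t *[R] r"
  unfolding evt_def using E.tpow_lift_pure[OF Rg pr_tmulti, of as "length as" t r fs] assms by simp

lemma evt_ahom: "as <: P ==> length as = n ==> t .: R ==> ahom (TE n) R (\<lambda>X. evt X as t)"
  unfolding evt_def by (rule E.tpow_lift_ahom[OF Rg pr_tmulti])

lemma evt_closed: "X .: (TE n) ==> as <: P ==> length as = n ==> t .: R ==> evt X as t .: R"
  using ahom_closed[OF evt_ahom] by simp

lemma ev_tmulti:
  assumes "X .: (TE n)"
  shows "tmulti R P n R (\<lambda>(r, as). r *[R] ev X as)"
  using assms
proof (induction rule: E.tpow_induct)
  case zero
  have "tmulti R P n R (\<lambda>_. 0[R])" by (rule tmultiI) simp_all
  then show ?case by (rule P.tmulti_cong) (simp add: ahom_zero[OF E.tpow_group Rg evt_ahom])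
next
  case (pure r fs)
  have "ahom R R (\<lambda>x. x *[R] r)" using pure by (intro ahomI) (simp_all add: P.l_distr)
  from tmulti_ahom_comp[OF pr_tmulti_right[OF pure(2,3)] this] show ?case
    by (rule P.tmulti_cong) (use pure pr_closed in \<open>simp add: evt_pure P.m_assoc\<close>)
next
  case (add X Y)
  have "tmulti R P n R (\<lambda>g. \<Oplus>\<^bsub>R\<^esub>i\<in>{..<2::nat}. (\<lambda>(r, as). r *[R] ev (if i = 0 then X else Y) as) g)"
    using add by (intro P.tmulti_sum[OF Rg]) auto
  then show ?case proof (rule P.tmulti_cong)
    fix r as assume "r .: R" "as <: P" "length as = n"
    then show "(case (r, as) of (r, as) => r *[R] ev (X +[TE n] Y) as) =
        (\<Oplus>\<^bsub>R\<^esub>i\<in>{..<2::nat}. (case (r, as) of (r, as) => r *[R] ev (if i = 0 then X else Y) as))"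
      using add evt_closed by (simp add: ahom_add[OF evt_ahom] P.r_distr numeral_2_eq_2 lessThan_Suc P.R.a_comm)
  qed
next
  case (neg X)
  from tmulti_ahom_comp[OF neg(2) ahom_uminus[OF Rg ahomI[of R "\<lambda>x. x"]]] show ?case
    by (rule P.tmulti_cong) (use neg evt_closed in \<open>simp_all add: ahom_neg[OF E.tpow_group Rg evt_ahom] P.r_minus\<close>)
qed

definition good :: "nat => 'e => bool" where
  "good N X \<longleftrightarrow> (\<forall>c\<in>carrier R. X <[E] c = (\<Oplus>\<^bsub>E\<^esub>i\<in>I N. e X (p i <[P] c) .[E] q i))"

lemma map_pq:
  "is \<in> lists_of (I N) n ==> set (map p is) \<subseteq> carrier P" "is \<in> lists_of (I N) n ==> set (map q is) \<subseteq> carrier E"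
  "is \<in> lists_of (I N) n ==> length is = n" using p_closed q_closed by (auto simp: lists_of_def)

abbreviation "expansion N n X \<equiv>
  fsum_lists (TE n) (I N) n (\<lambda>is. tp (ev X (map p is), map q is))"

text \<open>The tail is expanded first. The scalar obtained in front of it passes to the head
  \<open>f\<close> as a right multiple, to which the dual basis identity applies; the new scalar is
  then moved to the coefficient and is the value at the extended list of the
  \<open>p i\<close>.\<close>

lemma expand_pure: "\<lbrakk>r .: R; fs <: E; \<And>f. f \<in> set fs ==> good N f; n = length fs\<rbrakk> \<Longrightarrow>
    tp (r, fs) = expansion N n (tp (r, fs))"
proof (induction fs arbitrary: r n)
  case Nil
  then show ?case by (simp add: evt_pure)
next
  case (Cons f fs)
  define m where "m = length fs"
  note TM = E.tpow_pure_tmulti[where n = "Suc m"]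
  have f: "f .: E" "fs <: E" and r: "r .: R" and n: "n = Suc m" and gf: "good N f"
    using Cons.prems by (auto simp: m_def)
  have fc: "f <[E] s .: E" if "s .: R" for s using E.rsmult_closed f that by simp
  have hm: "tmulti (op_ring R) E m (TE (Suc m)) (\<lambda>(s, gs). tp (r, (f <[E] s) # gs))"
  proof (rule tmultiI, unfold prod.case, goal_cases)
    case (1 s gs)
    show ?case using 1 r fc by (intro E.tpow_pure_closed) auto
  next
    case (2 s t gs)
    show ?case
      using 2 r fc f tmulti_slot[OF TM, of r "[]" "f <[E] s" "f <[E] t" gs] E.rsmult_r_distr[of s t f] by simp
  next
    case (3 s xs x y ys)
    show ?case using 3 r fc tmulti_slot[OF TM, of r "(f <[E] s) # xs" x y ys] by simp
  next
    case (4 s t x xs)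
    show ?case
      using 4 r f fc tmulti_bal[OF TM, of r t "[]" "f <[E] s" x xs] E.rsmult_assoc[of s t f] by simp
  next
    case (5 s t xs x y ys)
    show ?case using 5 r fc tmulti_bal[OF TM, of r t "(f <[E] s) # xs" x y ys] by simp
  qed
  \<comment> \<open>\<open>h\<close> puts \<open>f\<close> in front of a tensor and lets
    \<open>f\<close> absorb its coefficient from the right.\<close>
  define h where "h = presented_lift (TE (Suc m)) (\<lambda>(s, gs). tp (r, (f <[E] s) # gs))"
  have h: "ahom (TE m) (TE (Suc m)) h"
    unfolding h_def by (rule E.tpow_lift_ahom[OF E.tpow_group hm])
  have hp: "h (tp (s, gs)) = tp (r, (f <[E] s) # gs)" if "s .: R" "gs <: E" "length gs = m" for s gs
    using E.tpow_lift_pure[OF E.tpow_group hm, of s gs] that by (simp add: h_def)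
  have one: "tp (1[R], fs) .: (TE m)" using f m_def by (intro E.tpow_pure_closed) auto
  note ec = evt_closed[OF one]
  have ex: "tp (1[R], fs) = expansion N m (tp (1[R], fs))"
    using Cons.prems m_def by (intro Cons.IH) auto
  have tc: "tp (ev (tp (1[R], fs)) (map p is), map q is) .: (TE m)" if "is \<in> lists_of (I N) m" for "is"
    using ec map_pq[OF that] by (intro E.tpow_pure_closed) auto
  have one_r: "f <[E] 1[R] = f" using E.rsmult_one[of f] f by simp
  have key: "h (tp (ev (tp (1[R], fs)) (map p is), map q is)) =
      (\<Oplus>\<^bsub>TE (Suc m)\<^esub>j\<in>I N. tp (ev (tp (r, f # fs)) (map p (j # is)), map q (j # is)))"
    and kc: "(\<Oplus>\<^bsub>TE (Suc m)\<^esub>j\<in>I N. tp (ev (tp (r, f # fs)) (map p (j # is)), map q (j # is))) .: (TE (Suc m))"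
    if "is": "is \<in> lists_of (I N) m" for "is"
  proof -
    let ?c = "ev (tp (1[R], fs)) (map p is)"
    note m = map_pq[OF "is"]
    have c: "?c .: R" using ec m by simp
    have c': "?c = pr fs (map p is) 1[R]"
      using evt_pure[of "1[R]" fs "map p is" "1[R]"] f m m_def pr_closed by simp
    have gc: "(\<lambda>i. e f (p i <[P] ?c) .[E] q i) \<in> I N \<rightarrow> carrier E"
      using c f e_closed p_closed q_closed P.rsmult_closed E.smult_closed by simp
    have sl: "ahom E (TE (Suc m)) (\<lambda>x. tp (r, x # map q is))"
      using tmulti_slot_ahom[OF TM, of r "[]" "map q is"] r m by simp
    have "h (tp (?c, map q is)) = tp (r, (f <[E] ?c) # map q is)" using hp c m by simp
    also have "f <[E] ?c = (\<Oplus>\<^bsub>E\<^esub>i\<in>I N. e f (p i <[P] ?c) .[E] q i)" using gf c by (simp add: good_def)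
    also have "tp (r, (\<Oplus>\<^bsub>E\<^esub>i\<in>I N. e f (p i <[P] ?c) .[E] q i) # map q is) =
        (\<Oplus>\<^bsub>TE (Suc m)\<^esub>i\<in>I N. tp (r, (e f (p i <[P] ?c) .[E] q i) # map q is))"
      by (rule ahom_finsum[OF E.M.abelian_group_axioms E.tpow_group sl gc])
    finally have 1: "h (tp (?c, map q is)) =
        (\<Oplus>\<^bsub>TE (Suc m)\<^esub>i\<in>I N. tp (r, (e f (p i <[P] ?c) .[E] q i) # map q is))" .
    have 2: "tp (r, (e f (p j <[P] ?c) .[E] q j) # map q is) = tp (ev (tp (r, f # fs)) (map p (j # is)), map q (j # is))"
      if j: "j \<in> I N" for j
    proof -
      have k: "e f (p j <[P] ?c) .: R" using c f e_closed p_closed[OF j] P.rsmult_closed by simp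
      have "ev (tp (r, f # fs)) (map p (j # is)) = e f (p j <[P] ?c) *[R] r"
        using evt_pure[of r "f # fs" "map p (j # is)" "1[R]"] r f m p_closed[OF j] m_def c' by simp
      then show ?thesis
        using tmulti_head[OF TM, of r "e f (p j <[P] ?c)" "q j" "map q is"] r k q_closed[OF j] m by simp
    qed
    have 3: "tp (r, (e f (p j <[P] ?c) .[E] q j) # map q is) .: (TE (Suc m))" if j: "j \<in> I N" for j
      using ahom_closed[OF sl] gc j by blast
    interpret TS: abelian_group "TE (Suc m)" by (rule E.tpow_group)
    have 4: "(\<Oplus>\<^bsub>TE (Suc m)\<^esub>i\<in>I N. tp (r, (e f (p i <[P] ?c) .[E] q i) # map q is)) =
        (\<Oplus>\<^bsub>TE (Suc m)\<^esub>j\<in>I N. tp (ev (tp (r, f # fs)) (map p (j # is)), map q (j # is)))"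
      by (rule TS.finsum_cong'[OF refl]) (use 2 3 in auto)
    show "h (tp (?c, map q is)) =
        (\<Oplus>\<^bsub>TE (Suc m)\<^esub>j\<in>I N. tp (ev (tp (r, f # fs)) (map p (j # is)), map q (j # is)))"
      using 1 4 by simp
    show "(\<Oplus>\<^bsub>TE (Suc m)\<^esub>j\<in>I N. tp (ev (tp (r, f # fs)) (map p (j # is)), map q (j # is))) .: (TE (Suc m))"
      unfolding 4[symmetric] by (rule TS.finsum_closed) (use 3 in auto)
  qed
  have "tp (r, f # fs) = h (tp (1[R], fs))" using hp[of "1[R]" fs] f m_def one_r by simp
  also have "... = h (expansion N m (tp (1[R], fs)))" using ex by simp
  also have "... = fsum_lists (TE (Suc m)) (I N) m (\<lambda>is. h (tp (ev (tp (1[R], fs)) (map p is), map q is)))"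
    by (rule ahom_fsum_lists[OF E.tpow_group E.tpow_group h tc])
  also have "... = fsum_lists (TE (Suc m)) (I N) m
      (\<lambda>is. \<Oplus>\<^bsub>TE (Suc m)\<^esub>j\<in>I N. tp (ev (tp (r, f # fs)) (map p (j # is)), map q (j # is)))"
    by (rule abelian_group.fsum_lists_cong[OF E.tpow_group]) (use key kc in simp_all)
  finally show ?case by (simp add: n)
qed

lemma ex_good: "fs <: E ==> \<exists>N0. \<forall>N\<ge>N0. \<forall>f\<in>set fs. good N f"
proof (induction fs)
  case (Cons f fs)
  then obtain N1 where "\<forall>N\<ge>N1. \<forall>f\<in>set fs. good N f" by auto
  moreover obtain N2 where "\<forall>N\<ge>N2. good N f"
    using dual_bases[of f] Cons.prems unfolding good_def by auto
  ultimately have "\<forall>N\<ge>max N1 N2. \<forall>f\<in>set (f # fs). good N f" by simp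
  then show ?case ..
qed simp

lemma expansion_ahom: "ahom (TE n) (TE n) (expansion N n)"
proof -
  interpret TS: abelian_group "TE n" by (rule E.tpow_group)
  have g: "ahom (TE n) (TE n) (\<lambda>X. tp (ev X (map p is), map q is))" if "is \<in> lists_of (I N) n" for "is"
  proof -
    have 1: "ahom (TE n) R (\<lambda>X. ev X (map p is))" using map_pq[OF that] by (intro evt_ahom) simp_all
    have 2: "ahom R (TE n) (\<lambda>r. tp (r, map q is))"
      using tmulti_closed[OF E.tpow_pure_tmulti, of _ "map q is" n] tmulti_add[OF E.tpow_pure_tmulti, of _ _ "map q is" n]
        map_pq[OF that] by (intro ahomI) simp_all
    show ?thesis by (rule ahom_comp[OF 1 2])
  qed
  have "ahom (TE n) (TE n) (\<lambda>X. fsum_lists (TE n) J m (\<lambda>is. g X is))"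
    if "\<And>is. is \<in> lists_of J m ==> ahom (TE n) (TE n) (\<lambda>X. g X is)" for J m and g :: "_ => 'i list => _"
    using that
  proof (induction m arbitrary: g)
    case (Suc m)
    have "ahom (TE n) (TE n) (\<lambda>X. fsum_lists (TE n) J m (\<lambda>is. \<Oplus>\<^bsub>TE n\<^esub>j\<in>J. g X (j # is)))"
      using Suc.prems by (intro Suc.IH ahom_sum[OF E.tpow_group]) simp
    then show ?case by simp
  qed simp
  from this[OF g] show ?thesis by simp
qed

text \<open>The expansion is additive in \<open>X\<close>, so it is enough to know it for pure
  tensors; for a sum the larger of the two levels serves both summands.\<close>

lemma expand:
  assumes "X .: (TE n)"
  shows "\<exists>N0. \<forall>N\<ge>N0. X = expansion N n X"
  using assms
proof (induction rule: E.tpow_induct)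
  case zero
  then show ?case using ahom_zero[OF E.tpow_group E.tpow_group expansion_ahom, of n] by simp
next
  case (pure r fs)
  then obtain N0 where "\<forall>N\<ge>N0. \<forall>f\<in>set fs. good N f" using ex_good by blast
  then show ?case using expand_pure[of r fs _ n] pure by (intro exI[of _ N0]) simp
next
  case (add X Y)
  then obtain N1 N2 where N: "\<forall>N\<ge>N1. X = expansion N n X" "\<forall>N\<ge>N2. Y = expansion N n Y" by blast
  have "\<forall>N\<ge>max N1 N2. X +[TE n] Y = expansion N n (X +[TE n] Y)"
    using N add(1,2) by (simp add: ahom_add[OF expansion_ahom])
  then show ?case ..
next
  case (neg X)
  then obtain N1 where N: "\<forall>N\<ge>N1. X = expansion N n X" by blast
  have "\<forall>N\<ge>N1. -[TE n] X = expansion N n (-[TE n] X)"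
    using N neg(1) by (simp add: ahom_neg[OF E.tpow_group E.tpow_group expansion_ahom])
  then show ?case ..
qed

text \<open>The coefficients in the expansion of \<open>X\<close> are its values at lists of the
  \<open>p i\<close>. Hence the pairing is nondegenerate on the side of \<open>E\<close>.\<close>

lemma ev_zeroD:
  assumes X: "X .: (TE n)" and z: "\<And>as. as <: P ==> length as = n ==> ev X as = 0[R]"
  shows "X = 0[TE n]"
proof -
  obtain N where N: "X = expansion N n X" using expand[OF X] by blast
  have "expansion N n X = expansion N n 0[TE n]"
  proof (rule abelian_group.fsum_lists_cong[OF E.tpow_group])
    fix "is" assume m: "is \<in> lists_of (I N) n"
    have "ev X (map p is) = 0[R]" "ev 0[TE n] (map p is) = 0[R]"
      using map_pq[OF m] z ahom_zero[OF E.tpow_group Rg evt_ahom, of "map p is" n] by simp_all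
    then show "tp (ev X (map p is), map q is) = tp (ev 0[TE n] (map p is), map q is)"
      "tp (ev 0[TE n] (map p is), map q is) .: (TE n)"
      using map_pq[OF m] by (auto intro!: E.tpow_pure_closed)
  qed
  then show ?thesis using N ahom_zero[OF E.tpow_group E.tpow_group expansion_ahom, of n N] by simp
qed

lemma ev_eqI:
  assumes X: "X .: (TE n)" and Y: "Y .: (TE n)"
    and eq: "\<And>as. as <: P ==> length as = n ==> ev X as = ev Y as"
  shows "X = Y"
proof -
  interpret TS: abelian_group "TE n" by (rule E.tpow_group)
  have "X -[TE n] Y = 0[TE n]" proof (rule ev_zeroD)
    fix as assume "as <: P" "length as = n"
    then show "ev (X -[TE n] Y) as = 0[R]"
      using ahom_minus[OF E.tpow_group Rg evt_ahom, of as n "1[R]" X Y] X Y eq evt_closed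
      by (simp add: a_minus_def P.R.r_neg)
  qed (use X Y in simp)
  then show ?thesis using TS.minus_eq_zero_iff[OF X Y] by simp
qed

text \<open>The values \<open>ev\<close> separate the elements of the tensor power, so relations
  between tensors may be tested on scalars. The well-definedness of concatenation and of the cobar
  differential is obtained in this way.\<close>

lemma tmulti_evI:
  assumes c: "\<And>r xs. r .: Q ==> xs <: M ==> length xs = n ==> F (r, xs) .: (TE k)"
    and t: "\<And>as. as <: P ==> length as = k ==> tmulti Q M n R (\<lambda>g. ev (F g) as)"
    and M: "bimodule Q M"
  shows "tmulti Q M n (TE k) F"
proof -
  interpret M: bimodule Q M by (rule M)
  interpret TS: abelian_group "TE k" by (rule E.tpow_group)
  show ?thesis proof (rule tmultiI, goal_cases)
    case (1 r xs)
    show ?case using c 1 .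
  next
    case (2 r s xs)
    show ?case
      by (rule ev_eqI[where n = k]) (use 2 c in \<open>simp_all add: ahom_add[OF evt_ahom] tmulti_add[OF t]\<close>)
  next
    case (3 r xs x y ys)
    show ?case
      by (rule ev_eqI[where n = k]) (use 3 c in \<open>simp_all add: ahom_add[OF evt_ahom] tmulti_slot[OF t]\<close>)
  next
    case (4 r s x xs)
    show ?case
      by (rule ev_eqI[where n = k]) (use 4 c M.smult_closed in \<open>simp_all add: tmulti_head[OF t]\<close>)
  next
    case (5 r s xs x y ys)
    show ?case
      by (rule ev_eqI[where n = k]) (use 5 c M.smult_closed M.rsmult_closed in \<open>simp_all add: tmulti_bal[OF t]\<close>)
  qed
qed

text \<open>The counterpart of \<open>expand_pure\<close> for the arguments: entries are replaced by
  their expansions from the right end, and the scalars travel left, into the entries of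
  \<open>xs\<close> or finally into the coefficient. That an entry may be replaced is a hypothesis
  on \<open>F\<close>: an element of high degree is not equal to its expansion, but it may be
  exchanged for it under a functional that ignores high degrees.\<close>

lemma expand_right:
  assumes F: "tmulti R P k R F" and ins: "\<And>r xs a ys. \<lbrakk>r .: R; xs <: P; a .: P; ys <: P;
      Suc (length xs + length ys) = k\<rbrakk> \<Longrightarrow>
      F (r, xs @ a # ys) = F (r, xs @ (\<Oplus>\<^bsub>P\<^esub>i\<in>I N. e (q i) a .[P] p i) # ys)"
  shows "\<lbrakk>r .: R; xs <: P; as <: P; length as = n; length xs + n = k\<rbrakk> \<Longrightarrow>
    F (r, xs @ as) = fsum_lists R (I N) n
      (\<lambda>is. F (fst (tpow_rscale R P (r, xs) (pr (map q is) as 1[R])),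
               snd (tpow_rscale R P (r, xs) (pr (map q is) as 1[R])) @ map p is))"
proof (induction as arbitrary: xs n)
  case Nil
  then show ?case by (cases xs rule: rev_cases) (simp_all add: P.rsmult_one)
next
  case (Cons a as)
  then obtain m where n: "n = Suc m" "length as = m" and ac: "a .: P" "as <: P" by auto
  note r = Cons.prems(1) and xs = Cons.prems(2)
  have 1: "F (r, (xs @ [a]) @ as) = fsum_lists R (I N) m
      (\<lambda>is. F (fst (tpow_rscale R P (r, xs @ [a]) (pr (map q is) as 1[R])),
               snd (tpow_rscale R P (r, xs @ [a]) (pr (map q is) as 1[R])) @ map p is))"
    by (rule Cons.IH) (use Cons.prems n in simp_all)
  define G where "G is j = F (fst (tpow_rscale R P (r, xs) (pr (map q (j # is)) (a # as) 1[R])),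
               snd (tpow_rscale R P (r, xs) (pr (map q (j # is)) (a # as) 1[R])) @ map p (j # is))" for "is" j
  have key: "F (r, xs @ (a <[P] pr (map q is) as 1[R]) # map p is) = (\<Oplus>\<^bsub>R\<^esub>j\<in>I N. G is j)"
    and kc: "(\<Oplus>\<^bsub>R\<^esub>j\<in>I N. G is j) .: R" if "is": "is \<in> lists_of (I N) m" for "is"
  proof -
    note m = map_pq[OF "is"]
    let ?b = "a <[P] pr (map q is) as 1[R]"
    have b: "?b .: P" using m ac pr_closed P.rsmult_closed by simp
    have len: "Suc (length xs + length (map p is)) = k" using m Cons.prems n by simp
    have gc: "(\<lambda>i. e (q i) ?b .[P] p i) \<in> I N \<rightarrow> carrier P"
      using b e_closed p_closed q_closed P.smult_closed by simp
    note sl = tmulti_slot_ahom[OF F r xs m(1) len]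
    have "F (r, xs @ ?b # map p is) = (\<Oplus>\<^bsub>R\<^esub>i\<in>I N. F (r, xs @ (e (q i) ?b .[P] p i) # map p is))"
      unfolding ins[OF r xs b m(1) len] by (rule ahom_finsum[OF P.M.abelian_group_axioms Rg sl gc])
    moreover have 2: "F (r, xs @ (e (q j) ?b .[P] p j) # map p is) = G is j" if j: "j \<in> I N" for j
    proof -
      have k: "e (q j) ?b .: R" using b e_closed q_closed[OF j] by simp
      show ?thesis proof (cases xs rule: rev_cases)
        case Nil
        then show ?thesis using tmulti_head[OF F r k p_closed[OF j] m(1)] len by (simp add: G_def)
      next
        case (snoc ys y)
        then show ?thesis
          using tmulti_bal[OF F r k _ _ p_closed[OF j] m(1), of ys y] len xs by (simp add: G_def)
      qed
    qed
    moreover have 3: "F (r, xs @ (e (q j) ?b .[P] p j) # map p is) .: R" if "j \<in> I N" for j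
      using ahom_closed[OF sl] gc that by blast
    moreover have "(\<Oplus>\<^bsub>R\<^esub>i\<in>I N. F (r, xs @ (e (q i) ?b .[P] p i) # map p is)) = (\<Oplus>\<^bsub>R\<^esub>j\<in>I N. G is j)"
      by (rule P.R.finsum_cong'[OF refl]) (use 2 3 in auto)
    ultimately show "F (r, xs @ ?b # map p is) = (\<Oplus>\<^bsub>R\<^esub>j\<in>I N. G is j)" "(\<Oplus>\<^bsub>R\<^esub>j\<in>I N. G is j) .: R"
      by (simp_all add: P.R.finsum_closed)
  qed
  have "F (r, xs @ a # as) = fsum_lists R (I N) m (\<lambda>is. \<Oplus>\<^bsub>R\<^esub>j\<in>I N. G is j)"
    unfolding 1[simplified] by (rule P.R.fsum_lists_cong) (use key kc in simp_all)
  then show ?case by (simp add: n G_def)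
qed

text \<open>The preimage of \<open>w\<close> is the sum, over lists of indices, of the tensors of
  the \<open>q i\<close> with coefficients \<open>w (map p is)\<close>.\<close>

lemma ev_surj:
  assumes F: "tmulti R P n R (\<lambda>(r, as). r *[R] w as)"
    and wc: "\<And>as. as <: P ==> length as = n ==> w as .: R"
    and ins: "\<And>xs a ys. \<lbrakk>xs <: P; a .: P; ys <: P;
      Suc (length xs + length ys) = n\<rbrakk> \<Longrightarrow>
      w (xs @ a # ys) = w (xs @ (\<Oplus>\<^bsub>P\<^esub>i\<in>I N. e (q i) a .[P] p i) # ys)"
  obtains X where "X .: (TE n)" "\<And>as. as <: P ==> length as = n ==> ev X as = w as"
proof
  let ?X = "fsum_lists (TE n) (I N) n (\<lambda>is. tp (w (map p is), map q is))"
  have tc: "tp (w (map p is), map q is) .: (TE n)" if "is \<in> lists_of (I N) n" for "is"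
    using wc map_pq[OF that] by (intro E.tpow_pure_closed) auto
  show "?X .: (TE n)" by (rule abelian_group.fsum_lists_closed[OF E.tpow_group tc])
  fix as assume as: "as <: P" "length as = n"
  have "ev ?X as = fsum_lists R (I N) n (\<lambda>is. ev (tp (w (map p is), map q is)) as)"
    using as by (intro ahom_fsum_lists[OF E.tpow_group Rg evt_ahom tc]) auto
  also have "... = fsum_lists R (I N) n (\<lambda>is. pr (map q is) as 1[R] *[R] w (map p is))"
  proof (rule P.R.fsum_lists_cong)
    fix "is" assume "is": "is \<in> lists_of (I N) n"
    show "ev (tp (w (map p is), map q is)) as = pr (map q is) as 1[R] *[R] w (map p is)"
      "pr (map q is) as 1[R] *[R] w (map p is) .: R"
      using map_pq[OF "is"] as evt_pure[of "w (map p is)" "map q is" as "1[R]"] wc pr_closed by auto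
  qed
  also have "... = fsum_lists R (I N) n (\<lambda>is. (\<lambda>(r, as). r *[R] w as)
      (fst (tpow_rscale R P (1[R], []) (pr (map q is) as 1[R])),
       snd (tpow_rscale R P (1[R], []) (pr (map q is) as 1[R])) @ map p is))"
    by (rule P.R.fsum_lists_cong) (use map_pq as pr_closed wc in simp_all)
  also have "... = (\<lambda>(r, as). r *[R] w as) (1[R], [] @ as)"
    by (rule expand_right[OF F, symmetric]) (use as ins in simp_all)
  also have "... = w as" using wc as by simp
  finally show "ev ?X as = w as" .
qed

lemma pr_snoc_rscale:
  "length fs = length as ==> fs <: E ==> as <: P ==> fs \<noteq> [] ==> s .: R ==> t .: R ==>
    pr (butlast fs @ [last fs <[E] s]) as t = pr fs as (t *[R] s)"
  "length fs = length as ==> as <: P ==> as \<noteq> [] ==> t .: R ==>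
    pr fs (butlast as @ [last as <[P] t]) 1[R] = pr fs as t" by (induction fs as rule: list_induct2)
    (auto simp: e_rsmult P.rsmult_assoc P.rsmult_closed P.rsmult_one)

lemma ev_snoc_rscale:
  assumes X: "X .: (TE n)" and as: "as <: P" "length as = n" "as \<noteq> []" and t: "t .: R"
  shows "ev X (butlast as @ [last as <[P] t]) = evt X as t"
proof (rule E.tpow_eqI[OF Rg _ _ _ X])
  have b: "set (butlast as @ [last as <[P] t]) \<subseteq> carrier P" "length (butlast as @ [last as <[P] t]) = n"
    using as t P.rsmult_closed[OF t, OF subsetD[OF as(1) last_in_set[OF as(3)]]] by (auto dest: in_set_butlastD)
  then show "ahom (TE n) R (\<lambda>X. ev X (butlast as @ [last as <[P] t]))" "ahom (TE n) R (\<lambda>X. evt X as t)"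
    using as t by (auto intro!: evt_ahom)
  show "ev (tp (r, fs)) (butlast as @ [last as <[P] t]) = evt (tp (r, fs)) as t"
    if "r .: (op_ring R)" "fs <: E" "length fs = n" for r fs
    using that as t b pr_snoc_rscale(2)[of fs as t] by (simp add: evt_pure)
qed

lemma evt_Nil: "X .: (TE 0) ==> t .: R ==> evt X [] t = t *[R] ev X []"
proof (rule E.tpow_eqI[OF Rg, where n = 0 and X = X])
  assume t: "t .: R"
  show "ahom (TE 0) R (\<lambda>X. evt X [] t)" using t by (intro evt_ahom) auto
  show "ahom (TE 0) R (\<lambda>X. t *[R] ev X [])"
    using ahom_comp[OF evt_ahom[of "[]" 0 "1[R]"] ahomI[of R "\<lambda>x. t *[R] x" R]] t by (simp add: P.r_distr)
  show "evt (tp (r, fs)) [] t = t *[R] ev (tp (r, fs)) []"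
    if "r .: (op_ring R)" "fs <: E" "length fs = 0" for r fs using that t by (simp add: evt_pure)
qed

text \<open>The value of the second tensor enters the first one as the scalar at its right end,
  which is what \<open>evt\<close> provides. Values are also how both nested lifts of
  \<open>tpow_concat\<close> are seen to be well defined.\<close>

lemma concat_ev:
  assumes X: "X .: (TE n)" and Y: "Y .: (TE m)"
  shows "tpow_concat (op_ring R) E n m X Y .: (TE (n + m))"
    and "\<lbrakk>as <: P; length as = n; bs <: P; length bs = m\<rbrakk> \<Longrightarrow>
      ev (tpow_concat (op_ring R) E n m X Y) (as @ bs) = evt X as (ev Y bs)"
proof -
  \<comment> \<open>The map of the inner lift in \<open>tpow_concat\<close>; the outer one is
    \<open>G\<close> below.\<close>
  define F where "F g = (\<lambda>(s, ys). let (r, xs) = tpow_rscale (op_ring R) E g s in tp (r, xs @ ys))" for g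
  have Fc: "F (r, xs) (s, ys) .: (TE (n + m))"
    and Fe: "\<lbrakk>as <: P; length as = n; bs <: P; length bs = m\<rbrakk> \<Longrightarrow>
      ev (F (r, xs) (s, ys)) (as @ bs) = pr xs as (pr ys bs 1[R] *[R] s) *[R] r"
    if "r .: R" "xs <: E" "length xs = n" "s .: R" "ys <: E" "length ys = m" for r xs s ys as bs
  proof -
    show "F (r, xs) (s, ys) .: (TE (n + m))" using that E.rsmult_closed[of s]
      by (cases xs rule: rev_cases) (auto simp: F_def intro!: E.tpow_pure_closed)
    assume *: "as <: P" "length as = n" "bs <: P" "length bs = m"
    show "ev (F (r, xs) (s, ys)) (as @ bs) = pr xs as (pr ys bs 1[R] *[R] s) *[R] r"
    proof (cases xs rule: rev_cases)
      case Nil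
      then show ?thesis
        using that * pr_closed[of ys bs "1[R]"] by (simp add: F_def evt_pure P.m_assoc)
    next
      case (snoc zs z)
      have "set (zs @ (z <[E] s) # ys) \<subseteq> carrier E" using that snoc E.rsmult_closed[of s z] by simp
      then have "ev (F (r, xs) (s, ys)) (as @ bs) = pr (butlast xs @ [last xs <[E] s]) as (pr ys bs 1[R]) *[R] r"
        using that * snoc pr_append[of "zs @ [z <[E] s]" as ys bs "1[R]"] by (simp add: F_def evt_pure)
      then show ?thesis
        using that * snoc pr_snoc_rscale(1)[of xs as s "pr ys bs 1[R]"] pr_closed[of ys bs "1[R]"] by simp
    qed
  qed
  have inner: "tmulti (op_ring R) E m (TE (n + m)) (F (r, xs))"
    if r: "r .: R" "xs <: E" "length xs = n" for r xs
  proof (rule tmulti_evI[OF _ _ E.bimodule_axioms])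
    show "F (r, xs) (s, ys) .: (TE (n + m))"
      if "s .: (op_ring R)" "ys <: E" "length ys = m" for s ys using Fc r that by simp
    fix cs assume cs: "cs <: P" "length cs = n + m"
    then obtain as bs where ab: "cs = as @ bs" "length as = n" "length bs = m" using splitE by blast
    have "ahom R R (\<lambda>u. pr xs as u *[R] r)"
      using ahom_comp[OF pr_ahom[of xs as] ahomI[of R "\<lambda>x. x *[R] r" R]] r ab cs by (simp add: P.l_distr)
    from tmulti_ahom_comp[OF pr_tmulti[of bs m "1[R]"] this]
    show "tmulti (op_ring R) E m R (\<lambda>g. ev (F (r, xs) g) cs)"
      by (rule E.tmulti_cong) (use ab cs r Fe in simp_all)
  qed
  define G where "G g = presented_lift (TE (n + m)) (F g) Y" for g
  have Gc: "G (r, xs) .: (TE (n + m))" if "r .: R" "xs <: E" "length xs = n" for r xs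
    unfolding G_def using ahom_closed[OF E.tpow_lift_ahom[OF E.tpow_group inner[OF that]] Y] .
  have Ge: "ev (G (r, xs)) (as @ bs) = pr xs as (ev Y bs) *[R] r"
    if r: "r .: R" "xs <: E" "length xs = n"
      and ab: "as <: P" "length as = n" "bs <: P" "length bs = m" for r xs as bs
    unfolding G_def
  proof (rule E.tpow_eqI[OF Rg _ _ _ Y])
    show "ahom (TE m) R (\<lambda>Y. ev (presented_lift (TE (n + m)) (F (r, xs)) Y) (as @ bs))"
      by (rule ahom_comp[OF E.tpow_lift_ahom[OF E.tpow_group inner[OF r]] evt_ahom]) (use ab in auto)
    have "ahom R R (\<lambda>u. pr xs as u *[R] r)"
      using ahom_comp[OF pr_ahom[of xs as] ahomI[of R "\<lambda>x. x *[R] r" R]] r ab by (simp add: P.l_distr)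
    from ahom_comp[OF evt_ahom[of bs m "1[R]"] this]
    show "ahom (TE m) R (\<lambda>Y. pr xs as (ev Y bs) *[R] r)" using ab by simp
    show "ev (presented_lift (TE (n + m)) (F (r, xs)) (tp (s, ys))) (as @ bs) = pr xs as (ev (tp (s, ys)) bs) *[R] r"
      if "s .: (op_ring R)" "ys <: E" "length ys = m" for s ys
      using E.tpow_lift_pure[OF E.tpow_group inner[OF r] that] that r ab by (simp add: evt_pure Fe)
  qed
  have outer: "tmulti (op_ring R) E n (TE (n + m)) G"
  proof (rule tmulti_evI[OF _ _ E.bimodule_axioms])
    show "G (r, xs) .: (TE (n + m))" if "r .: (op_ring R)" "xs <: E" "length xs = n" for r xs
      using Gc that by simp
    fix cs assume cs: "cs <: P" "length cs = n + m"
    then obtain as bs where ab: "cs = as @ bs" "length as = n" "length bs = m" using splitE by blast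
    have "tmulti (op_ring R) E n R (\<lambda>(r, fs). pr fs as (ev Y bs) *[R] r)"
      using ab cs Y evt_closed by (intro pr_tmulti) auto
    then show "tmulti (op_ring R) E n R (\<lambda>g. ev (G g) cs)"
      by (rule E.tmulti_cong) (use ab cs Ge in simp_all)
  qed
  have cc: "tpow_concat (op_ring R) E n m X Y = presented_lift (TE (n + m)) G X"
    unfolding tpow_concat_def G_def F_def by (simp add: Let_def case_prod_beta)
  show "tpow_concat (op_ring R) E n m X Y .: (TE (n + m))"
    unfolding cc using ahom_closed[OF E.tpow_lift_ahom[OF E.tpow_group outer] X] .
  assume ab: "as <: P" "length as = n" "bs <: P" "length bs = m"
  show "ev (tpow_concat (op_ring R) E n m X Y) (as @ bs) = evt X as (ev Y bs)" unfolding cc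
  proof (rule E.tpow_eqI[OF Rg _ _ _ X])
    show "ahom (TE n) R (\<lambda>X. ev (presented_lift (TE (n + m)) G X) (as @ bs))"
      by (rule ahom_comp[OF E.tpow_lift_ahom[OF E.tpow_group outer] evt_ahom]) (use ab in auto)
    have yc: "ev Y bs .: R" using evt_closed ab Y by simp
    then show "ahom (TE n) R (\<lambda>X. evt X as (ev Y bs))" using evt_ahom ab by simp
    show "ev (presented_lift (TE (n + m)) G (tp (r, xs))) (as @ bs) = evt (tp (r, xs)) as (ev Y bs)"
      if "r .: (op_ring R)" "xs <: E" "length xs = n" for r xs
      using E.tpow_lift_pure[OF E.tpow_group outer that] that ab yc by (simp add: evt_pure Ge)
  qed
qed

lemma pairing_bilin:
  assumes "a .: P" "b .: P"
  shows "bilin (op_ring R) E E R (\<lambda>(y, z). e y (a <[P] e z b))"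
proof (rule bilinI, unfold prod.case, goal_cases)
  case (1 y)
  show ?case
    using ahom_comp[OF ahom_comp[OF e_left[OF assms(2)] P.ahom_rsmult_right[OF assms(1)]] e_right[OF 1]] .
next
  case (2 z)
  show ?case using assms 2 by (intro e_left P.rsmult_closed e_closed)
next
  case (3 y r z)
  show ?case
    using 3 assms e_closed[OF 3(3) assms(2)] P.rsmult_closed by (simp add: e_smult e_rsmult P.rsmult_assoc)
qed

end

section \<open>From the cobar complex to the cochains of the bar complex\<close>

text \<open>\<open>cmp\<close> plays the reduced comultiplication of the graded dual, and
  \<open>cmp_pair\<close> says that it is dual to the multiplication of \<open>A_+\<close>.\<close>

locale bar_pairing = connected_graded_rring R A + pp: paired R "pos_part A" E e I p q
  for R :: "('r, 'x) ring_scheme" (structure)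
    and A :: "('r, 'a, 'y) graded_bimodule_scheme" (structure)
    and E :: "('r, 'e, 'z) bimodule_scheme" and e :: "'e => 'a => 'r"
    and I :: "nat => 'i set" and p :: "'i => 'a" and q :: "'i => 'e" +
  fixes cmp :: "'e => ('e \<times> 'e \<Rightarrow>\<^sub>0 int) set"
  assumes cmp_closed: "X .: E ==> cmp X .: (tensor (op_ring R) E E)"
    and cmp_pair: "X .: E ==> a .: (pos_part A) ==> b .: (pos_part A) ==>
      presented_lift R (\<lambda>(y, z). e y (a <[A] e z b)) (cmp X) = e X (a *[A] b)"
begin

definition \<Phi> :: "nat => ('r \<times> 'e list \<Rightarrow>\<^sub>0 int) set => (('r \<times> 'a list \<Rightarrow>\<^sub>0 int) set => 'r)" where
  "\<Phi> n X = (\<lambda>Y\<in>carrier (BT n). presented_lift R (\<lambda>(s, as). s *[R] pp.ev X as) Y)"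

lemma \<Phi>_closed: "X .: (pp.TE n) ==> \<Phi> n X .: (ECH n)"
  unfolding \<Phi>_def using pp.evt_closed by (intro ECH_lift pp.ev_tmulti) (simp_all add: R.m_assoc)

lemma \<Phi>_pure: "X .: (pp.TE n) ==> r .: R ==> as <: AP ==> length as = n ==>
    \<Phi> n X (bt (r, as)) = r *[R] pp.ev X as"
  using P.tpow_lift_pure[OF Rg pp.ev_tmulti, of X n r as] P.tpow_pure_closed[of r as n]
  by (simp add: \<Phi>_def)

lemma \<Phi>_one: "X .: (pp.TE n) ==> as <: AP ==> length as = n ==> \<Phi> n X (bt (1[R], as)) = pp.ev X as"
  using pp.evt_closed by (simp add: \<Phi>_pure)

lemma \<Phi>_ahom: "ahom (pp.TE n) (ECH n) (\<Phi> n)"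
proof (rule ahomI)
  interpret TE: abelian_group "pp.TE n" by (rule pp.E.tpow_group)
  interpret EC: abelian_group "ECH n" by (rule ECH_group)
  show "\<Phi> n X .: (ECH n)" if "X .: (pp.TE n)" for X using \<Phi>_closed that .
  show "\<Phi> n (X +[pp.TE n] Y) = \<Phi> n X +[ECH n] \<Phi> n Y" if "X .: (pp.TE n)" "Y .: (pp.TE n)" for X Y
    by (rule ECH_eqI[where n = n])
      (use that \<Phi>_closed in \<open>simp_all add: ECH_apply \<Phi>_one P.tpow_pure_closed ahom_add[OF pp.evt_ahom]\<close>)
qed

lemma \<Phi>_inj:
  assumes X: "X .: (pp.TE n)" and z: "\<Phi> n X = 0[ECH n]"
  shows "X = 0[pp.TE n]"
proof (rule pp.ev_zeroD[OF X])
  fix as assume "as <: AP" "length as = n"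
  then show "pp.ev X as = 0[R]"
    using \<Phi>_one[OF X, of as] by (simp add: z ECH_apply P.tpow_pure_closed)
qed

lemma \<Phi>_concat:
  assumes X: "X .: (pp.TE n)" and Y: "Y .: (pp.TE m)"
  shows "\<Phi> (n + m) (tpow_concat (op_ring R) E n m X Y) = ext_cup R A n m (\<Phi> n X) (\<Phi> m Y)"
proof (rule ECH_eqI)
  show "\<Phi> (n + m) (tpow_concat (op_ring R) E n m X Y) .: (ECH (n + m))"
    using \<Phi>_closed pp.concat_ev(1) X Y by blast
  show "ext_cup R A n m (\<Phi> n X) (\<Phi> m Y) .: (ECH (n + m))" using cup_closed \<Phi>_closed X Y by blast
  fix cs assume cs: "cs <: AP" "length cs = n + m"
  then obtain as bs where ab: "cs = as @ bs" "length as = n" "length bs = m"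
    using pp.splitE by blast
  have s: "as <: AP" "bs <: AP" using ab cs by auto
  have t: "pp.ev Y bs .: R" using pp.evt_closed Y s ab by simp
  have "ext_cup R A n m (\<Phi> n X) (\<Phi> m Y) (bt (1[R], cs)) = \<Phi> n X (bt (1[R], as) <[BT n] pp.ev Y bs)"
    using cup_pure[OF \<Phi>_closed[OF X] \<Phi>_closed[OF Y], of "1[R]" cs] cs ab s Y by (simp add: \<Phi>_one)
  also have "... = \<Phi> n X (bt (tpow_rscale R AP (1[R], as) (pp.ev Y bs)))"
    using s ab t by (simp add: P.tpow_rsmult_pure)
  \<comment> \<open>The value of \<open>Y\<close> multiplies the last entry of \<open>as\<close>
    from the right or, if \<open>n = 0\<close>, the coefficient.\<close>
  also have "... = pp.evt X as (pp.ev Y bs)" proof (cases as rule: rev_cases)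
    case Nil
    then show ?thesis
      using X ab t pp.evt_Nil[of X "pp.ev Y bs"] \<Phi>_pure[of X n "pp.ev Y bs" "[]"] by simp
  next
    case (snoc zs z)
    have "z <[A] pp.ev Y bs .: AP" using P.rsmult_closed[OF t, of z] s snoc by (simp add: pos_simps)
    then show ?thesis
      using pp.ev_snoc_rscale[OF X s(1) ab(2) _ t] \<Phi>_one[OF X, of "zs @ [z <[AP] pp.ev Y bs]"] snoc s ab
      by (simp add: pos_simps)
  qed
  finally show "\<Phi> (n + m) (tpow_concat (op_ring R) E n m X Y) (bt (1[R], cs)) =
      ext_cup R A n m (\<Phi> n X) (\<Phi> m Y) (bt (1[R], cs))"
    using \<Phi>_one[OF pp.concat_ev(1)[OF X Y] cs] pp.concat_ev(2)[OF X Y s(1) ab(2) s(2) ab(3)] ab by simp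
qed

lemma unit_closed: "pp.tp (1[R], []) .: (pp.TE 0)" by (rule pp.E.tpow_pure_closed) simp_all

lemma \<Phi>_unit: "\<Phi> 0 (pp.tp (1[R], [])) = ext_unit R A"
  by (rule ECH_eqI[OF \<Phi>_closed[OF unit_closed] ext_unit_closed])
    (simp add: \<Phi>_one[OF unit_closed] ext_unit_pure pp.evt_pure)

abbreviation "TEE \<equiv> tensor (op_ring R) E E"

sublocale EE: bimodule_pair "op_ring R" E E ..

definition split_at :: "nat => 'r \<times> 'e list => ('r \<times> 'e list \<Rightarrow>\<^sub>0 int) set" where
  "split_at i = (\<lambda>(r, xs). presented_lift (pp.TE (Suc (length xs)))
     (\<lambda>(y, z). pp.tp (r, take i xs @ [y, z] @ drop (Suc i) xs)) (cmp (xs ! i)))"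

text \<open>Written term by term as \<open>cobar_diff\<close>, with \<open>cmp\<close> for
  \<open>comult_pos\<close>, so that the two agree by unfolding.\<close>

definition codiff :: "nat => ('r \<times> 'e list \<Rightarrow>\<^sub>0 int) set => ('r \<times> 'e list \<Rightarrow>\<^sub>0 int) set" where
  "codiff n = (let T = pp.TE (Suc n) in presented_lift T (\<lambda>(r, xs).
     \<Oplus>\<^bsub>T\<^esub>i\<in>{..<n}. add_pow T ((-1) ^ i :: int)
       (presented_lift T (\<lambda>(y, z). pp.tp (r, take i xs @ [y, z] @ drop (Suc i) xs)) (cmp (xs ! i)))))"

lemma AP_rsmult: "a .: AP ==> r .: R ==> a <[A] r .: AP"
  using P.rsmult_closed[of r a] by (simp add: pos_simps)

lemma pair_bilin:
  assumes "a .: AP" "b .: AP"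
  shows "bilin (op_ring R) E E R (\<lambda>(y, z). e y (a <[A] e z b))"
  using pp.pairing_bilin[OF assms] by (simp add: pos_simps)

text \<open>Splitting the \<open>i\<close>-th tensor factor is dual to merging the entries
  \<open>i\<close> and \<open>i + 1\<close>. After the outer and inner factors of the nested value
  are peeled off, this is \<open>cmp_pair\<close>.\<close>

lemma split_at_props:
  assumes r: "r .: R" and xs: "xs <: E" "length xs = n" and i: "i < n"
  shows "split_at i (r, xs) .: (pp.TE (Suc n))" and "\<lbrakk>as <: AP; length as = Suc n\<rbrakk> \<Longrightarrow>
      pp.ev (split_at i (r, xs)) as = pp.pr xs (mrg A i as) 1[R] *[R] r"
proof -
  obtain ys x zs where x: "xs = ys @ x # zs" "length ys = i"
    using id_take_nth_drop[of i xs] i xs by (metis length_take min.absorb4)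
  have s: "ys <: E" "x .: E" "zs <: E" and n: "Suc (length ys + length zs) = n" using x xs by auto
  let ?g = "\<lambda>(y, z). pp.tp (r, ys @ y # z # zs)"
  note TM = pp.E.tpow_pure_tmulti[where n = "Suc n"]
  have g: "bilin (op_ring R) E E (pp.TE (Suc n)) ?g"
  proof (rule bilinI, unfold prod.case, goal_cases)
    case (1 y)
    show ?case using tmulti_slot_ahom[OF TM, of r "ys @ [y]" zs] r s 1 n by simp
  next
    case (2 z)
    show ?case using tmulti_slot_ahom[OF TM, of r ys "z # zs"] r s 2 n by simp
  next
    case (3 y t z)
    show ?case using tmulti_bal[OF TM, of r t ys y z zs] r s 3 n by simp
  qed
  have sp: "split_at i (r, xs) = presented_lift (pp.TE (Suc n)) ?g (cmp x)"
    using x xs nth_append_length[of ys x zs] by (simp add: split_at_def)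
  note la = EE.lift_ahom[OF pp.E.tpow_group g] and cx = cmp_closed[OF s(2)]
  show "split_at i (r, xs) .: (pp.TE (Suc n))" unfolding sp by (rule ahom_closed[OF la cx])
  assume as: "as <: AP" "length as = Suc n"
  then have "length as = length ys + Suc (Suc (length zs))" using n by simp
  then obtain bs b' where b': "as = bs @ b'" "length bs = length ys" "length b' = Suc (Suc (length zs))"
    by (rule pp.splitE)
  then obtain a b cs where b: "b' = a # b # cs" "length cs = length zs"
    by (cases b'; cases "tl b'") auto
  have c: "bs <: AP" "a .: AP" "b .: AP" "cs <: AP" using as b b' by auto
  \<comment> \<open>The value of the factors behind the split one; it is absorbed into the entry
    \<open>b\<close>, so that \<open>cmp_pair\<close> is used at \<open>a\<close> and
    \<open>b u\<close>.\<close>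
  define u where "u = pp.pr zs cs 1[R]"
  have u: "u .: R" unfolding u_def using c s by (intro pp.pr_closed) auto
  let ?h = "\<lambda>(y, z). e y (a <[A] e z (b <[A] u))"
  note hb = pair_bilin[OF c(2) AP_rsmult[OF c(3) u]]
  have "pp.ev (presented_lift (pp.TE (Suc n)) ?g (cmp x)) as = pp.pr ys bs (presented_lift R ?h (cmp x)) *[R] r"
  proof (rule EE.tensor_eqI[OF Rg _ _ _ cx])
    show "ahom TEE R (\<lambda>Z. pp.ev (presented_lift (pp.TE (Suc n)) ?g Z) as)"
      using as by (intro ahom_comp[OF la pp.evt_ahom]) auto
    have 1: "ahom R R (\<lambda>u. u *[R] r)" using r by (intro ahomI) (simp_all add: R.l_distr)
    have 2: "ahom R R (pp.pr ys bs)" using b' s c by (intro pp.pr_ahom) auto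
    show "ahom TEE R (\<lambda>Z. pp.pr ys bs (presented_lift R ?h Z) *[R] r)"
      by (rule ahom_comp[OF ahom_comp[OF EE.lift_ahom[OF Rg hb] 2] 1])
    fix y z assume yz: "y .: E" "z .: E"
    have "pp.ev (pp.tp (r, ys @ y # z # zs)) as = pp.pr (ys @ y # z # zs) as 1[R] *[R] r"
      using yz s r as n by (intro pp.evt_pure) auto
    then show "pp.ev (presented_lift (pp.TE (Suc n)) ?g (tensor_pure (op_ring R) E E y z)) as =
        pp.pr ys bs (presented_lift R ?h (tensor_pure (op_ring R) E E y z)) *[R] r"
      using EE.lift_pure[OF pp.E.tpow_group g yz] EE.lift_pure[OF Rg hb yz] b b'
      by (simp add: pp.pr_append u_def pos_simps)
  qed
  also have "presented_lift R ?h (cmp x) = e x ((a *[A] b) <[A] u)"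
    using cmp_pair[OF s(2) c(2) AP_rsmult[OF c(3) u]] mult_rsmult_right[OF u pos_closed pos_closed] c by simp
  also have "pp.pr ys bs ... = pp.pr xs (mrg A i as) 1[R]"
    using b b' x mrg_append_right[of A bs 0 "a # b # cs"] by (simp add: pp.pr_append u_def pos_simps)
  finally show "pp.ev (split_at i (r, xs)) as = pp.pr xs (mrg A i as) 1[R] *[R] r" unfolding sp .
qed

text \<open>On generators the values of the sum are alternating sums of pairings with merged lists.
  These are visibly multilinear, which by \<open>tmulti_evI\<close> shows that the lift is well
  defined, and they are at the same time the asserted formula.\<close>

lemma codiff_props:
  shows codiff_ahom: "ahom (pp.TE n) (pp.TE (Suc n)) (codiff n)"
    and codiff_ev: "\<lbrakk>X .: (pp.TE n); as <: AP; length as = Suc n\<rbrakk> \<Longrightarrow>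
      pp.ev (codiff n X) as = altsum R n (\<lambda>i. pp.ev X (mrg A i as))"
proof -
  let ?T = "pp.TE (Suc n)"
  define F where "F g = altsum ?T n (\<lambda>i. split_at i g)" for g
  interpret T: abelian_group ?T by (rule pp.E.tpow_group)
  have m: "set (mrg A i as) \<subseteq> carrier AP" "length (mrg A i as) = n"
    if "as <: AP" "length as = Suc n" "i < n" for as i
    using set_mrg[OF that(1)] length_mrg[of i as A] that by simp_all
  have Fc: "F (r, xs) .: ?T" if "r .: R" "xs <: E" "length xs = n" for r xs
    unfolding F_def using split_at_props(1)[OF that] by (rule T.altsum_closed)
  have Fe: "pp.ev (F (r, xs)) as = altsum R n (\<lambda>i. pp.pr xs (mrg A i as) 1[R] *[R] r)"
    if x: "r .: R" "xs <: E" "length xs = n" and as: "as <: AP" "length as = Suc n" for r xs as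
  proof -
    have "pp.ev (F (r, xs)) as = altsum R n (\<lambda>i. pp.ev (split_at i (r, xs)) as)"
      unfolding F_def using split_at_props(1)[OF x] as
      by (intro ahom_altsum[OF pp.E.tpow_group Rg pp.evt_ahom]) auto
    also have "... = altsum R n (\<lambda>i. pp.pr xs (mrg A i as) 1[R] *[R] r)"
      using split_at_props(2)[OF x _ as] pp.pr_closed m[OF as] x by (intro R.altsum_cong) auto
    finally show ?thesis .
  qed
  have Ft: "tmulti (op_ring R) E n ?T F" proof (rule pp.tmulti_evI[OF _ _ pp.E.bimodule_axioms])
    show "F (r, xs) .: ?T" if "r .: (op_ring R)" "xs <: E" "length xs = n" for r xs
      using Fc that by simp
    fix as assume as: "as <: AP" "length as = Suc n"
    have s: "ahom R R (sg R i)" for i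
      using ahom_sg_map[OF Rg, of R "\<lambda>x. x" i] by (simp add: ahom_def)
    have "tmulti (op_ring R) E n R (\<lambda>g. \<Oplus>\<^bsub>R\<^esub>i\<in>{..<n}. sg R i ((\<lambda>(r, xs). pp.pr xs (mrg A i as) 1[R] *[R] r) g))"
      using m[OF as] by (intro pp.E.tmulti_sum[OF Rg] tmulti_ahom_comp[OF pp.pr_tmulti s]) auto
    then show "tmulti (op_ring R) E n R (\<lambda>g. pp.ev (F g) as)" proof (rule pp.E.tmulti_cong)
      fix r xs assume x: "r .: (op_ring R)" "xs <: E" "length xs = n"
      show "pp.ev (F (r, xs)) as =
          (\<Oplus>\<^bsub>R\<^esub>i\<in>{..<n}. sg R i ((\<lambda>(r, xs). pp.pr xs (mrg A i as) 1[R] *[R] r) (r, xs)))"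
        using Fe[of r xs as] x as pp.pr_closed m[OF as] R.altsum_sg[of n "\<lambda>i. pp.pr xs (mrg A i as) 1[R] *[R] r"]
        by simp
    qed
  qed
  have cd: "codiff n X = presented_lift ?T (\<lambda>(r, xs). \<Oplus>\<^bsub>?T\<^esub>i\<in>{..<n}. add_pow ?T ((-1) ^ i :: int)
      (presented_lift ?T (\<lambda>(y, z). pp.tp (r, take i xs @ [y, z] @ drop (Suc i) xs)) (cmp (xs ! i)))) X" for X
    by (simp add: codiff_def Let_def)
  let ?F = "\<lambda>(r, xs). \<Oplus>\<^bsub>?T\<^esub>i\<in>{..<n}. add_pow ?T ((-1) ^ i :: int)
      (presented_lift ?T (\<lambda>(y, z). pp.tp (r, take i xs @ [y, z] @ drop (Suc i) xs)) (cmp (xs ! i)))"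
  have eq: "?F (r, xs) = F (r, xs)" if "length xs = n" for r xs
    using that by (simp add: F_def altsum_def split_at_def)
  have t: "tmulti (op_ring R) E n ?T ?F" using Ft by (rule pp.E.tmulti_cong) (rule eq)
  have a: "ahom (pp.TE n) ?T (\<lambda>X. codiff n X)"
    unfolding cd by (rule pp.E.tpow_lift_ahom[OF pp.E.tpow_group t])
  then show "ahom (pp.TE n) ?T (codiff n)" by simp
  assume X: "X .: (pp.TE n)" and as: "as <: AP" "length as = Suc n"
  show "pp.ev (codiff n X) as = altsum R n (\<lambda>i. pp.ev X (mrg A i as))"
  proof (rule pp.E.tpow_eqI[OF Rg _ _ _ X])
    show "ahom (pp.TE n) R (\<lambda>X. pp.ev (codiff n X) as)"
      using as by (intro ahom_comp[OF a pp.evt_ahom]) auto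
    show "ahom (pp.TE n) R (\<lambda>X. altsum R n (\<lambda>i. pp.ev X (mrg A i as)))"
      using m[OF as] by (intro ahom_altsum_map[OF Rg] pp.evt_ahom) auto
    fix r fs assume f: "r .: (op_ring R)" "fs <: E" "length fs = n"
    have "pp.ev (codiff n (pp.tp (r, fs))) as = pp.ev (F (r, fs)) as"
      using pp.E.tpow_lift_pure[OF pp.E.tpow_group t f] eq[OF f(3), of r] unfolding cd by simp
    also have "... = altsum R n (\<lambda>i. pp.pr fs (mrg A i as) 1[R] *[R] r)" using Fe f as by simp
    also have "... = altsum R n (\<lambda>i. pp.ev (pp.tp (r, fs)) (mrg A i as))"
      using f m[OF as] pp.pr_closed by (intro R.altsum_cong) (auto simp: pp.evt_pure)
    finally show "pp.ev (codiff n (pp.tp (r, fs))) as = altsum R n (\<lambda>i. pp.ev (pp.tp (r, fs)) (mrg A i as))" .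
  qed
qed

lemma \<Phi>_d:
  assumes X: "X .: (pp.TE n)"
  shows "\<Phi> (Suc n) (codiff n X) = ext_diff R A n (\<Phi> n X)"
proof (rule ECH_eqI)
  have c: "codiff n X .: (pp.TE (Suc n))" by (rule ahom_closed[OF codiff_ahom X])
  then show "\<Phi> (Suc n) (codiff n X) .: (ECH (Suc n))" by (rule \<Phi>_closed)
  show "ext_diff R A n (\<Phi> n X) .: (ECH (Suc n))" by (rule ext_diff_closed[OF \<Phi>_closed[OF X]])
  fix as assume as: "as <: AP" "length as = Suc n"
  have "pp.ev (codiff n X) as = altsum R n (\<lambda>i. \<Phi> n X (bt (1[R], mrg A i as)))"
    unfolding codiff_ev[OF X as] using set_mrg[OF as(1)] length_mrg[of _ as A] as X pp.evt_closed[OF X]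
    by (intro R.altsum_cong) (simp_all add: \<Phi>_one)
  then show "\<Phi> (Suc n) (codiff n X) (bt (1[R], as)) =
      ext_diff R A n (\<Phi> n X) (bt (1[R], as))"
    using \<Phi>_one[OF c as] ext_diff_pure[OF \<Phi>_closed[OF X], of "1[R]" as] as by simp
qed

end

section \<open>Truncation by internal degree\<close>

lemma list_splitE:
  assumes "length as = n + m"
  obtains bs cs where "as = bs @ cs" "length bs = n" "length cs = m"
  using assms that[of "take n as" "drop n as"] by simp

context connected_graded_rring
begin

text \<open>The index is the internal degree of the tensor. Every entry has positive degree, so a
  list of length \<open>n\<close> has internal degree at least \<open>n\<close>, and degree
  \<open>n\<close> forces all entries into \<open>A^1\<close>.\<close>

inductive homl :: "nat => 'a list => bool" where
  homl_Nil: "homl 0 []"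
| homl_Cons: "a \<in> hcomp A k ==> 0 < k ==> homl s as ==> homl (k + s) (a # as)"

lemma homl_APl: "homl s as ==> as \<in> APl (length as)"
  by (induction rule: homl.induct) (auto simp: APl_def intro: hcomp_pos)

lemma homl_append: "homl s as ==> homl t bs ==> homl (s + t) (as @ bs)"
  by (induction rule: homl.induct) (auto simp: add.assoc intro: homl.intros)

lemma homl_ConsE:
  assumes "homl s (a # as)"
  obtains k t where "s = k + t" "a \<in> hcomp A k" "0 < k" "homl t as" using assms by cases auto

lemma homl_mrg: "homl s as ==> Suc i < length as ==> homl s (mrg A i as)"
proof (induction i arbitrary: s as)
  case 0
  then obtain a b cs where "as = a # b # cs" by (cases as; cases "tl as") auto
  moreover from this 0(1) obtain k l t where "s = k + (l + t)" "a \<in> hcomp A k" "0 < k" "b \<in> hcomp A l" "homl t cs"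
    by (auto elim!: homl_ConsE)
  ultimately show ?case
    using homl_Cons[of "a *[A] b" "k + l" t cs] by (simp add: mult_degree add.assoc)
next
  case (Suc i)
  then obtain a cs where "as = a # cs" by (cases as) auto
  then show ?case using Suc by (auto elim!: homl_ConsE intro!: homl_Cons)
qed

lemma mlin_slot_ahom:
  assumes "mlin n w" "xs <: AP" "ys <: AP" "Suc (length xs + length ys) = n"
  shows "ahom AP R (\<lambda>x. w (xs @ x # ys))"
  using assms mlin_slot[OF assms(1)] by (intro ahomI mlin_closed'[OF assms(1)]) auto

text \<open>The entries are split into homogeneous parts one after the other; \<open>xs\<close> is
  the part of the list that has been treated.\<close>

lemma mlin_eq_homl:
  assumes w: "mlin n w" and v: "mlin n v" and eq: "\<And>s as. homl s as ==> length as = n ==> w as = v as"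
    and as: "as \<in> APl n"
  shows "w as = v as"
proof -
  have "w (xs @ as) = v (xs @ as)" if "homl s xs" "as <: AP" "length xs + length as = n" for s xs as
    using that
  proof (induction as arbitrary: s xs)
    case Nil
    then show ?case using eq[of s xs] by simp
  next
    case (Cons a as)
    have xs: "xs <: AP" using homl_APl[OF Cons.prems(1)] by (simp add: APl_def)
    have "a .: AP" using Cons.prems by simp
    then show ?case proof (induction rule: pos_induct)
      case (homog k a)
      have "homl (s + (k + 0)) (xs @ [a])"
        using homog by (intro homl_append[OF Cons.prems(1)] homl_Cons homl_Nil)
      from Cons.IH[OF this] show ?case using Cons.prems by simp
    next
      case (add a b)
      then show ?case
        using mlin_slot[OF w xs add(1,2), of as] mlin_slot[OF v xs add(1,2), of as] Cons.prems
        by (simp add: pos_simps)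
    qed
  qed
  from this[OF homl_Nil, of as] show ?thesis using as by (simp add: APl_def)
qed

definition degs :: "nat => nat => nat list set" where
  "degs n N = {ks. length ks = n \<and> sum_list ks \<le> N}"

lemma degs_le: "ks \<in> degs n N ==> k \<in> set ks ==> k \<le> N"
  using member_le_sum_list[of k ks] by (auto simp: degs_def)

lemma finite_degs: "finite (degs n N)"
proof (rule finite_subset)
  show "degs n N \<subseteq> {ks. set ks \<subseteq> {..N} \<and> length ks = n}" using degs_le by (auto simp: degs_def)
qed (simp add: finite_lists_length_eq)

text \<open>Precomposition with the projection of the tensor power to internal degrees at most
  \<open>N\<close>, as a finite sum over the degrees of the entries. Tuples that contain 0
  contribute nothing, since an element of \<open>A_+\<close> has no component in degree 0.\<close>

definition trunc :: "nat => ('a list => 'r) => 'a list => 'r" where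
  "trunc N w as = (\<Oplus>\<^bsub>R\<^esub>ks\<in>degs (length as) N. w (map2 (hproj A) ks as))"

lemma hproj_AP: "a .: AP ==> hproj A k a .: AP"
  using hproj_homog[OF hproj_hcomp[of a k], of 0] hproj_closed[of a k] by (auto simp: pos_carrier)

lemma map2_hproj_AP: "as <: AP ==> set (map2 (hproj A) ks as) \<subseteq> carrier AP"
proof (induction as arbitrary: ks)
  case (Cons a as)
  then show ?case using hproj_AP by (cases ks) simp_all
qed simp

lemma mlin_hproj:
  assumes w: "mlin n w" and ks: "length ks = n"
  shows "mlin n (\<lambda>as. w (map2 (hproj A) ks as))"
proof (rule mlinI, goal_cases)
  case (1 as)
  show ?case using 1 ks map2_hproj_AP[of as ks] by (intro mlin_closed'[OF w]) (auto simp: APl_def)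
next
  case (2 xs x y ys)
  show ?case proof -
    have "length ks = length xs + Suc (length ys)" using ks 2 by simp
    then obtain ks1 l where l: "ks = ks1 @ l" "length ks1 = length xs" "length l = Suc (length ys)"
      by (rule list_splitE)
    then obtain k ks2 where k: "l = k # ks2" by (cases l) auto
    show ?thesis
      using mlin_slot[OF w map2_hproj_AP[OF 2(1), of ks1] hproj_AP[OF 2(2), of k] hproj_AP[OF 2(3), of k]
          map2_hproj_AP[OF 2(4), of ks2]] l k 2 hproj_add[OF pos_closed[OF 2(2)] pos_closed[OF 2(3)]]
      by (simp add: pos_simps)
  qed
next
  case (3 s x xs)
  show ?case proof -
    obtain k ks2 where k: "ks = k # ks2" using ks 3 by (cases ks) auto
    show ?thesis
      using mlin_head[OF w 3(1) hproj_AP[OF 3(2), of k] map2_hproj_AP[OF 3(3), of ks2]] k 3 ks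
        hproj_smult[OF 3(1) pos_closed[OF 3(2)]] by (simp add: pos_simps)
  qed
next
  case (4 s xs x y ys)
  show ?case proof -
    have "length ks = length xs + Suc (Suc (length ys))" using ks 4 by simp
    then obtain ks1 l where l: "ks = ks1 @ l" "length ks1 = length xs" "length l = Suc (Suc (length ys))"
      by (rule list_splitE)
    then obtain k k' ks2 where k: "l = k # k' # ks2" by (cases l; cases "tl l") auto
    show ?thesis
      using mlin_bal[OF w 4(1) map2_hproj_AP[OF 4(2), of ks1] hproj_AP[OF 4(3), of k] hproj_AP[OF 4(4), of k']
          map2_hproj_AP[OF 4(5), of ks2]] l k 4 hproj_rsmult[OF 4(1) pos_closed[OF 4(3)]]
        hproj_smult[OF 4(1) pos_closed[OF 4(4)]] by (simp add: pos_simps)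
  qed
qed

lemma mlin_sum:
  assumes w: "\<And>i. i \<in> J ==> mlin n (w i)" and J: "finite J"
  shows "mlin n (\<lambda>as. \<Oplus>\<^bsub>R\<^esub>i\<in>J. w i as)"
  using J w
proof (induction J)
  case empty
  then show ?case using mlin_zero by simp
next
  case (insert j J)
  have "mlin n (\<lambda>as. w j as +[R] (\<Oplus>\<^bsub>R\<^esub>i\<in>J. w i as))" using insert by (intro mlin_add) auto
  then show ?case proof (rule mlin_cong)
    fix as assume as: "as \<in> APl n"
    show "(\<Oplus>\<^bsub>R\<^esub>i\<in>insert j J. w i as) = w j as +[R] (\<Oplus>\<^bsub>R\<^esub>i\<in>J. w i as)"
      using insert.hyps mlin_closed[OF insert.prems as] by (intro R.finsum_insert) auto
  qed
qed

lemma mlin_trunc: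
  assumes w: "mlin n w"
  shows "mlin n (trunc N w)"
  by (rule mlin_cong[OF mlin_sum[of "degs n N" n "\<lambda>ks as. w (map2 (hproj A) ks as)"]])
    (use mlin_hproj[OF w] finite_degs in \<open>auto simp: degs_def trunc_def APl_def\<close>)

text \<open>Only the tuple \<open>ds\<close> survives in \<open>trunc\<close>, as any other one puts
  a zero among the entries and multilinearity kills the term. A zero entry belongs to every degree,
  so \<open>ds\<close> is taken from the derivation of \<open>homl\<close> and not from the
  list.\<close>

lemma homl_degs:
  assumes "homl s as"
  obtains ds where "length ds = length as" "sum_list ds = s" "map2 (hproj A) ds as = as"
    "\<And>ks. length ks = length as ==> ks \<noteq> ds ==> 0[A] \<in> set (map2 (hproj A) ks as)" using assms
proof (induction arbitrary: thesis rule: homl.induct)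
  case homl_Nil
  then show ?case by simp
next
  case (homl_Cons a k s as)
  obtain ds where ds: "length ds = length as" "sum_list ds = s" "map2 (hproj A) ds as = as"
    "\<And>ks. length ks = length as ==> ks \<noteq> ds ==> 0[A] \<in> set (map2 (hproj A) ks as)"
    using homl_Cons.IH by blast
  show ?case proof (rule homl_Cons.prems[of "k # ds"])
    fix ks assume ks: "length ks = length (a # as)" "ks \<noteq> k # ds"
    then obtain l ls where l: "ks = l # ls" by (cases ks) auto
    show "0[A] \<in> set (map2 (hproj A) ks (a # as))" proof (cases "l = k")
      case True
      then show ?thesis using ds(4)[of ls] ks l by auto
    next
      case False
      then show ?thesis using l hproj_homog[OF homl_Cons.hyps(1), of l] by simp
    qed
  qed (use ds hproj_homog[OF homl_Cons.hyps(1)] in auto)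
qed

lemma mlin_has_zero:
  assumes w: "mlin n w" and as: "as \<in> APl n" and z: "0[A] \<in> set as"
  shows "w as = 0[R]"
proof -
  obtain xs ys where x: "as = xs @ 0[A] # ys" using split_list[OF z] by blast
  then have "ahom AP R (\<lambda>x. w (xs @ x # ys))"
    using as by (intro mlin_slot_ahom[OF w]) (auto simp: APl_def)
  from ahom_zero[OF P.M.abelian_group_axioms Rg this] show ?thesis using x by (simp add: pos_simps)
qed

lemma trunc_homl:
  assumes w: "mlin n w" and as: "homl s as" "length as = n"
  shows "trunc N w as = (if s \<le> N then w as else 0[R])"
proof -
  have a: "as \<in> APl n" using homl_APl as by blast
  have wc: "w as .: R" using mlin_closed[OF w a] .
  obtain ds where ds: "length ds = length as" "sum_list ds = s" "map2 (hproj A) ds as = as"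
    "\<And>ks. length ks = length as ==> ks \<noteq> ds ==> 0[A] \<in> set (map2 (hproj A) ks as)"
    using homl_degs[OF as(1)] by blast
  have t: "w (map2 (hproj A) ks as) = (if ds = ks then w as else 0[R])" if "ks \<in> degs n N" for ks
  proof (cases "ds = ks")
    case False
    have "map2 (hproj A) ks as \<in> APl n"
      using that a map2_hproj_AP[of as ks] by (auto simp: APl_def degs_def)
    then show ?thesis
      using mlin_has_zero[OF w _ ds(4)[of ks]] that False as by (auto simp: degs_def)
  qed (use ds in auto)
  have "trunc N w as = (\<Oplus>\<^bsub>R\<^esub>ks\<in>degs n N. if ds = ks then w as else 0[R])"
    unfolding trunc_def as(2) using t wc by (intro R.finsum_cong') auto
  also have "... = (if s \<le> N then w as else 0[R])" proof (cases "s \<le> N")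
    case True
    then have "ds \<in> degs n N" using ds as by (simp add: degs_def)
    then show ?thesis
      using R.finsum_singleton[of ds "degs n N" "\<lambda>_. w as"] finite_degs wc True by simp
  next
    case False
    then have "ds \<notin> degs n N" using ds by (simp add: degs_def)
    then have "(\<Oplus>\<^bsub>R\<^esub>ks\<in>degs n N. if ds = ks then w as else 0[R]) = (\<Oplus>\<^bsub>R\<^esub>ks\<in>degs n N. 0[R])"
      by (intro R.finsum_cong') auto
    then show ?thesis using False R.finsum_zero by simp
  qed
  finally show ?thesis .
qed

lemma trunc_eqI:
  assumes w: "mlin n w" and van: "\<And>s as. homl s as ==> length as = n ==> N < s ==> w as = 0[R]"
    and as: "as \<in> APl n"
  shows "trunc N w as = w as"
  by (rule mlin_eq_homl[OF mlin_trunc[OF w] w _ as]) (use trunc_homl[OF w] van in force)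

abbreviation "bdry n w as \<equiv> altsum R n (\<lambda>i. w (mrg A i as))"

lemma mlin_bdry: "mlin n w ==> mlin (Suc n) (bdry n w)"
  using mlin_mrg by (intro mlin_altsum) auto

text \<open>Merging preserves the internal degree. On a homogeneous list all terms of the boundary
  are therefore kept or dropped together.\<close>

lemma trunc_bdry:
  assumes w: "mlin n w" and as: "as \<in> APl (Suc n)"
  shows "trunc N (bdry n w) as = bdry n (trunc N w) as"
proof (rule mlin_eq_homl[OF mlin_trunc[OF mlin_bdry[OF w]] mlin_bdry[OF mlin_trunc[OF w]] _ as])
  fix s as assume as: "homl s as" "length as = Suc n"
  have m: "homl s (mrg A i as)" "length (mrg A i as) = n" if "i < n" for i
    using homl_mrg[OF as(1), of i] length_mrg[of i as A] as that by auto
  have c: "w (mrg A i as) .: R" if "i < n" for i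
    using mlin_closed[OF w] homl_APl[OF m(1)[OF that]] m(2)[OF that] by simp
  have "bdry n (trunc N w) as = altsum R n (\<lambda>i. if s \<le> N then w (mrg A i as) else 0[R])"
    using trunc_homl[OF w m] c by (intro R.altsum_cong) auto
  then show "trunc N (bdry n w) as = bdry n (trunc N w) as"
    using trunc_homl[OF mlin_bdry[OF w] as] R.altsum_zero[of n "\<lambda>_. 0[R]"] by simp
qed

lemma trunc_cong:
  assumes "\<And>as. as \<in> APl n ==> w as = v as" "as \<in> APl n" "\<And>as. as \<in> APl n ==> v as .: R"
  shows "trunc N w as = trunc N v as"
proof -
  have "map2 (hproj A) ks as \<in> APl n" if "ks \<in> degs n N" for ks
    using that assms(2) map2_hproj_AP[of as ks] by (auto simp: APl_def degs_def)
  moreover have "length as = n" using assms(2) by (simp add: APl_def)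
  ultimately show ?thesis unfolding trunc_def using assms by (intro R.finsum_cong') auto
qed

lemma mlin_ECH:
  assumes f: "f .: (ECH n)"
  shows "mlin n (\<lambda>as. f (bt (1[R], as)))"
  unfolding mlin_def
proof (intro conjI ballI)
  show "f (bt (1[R], as)) .: R" if "as \<in> APl n" for as
    using that by (intro ECH_closed[OF f] P.tpow_pure_closed) (auto simp: APl_def)
  show "tmulti R AP n R (\<lambda>(r, as). r *[R] f (bt (1[R], as)))"
    by (rule P.tmulti_cong[OF tmulti_ahom_comp[OF P.tpow_pure_tmulti ECH_ahom[OF f]]])
      (simp add: P.tpow_smult_pure[where n = n] P.tpow_pure_closed flip: ECH_smult[OF f])
qed

lemma mlin_to_ECH:
  assumes v: "mlin n v"
  obtains f where "f .: (ECH n)" "\<And>as. as <: AP ==> length as = n ==> f (bt (1[R], as)) = v as"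
proof
  let ?f = "\<lambda>X\<in>carrier (BT n). presented_lift R (\<lambda>(r, as). r *[R] v as) X"
  note t = mlin_tmulti[OF v] and vc = mlin_closed'[OF v]
  show "?f .: (ECH n)" by (rule ECH_lift[OF t]) (simp add: R.m_assoc vc)
  show "?f (bt (1[R], as)) = v as" if "as <: AP" "length as = n" for as
    using P.tpow_lift_pure[OF Rg t _ that] that by (simp add: P.tpow_pure_closed vc)
qed

lemma ext_diff_bdry:
  assumes "f .: (ECH n)" "as <: AP" "length as = Suc n"
  shows "ext_diff R A n f (bt (1[R], as)) = bdry n (\<lambda>as. f (bt (1[R], as))) as"
  using ext_diff_pure[OF assms(1) _ assms(2,3), of "1[R]"] by simp

lemma ext_cochain_ring: "cochain_ring ECH (ext_diff R A) (ext_cup R A) (ext_unit R A)"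
proof (rule cochain_ring_Leibniz[OF ECH_group ext_diff_ahom ext_diff_ext_diff cup_closed cup_add_left
      cup_add_right ext_Leibniz])
  show "ext_unit R A \<in> cocycles ECH (ext_diff R A) 0" unfolding cocycles_def
  proof (intro CollectI conjI ext_unit_closed)
    interpret E1: abelian_group "ECH (Suc 0)" by (rule ECH_group)
    show "ext_diff R A 0 (ext_unit R A) = 0[ECH (Suc 0)]"
      by (rule ECH_eqI[OF ext_diff_closed[OF ext_unit_closed] E1.zero_closed])
        (simp add: ext_diff_bdry[OF ext_unit_closed] R.altsum_0 ECH_apply P.tpow_pure_closed)
  qed
qed

end

section \<open>Cohomology of the bar and cobar constructions\<close>

text \<open>Ties the level of the dual bases to the internal degree: level \<open>N\<close>
  reproduces all components of degree at most \<open>N\<close>, and each element of \<open>E\<close>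
  is blind to all but finitely many degrees.\<close>

locale koszul_bar_pairing = koszul R A C \<theta> + bar_pairing R A E e I p q cmp
  for R :: "('r, 'x) ring_scheme" (structure)
    and A :: "('r, 'a, 'y) graded_bimodule_scheme" (structure)
    and C :: "('r, 'c, 'z) graded_coring_scheme" (structure) and \<theta> :: "'c => 'a"
    and E :: "('r, 'e, 'v) bimodule_scheme" and e :: "'e => 'a => 'r"
    and I :: "nat => 'i set" and p :: "'i => 'a" and q :: "'i => 'e"
    and cmp :: "'e => ('e \<times> 'e \<Rightarrow>\<^sub>0 int) set" +
  assumes hproj_basis: "a .: (pos_part A) ==> k \<le> N ==>
      hproj A k (\<Oplus>\<^bsub>pos_part A\<^esub>i\<in>I N. e (q i) a .[pos_part A] p i) = hproj A k a"
    and e_bounded: "X .: E ==> \<exists>N. \<forall>k>N. \<forall>a\<in>hcomp A k. e X a = 0[R]"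
begin

text \<open>Pigeonhole: if the total degree exceeds \<open>M\<close> times the number of entries,
  some entry has degree above \<open>M\<close> and is sent to zero by its functional; the zero then
  propagates outwards through the nested value.\<close>

lemma pr_bounded:
  assumes f: "\<And>f k a. f \<in> set fs ==> M < k ==> a \<in> hcomp A k ==> e f a = 0[R]" and fs: "fs <: E"
    and as: "homl s as" "length as = length fs" "length fs * M < s"
  shows "pp.pr fs as 1[R] = 0[R]"
  using as(1) f fs as(2,3)
proof (induction arbitrary: fs rule: homl.induct)
  case homl_Nil
  then show ?case by simp
next
  case (homl_Cons a k s as)
  then obtain f gs where fs: "fs = f # gs" by (cases fs) auto
  have a: "a .: AP" and as: "as <: AP"
    using homl_Cons.hyps hcomp_pos homl_APl by (auto simp: APl_def)
  have t: "pp.pr gs as 1[R] .: R" using as fs homl_Cons.prems by (intro pp.pr_closed) auto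
  show ?case proof (cases "M < k")
    case True
    have "a <[A] pp.pr gs as 1[R] \<in> hcomp A k" using hcomp_rsmult[OF t homl_Cons.hyps(1)] .
    then show ?thesis using homl_Cons.prems(1)[of f k] True fs by (simp add: pos_simps)
  next
    case False
    have "pp.pr gs as 1[R] = 0[R]" proof (rule homl_Cons.IH)
      show "\<And>f k a. f \<in> set gs ==> M < k ==> a \<in> hcomp A k ==> e f a = 0[R]"
        using homl_Cons.prems(1) fs by simp
    qed (use homl_Cons.prems fs False in auto)
    moreover have "e f 0[A] = 0[R]"
      using ahom_zero[OF P.M.abelian_group_axioms Rg pp.e_right[of f]] fs homl_Cons.prems by (simp add: pos_simps)
    ultimately show ?thesis
      using fs ahom_zero[OF Rg P.M.abelian_group_axioms P.ahom_rsmult_right[OF a]] by (simp add: pos_simps)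
  qed
qed

lemma ev_bounded:
  assumes "X .: (pp.TE n)"
  shows "\<exists>N. \<forall>s as. N < s --> homl s as --> length as = n --> pp.ev X as = 0[R]"
  using assms
proof (induction rule: pp.E.tpow_induct)
  case zero
  have "pp.ev 0[pp.TE n] as = 0[R]" if "homl s as" "length as = n" for s as
    using homl_APl[OF that(1)] that(2)
    by (intro ahom_zero[OF pp.E.tpow_group Rg pp.evt_ahom]) (auto simp: APl_def)
  then show ?case by blast
next
  case (pure r fs)
  have "\<exists>M. \<forall>f\<in>set fs. \<forall>k>M. \<forall>a\<in>hcomp A k. e f a = 0[R]" using pure(2) proof (induction fs)
    case (Cons f fs)
    then obtain M where M: "\<forall>f\<in>set fs. \<forall>k>M. \<forall>a\<in>hcomp A k. e f a = 0[R]" by auto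
    obtain M' where M': "\<forall>k>M'. \<forall>a\<in>hcomp A k. e f a = 0[R]" using e_bounded[of f] Cons.prems by auto
    have "\<forall>g\<in>set (f # fs). \<forall>k>max M M'. \<forall>a\<in>hcomp A k. e g a = 0[R]"
      using M M' by (metis max_less_iff_conj set_ConsD)
    then show ?case ..
  qed simp
  then obtain M where M: "\<And>f k a. f \<in> set fs ==> M < k ==> a \<in> hcomp A k ==> e f a = 0[R]" by blast
  have "pp.ev (pp.tp (r, fs)) as = 0[R]" if "n * M < s" "homl s as" "length as = n" for s as
    using pr_bounded[of fs M s as] M pure that homl_APl[OF that(2)] by (simp add: pp.evt_pure APl_def)
  then show ?case by blast
next
  case (add X Y)
  then obtain N1 N2 where N: "\<forall>s as. N1 < s --> homl s as --> length as = n --> pp.ev X as = 0[R]"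
    "\<forall>s as. N2 < s --> homl s as --> length as = n --> pp.ev Y as = 0[R]" by blast
  have "pp.ev (X +[pp.TE n] Y) as = 0[R]" if "max N1 N2 < s" "homl s as" "length as = n" for s as
  proof -
    have "pp.ev X as = 0[R]" "pp.ev Y as = 0[R]" using N that by auto
    then show ?thesis
      using that ahom_add[OF pp.evt_ahom[of as n "1[R]"] add(1,2)] homl_APl[OF that(2)] by (simp add: APl_def)
  qed
  then show ?case by blast
next
  case (neg X)
  then obtain N where N: "\<forall>s as. N < s --> homl s as --> length as = n --> pp.ev X as = 0[R]"
    by blast
  have "pp.ev (-[pp.TE n] X) as = 0[R]" if "N < s" "homl s as" "length as = n" for s as proof -
    have "pp.ev X as = 0[R]" using N that by auto
    then show ?thesis
      using that ahom_neg[OF pp.E.tpow_group Rg pp.evt_ahom[of as n "1[R]"] neg(1)] homl_APl[OF that(2)]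
      by (simp add: APl_def)
  qed
  then show ?case by blast
qed

lemma mlin_ev:
  assumes "X .: (pp.TE n)"
  shows "mlin n (pp.ev X)"
  unfolding mlin_def
proof (intro conjI ballI)
  show "pp.ev X as .: R" if "as \<in> APl n" for as
    using that assms by (intro pp.evt_closed) (auto simp: APl_def)
qed (rule pp.ev_tmulti[OF assms])

text \<open>In \<open>trunc N w\<close> every entry is seen only through its components of degree at
  most \<open>N\<close>, and those are unchanged when the entry is replaced by its expansion at
  level \<open>N\<close>. This is the hypothesis of \<open>ev_surj\<close>.\<close>

lemma trunc_ev:
  assumes w: "mlin n w"
  obtains X where "X .: (pp.TE n)" "\<And>as. as \<in> APl n ==> pp.ev X as = trunc N w as"
proof -
  have ins: "trunc N w (xs @ a # ys) =
      trunc N w (xs @ (\<Oplus>\<^bsub>AP\<^esub>i\<in>I N. e (q i) a .[AP] p i) # ys)"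
    if *: "xs <: AP" "a .: AP" "ys <: AP" "Suc (length xs + length ys) = n" for xs a ys
  proof -
    let ?b = "\<Oplus>\<^bsub>AP\<^esub>i\<in>I N. e (q i) a .[AP] p i"
    have b: "?b .: AP"
      using *(2) pp.e_closed pp.p_closed pp.q_closed P.smult_closed by (intro P.M.finsum_closed) auto
    have "w (map2 (hproj A) ks (xs @ a # ys)) = w (map2 (hproj A) ks (xs @ ?b # ys))"
      "w (map2 (hproj A) ks (xs @ ?b # ys)) .: R" if ks: "ks \<in> degs n N" for ks
    proof -
      have "length ks = length xs + Suc (length ys)" using ks * by (simp add: degs_def)
      then obtain ks1 l where l: "ks = ks1 @ l" "length ks1 = length xs" "length l = Suc (length ys)"
        by (rule list_splitE)
      then obtain k ks2 where k: "l = k # ks2" by (cases l) auto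
      \<comment> \<open>The degrees of the tuple sum to at most \<open>N\<close>, so each of them is
        at most \<open>N\<close>.\<close>
      have "k \<le> N" using degs_le[OF ks, of k] l k by simp
      then show "w (map2 (hproj A) ks (xs @ a # ys)) = w (map2 (hproj A) ks (xs @ ?b # ys))"
        using hproj_basis[OF *(2)] l k by simp
      show "w (map2 (hproj A) ks (xs @ ?b # ys)) .: R"
        using map2_hproj_AP[of "xs @ ?b # ys" ks] ks * b by (intro mlin_closed'[OF w]) (auto simp: degs_def)
    qed
    then show ?thesis unfolding trunc_def using * by (intro R.finsum_cong') auto
  qed
  note t = mlin_trunc[OF w, of N]
  obtain X where "X .: (pp.TE n)" "\<And>as. as <: AP ==> length as = n ==> pp.ev X as = trunc N w as"
    using pp.ev_surj[where w = "trunc N w" and n = n and N = N, OF mlin_tmulti[OF t] mlin_closed'[OF t] ins] by blast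
  then show thesis using that by (simp add: APl_def)
qed

theorem comparison: "cochain_ring_comparison ECH (ext_diff R A) (ext_cup R A) (ext_unit R A)
     pp.TE codiff (tpow_concat (op_ring R) E) (pp.tp (1[R], [])) \<Phi>"
proof (rule cochain_ring_comparison.intro[OF ext_cochain_ring],
    rule cochain_ring_comparison_axioms.intro, rule pp.E.tpow_group, rule codiff_ahom, rule \<Phi>_ahom,
    erule \<Phi>_inj, assumption, erule \<Phi>_d, erule pp.concat_ev(1), assumption, erule \<Phi>_concat, assumption,
    rule unit_closed, rule \<Phi>_unit)
  fix n f assume f: "f \<in> cocycles ECH (ext_diff R A) n"
  interpret EC: abelian_group "ECH n" by (rule ECH_group)
  define w where "w as = f (bt (1[R], as))" for as
  have fc: "f .: (ECH n)" and fz: "ext_diff R A n f = 0[ECH (Suc n)]"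
    using f by (auto simp: cocycles_def)
  have w: "mlin n w" unfolding w_def by (rule mlin_ECH[OF fc])
  have wz: "bdry n w as = 0[R]" if "as \<in> APl (Suc n)" for as
    using ext_diff_bdry[OF fc, of as] that fz
    by (simp add: w_def[abs_def] APl_def ECH_apply P.tpow_pure_closed)
  \<comment> \<open>Cutting at \<open>n\<close> keeps only the diagonal part, because
    \<open>n\<close> entries of positive degree have total degree at least \<open>n\<close>. This
    part is in the image of the pairing.\<close>
  obtain X where X: "X .: (pp.TE n)" and eX: "\<And>as. as \<in> APl n ==> pp.ev X as = trunc n w as"
    using trunc_ev[OF w] by blast
  note XE = \<Phi>_closed[OF X]
  have fX: "f -[ECH n] \<Phi> n X \<in> coboundaries ECH (ext_diff R A) n" proof (cases n)
    case 0
    \<comment> \<open>In degree 0 the only list is empty and has internal degree 0, so truncation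
      changes nothing and the difference is zero, the only coboundary there.\<close>
    have "f = \<Phi> n X" proof (rule ECH_eqI[OF fc XE])
      fix as assume as: "as <: AP" "length as = n"
      have "as = []" "homl 0 []" using as 0 homl_Nil by auto
      then show "f (bt (1[R], as)) = \<Phi> n X (bt (1[R], as))"
        using \<Phi>_one[OF X as] eX[of as] trunc_homl[OF w, of 0 "[]" n] 0 by (simp add: w_def APl_def)
    qed
    then show ?thesis using XE 0 EC.r_neg by (simp add: coboundaries_def a_minus_def)
  next
    case (Suc m)
    \<comment> \<open>The difference of the cocycle and its diagonal part, to which
      \<open>mlin_cocycle_exact\<close> applies: truncation commutes with the boundary, so
      \<open>v\<close> is a cocycle, and it vanishes on lists of degree-one entries by
      construction.\<close>
    define v where "v as = w as +[R] sg R 1 (trunc n w as)" for as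
    have v: "mlin (Suc m) v"
      unfolding v_def using w mlin_trunc[OF w, of n] Suc by (intro mlin_add mlin_sg) auto
    have tc: "trunc n w as .: R" "w as .: R" if "as \<in> APl n" for as
      using mlin_closed[OF mlin_trunc[OF w] that] mlin_closed[OF w that] by auto
    have bv: "bdry (Suc m) v as = 0[R]" if as: "as \<in> APl (Suc (Suc m))" for as proof -
      have m: "mrg A i as \<in> APl n" if "i < Suc m" for i using APl_mrg[OF as that] Suc by simp
      have "bdry (Suc m) v as = bdry (Suc m) w as +[R] bdry (Suc m) (\<lambda>as. sg R 1 (trunc n w as)) as"
        unfolding v_def using tc m R.sg_closed by (intro R.altsum_add) auto
      also have "bdry (Suc m) (\<lambda>as. sg R 1 (trunc n w as)) as = sg R 1 (bdry (Suc m) (trunc n w) as)"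
      proof -
        have "ahom R R (sg R 1)" using ahom_sg_map[OF Rg, of R "\<lambda>x. x" 1] by (simp add: ahom_def)
        then show ?thesis using tc m by (intro ahom_altsum[OF Rg Rg, symmetric]) auto
      qed
      also have "bdry (Suc m) (trunc n w) as = trunc n (bdry n w) as"
        using trunc_bdry[OF w, of as n] as Suc by simp
      also have "... = trunc n (\<lambda>_. 0[R]) as"
        by (rule trunc_cong[where n = "Suc n"]) (use wz as Suc in auto)
      also have "... = 0[R]" by (simp add: trunc_def R.finsum_zero)
      finally show ?thesis using wz[of as] as Suc R.sg_zero by simp
    qed
    have hom1: "homl (length as) as" if "set as \<subseteq> hcomp A 1" for as using that proof (induction as)
      case (Cons a as)
      then show ?case using homl_Cons[of a 1 "length as" as] by (simp add: One_nat_def)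
    qed (simp add: homl_Nil)
    have v1: "v as = 0[R]" if as: "as \<in> A1l (Suc m)" for as proof -
      have "homl n as" "length as = n" using hom1[of as] as Suc by (auto simp: A1l_def)
      then show ?thesis
        using trunc_homl[OF w, of n as n] tc(2)[OF A1l_APl, of as] as Suc by (simp add: v_def sg_def R.r_neg)
    qed
    obtain u where u: "mlin m u" "\<And>as. as \<in> APl (Suc m) ==> bdry m u as = v as"
      using mlin_cocycle_exact[OF v bv v1] by blast
    obtain g where g: "g .: (ECH m)" "\<And>as. as <: AP ==> length as = m ==> g (bt (1[R], as)) = u as"
      using mlin_to_ECH[OF u(1)] by blast
    have "f -[ECH n] \<Phi> n X = ext_diff R A m g" proof (rule ECH_eqI[where n = n])
      show "f -[ECH n] \<Phi> n X .: (ECH n)" using fc XE by simp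
      show "ext_diff R A m g .: (ECH n)" using ext_diff_closed[OF g(1)] Suc by simp
      fix as assume as: "as <: AP" "length as = n"
      have pc: "bt (1[R], as) .: (BT n)" using as by (intro P.tpow_pure_closed) auto
      have "ext_diff R A m g (bt (1[R], as)) = bdry m u as"
        unfolding ext_diff_bdry[OF g(1) as(1) as(2)[unfolded Suc]]
        using g(2) set_mrg[OF as(1)] length_mrg[of _ as A] as Suc mlin_closed'[OF u(1)] by (intro R.altsum_cong) auto
      also have "... = w as -[R] trunc n w as"
        using u(2)[of as] as Suc by (simp add: v_def sg_def APl_def a_minus_def)
      also have "... = f (bt (1[R], as)) -[R] \<Phi> n X (bt (1[R], as))"
        using \<Phi>_one[OF X as] eX[of as] as by (simp add: w_def APl_def)
      finally show "(f -[ECH n] \<Phi> n X) (bt (1[R], as)) = ext_diff R A m g (bt (1[R], as))"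
        using bimodule.left_dual_neg_apply[OF BT_bimodule, of "\<Phi> n X" n] XE pc EC.a_inv_closed[OF XE]
        by (simp add: a_minus_def ECH_apply flip: ext_cochains_eq)
    qed
    then show ?thesis using g Suc by (auto simp: coboundaries_def)
  qed
  have "f = (f -[ECH n] \<Phi> n X) +[ECH n] \<Phi> n X"
    using fc XE by (simp add: a_minus_def EC.a_assoc EC.l_neg)
  then show "\<exists>z\<in>carrier (pp.TE n). \<exists>b\<in>coboundaries ECH (ext_diff R A) n. f = b +[ECH n] \<Phi> n z"
    using X fX by blast
next
  fix n z assume z: "z \<in> cocycles pp.TE codiff n" and b: "\<Phi> n z \<in> coboundaries ECH (ext_diff R A) n"
  have zc: "z .: (pp.TE n)" using z by (simp add: cocycles_def)
  show "z \<in> coboundaries pp.TE codiff n" proof (cases n)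
    case 0
    then show ?thesis using \<Phi>_inj[OF zc] b by (simp add: coboundaries_def)
  next
    case (Suc m)
    then obtain g where g: "g .: (ECH m)" "\<Phi> n z = ext_diff R A m g"
      using b by (auto simp: coboundaries_def)
    define w where "w as = g (bt (1[R], as))" for as
    have w: "mlin m w" unfolding w_def by (rule mlin_ECH[OF g(1)])
    have zw: "pp.ev z as = bdry m w as" if "as \<in> APl n" for as
      using \<Phi>_one[OF zc, of as] ext_diff_bdry[OF g(1), of as] that g(2) Suc by (simp add: APl_def w_def[abs_def])
    \<comment> \<open>The cochain \<open>g\<close> may be unbounded, but its coboundary is the image
      of \<open>z\<close> and vanishes above some degree \<open>N\<close>. Cutting \<open>g\<close>
      there leaves the coboundary unchanged and brings \<open>g\<close> into the image of the
      pairing.\<close>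
    obtain N where N: "\<forall>s as. N < s --> homl s as --> length as = n --> pp.ev z as = 0[R]"
      using ev_bounded[OF zc] by blast
    obtain Y where Y: "Y .: (pp.TE m)" "\<And>as. as \<in> APl m ==> pp.ev Y as = trunc N w as"
      using trunc_ev[OF w] by blast
    have "codiff m Y = z" proof (rule pp.ev_eqI[OF _ zc])
      show "codiff m Y .: (pp.TE n)" using ahom_closed[OF codiff_ahom Y(1)] Suc by simp
      fix as assume as: "as <: AP" "length as = n"
      then have a: "as \<in> APl (Suc m)" "as \<in> APl n" using Suc by (auto simp: APl_def)
      have "pp.ev (codiff m Y) as = bdry m (pp.ev Y) as"
        using codiff_ev[OF Y(1) as(1)] as Suc by simp
      also have "... = bdry m (trunc N w) as"
        using Y(2) APl_mrg[OF a(1)] mlin_closed[OF mlin_trunc[OF w]] by (intro R.altsum_cong) auto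
      also have "... = trunc N (bdry m w) as" using trunc_bdry[OF w a(1)] by simp
      also have "... = trunc N (pp.ev z) as"
        by (rule trunc_cong[OF _ a(2)]) (simp_all only: zw[symmetric] mlin_closed[OF mlin_ev[OF zc]])
      also have "... = pp.ev z as" using N by (intro trunc_eqI[OF mlin_ev[OF zc] _ a(2)]) blast
      finally show "pp.ev (codiff m Y) as = pp.ev z as" .
    qed
    then show ?thesis using Y(1) Suc by (auto simp: coboundaries_def)
  qed
qed

end

section \<open>The graded dual\<close>

text \<open>Transport of the bimodule laws along a map onto the carrier that respects all
  operations, as the quotient map to \<open>D / D_0\<close> does.\<close>

lemma bimodule_image:
  assumes "bimodule R M" and car: "carrier E = h ` carrier M" and zero: "0[E] = h 0[M]"
    and add: "\<And>x y. x .: M ==> y .: M ==> h x +[E] h y = h (x +[M] y)"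
    and l: "\<And>r x. r .: R ==> x .: M ==> r .[E] h x = h (r .[M] x)"
    and r: "\<And>r x. r .: R ==> x .: M ==> h x <[E] r = h (x <[M] r)"
  shows "bimodule R E"
proof -
  interpret M: bimodule R M by fact
  note c = M.smult_closed M.rsmult_closed M.M.add.m_closed
  have "abelian_group E" proof (rule abelian_groupI)
    show "\<exists>y\<in>carrier E. y +[E] x = 0[E]" if x: "x .: E" for x proof -
      obtain y where y: "y .: M" "x = h y" using x by (auto simp: car)
      then have "h (-[M] y) .: E" "h (-[M] y) +[E] x = 0[E]"
        by (simp_all add: car zero add M.M.l_neg)
      then show ?thesis by blast
    qed
    show "x +[E] y = y +[E] x" if "x .: E" "y .: E" for x y
      using that M.M.a_comm by (auto simp: car add)
  qed (auto simp: car zero add M.M.a_assoc)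
  then show ?thesis
    by (intro bimodule.intro left_module.intro M.ring_axioms left_module_axioms.intro bimodule_axioms.intro)
      (auto simp: car add l r c M.smult_l_distr M.smult_r_distr M.smult_assoc M.smult_one
        M.rsmult_r_distr M.rsmult_l_distr M.rsmult_assoc M.rsmult_one M.smult_rsmult)
qed

text \<open>Shows that the set-theoretic actions in \<open>quot_bimodule\<close> are those induced
  on representatives.\<close>

lemma (in bimodule) coset_image:
  assumes N: "additive_subgroup N M" and h: "ahom M M h" and hN: "\<And>n. n \<in> N ==> h n \<in> N"
    and x: "x .: M"
  shows "N <+>\<^bsub>M\<^esub> h ` (N +>\<^bsub>M\<^esub> x) = N +>\<^bsub>M\<^esub> h x"
proof -
  note Nc = additive_subgroup.a_Hcarr[OF N]
  have hx: "h x .: M" using ahom_closed[OF h x] .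
  show ?thesis proof (intro equalityI subsetI)
    fix y assume "y \<in> N <+>\<^bsub>M\<^esub> h ` (N +>\<^bsub>M\<^esub> x)"
    then obtain n n' where n: "n \<in> N" "n' \<in> N" "y = n +[M] h (n' +[M] x)"
      by (auto simp: set_add_def' a_r_coset_def')
    then have "y = (n +[M] h n') +[M] h x" using Nc hN x hx by (simp add: ahom_add[OF h] M.a_assoc)
    then show "y \<in> N +>\<^bsub>M\<^esub> h x"
      using additive_subgroup.a_closed[OF N n(1) hN[OF n(2)]] by (auto simp: a_r_coset_def')
  next
    fix y assume "y \<in> N +>\<^bsub>M\<^esub> h x"
    then obtain n where n: "n \<in> N" "y = n +[M] h x" by (auto simp: a_r_coset_def')
    have "x \<in> N +>\<^bsub>M\<^esub> x" using additive_subgroup.zero_closed[OF N] x by (force simp: a_r_coset_def')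
    then show "y \<in> N <+>\<^bsub>M\<^esub> h ` (N +>\<^bsub>M\<^esub> x)" using n by (auto simp: set_add_def')
  qed
qed

section \<open>The graded dual, its quotient by degree 0, and evaluation on the ring\<close>

locale finite_rring = connected_graded_rring R A for R :: "('r, 'x) ring_scheme" (structure)
    and A :: "('r, 'a, 'y) graded_bimodule_scheme" (structure) +
  assumes ss: "semisimple_ring R" and lfin: "left_locally_finite R A"
begin

abbreviation "V n \<equiv> left_dual R (hpart A n)"
abbreviation "D \<equiv> gr_dual R A"
abbreviation "DB \<equiv> gr_dual_bimodule R A"
abbreviation "Q \<equiv> coring_pos D"
abbreviation "incl n \<equiv> gr_dual_incl R A n"
abbreviation "\<pi> x \<equiv> hcomp D 0 +>\<^bsub>D\<^esub> x"

lemma V_bimodule: "bimodule (op_ring R) (V n)"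
  by (rule bimodule.left_dual_bimodule[OF hpart_bimodule])

lemma DB_simps: "carrier DB = {f. (\<forall>n. f n .: (V n)) \<and> finite {n. f n \<noteq> 0[V n]}}"
  "0[DB] = (\<lambda>n. 0[V n])" "f +[DB] g = (\<lambda>n. f n +[V n] g n)"
  "r .[DB] f = (\<lambda>n. r .[V n] f n)" "f <[DB] r = (\<lambda>n. f n <[V n] r)"
  by (simp_all add: gr_dual_bimodule_def Let_def)

lemma D_simps: "carrier D = {f. (\<forall>n. f n .: (V n)) \<and> finite {n. f n \<noteq> 0[V n]}}"
  "0[D] = (\<lambda>n. 0[V n])" "f +[D] g = (\<lambda>n. f n +[V n] g n)"
  "r .[D] f = (\<lambda>n. r .[V n] f n)" "f <[D] r = (\<lambda>n. f n <[V n] r)"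
  "hcomp D n = incl n ` carrier (V n)" "comult D = gr_dual_comult R A"
  by (simp_all add: gr_dual_def graded_bimodule.defs graded_coring.defs gr_dual_bimodule_def Let_def)

lemma D_bimodule: "bimodule (op_ring R) D" by (rule bimodule_pointwise[OF V_bimodule D_simps(1-5)])

text \<open>\<open>D\<close> and \<open>DB\<close> have the same elements and operations but are
  different records: the comultiplication takes values in the tensor square of \<open>DB\<close>,
  while the quotient \<open>Q\<close> is formed from \<open>D\<close>.\<close>

lemma DB_bimodule: "bimodule (op_ring R) DB" by (rule bimodule_pointwise[OF V_bimodule DB_simps])

lemma D_apply: "f .: D ==> f n .: (V n)" by (simp add: D_simps)

lemma V_zero: "a \<in> hcomp A n ==> 0[V n] a = 0[R]" by (simp add: left_dual_simps hpart_simps)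

sublocale D: bimodule "op_ring R" D by (rule D_bimodule)

lemma V_group: "abelian_group (V n)" by (rule bimodule.left_dual_group[OF hpart_bimodule])

lemma incl_closed: "\<alpha> .: (V n) ==> incl n \<alpha> .: D"
proof -
  assume "\<alpha> .: (V n)"
  moreover have "finite {k. incl n \<alpha> k \<noteq> 0[V k]}"
    by (rule finite_subset[of _ "{n}"]) (auto simp: gr_dual_incl_def)
  moreover have "0[V k] .: (V k)" for k
    using abelian_monoid.zero_closed[OF abelian_group.axioms(1)[OF V_group]] .
  ultimately show ?thesis by (simp add: D_simps gr_dual_incl_def)
qed

lemma D0_iff: "f \<in> hcomp D 0 \<longleftrightarrow> f .: D \<and> (\<forall>k>0. f k = 0[V k])"
proof
  assume "f \<in> hcomp D 0"
  then show "f .: D \<and> (\<forall>k>0. f k = 0[V k])"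
    using incl_closed[of _ 0] by (auto simp: D_simps(6) gr_dual_incl_def)
next
  assume f: "f .: D \<and> (\<forall>k>0. f k = 0[V k])"
  then have "f = incl 0 (f 0)" by (auto simp: gr_dual_incl_def fun_eq_iff)
  then show "f \<in> hcomp D 0" using f D_apply[of f 0] by (auto simp: D_simps(6))
qed

lemma D_neg: "f .: D ==> (-[D] f) k = -[V k] f k"
  using ahom_neg[OF D.M.abelian_group_axioms V_group ahomI[of D "\<lambda>f. f k" "V k"], of f] D_apply
  by (simp add: D_simps(3))

lemma D0_subgroup: "additive_subgroup (hcomp D 0) D"
proof -
  have "subgroup (hcomp D 0) (add_monoid D)"
  proof (rule group.subgroupI[OF abelian_group.a_group[OF D.M.abelian_group_axioms]])
    interpret V: abelian_group "V k" for k by (rule V_group)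
    show "hcomp D 0 \<subseteq> carrier (add_monoid D)" by (auto simp: D0_iff)
    show "hcomp D 0 \<noteq> {}" using D.M.zero_closed by (auto simp: D0_iff D_simps(2))
    show "inv\<^bsub>add_monoid D\<^esub> x \<in> hcomp D 0" if "x \<in> hcomp D 0" for x
      using that by (auto simp: D0_iff D_neg simp flip: a_inv_def)
    show "x *[add_monoid D] y \<in> hcomp D 0" if "x \<in> hcomp D 0" "y \<in> hcomp D 0" for x y
      using that D.M.a_closed[of x y] by (auto simp: D0_iff D_simps(3))
  qed
  then show ?thesis by (rule additive_subgroup.intro)
qed

lemma Q_carrier: "carrier Q = (\<lambda>x. \<pi> x) ` carrier D" "0[Q] = \<pi> 0[D]"
  and Q_add: "x .: D ==> y .: D ==> \<pi> x +[Q] \<pi> y = \<pi> (x +[D] y)"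
  and Q_smult: "r .: R ==> x .: D ==> r .[Q] \<pi> x = \<pi> (r .[D] x)"
  and Q_rsmult: "r .: R ==> x .: D ==> \<pi> x <[Q] r = \<pi> (x <[D] r)"
proof -
  note as = abelian_subgroupI3[OF D0_subgroup D.M.abelian_group_axioms]
  show "carrier Q = (\<lambda>x. \<pi> x) ` carrier D"
    by (auto simp: coring_pos_def quot_bimodule_def A_RCOSETS_def')
  show "0[Q] = \<pi> 0[D]"
    using D.M.a_coset_add_zero[of "hcomp D 0"] additive_subgroup.a_subset[OF D0_subgroup]
    by (simp add: coring_pos_def quot_bimodule_def)
  show "\<pi> x +[Q] \<pi> y = \<pi> (x +[D] y)" if "x .: D" "y .: D"
    using abelian_subgroup.a_rcos_sum[OF as that] by (simp add: coring_pos_def quot_bimodule_def)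
  assume rx: "r .: R" "x .: D"
  interpret V: bimodule "op_ring R" "V k" for k by (rule V_bimodule)
  have "r .[D] n \<in> hcomp D 0" "n <[D] r \<in> hcomp D 0" if "n \<in> hcomp D 0" for n
    using that rx D.smult_closed[of r n] D.rsmult_closed[of r n] V.smult_zero[of r] V.zero_rsmult[of r]
    by (auto simp: D0_iff D_simps(4,5))
  then show "r .[Q] \<pi> x = \<pi> (r .[D] x)" "\<pi> x <[Q] r = \<pi> (x <[D] r)"
    using D.coset_image[OF D0_subgroup D.ahom_smult _ rx(2), of r] rx
      D.coset_image[OF D0_subgroup D.ahom_rsmult _ rx(2), of r]
    by (simp_all add: coring_pos_def quot_bimodule_def)
qed

lemma Q_bimodule: "bimodule (op_ring R) Q"
proof (rule bimodule_image[where h = "\<lambda>x. \<pi> x"])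
  show "bimodule (op_ring R) D" by (rule D_bimodule)
qed (simp_all add: Q_carrier Q_add Q_smult Q_rsmult)

text \<open>Embeds the graded dual into the functionals on the whole of \<open>A\<close>. For
  \<open>x\<close> in the graded dual only finitely many components contribute.\<close>

definition evD :: "(nat => 'a => 'r) => 'a => 'r" where
  "evD x a = (\<Oplus>\<^bsub>R\<^esub>k\<in>{k. x k \<noteq> 0[V k]}. x k (hproj A k a))"

lemma D_val: "x .: D ==> a .: A ==> x k (hproj A k a) .: R"
  using left_dual_closed[OF D_apply[of x k], of "hproj A k a"] hproj_hcomp by (simp add: hpart_simps)

lemma evD_eq:
  assumes x: "x .: D" and a: "a .: A" and F: "finite F" "\<And>k. k \<notin> F ==> x k = 0[V k]"
  shows "evD x a = (\<Oplus>\<^bsub>R\<^esub>k\<in>F. x k (hproj A k a))"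
  unfolding evD_def
proof (rule R.add.finprod_mono_neutral_cong_left)
  show "x i (hproj A i a) = 0[R]" if "i \<in> F - {k. x k \<noteq> 0[V k]}" for i
    using that V_zero[OF hproj_hcomp[OF a], of i] by simp
qed (use F D_val[OF x a] in auto)

lemma D_bound:
  assumes "x .: D"
  obtains N where "\<And>k. N \<le> k ==> x k = 0[V k]"
proof -
  have "finite {k. x k \<noteq> 0[V k]}" using assms by (simp add: D_simps)
  then obtain N where "\<forall>k\<in>{k. x k \<noteq> 0[V k]}. k < N" using finite_nat_set_iff_bounded by blast
  then show thesis using that[of N] by (meson mem_Collect_eq not_le)
qed

lemma D_bound2:
  assumes "x .: D" "y .: D"
  obtains N where "\<And>k. k \<notin> {..<N} ==> x k = 0[V k]" "\<And>k. k \<notin> {..<N} ==> y k = 0[V k]"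
proof -
  obtain N M where "\<And>k. N \<le> k ==> x k = 0[V k]" "\<And>k. M \<le> k ==> y k = 0[V k]"
    using D_bound assms by metis
  then show thesis using that[of "max N M"] by (simp add: not_less)
qed

definition eQ :: "(nat => 'a => 'r) set => 'a => 'r" where "eQ X a = evD (SOME x. x \<in> X) a"

lemma coset_val:
  assumes "x .: D" "y \<in> \<pi> x"
  shows "y .: D" "\<And>k. 0 < k ==> y k = x k"
proof -
  obtain n where n: "n \<in> hcomp D 0" "y = n +[D] x" using assms(2) by (auto simp: a_r_coset_def')
  then have nD: "n .: D" "\<forall>k>0. n k = 0[V k]" by (auto simp: D0_iff)
  show "y .: D" using D.M.a_closed[OF nD(1) assms(1)] n by simp
  interpret V: abelian_group "V k" for k by (rule V_group)
  show "y k = x k" if "0 < k" for k using n nD that D_apply[OF assms(1)] by (simp add: D_simps(3))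
qed

lemma some_coset:
  assumes "x .: D"
  shows "(SOME y. y \<in> \<pi> x) \<in> \<pi> x"
  by (rule someI[of _ x]) (rule abelian_subgroup.a_rcos_self[OF abelian_subgroupI3[OF D0_subgroup D.M.abelian_group_axioms] assms])

lemma AP_hproj0: "a .: AP ==> hproj A 0 a = 0[A]" by (simp add: pos_carrier)

lemma V_ahom: "\<alpha> .: (V n) ==> ahom (hpart A n) R \<alpha>" by (rule left_dual_ahom)

lemma V_at_zero: "\<alpha> .: (V n) ==> \<alpha> 0[A] = 0[R]"
  using ahom_zero[OF _ Rg V_ahom] bimodule.axioms(1)[OF hpart_bimodule]
  by (metis hpart_simps(2) left_module.axioms(2))

text \<open>Representatives of a class differ only in their component of degree 0, which an element
  of \<open>A_+\<close> does not meet; so the choice made in \<open>eQ\<close> is immaterial on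
  \<open>A_+\<close>.\<close>

lemma eQ_pi:
  assumes x: "x .: D" and a: "a .: AP"
  shows "eQ (\<pi> x) a = evD x a"
proof -
  define y where "y = (SOME y. y \<in> \<pi> x)"
  have y: "y .: D" "\<And>k. 0 < k ==> y k = x k"
    using coset_val[OF x some_coset[OF x]] by (simp_all add: y_def)
  obtain N where N: "\<And>k. k \<notin> {..<N} ==> x k = 0[V k]" "\<And>k. k \<notin> {..<N} ==> y k = 0[V k]"
    using D_bound2[OF x y(1)] by blast
  have "evD y a = (\<Oplus>\<^bsub>R\<^esub>k\<in>{..<N}. y k (hproj A k a))"
    using evD_eq[OF y(1) pos_closed[OF a] finite_lessThan N(2)] by simp
  also have "... = (\<Oplus>\<^bsub>R\<^esub>k\<in>{..<N}. x k (hproj A k a))" proof (rule R.finsum_cong'[OF refl])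
    show "y k (hproj A k a) = x k (hproj A k a)" for k
      using y(2)[of k] AP_hproj0[OF a] V_at_zero[OF D_apply[OF x]] V_at_zero[OF D_apply[OF y(1)]] by (cases "k = 0") auto
  qed (use D_val[OF x pos_closed[OF a]] in auto)
  also have "... = evD x a" using evD_eq[OF x pos_closed[OF a] finite_lessThan N(1)] by simp
  finally show ?thesis by (simp add: eQ_def y_def)
qed

lemma QE:
  assumes "X .: Q"
  obtains x where "x .: D" "X = \<pi> x" using assms by (auto simp: Q_carrier)

lemma pi_closed: "x .: D ==> \<pi> x .: Q" by (simp add: Q_carrier)

lemma evD_homog:
  assumes x: "x .: D" and a: "a \<in> hcomp A k"
  shows "evD x a = x k a"
proof -
  obtain N where N: "\<And>k. N \<le> k ==> x k = 0[V k]" using D_bound[OF x] by blast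
  have v: "x k a .: R" using D_val[OF x hcomp_closed[OF a], of k] hproj_homog[OF a, of k] by simp
  have "evD x a = (\<Oplus>\<^bsub>R\<^esub>l\<in>{..max N k}. x l (hproj A l a))"
    using N by (intro evD_eq[OF x hcomp_closed[OF a]]) auto
  also have "... = (\<Oplus>\<^bsub>R\<^esub>l\<in>{..max N k}. if k = l then x k a else 0[R])"
    using hproj_homog[OF a] V_at_zero[OF D_apply[OF x]] v by (intro R.finsum_cong') auto
  also have "... = x k a" using R.finsum_singleton[of k "{..max N k}" "\<lambda>_. x k a"] v by simp
  finally show ?thesis .
qed

lemma evD_ahom:
  assumes x: "x .: D"
  shows "ahom A R (evD x)"
  unfolding evD_def[abs_def]
proof (rule ahom_sum[OF Rg])
  fix k
  show "ahom A R (\<lambda>a. x k (hproj A k a))"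
    using D_val[OF x] hproj_hcomp left_dual_add[OF D_apply[OF x, of k]]
    by (intro ahomI) (simp_all add: hproj_add hpart_simps)
qed

lemma evD_ops:
  assumes x: "x .: D" and a: "a .: A"
  shows "y .: D ==> evD (x +[D] y) a = evD x a +[R] evD y a"
    and "s .: R ==> evD (s .[D] x) a = evD x a *[R] s"
    and "s .: R ==> evD (x <[D] s) a = evD x (a <[A] s)"
    and "s .: R ==> evD x (s .[A] a) = s *[R] evD x a"
proof -
  interpret V: bimodule "op_ring R" "V k" for k by (rule V_bimodule)
  note e = evD_eq[OF _ _ finite_lessThan] and ac = rsmult_closed[OF _ a] smult_closed[OF _ a]
  have h: "hproj A k a \<in> hcomp A k" for k using hproj_hcomp[OF a] .
  have v: "(z +[D] y) k (hproj A k a) = z k (hproj A k a) +[R] y k (hproj A k a)"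
    "(s .[D] z) k (hproj A k a) = z k (hproj A k a) *[R] s"
    "s .: R ==> (z <[D] s) k (hproj A k a) = z k (hproj A k (a <[A] s))" for z y s k
    using h[of k] hproj_rsmult[OF _ a] by (simp_all add: D_simps left_dual_simps hpart_simps)
  show "evD (x +[D] y) a = evD x a +[R] evD y a" if y: "y .: D" proof -
    obtain N where N: "\<And>k. k \<notin> {..<N} ==> x k = 0[V k]" "\<And>k. k \<notin> {..<N} ==> y k = 0[V k]"
      using D_bound2[OF x y] by blast
    have "evD (x +[D] y) a = (\<Oplus>\<^bsub>R\<^esub>k\<in>{..<N}. (x +[D] y) k (hproj A k a))"
      by (rule e[OF D.M.a_closed[OF x y] a]) (simp add: N D_simps(3))
    then show ?thesis
      using e[OF x a N(1)] e[OF y a N(2)] D_val[OF _ a] x y by (simp add: v R.finsum_addf)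
  qed
  obtain N where N: "\<And>k. k \<notin> {..<N} ==> x k = 0[V k]" using D_bound2[OF x x] by blast
  note ex = e[OF x a N]
  assume s: "s .: R"
  have "evD (s .[D] x) a = (\<Oplus>\<^bsub>R\<^esub>k\<in>{..<N}. (s .[D] x) k (hproj A k a))"
    using s x by (intro e[OF D.smult_closed a]) (simp_all add: N D_simps(4) V.smult_zero)
  then show "evD (s .[D] x) a = evD x a *[R] s"
    using ex s D_val[OF x a] by (simp add: v R.finsum_ldistr)
  have "evD (x <[D] s) a = (\<Oplus>\<^bsub>R\<^esub>k\<in>{..<N}. (x <[D] s) k (hproj A k a))"
    using s x by (intro e[OF D.rsmult_closed a]) (simp_all add: N D_simps(5) V.zero_rsmult)
  then show "evD (x <[D] s) a = evD x (a <[A] s)" using e[OF x ac(1)[OF s] N] by (simp add: v s)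
  have "x k (hproj A k (s .[A] a)) = s *[R] x k (hproj A k a)" for k
    using left_dual_smult[OF D_apply[OF x, of k], of "hproj A k a" s] h[of k] s
    by (simp add: hproj_smult[OF s a] hpart_simps)
  then show "evD x (s .[A] a) = s *[R] evD x a"
    using e[OF x ac(2)[OF s] N] ex s D_val[OF x a] by (simp add: R.finsum_rdistr)
qed

end

context finite_rring
begin

section \<open>Dual bases of the homogeneous components\<close>

definition is_dual_basis :: "nat => 'a set \<times> ('a => 'a => 'r) => bool" where
  "is_dual_basis k = (\<lambda>(X, c). finite X \<and> X \<subseteq> hcomp A k \<and> (\<forall>v\<in>X. c v .: (V k)) \<and>
     (\<forall>a\<in>hcomp A k. a = (\<Oplus>\<^bsub>A\<^esub>v\<in>X. c v a .[A] v)))"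

definition basis :: "nat => 'a set" where "basis k = fst (SOME Xc. is_dual_basis k Xc)"

definition coord :: "nat => 'a => 'a => 'r" where "coord k = snd (SOME Xc. is_dual_basis k Xc)"

lemma basis_facts: "is_dual_basis k (basis k, coord k)"
proof -
  interpret H: bimodule R "hpart A k" by (rule hpart_bimodule)
  have "finitely_generated R (hpart A k)" using lfin by (simp add: left_locally_finite_def)
  then obtain X c where X: "finite X" "X \<subseteq> carrier (hpart A k)"
    "\<And>x. x \<in> X ==> left_linear R (hpart A k) (regular R) (c x)"
    "\<And>v. v .: (hpart A k) ==> v = (\<Oplus>\<^bsub>hpart A k\<^esub>x\<in>X. c x v .[hpart A k] x)"
    using dual_basis[OF ss H.left_module_axioms] by blast
  let ?c = "\<lambda>v. restrict (c v) (hcomp A k)"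
  have "is_dual_basis k (X, ?c)" unfolding is_dual_basis_def prod.case proof (intro conjI ballI)
    show "?c v .: (V k)" if "v \<in> X" for v
      using X(3)[OF that] by (simp add: left_dual_simps hpart_simps left_linear_def Pi_def hcomp_props(3,4))
    fix a assume a: "a \<in> hcomp A k"
    have cR: "c v a .: R" if "v \<in> X" for v
      using ahom_closed[OF left_linear_ahom[OF X(3)[OF that]], of a] a by (simp add: hpart_simps)
    have "a = (\<Oplus>\<^bsub>hpart A k\<^esub>x\<in>X. c x a .[hpart A k] x)" using X(4)[of a] a by (simp add: hpart_simps)
    also have "... = (\<Oplus>\<^bsub>A\<^esub>x\<in>X. c x a .[A] x)"
      unfolding hpart_simps using cR X(2) hcomp_props(4) by (intro hpart_finsum) (auto simp: hpart_simps)
    finally show "a = (\<Oplus>\<^bsub>A\<^esub>v\<in>X. ?c v a .[A] v)" using a by simp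
  qed (use X in \<open>auto simp: hpart_simps\<close>)
  then have "is_dual_basis k (SOME Xc. is_dual_basis k Xc)" by (rule someI)
  then show ?thesis by (simp add: basis_def coord_def)
qed

lemma basis_props:
  "finite (basis k)" "v \<in> basis k ==> v \<in> hcomp A k" "v \<in> basis k ==> coord k v .: (V k)"
  "a \<in> hcomp A k ==> a = (\<Oplus>\<^bsub>A\<^esub>v\<in>basis k. coord k v a .[A] v)"
  using basis_facts[of k] by (auto simp: is_dual_basis_def)

lemma coord_closed: "v \<in> basis k ==> a \<in> hcomp A k ==> coord k v a .: R"
  using left_dual_closed[OF basis_props(3)] by (simp add: hpart_simps)

text \<open>Starts in degree 1 because only \<open>A_+\<close> is to be reproduced. Passing to
  higher levels adds the bases of further degrees.\<close>

definition Ix :: "nat => (nat \<times> 'a) set" where "Ix N = Sigma {1..N} basis"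

definition qx :: "nat \<times> 'a => (nat => 'a => 'r) set" where "qx = (\<lambda>(k, v). \<pi> (incl k (coord k v)))"

lemma Ix_props: "i \<in> Ix N ==> snd i \<in> hcomp A (fst i)" "i \<in> Ix N ==> 0 < fst i" "i \<in> Ix N ==> snd i .: AP"
  "i \<in> Ix N ==> qx i .: Q"
  using basis_props(2,3) hcomp_pos[OF basis_props(2)] by (auto simp: Ix_def qx_def intro!: pi_closed incl_closed)

lemma incl_eQ:
  assumes "\<alpha> .: (V k)" "a .: AP"
  shows "eQ (\<pi> (incl k \<alpha>)) a = \<alpha> (hproj A k a)"
proof -
  have "evD (incl k \<alpha>) a = (\<Oplus>\<^bsub>R\<^esub>l\<in>{k}. incl k \<alpha> l (hproj A l a))"
    by (rule evD_eq[OF incl_closed[OF assms(1)] pos_closed[OF assms(2)]]) (auto simp: gr_dual_incl_def)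
  then show ?thesis
    using eQ_pi[OF incl_closed[OF assms(1)] assms(2)] left_dual_closed[OF assms(1), of "hproj A k a"]
      hproj_hcomp[OF pos_closed[OF assms(2)], of k] by (simp add: gr_dual_incl_def hpart_simps)
qed

lemma eQ_right: "X .: Q ==> ahom AP R (eQ X)"
proof -
  assume "X .: Q"
  then obtain x where x: "x .: D" "X = \<pi> x" by (rule QE)
  have "ahom AP R (evD x)"
    using ahom_add[OF evD_ahom[OF x(1)]] ahom_closed[OF evD_ahom[OF x(1)]] pos_closed
    by (intro ahomI) (simp_all add: pos_simps)
  then show ?thesis using P.M.a_closed by (auto simp: ahom_def x eQ_pi Pi_iff)
qed

lemma eQ_ops:
  assumes X: "X .: Q" and a: "a .: AP"
  shows "Y .: Q ==> eQ (X +[Q] Y) a = eQ X a +[R] eQ Y a"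
    and "s .: R ==> eQ (s .[Q] X) a = eQ X a *[R] s"
    and "s .: R ==> eQ (X <[Q] s) a = eQ X (a <[AP] s)"
    and "s .: R ==> eQ X (s .[AP] a) = s *[R] eQ X a"
proof -
  obtain x where x: "x .: D" "X = \<pi> x" using X by (rule QE)
  note o = evD_ops[OF x(1) pos_closed[OF a]]
  show "eQ (X +[Q] Y) a = eQ X a +[R] eQ Y a" if Y: "Y .: Q" proof -
    obtain y where y: "y .: D" "Y = \<pi> y" using Y by (rule QE)
    show ?thesis using D.M.a_closed[OF x(1) y(1)] x y a o(1) by (simp add: Q_add eQ_pi)
  qed
  assume s: "s .: R"
  show "eQ (s .[Q] X) a = eQ X a *[R] s"
    using s D.smult_closed[of s x] x a o(2) by (simp add: Q_smult eQ_pi)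
  show "eQ (X <[Q] s) a = eQ X (a <[AP] s)"
    using s D.rsmult_closed[of s x] x a o(3) P.rsmult_closed[OF s a] by (simp add: Q_rsmult eQ_pi pos_simps)
  show "eQ X (s .[AP] a) = s *[R] eQ X a"
    using s x a o(4) P.smult_closed[OF s a] by (simp add: eQ_pi pos_simps)
qed

lemma eQ_closed: "X .: Q ==> a .: AP ==> eQ X a .: R"
  using ahom_closed[OF eQ_right] .

text \<open>A representative has finitely many components, so the value depends on finitely many
  degrees of the argument. This bound becomes the level in the dual basis identity.\<close>

lemma eQ_bounded:
  assumes "X .: Q"
  obtains N where "\<And>a b. a .: AP ==> b .: AP ==> (\<And>k. k \<le> N ==> hproj A k a = hproj A k b) ==> eQ X a = eQ X b"
proof -
  obtain x where x: "x .: D" "X = \<pi> x" using assms by (rule QE)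
  obtain N where N: "\<And>k. N \<le> k ==> x k = 0[V k]" using D_bound[OF x(1)] by blast
  have e: "eQ X a = (\<Oplus>\<^bsub>R\<^esub>k\<in>{..N}. x k (hproj A k a))" if "a .: AP" for a
    using evD_eq[OF x(1) pos_closed[OF that], of "{..N}"] N eQ_pi[OF x(1) that] x(2) by simp
  show thesis proof (rule that)
    fix a b assume ab: "a .: AP" "b .: AP" "\<And>k. k \<le> N ==> hproj A k a = hproj A k b"
    show "eQ X a = eQ X b" unfolding e[OF ab(1)] e[OF ab(2)]
      by (rule R.finsum_cong') (use ab D_val[OF x(1) pos_closed[OF ab(2)]] in auto)
  qed
qed

text \<open>Evaluation at homogeneous elements recovers every component of positive degree; two
  representatives that agree in these differ by an element of \<open>D_0\<close>.\<close>

lemma eQ_eqI: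
  assumes X: "X .: Q" and Y: "Y .: Q" and eq: "\<And>a. a .: AP ==> eQ X a = eQ Y a"
  shows "X = Y"
proof -
  obtain x where x: "x .: D" "X = \<pi> x" using X by (rule QE)
  obtain y where y: "y .: D" "Y = \<pi> y" using Y by (rule QE)
  have xy: "x k = y k" if k: "0 < k" for k
  proof (rule left_dual_eqI[OF D_apply[OF x(1)] D_apply[OF y(1)]])
    fix a assume "a .: (hpart A k)"
    then have a: "a \<in> hcomp A k" by (simp add: hpart_simps)
    show "x k a = y k a"
      using eq[OF hcomp_pos[OF a k]] eQ_pi[OF _ hcomp_pos[OF a k]] evD_homog[OF _ a] x y by simp
  qed
  interpret V: abelian_group "V k" for k by (rule V_group)
  let ?d = "x -[D] y"
  have d: "?d \<in> hcomp D 0" using D.M.minus_closed[OF x(1) y(1)] xy D_apply[OF y(1)]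
    by (auto simp: D0_iff a_minus_def D_simps(3) D_neg[OF y(1)] V.r_neg)
  have j: "\<pi> z = hcomp D 0" if "z \<in> hcomp D 0" for z
    using D.M.a_coset_join2[OF _ additive_subgroup.a_subgroup[OF D0_subgroup] that] that by (simp add: D0_iff)
  interpret Q: bimodule "op_ring R" Q by (rule Q_bimodule)
  have "\<pi> x = \<pi> (?d +[D] y)" using x y by (simp add: a_minus_def D.M.a_assoc D.M.l_neg)
  also have "... = \<pi> ?d +[Q] \<pi> y"
    using D.M.minus_closed[OF x(1) y(1)] y(1) by (rule Q_add[symmetric])
  also have "\<pi> ?d = 0[Q]"
    using j[OF d] j[of "0[D]"] additive_subgroup.zero_closed[OF D0_subgroup] by (simp add: Q_carrier(2))
  finally show ?thesis using x y pi_closed[OF y(1)] by simp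
qed

text \<open>Level \<open>N\<close> joins the dual bases of the degrees from 1 to \<open>N\<close>,
  and the projection to degree \<open>l\<close> leaves the expansion in that one degree.\<close>

lemma basis_proj:
  assumes a: "a .: AP" and l: "l \<le> N"
  shows "hproj A l (\<Oplus>\<^bsub>AP\<^esub>i\<in>Ix N. eQ (qx i) a .[AP] snd i) = hproj A l a"
proof -
  have ac: "a .: A" using pos_closed[OF a] .
  let ?t = "\<lambda>i. coord (fst i) (snd i) (hproj A (fst i) a) .[A] snd i"
  have th: "?t i \<in> hcomp A (fst i)" if "i \<in> Ix N" for i
    using that coord_closed hproj_hcomp[OF ac] hcomp_props(4) basis_props(2) by (auto simp: Ix_def)
  have tc: "?t i .: AP" if "i \<in> Ix N" for i using hcomp_pos[OF th[OF that] Ix_props(2)[OF that]] .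
  have te: "eQ (qx i) a .[AP] snd i = ?t i" if "i \<in> Ix N" for i
    using that incl_eQ[OF _ a] basis_props(3) by (auto simp: Ix_def qx_def pos_simps)
  have h: "ahom AP A (hproj A l)"
    using hproj_add pos_closed hproj_closed by (intro ahomI) (simp_all add: pos_simps)
  have fin: "finite (Ix N)" using basis_props(1) by (simp add: Ix_def)
  have "(\<Oplus>\<^bsub>AP\<^esub>i\<in>Ix N. eQ (qx i) a .[AP] snd i) = (\<Oplus>\<^bsub>AP\<^esub>i\<in>Ix N. ?t i)"
    using te tc by (intro P.M.finsum_cong') auto
  also have "hproj A l ... = (\<Oplus>\<^bsub>A\<^esub>i\<in>Ix N. hproj A l (?t i))"
    using tc by (intro ahom_finsum[OF P.M.abelian_group_axioms abelian_group_axioms h]) auto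
  also have "... = (\<Oplus>\<^bsub>A\<^esub>i\<in>Ix N. if fst i = l then ?t i else 0[A])"
    using hproj_homog[OF th] hcomp_closed[OF th] by (intro finsum_cong') auto
  \<comment> \<open>No index has degree 0; there both sides are zero because \<open>a\<close> is in
    \<open>A_+\<close>.\<close>
  also have "... = hproj A l a" proof (cases "l = 0")
    case True
    then have "(\<Oplus>\<^bsub>A\<^esub>i\<in>Ix N. if fst i = l then ?t i else 0[A]) = (\<Oplus>\<^bsub>A\<^esub>i\<in>Ix N. 0[A])"
      by (intro finsum_cong') (auto dest: Ix_props(2))
    then show ?thesis using AP_hproj0[OF a] True by (simp add: finsum_zero)
  next
    case False
    have "(\<Oplus>\<^bsub>A\<^esub>i\<in>Ix N. if fst i = l then ?t i else 0[A]) = (\<Oplus>\<^bsub>A\<^esub>i\<in>Pair l ` basis l. ?t i)"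
      using fin l False hcomp_closed[OF th]
      by (intro add.finprod_mono_neutral_cong_right) (auto simp: Ix_def)
    also have "... = (\<Oplus>\<^bsub>A\<^esub>v\<in>basis l. ?t (l, v))" using hcomp_closed[OF th[of "(l, _)"]] l False
      by (intro finsum_reindex) (auto simp: Ix_def inj_on_def)
    also have "... = hproj A l a" using basis_props(4)[OF hproj_hcomp[OF ac], of l] by simp
    finally show ?thesis .
  qed
  finally show ?thesis .
qed

text \<open>For the dual basis identity, evaluate both sides at \<open>a\<close>. By linearity the
  sum becomes the value of \<open>X c\<close> at the expansion of \<open>a\<close>, which agrees
  with \<open>a\<close> up to degree \<open>N\<close>; from \<open>N0\<close> on, \<open>X\<close>
  cannot tell the two apart after right multiplication by \<open>c\<close>, since this preserves
  degrees.\<close>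

lemma paired_Q: "paired R AP Q eQ Ix snd qx"
proof (rule paired.intro[OF P.bimodule_axioms Q_bimodule], rule paired_axioms.intro)
  interpret Q: bimodule "op_ring R" Q by (rule Q_bimodule)
  show left: "ahom Q R (\<lambda>X. eQ X v)" if "v .: AP" for v
    using eQ_closed eQ_ops(1) that by (intro ahomI) auto
  fix X assume X: "X .: Q"
  obtain N0 where N0: "\<And>a b. a .: AP ==> b .: AP ==>
      (\<And>k. k \<le> N0 ==> hproj A k a = hproj A k b) ==> eQ X a = eQ X b"
    using eQ_bounded[OF X] by blast
  show "\<exists>N0. \<forall>N\<ge>N0. \<forall>c\<in>carrier R. X <[Q] c = (\<Oplus>\<^bsub>Q\<^esub>i\<in>Ix N. eQ X (snd i <[AP] c) .[Q] qx i)"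
  proof (intro exI allI impI ballI)
    fix N c assume N: "N0 \<le> N" and c: "c .: R"
    have t: "eQ X (snd i <[AP] c) .[Q] qx i .: Q" if "i \<in> Ix N" for i
      using Ix_props(3,4)[OF that] X c P.rsmult_closed eQ_closed Q.smult_closed by simp
    show "X <[Q] c = (\<Oplus>\<^bsub>Q\<^esub>i\<in>Ix N. eQ X (snd i <[AP] c) .[Q] qx i)" proof (rule eQ_eqI)
      show "X <[Q] c .: Q" using Q.rsmult_closed[of c X] X c by simp
      show "(\<Oplus>\<^bsub>Q\<^esub>i\<in>Ix N. eQ X (snd i <[AP] c) .[Q] qx i) .: Q"
        using t by (intro Q.M.finsum_closed) auto
      fix a assume a: "a .: AP"
      let ?s = "\<lambda>i. eQ (qx i) a .[AP] snd i"
      have s: "?s i .: AP" if "i \<in> Ix N" for i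
        using Ix_props(3,4)[OF that] a eQ_closed P.smult_closed by simp
      let ?b = "\<Oplus>\<^bsub>AP\<^esub>i\<in>Ix N. ?s i"
      have b: "?b .: AP" using s by (intro P.M.finsum_closed) auto
      have "eQ (\<Oplus>\<^bsub>Q\<^esub>i\<in>Ix N. eQ X (snd i <[AP] c) .[Q] qx i) a =
          (\<Oplus>\<^bsub>R\<^esub>i\<in>Ix N. eQ (eQ X (snd i <[AP] c) .[Q] qx i) a)"
        using t by (intro ahom_finsum[OF Q.M.abelian_group_axioms Rg left[OF a]]) auto
      also have "... = (\<Oplus>\<^bsub>R\<^esub>i\<in>Ix N. eQ (X <[Q] c) (?s i))" proof (rule R.finsum_cong'[OF refl])
        show "(\<lambda>i. eQ (X <[Q] c) (?s i)) \<in> Ix N \<rightarrow> carrier R"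
          using s eQ_closed Q.rsmult_closed[of c X] X c by auto
        show "eQ (eQ X (snd i <[AP] c) .[Q] qx i) a = eQ (X <[Q] c) (?s i)" if i: "i \<in> Ix N" for i
          using Ix_props(3,4)[OF i] X c a P.rsmult_closed eQ_closed Q.rsmult_closed[of c X] P.smult_closed
          by (simp add: eQ_ops(2) eQ_ops(3) eQ_ops(4))
      qed
      also have "... = eQ (X <[Q] c) ?b" using s Q.rsmult_closed[of c X] X c
        by (intro ahom_finsum[OF P.M.abelian_group_axioms Rg eQ_right, symmetric]) auto
      also have "... = eQ X (?b <[AP] c)" using X b c by (rule eQ_ops(3))
      also have "... = eQ X (a <[AP] c)" proof (rule N0)
        show "?b <[AP] c .: AP" "a <[AP] c .: AP" using a b c P.rsmult_closed by auto
        show "hproj A k (?b <[AP] c) = hproj A k (a <[AP] c)" if "k \<le> N0" for k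
          using basis_proj[OF a, of k N] that N hproj_rsmult[OF c pos_closed[OF b], of k] hproj_rsmult[OF c pos_closed[OF a], of k]
          by (simp add: pos_simps)
      qed
      also have "... = eQ (X <[Q] c) a" using eQ_ops(3)[OF X a c] by simp
      finally show "eQ (X <[Q] c) a = eQ (\<Oplus>\<^bsub>Q\<^esub>i\<in>Ix N. eQ X (snd i <[AP] c) .[Q] qx i) a" ..
    qed
  qed
qed (use eQ_right eQ_ops Ix_props in auto)

end

lemma bilin_right: "bilin R M N G \<phi> ==> x .: M ==> ahom N G (\<lambda>y. \<phi> (x, y))"
  and bilin_left: "bilin R M N G \<phi> ==> y .: N ==> ahom M G (\<lambda>x. \<phi> (x, y))"
  and bilin_bal: "bilin R M N G \<phi> ==> x .: M ==> r .: R ==> y .: N ==>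
    \<phi> (x <[M] r, y) = \<phi> (x, r .[N] y)" by (simp_all add: bilin_def)

context finite_rring
begin

section \<open>The components of the comultiplication of the graded dual\<close>

abbreviation "TV n m \<equiv> tensor (op_ring R) (V n) (V m)"
abbreviation "TH n m \<equiv> tensor R (hpart A n) (hpart A m)"
abbreviation "TD \<equiv> tensor (op_ring R) DB DB"
abbreviation "TQ \<equiv> tensor (op_ring R) Q Q"
abbreviation "hp n m \<equiv> tensor_pure R (hpart A n) (hpart A m)"
text \<open>With \<open>hpair\<close> next to it, two readings of the one expression
  \<open>\<alpha> (v \<beta>(w))\<close>: balanced over the opposite ring in the functionals, and
  balanced over \<open>R\<close> in the arguments. \<open>dual_tensor_map\<close> combines
  both.\<close>

abbreviation "vpair v w \<equiv> \<lambda>(\<alpha>, \<beta>). \<alpha> (v <[A] \<beta> w)"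
abbreviation "hpair \<alpha> \<beta> \<equiv> \<lambda>(v, w). \<alpha> (v <[A] \<beta> w)"

sublocale TV: bimodule_pair "op_ring R" "V n" "V m" for n m
  by (intro bimodule_pair.intro V_bimodule)

sublocale TH: bimodule_pair R "hpart A n" "hpart A m" for n m
  by (intro bimodule_pair.intro hpart_bimodule)

sublocale TD: bimodule_pair "op_ring R" DB DB by (intro bimodule_pair.intro DB_bimodule)

sublocale TQ: bimodule_pair "op_ring R" Q Q by (intro bimodule_pair.intro Q_bimodule)

lemma V_facts:
  assumes "\<alpha> .: (V n)"
  shows V_closed: "v \<in> hcomp A n ==> \<alpha> v .: R"
    and V_add: "v \<in> hcomp A n ==> w \<in> hcomp A n ==> \<alpha> (v +[A] w) = \<alpha> v +[R] \<alpha> w"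
    and V_smult: "v \<in> hcomp A n ==> r .: R ==> \<alpha> (r .[A] v) = r *[R] \<alpha> v"
  using left_dual_closed[OF assms] left_dual_add[OF assms] left_dual_smult[OF assms]
  by (simp_all add: hpart_simps)

lemma V_ops:
  assumes "v \<in> hcomp A n"
  shows "(\<alpha> +[V n] \<beta>) v = \<alpha> v +[R] \<beta> v" "(s .[V n] \<alpha>) v = \<alpha> v *[R] s" "(\<alpha> <[V n] s) v = \<alpha> (v <[A] s)"
  using assms by (simp_all add: left_dual_simps hpart_simps)

lemma vpair_bilin:
  assumes v: "v \<in> hcomp A n" and w: "w \<in> hcomp A m"
  shows "bilin (op_ring R) (V n) (V m) R (vpair v w)"
proof (rule bilinI, unfold prod.case, goal_cases)
  case (1 \<alpha>)
  show ?case using v w V_closed[OF _ w] 1 hcomp_rsmult[OF _ v]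
    by (intro ahomI) (simp_all add: V_closed[OF 1] V_ops rsmult_r_distr hcomp_closed V_add[OF 1])
next
  case (2 \<beta>)
  show ?case
    using V_closed[OF 2 w] hcomp_rsmult[OF _ v] by (intro ahomI) (simp_all add: V_closed V_ops)
next
  case (3 \<alpha> r \<beta>)
  show ?case
    using 3 V_closed[OF 3(3) w] hcomp_rsmult[OF _ v] v w by (simp add: V_ops rsmult_assoc hcomp_closed)
qed

lemma hpair_bilin:
  assumes \<alpha>: "\<alpha> .: (V n)" and \<beta>: "\<beta> .: (V m)"
  shows "bilin R (hpart A n) (hpart A m) R (hpair \<alpha> \<beta>)"
proof (rule bilinI; unfold prod.case hpart_simps)
  note cl = V_closed[OF \<alpha>] V_closed[OF \<beta>] hcomp_rsmult hcomp_props(3,4)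
  show "ahom (hpart A m) R (\<lambda>w. \<alpha> (v <[A] \<beta> w))" if v: "v \<in> hcomp A n" for v
    using v by (intro ahomI) (simp_all add: hpart_simps cl V_add[OF \<beta>] V_add[OF \<alpha>] rsmult_r_distr hcomp_closed)
  show "ahom (hpart A n) R (\<lambda>v. \<alpha> (v <[A] \<beta> w))" if w: "w \<in> hcomp A m" for w
    using w by (intro ahomI) (simp_all add: hpart_simps cl V_add[OF \<alpha>] rsmult_l_distr hcomp_closed)
  show "\<alpha> (v <[A] r <[A] \<beta> w) = \<alpha> (v <[A] \<beta> (r .[A] w))"
    if "v \<in> hcomp A n" "r .: R" "w \<in> hcomp A m" for v r w
    using that by (simp add: V_smult[OF \<beta>] cl rsmult_assoc hcomp_closed)
qed

abbreviation "dmap n m \<alpha> \<beta> \<equiv> \<lambda>X\<in>carrier (TH n m). presented_lift R (hpair \<alpha> \<beta>) X"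

lemma hpair_pure: "\<alpha> .: (V n) ==> \<beta> .: (V m) ==> v \<in> hcomp A n ==> w \<in> hcomp A m ==>
    presented_lift R (hpair \<alpha> \<beta>) (hp n m v w) = \<alpha> (v <[A] \<beta> w)"
  using TH.lift_pure[OF Rg hpair_bilin, of \<alpha> n \<beta> m v w] by (simp add: hpart_simps)

lemma dmap_closed:
  assumes \<alpha>: "\<alpha> .: (V n)" and \<beta>: "\<beta> .: (V m)"
  shows "dmap n m \<alpha> \<beta> .: (left_dual R (TH n m))"
proof (rule left_dual_memI)
  interpret T: bimodule R "TH n m" by (rule TH.tensor_bimodule)
  note la = TH.lift_ahom[OF Rg hpair_bilin[OF \<alpha> \<beta>]]
  show "presented_lift R (hpair \<alpha> \<beta>) X .: R" if "X .: (TH n m)" for X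
    using ahom_closed[OF la that] .
  show "presented_lift R (hpair \<alpha> \<beta>) (X +[TH n m] Y) =
      presented_lift R (hpair \<alpha> \<beta>) X +[R] presented_lift R (hpair \<alpha> \<beta>) Y"
    if "X .: (TH n m)" "Y .: (TH n m)" for X Y using ahom_add[OF la that] .
  show "presented_lift R (hpair \<alpha> \<beta>) (r .[TH n m] X) = r *[R] presented_lift R (hpair \<alpha> \<beta>) X"
    if r: "r .: R" and X: "X .: (TH n m)" for r X
  proof (rule TH.tensor_eqI[OF Rg _ _ _ X])
    show "ahom (TH n m) R (\<lambda>X. presented_lift R (hpair \<alpha> \<beta>) (r .[TH n m] X))"
      by (rule ahom_comp[OF T.ahom_smult[OF r] la])
    have "ahom R R (\<lambda>x. r *[R] x)" using r by (intro ahomI) (simp_all add: R.r_distr)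
    from ahom_comp[OF la this] show "ahom (TH n m) R (\<lambda>X. r *[R] presented_lift R (hpair \<alpha> \<beta>) X)" .
    fix v w assume vw: "v .: (hpart A n)" "w .: (hpart A m)"
    then have h: "v \<in> hcomp A n" "w \<in> hcomp A m" by (simp_all add: hpart_simps)
    then show "presented_lift R (hpair \<alpha> \<beta>) (r .[TH n m] hp n m v w) =
        r *[R] presented_lift R (hpair \<alpha> \<beta>) (hp n m v w)"
      using r V_closed[OF \<beta>] hcomp_props(4)[OF r] hcomp_rsmult V_smult[OF \<alpha>] TH.smult_pure[OF r vw]
      by (simp add: hpair_pure[OF \<alpha> \<beta>] hpart_simps smult_rsmult hcomp_closed)
  qed
qed (rule bimodule.axioms(1)[OF TH.tensor_bimodule])

lemma dual_eqI:
  assumes f: "f .: (left_dual R (TH n m))" and g: "g .: (left_dual R (TH n m))"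
    and eq: "\<And>v w. v \<in> hcomp A n ==> w \<in> hcomp A m ==> f (hp n m v w) =
      g (hp n m v w)"
  shows "f = g" by (rule left_dual_eqI[OF f g],
      rule TH.tensor_eqI[OF Rg left_dual_ahom[OF f] left_dual_ahom[OF g]])
    (use eq in \<open>simp_all add: hpart_simps\<close>)

lemma dmap_pure: "\<alpha> .: (V n) ==> \<beta> .: (V m) ==> v \<in> hcomp A n ==> w \<in> hcomp A m ==>
    dmap n m \<alpha> \<beta> (hp n m v w) = \<alpha> (v <[A] \<beta> w)"
  using TH.pure_closed[where n = n and m = m] by (simp add: hpair_pure hpart_simps)

lemma TH_dual_group: "abelian_group (left_dual R (TH n m))"
  by (rule bimodule.left_dual_group[OF TH.tensor_bimodule])

lemma TH_dual_add: "v \<in> hcomp A n ==> w \<in> hcomp A m ==> (f +[left_dual R (TH n m)] g) (hp n m v w) =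
    f (hp n m v w) +[R] g (hp n m v w)"
  using TH.pure_closed[of v n w m] by (simp add: left_dual_simps hpart_simps)

lemma dmap_bilin: "bilin (op_ring R) (V n) (V m) (left_dual R (TH n m)) (\<lambda>(\<alpha>, \<beta>). dmap n m \<alpha> \<beta>)"
proof -
  interpret L: abelian_group "left_dual R (TH n m)" by (rule TH_dual_group)
  note Vc = abelian_monoid.a_closed[OF abelian_group.axioms(1)[OF V_group]]
    bimodule.rsmult_closed[OF V_bimodule] left_module.smult_closed[OF bimodule.axioms(1)[OF V_bimodule]]
  show ?thesis proof (rule bilinI; unfold prod.case)
    show "ahom (V m) (left_dual R (TH n m)) (dmap n m \<alpha>)" if \<alpha>: "\<alpha> .: (V n)" for \<alpha>
    proof (rule ahomI)
      show "dmap n m \<alpha> (\<beta> +[V m] \<gamma>) = dmap n m \<alpha> \<beta> +[left_dual R (TH n m)] dmap n m \<alpha> \<gamma>"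
        if \<beta>: "\<beta> .: (V m)" and \<gamma>: "\<gamma> .: (V m)" for \<beta> \<gamma>
      proof (rule dual_eqI)
        fix v w assume "v \<in> hcomp A n" "w \<in> hcomp A m"
        then show "dmap n m \<alpha> (\<beta> +[V m] \<gamma>) (hp n m v w) =
          (dmap n m \<alpha> \<beta> +[left_dual R (TH n m)] dmap n m \<alpha> \<gamma>) (hp n m v w)"
          unfolding TH_dual_add[OF \<open>v \<in> hcomp A n\<close> \<open>w \<in> hcomp A m\<close>]
          using ahom_add[OF bilin_right[OF vpair_bilin \<alpha>, of v w m] \<beta> \<gamma>] \<alpha> \<beta> \<gamma> by (simp only: dmap_pure Vc(1) prod.case)
      qed (simp_all only: dmap_closed \<alpha> \<beta> \<gamma> Vc(1) L.a_closed)
    qed (rule dmap_closed[OF \<alpha>])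
    show "ahom (V n) (left_dual R (TH n m)) (\<lambda>\<alpha>. dmap n m \<alpha> \<beta>)" if \<beta>: "\<beta> .: (V m)" for \<beta>
    proof (rule ahomI)
      show "dmap n m (\<alpha> +[V n] \<gamma>) \<beta> = dmap n m \<alpha> \<beta> +[left_dual R (TH n m)] dmap n m \<gamma> \<beta>"
        if \<alpha>: "\<alpha> .: (V n)" and \<gamma>: "\<gamma> .: (V n)" for \<alpha> \<gamma>
      proof (rule dual_eqI)
        fix v w assume "v \<in> hcomp A n" "w \<in> hcomp A m"
        then show "dmap n m (\<alpha> +[V n] \<gamma>) \<beta> (hp n m v w) =
          (dmap n m \<alpha> \<beta> +[left_dual R (TH n m)] dmap n m \<gamma> \<beta>) (hp n m v w)"
          unfolding TH_dual_add[OF \<open>v \<in> hcomp A n\<close> \<open>w \<in> hcomp A m\<close>]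
          using ahom_add[OF bilin_left[OF vpair_bilin \<beta>, of v n w] \<alpha> \<gamma>] \<alpha> \<beta> \<gamma> by (simp only: dmap_pure Vc(1) prod.case)
      qed (simp_all only: dmap_closed \<alpha> \<beta> \<gamma> Vc(1) L.a_closed)
    qed (rule dmap_closed[OF _ \<beta>])
    show "dmap n m (\<alpha> <[V n] r) \<beta> = dmap n m \<alpha> (r .[V m] \<beta>)"
      if "\<alpha> .: (V n)" "r .: (op_ring R)" "\<beta> .: (V m)" for \<alpha> r \<beta>
    proof (rule dual_eqI)
      fix v w assume "v \<in> hcomp A n" "w \<in> hcomp A m"
      then show "dmap n m (\<alpha> <[V n] r) \<beta> (hp n m v w) =
          dmap n m \<alpha> (r .[V m] \<beta>) (hp n m v w)"
        using bilin_bal[OF vpair_bilin that, of v w] that by (simp only: dmap_pure Vc prod.case)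
    qed (rule dmap_closed[OF Vc(2)[OF that(2,1)] that(3)], rule dmap_closed[OF that(1) Vc(3)[OF that(2,3)]])
  qed
qed

lemma dual_tensor_map_pure:
  assumes Z: "Z .: (TV n m)" and v: "v \<in> hcomp A n" and w: "w \<in> hcomp A m"
  shows "dual_tensor_map R A n m Z .: (left_dual R (TH n m))"
    and "dual_tensor_map R A n m Z (hp n m v w) = presented_lift R (vpair v w) Z"
proof -
  note la = TV.lift_ahom[OF TH_dual_group dmap_bilin, of n m]
  have d: "dual_tensor_map R A n m Z = presented_lift (left_dual R (TH n m)) (\<lambda>(\<alpha>, \<beta>). dmap n m \<alpha> \<beta>) Z" for Z
    by (simp add: dual_tensor_map_def)
  show "dual_tensor_map R A n m Z .: (left_dual R (TH n m))"
    unfolding d by (rule ahom_closed[OF la Z])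
  have pc: "hp n m v w .: (TH n m)" using TH.pure_closed[of v n w m] v w by (simp add: hpart_simps)
  show "dual_tensor_map R A n m Z (hp n m v w) = presented_lift R (vpair v w) Z" unfolding d
  proof (rule TV.tensor_eqI[OF Rg _ _ _ Z])
    show "ahom (TV n m) R (\<lambda>Z. presented_lift (left_dual R (TH n m)) (\<lambda>(\<alpha>, \<beta>). dmap n m \<alpha> \<beta>) Z
        (hp n m v w))" by (rule ahom_comp[OF la bimodule.left_dual_eval[OF TH.tensor_bimodule pc]])
    show "ahom (TV n m) R (\<lambda>Z. presented_lift R (vpair v w) Z)"
      by (rule TV.lift_ahom[OF Rg vpair_bilin[OF v w]])
    fix \<alpha> \<beta> assume ab: "\<alpha> .: (V n)" "\<beta> .: (V m)"
    show "presented_lift (left_dual R (TH n m)) (\<lambda>(\<alpha>, \<beta>). dmap n m \<alpha> \<beta>) (tensor_pure (op_ring R) (V n) (V m) \<alpha> \<beta>)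
        (hp n m v w) = presented_lift R (vpair v w) (tensor_pure (op_ring R) (V n) (V m) \<alpha> \<beta>)"
      using TV.lift_pure[OF TH_dual_group dmap_bilin ab] TV.lift_pure[OF Rg vpair_bilin[OF v w] ab]
        dmap_pure[OF ab v w] by simp
  qed
qed

lemma mult_transpose_props:
  assumes \<phi>: "\<phi> .: (V (n + m))"
  shows "X .: (TH n m) ==> presented_lift A (\<lambda>(v, w). v *[A] w) X \<in> hcomp A (n + m)"
    and "ahom (TH n m) R (mult_transpose R A n m \<phi>)" and "v \<in> hcomp A n ==> w \<in> hcomp A m ==>
      mult_transpose R A n m \<phi> (hp n m v w) = \<phi> (v *[A] w)"
proof -
  interpret T: abelian_group "TH n m" by (rule TH.tensor_group)
  have b: "bilin R (hpart A n) (hpart A m) A (\<lambda>(v, w). v *[A] w)"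
    by (rule bilinI; unfold prod.case hpart_simps)
      (auto intro!: ahomI simp: hpart_simps hcomp_closed A.r_distr A.l_distr mult_balanced)
  note la = TH.lift_ahom[OF abelian_group_axioms b]
  have p: "presented_lift A (\<lambda>(v, w). v *[A] w) (hp n m v w) = v *[A] w"
    if "v \<in> hcomp A n" "w \<in> hcomp A m" for v w
    using TH.lift_pure[OF abelian_group_axioms b, of v w] that by (simp add: hpart_simps)
  have c: "presented_lift A (\<lambda>(v, w). v *[A] w) X \<in> hcomp A (n + m)" if "X .: (TH n m)" for X
    using that
  proof (induction rule: TH.tensor_induct)
    case (pure x y)
    then show ?case by (simp add: hpart_simps p mult_degree)
  qed (simp_all add: ahom_zero[OF TH.tensor_group abelian_group_axioms la] ahom_add[OF la]
      ahom_neg[OF TH.tensor_group abelian_group_axioms la] hcomp_props)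
  then show "X .: (TH n m) ==> presented_lift A (\<lambda>(v, w). v *[A] w) X \<in> hcomp A (n + m)" .
  show "ahom (TH n m) R (mult_transpose R A n m \<phi>)"
    by (rule ahomI) (simp_all add: mult_transpose_def ahom_add[OF la] V_add[OF \<phi>] V_closed[OF \<phi>] c)
  show "mult_transpose R A n m \<phi> (hp n m v w) = \<phi> (v *[A] w)" if "v \<in> hcomp A n" "w \<in> hcomp A m"
    using TH.pure_closed[of v n w m] that by (simp add: mult_transpose_def p hpart_simps)
qed

text \<open>\<open>gr_dual_comult_comp\<close> is an inverse image under
  \<open>dual_tensor_map\<close>, so its defining property follows as soon as the transpose of the
  multiplication is in the range. A preimage is written down with the dual basis of
  \<open>A^m\<close>. The outcome is the duality formula, by which the component is used from here
  on.\<close>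

lemma comult_comp_props:
  assumes \<phi>: "\<phi> .: (V (n + m))"
  shows "gr_dual_comult_comp R A n m \<phi> .: (TV n m)" and "v \<in> hcomp A n ==> w \<in> hcomp A m ==>
      presented_lift R (vpair v w) (gr_dual_comult_comp R A n m \<phi>) = \<phi> (v *[A] w)"
proof -
  interpret T: abelian_group "TV n m" by (rule TV.tensor_group)
  \<comment> \<open>The preimage is the sum over the basis elements \<open>u\<close> of
    \<open>\<phi>(- u)\<close> tensored with the coordinate functional of \<open>u\<close>. Paired
    with \<open>v\<close> and \<open>w\<close> it gives \<phi> at \<open>v\<close> times the
    expansion of \<open>w\<close>.\<close>
  let ?\<alpha> = "\<lambda>u. \<lambda>v\<in>hcomp A n. \<phi> (v *[A] u)"
  note cl = V_closed[OF \<phi>] mult_degree hcomp_closed hcomp_props(3,4)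
  have \<alpha>: "?\<alpha> u .: (V n)" if u: "u \<in> hcomp A m" for u
    using left_dual_memI[of "hpart A n" "\<lambda>v. \<phi> (v *[A] u)" R] u bimodule.axioms(1)[OF hpart_bimodule]
    by (simp add: hpart_simps cl A.l_distr V_add[OF \<phi>] V_smult[OF \<phi>] flip: smult_mult)
  let ?z = "\<lambda>u. tensor_pure (op_ring R) (V n) (V m) (?\<alpha> u) (coord m u)"
  have zc: "?z u .: (TV n m)" if "u \<in> basis m" for u
    using TV.pure_closed[OF \<alpha> basis_props(3)] basis_props(2) that by blast
  define Z where "Z = (\<Oplus>\<^bsub>TV n m\<^esub>u\<in>basis m. ?z u)"
  have Z: "Z .: (TV n m)" unfolding Z_def using zc by (intro T.finsum_closed) auto
  have Ze: "presented_lift R (vpair v w) Z = \<phi> (v *[A] w)" if v: "v \<in> hcomp A n" and w: "w \<in> hcomp A m" for v w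
  proof -
    note vb = vpair_bilin[OF v w]
    have "presented_lift R (vpair v w) Z = (\<Oplus>\<^bsub>R\<^esub>u\<in>basis m. presented_lift R (vpair v w) (?z u))"
      unfolding Z_def using zc
      by (intro ahom_finsum[OF TV.tensor_group Rg TV.lift_ahom[OF Rg vb]]) auto
    also have "... = (\<Oplus>\<^bsub>R\<^esub>u\<in>basis m. \<phi> (v *[A] (coord m u w .[A] u)))"
    proof (rule R.finsum_cong'[OF refl])
      fix u assume u: "u \<in> basis m"
      have cw: "coord m u w .: R" by (rule coord_closed[OF u w])
      show "presented_lift R (vpair v w) (?z u) = \<phi> (v *[A] (coord m u w .[A] u))"
        using TV.lift_pure[OF Rg vb \<alpha>[OF basis_props(2)[OF u]] basis_props(3)[OF u]]
          hcomp_rsmult[OF cw v] mult_balanced[OF cw hcomp_closed[OF v] hcomp_closed[OF basis_props(2)[OF u]]]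
        by simp
    qed (use coord_closed[OF _ w] v basis_props(2) in \<open>simp add: cl\<close>)
    also have "... = \<phi> (v *[A] w)" proof -
      have a: "ahom (hpart A m) R (\<lambda>u. \<phi> (v *[A] u))"
        using v by (intro ahomI) (simp_all add: hpart_simps cl A.r_distr V_add[OF \<phi>])
      have t: "coord m u w .[A] u \<in> hcomp A m" if "u \<in> basis m" for u
        using that coord_closed[OF _ w] basis_props(2) by (simp add: cl)
      have "(\<Oplus>\<^bsub>R\<^esub>u\<in>basis m. \<phi> (v *[A] (coord m u w .[A] u))) =
          \<phi> (v *[A] (\<Oplus>\<^bsub>hpart A m\<^esub>u\<in>basis m. coord m u w .[A] u))"
        using t by (intro ahom_finsum[OF left_module.axioms(2)[OF bimodule.axioms(1)[OF hpart_bimodule]] Rg a, symmetric]) (simp add: hpart_simps)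
      also have "(\<Oplus>\<^bsub>hpart A m\<^esub>u\<in>basis m. coord m u w .[A] u) = w"
        using hpart_finsum[where I = "basis m" and f = "\<lambda>u. coord m u w .[A] u", OF t] basis_props(4)[OF w, symmetric]
        by (rule trans)
      finally show ?thesis .
    qed
    finally show ?thesis .
  qed
  have "dual_tensor_map R A n m Z = mult_transpose R A n m \<phi>" proof (rule extensionalityI)
    have dz: "dual_tensor_map R A n m Z .: (left_dual R (TH n m))"
      using dual_tensor_map_pure(1)[OF Z hcomp_props(2) hcomp_props(2)] .
    then show "dual_tensor_map R A n m Z \<in> extensional (carrier (TH n m))"
      by (simp add: left_dual_simps)
    show "mult_transpose R A n m \<phi> \<in> extensional (carrier (TH n m))"
      by (simp add: mult_transpose_def)
    show "dual_tensor_map R A n m Z X = mult_transpose R A n m \<phi> X" if X: "X .: (TH n m)" for X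
      by (rule TH.tensor_eqI[OF Rg left_dual_ahom[OF dz] mult_transpose_props(2)[OF \<phi>] _ X])
        (simp add: hpart_simps mult_transpose_props(3)[OF \<phi>] dual_tensor_map_pure(2)[OF Z] Ze)
  qed
  then have im: "mult_transpose R A n m \<phi> \<in> dual_tensor_map R A n m ` carrier (TV n m)"
    using imageI[OF Z, of "dual_tensor_map R A n m"] by (simp only:)
  show c: "gr_dual_comult_comp R A n m \<phi> .: (TV n m)"
    unfolding gr_dual_comult_comp_def by (rule inv_into_into[OF im])
  have "dual_tensor_map R A n m (gr_dual_comult_comp R A n m \<phi>) = mult_transpose R A n m \<phi>"
    unfolding gr_dual_comult_comp_def by (rule f_inv_into_f[OF im])
  then show "presented_lift R (vpair v w) (gr_dual_comult_comp R A n m \<phi>) = \<phi> (v *[A] w)"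
    if "v \<in> hcomp A n" "w \<in> hcomp A m"
    using dual_tensor_map_pure(2)[OF c that] mult_transpose_props(3)[OF \<phi> that] by simp
qed

end

context finite_rring
begin

section \<open>The total comultiplication and its reduction to positive degrees\<close>

lemma DB_D: "carrier DB = carrier D" "x +[DB] y = x +[D] y" "r .[DB] x = r .[D] x" "x <[DB] r = x <[D] r"
  by (simp_all add: DB_simps D_simps)

lemma incl_ops: "incl n (\<alpha> +[V n] \<beta>) = incl n \<alpha> +[D] incl n \<beta>"
  "s .: R ==> incl n (s .[V n] \<alpha>) = s .[D] incl n \<alpha>"
  "s .: R ==> incl n (\<alpha> <[V n] s) = incl n \<alpha> <[D] s"
proof -
  note z = left_module.smult_zero[OF bimodule.axioms(1)[OF V_bimodule]] bimodule.zero_rsmult[OF V_bimodule]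
    abelian_monoid.l_zero[OF abelian_group.axioms(1)[OF V_group] abelian_monoid.zero_closed[OF abelian_group.axioms(1)[OF V_group]]]
  show "incl n (\<alpha> +[V n] \<beta>) = incl n \<alpha> +[D] incl n \<beta>"
    by (simp add: D_simps(3) gr_dual_incl_def fun_eq_iff z)
  show "s .: R ==> incl n (s .[V n] \<alpha>) = s .[D] incl n \<alpha>"
    "s .: R ==> incl n (\<alpha> <[V n] s) = incl n \<alpha> <[D] s"
    by (simp_all add: D_simps(4,5) gr_dual_incl_def fun_eq_iff z)
qed

lemma incl_bilin:
  "bilin (op_ring R) (V n) (V m) TD (\<lambda>(\<alpha>, \<beta>). tensor_pure (op_ring R) DB DB (incl n \<alpha>) (incl m \<beta>))"
proof (rule bilinI; unfold prod.case)
  note i = incl_closed[folded DB_D(1)]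
  show "ahom (V m) TD (\<lambda>\<beta>. tensor_pure (op_ring R) DB DB (incl n \<alpha>) (incl m \<beta>))" if "\<alpha> .: (V n)" for \<alpha>
    using that i by (intro ahomI) (simp_all add: TD.pure_closed TD.pure_add_r incl_ops(1) flip: DB_D(2))
  show "ahom (V n) TD (\<lambda>\<alpha>. tensor_pure (op_ring R) DB DB (incl n \<alpha>) (incl m \<beta>))" if "\<beta> .: (V m)" for \<beta>
    using that i by (intro ahomI) (simp_all add: TD.pure_closed TD.pure_add_l incl_ops(1) flip: DB_D(2))
  show "tensor_pure (op_ring R) DB DB (incl n (\<alpha> <[V n] r)) (incl m \<beta>) =
      tensor_pure (op_ring R) DB DB (incl n \<alpha>) (incl m (r .[V m] \<beta>))"
    if "\<alpha> .: (V n)" "r .: (op_ring R)" "\<beta> .: (V m)" for \<alpha> r \<beta>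
    using TD.pure_balanced[OF i[OF that(1)] that(2) i[OF that(3)]] that by (simp add: incl_ops(2,3) DB_D(3,4))
qed

abbreviation "jmap n m \<equiv> presented_lift TD (\<lambda>(\<alpha>, \<beta>). tensor_pure (op_ring R) DB DB (incl n \<alpha>) (incl m \<beta>))"
abbreviation "pairD a b \<equiv> presented_lift R (\<lambda>(y, z). evD y (a <[A] evD z b))"
abbreviation "pairQ a b \<equiv> presented_lift R (\<lambda>(y, z). eQ y (a <[A] eQ z b))"

lemma evD_closed: "x .: D ==> a .: A ==> evD x a .: R"
  using ahom_closed[OF evD_ahom] .

lemma pairD_bilin:
  assumes a: "a .: A" and b: "b .: A"
  shows "bilin (op_ring R) DB DB R (\<lambda>(y, z). evD y (a <[A] evD z b))"
proof (rule bilinI, unfold prod.case DB_D, goal_cases)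
  case (1 y)
  show ?case using a b evD_closed rsmult_closed
    by (intro ahomI) (simp_all add: DB_D evD_ops(1) rsmult_r_distr ahom_add[OF evD_ahom[OF 1]] 1)
next
  case (2 z)
  show ?case using a b evD_closed rsmult_closed 2 by (intro ahomI) (simp_all add: DB_D evD_ops(1))
next
  case (3 y r z)
  show ?case using 3 a b evD_closed rsmult_closed by (simp add: evD_ops(2,3) rsmult_assoc)
qed

lemma jmap_ahom: "ahom (TV n m) TD (jmap n m)" by (rule TV.lift_ahom[OF TD.tensor_group incl_bilin])

lemma incl_homog: "\<alpha> .: (V n) ==> a \<in> hcomp A i ==> evD (incl n \<alpha>) a = (if i = n then \<alpha> a else 0[R])"
  using evD_homog[OF incl_closed, of \<alpha> n a i] V_zero by (simp add: gr_dual_incl_def)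

text \<open>An included functional vanishes outside its own degree, so homogeneous arguments single
  out one bidegree of the comultiplication.\<close>

lemma pairD_jmap:
  assumes Z: "Z .: (TV n m)" and a: "a \<in> hcomp A i" and b: "b \<in> hcomp A j"
  shows "pairD a b (jmap n m Z) = (if (n, m) = (i, j) then presented_lift R (vpair a b) Z else 0[R])"
proof -
  note pb = pairD_bilin[OF hcomp_closed[OF a] hcomp_closed[OF b]]
  note l = ahom_comp[OF jmap_ahom TD.lift_ahom[OF Rg pb], of n m]
  have p: "pairD a b (jmap n m (tensor_pure (op_ring R) (V n) (V m) \<alpha> \<beta>)) =
      (if (n, m) = (i, j) then \<alpha> (a <[A] \<beta> b) else 0[R])" if ab: "\<alpha> .: (V n)" "\<beta> .: (V m)" for \<alpha> \<beta>
  proof -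
    have "pairD a b (jmap n m (tensor_pure (op_ring R) (V n) (V m) \<alpha> \<beta>)) = evD (incl n \<alpha>) (a <[A] evD (incl m \<beta>) b)"
      using TV.lift_pure[OF TD.tensor_group incl_bilin ab]
        TD.lift_pure[OF Rg pb, of "incl n \<alpha>" "incl m \<beta>"] incl_closed[OF ab(1)] incl_closed[OF ab(2)]
      by (simp add: DB_D)
    also have "evD (incl m \<beta>) b = (if j = m then \<beta> b else 0[R])" by (rule incl_homog[OF ab(2) b])
    also have "evD (incl n \<alpha>) (a <[A] (if j = m then \<beta> b else 0[R])) =
        (if i = n then \<alpha> (a <[A] (if j = m then \<beta> b else 0[R])) else 0[R])"
      using V_closed[OF ab(2), of b] b hcomp_rsmult[OF _ a] by (intro incl_homog[OF ab(1)]) auto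
    also have "... = (if (n, m) = (i, j) then \<alpha> (a <[A] \<beta> b) else 0[R])"
      using V_at_zero[OF ab(1)] ahom_zero[OF Rg abelian_group_axioms ahom_rsmult_right[OF hcomp_closed[OF a]]] by auto
    finally show ?thesis .
  qed
  show ?thesis proof (cases "(n, m) = (i, j)")
    case True
    have "pairD a b (jmap n m Z) = presented_lift R (vpair a b) Z"
    proof (rule TV.tensor_eqI[OF Rg l _ _ Z])
      show vl: "ahom (TV n m) R (presented_lift R (vpair a b))"
        using a b True by (intro TV.lift_ahom[OF Rg vpair_bilin]) auto
      fix \<alpha> \<beta> assume ab: "\<alpha> .: (V n)" "\<beta> .: (V m)"
      have "presented_lift R (vpair a b) (tensor_pure (op_ring R) (V n) (V m) \<alpha> \<beta>) = \<alpha> (a <[A] \<beta> b)"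
        using TV.lift_pure[OF Rg vpair_bilin ab, of a b] a b True by simp
      then show "pairD a b (jmap n m (tensor_pure (op_ring R) (V n) (V m) \<alpha> \<beta>)) =
          presented_lift R (vpair a b) (tensor_pure (op_ring R) (V n) (V m) \<alpha> \<beta>)"
        using p[OF ab] True by simp
    qed
    then show ?thesis using True by simp
  next
    case False
    have "pairD a b (jmap n m Z) = 0[R]" by (rule TV.tensor_eqI[OF Rg l ahom_zero_map[OF Rg] _ Z])
        (simp only: p False if_False)
    then show ?thesis using False by (simp only: if_False)
  qed
qed

text \<open>Of the finitely many bidegrees summed in \<open>gr_dual_comult\<close>, that of the
  arguments remains, and there the duality formula of the component applies. If this bidegree does
  not occur in the sum, the component of \<open>x\<close> is zero, and so are both sides.\<close>

lemma comult_props: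
  assumes x: "x .: D"
  shows "comult D x .: TD"
    and "a \<in> hcomp A i ==> b \<in> hcomp A j ==> pairD a b (comult D x) = x (i + j) (a *[A] b)"
proof -
  interpret T: abelian_group TD by (rule TD.tensor_group)
  let ?J = "{(n, m). x (n + m) \<noteq> 0[V (n + m)]}"
  let ?f = "\<lambda>(n, m). jmap n m (gr_dual_comult_comp R A n m (x (n + m)))"
  have eq: "comult D x = finsum TD ?f ?J" by (simp add: D_simps(7) gr_dual_comult_def Let_def)
  have fc: "?f nm .: TD" for nm
    using ahom_closed[OF jmap_ahom comult_comp_props(1)[OF D_apply[OF x]]] by (simp add: case_prod_beta)
  then show "comult D x .: TD" unfolding eq by (intro T.finsum_closed) auto
  obtain N where N: "\<And>k. N \<le> k ==> x k = 0[V k]" using D_bound[OF x] by blast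
  \<comment> \<open>Both indices are at most \<open>n + m\<close>, which stays below the bound on
    the support of \<open>x\<close>; without finiteness the sum would be zero by convention.\<close>
  have fin: "finite ?J"
    by (rule finite_subset[of _ "{..<N} \<times> {..<N}"]) (use N in \<open>force simp: not_less\<close>, simp)
  assume a: "a \<in> hcomp A i" and b: "b \<in> hcomp A j"
  have ab: "a *[A] b \<in> hcomp A (i + j)" using mult_degree[OF a b] .
  have v: "x (i + j) (a *[A] b) .: R" using V_closed[OF D_apply[OF x] ab] .
  note pl = TD.lift_ahom[OF Rg pairD_bilin[OF hcomp_closed[OF a] hcomp_closed[OF b]]]
  have t: "pairD a b (?f nm) = (if (i, j) = nm then x (i + j) (a *[A] b) else 0[R])" for nm
    using pairD_jmap[OF comult_comp_props(1)[OF D_apply[OF x]] a b, of "fst nm" "snd nm"]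
      comult_comp_props(2)[OF D_apply[OF x] a b] by (cases nm) auto
  have "pairD a b (comult D x) = (\<Oplus>\<^bsub>R\<^esub>nm\<in>?J. pairD a b (?f nm))"
    unfolding eq using fc by (intro ahom_finsum[OF TD.tensor_group Rg pl]) blast
  also have "... = (\<Oplus>\<^bsub>R\<^esub>nm\<in>?J. if (i, j) = nm then x (i + j) (a *[A] b) else 0[R])"
    using t v by (intro R.finsum_cong') auto
  also have "... = x (i + j) (a *[A] b)" proof (cases "(i, j) \<in> ?J")
    case True
    then show ?thesis using R.finsum_singleton[OF True fin, of "\<lambda>_. x (i + j) (a *[A] b)"] v by simp
  next
    case False
    then have "(\<Oplus>\<^bsub>R\<^esub>nm\<in>?J. if (i, j) = nm then x (i + j) (a *[A] b) else 0[R]) = (\<Oplus>\<^bsub>R\<^esub>nm\<in>?J. 0[R])"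
      by (intro R.finsum_cong') auto
    then show ?thesis using False V_zero[OF ab] by (simp add: R.finsum_zero)
  qed
  finally show "pairD a b (comult D x) = x (i + j) (a *[A] b)" .
qed

lemma pi_bilin: "bilin (op_ring R) DB DB TQ (\<lambda>(x, y). tensor_pure (op_ring R) Q Q (\<pi> x) (\<pi> y))"
proof (rule bilinI, unfold prod.case DB_D, goal_cases)
  case (1 x)
  show ?case
    using 1 by (intro ahomI) (simp_all add: DB_D TQ.pure_closed TQ.pure_add_r pi_closed flip: Q_add)
next
  case (2 y)
  show ?case
    using 2 by (intro ahomI) (simp_all add: DB_D TQ.pure_closed TQ.pure_add_l pi_closed flip: Q_add)
next
  case (3 x r y)
  show ?case using TQ.pure_balanced[of "\<pi> x" r "\<pi> y"] 3 by (simp add: pi_closed Q_smult Q_rsmult)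
qed

abbreviation "cmpQ \<equiv> comult_pos (op_ring R) D"

lemma pairQ_bilin:
  assumes "a .: AP" "b .: AP"
  shows "bilin (op_ring R) Q Q R (\<lambda>(y, z). eQ y (a <[A] eQ z b))"
  using paired.pairing_bilin[OF paired_Q assms] by (simp add: pos_simps)

lemma AP_rscale: "a .: AP ==> r .: R ==> a <[A] r .: AP"
  using P.rsmult_closed[of r a] by (simp add: pos_simps)

text \<open>The reduced comultiplication is paired through a representative in \<open>D\<close>.
  Positive degrees are required because the evaluations of a class and of its representatives agree
  on \<open>A_+\<close>.\<close>

lemma comult_pos_closed:
  assumes X: "X .: Q"
  shows "cmpQ X .: TQ"
    and "a \<in> hcomp A i ==> 0 < i ==> b \<in> hcomp A j ==> 0 < j ==> pairQ a b (cmpQ X) = eQ X (a *[A] b)"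
proof -
  obtain x where x: "x .: D" "X = \<pi> x" using X by (rule QE)
  define d where "d = (SOME d. d \<in> X)"
  have d: "d .: D" unfolding d_def x(2) by (rule coset_val(1)[OF x(1) some_coset[OF x(1)]])
  note la = TD.lift_ahom[OF TQ.tensor_group pi_bilin] and cd = comult_props[OF d]
  have eq: "cmpQ X = presented_lift TQ (\<lambda>(x, y). tensor_pure (op_ring R) Q Q (\<pi> x) (\<pi> y)) (comult D d)"
    by (simp add: comult_pos_def d_def)
  show "cmpQ X .: TQ" unfolding eq by (rule ahom_closed[OF la cd(1)])
  assume a: "a \<in> hcomp A i" "0 < i" and b: "b \<in> hcomp A j" "0 < j"
  note ab = hcomp_pos[OF a] hcomp_pos[OF b]
  note pq = pairQ_bilin[OF ab] and pd = pairD_bilin[OF pos_closed[OF ab(1)] pos_closed[OF ab(2)]]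
  have "pairQ a b (cmpQ X) = pairD a b (comult D d)" unfolding eq
  proof (rule TD.tensor_eqI[OF Rg _ TD.lift_ahom[OF Rg pd] _ cd(1)])
    show "ahom TD R (\<lambda>Z. pairQ a b (presented_lift TQ (\<lambda>(x, y). tensor_pure (op_ring R) Q Q (\<pi> x) (\<pi> y)) Z))"
      by (rule ahom_comp[OF la TQ.lift_ahom[OF Rg pq]])
    fix y z assume yz: "y .: DB" "z .: DB"
    then have yz': "y .: D" "z .: D" by (simp_all add: DB_D)
    have "eQ (\<pi> y) (a <[A] eQ (\<pi> z) b) = evD y (a <[A] evD z b)"
      using eQ_pi[OF yz'(2) ab(2)] eQ_pi[OF yz'(1) AP_rscale[OF ab(1) evD_closed[OF yz'(2) pos_closed[OF ab(2)]]]] by simp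
    then show "pairQ a b (presented_lift TQ (\<lambda>(x, y). tensor_pure (op_ring R) Q Q (\<pi> x) (\<pi> y)) (tensor_pure (op_ring R) DB DB y z)) =
        pairD a b (tensor_pure (op_ring R) DB DB y z)"
      using TD.lift_pure[OF TQ.tensor_group pi_bilin yz] TD.lift_pure[OF Rg pd yz]
        TQ.lift_pure[OF Rg pq pi_closed[OF yz'(1)] pi_closed[OF yz'(2)]] by simp
  qed
  also have "... = d (i + j) (a *[A] b)" by (rule cd(2)[OF a(1) b(1)])
  \<comment> \<open>\<open>comult_pos\<close> and \<open>eQ\<close> select the same representative
    \<open>d\<close> of the class.\<close>
  also have "... = eQ X (a *[A] b)"
    using evD_homog[OF d mult_degree[OF a(1) b(1)]] by (simp add: eQ_def d_def)
  finally show "pairQ a b (cmpQ X) = eQ X (a *[A] b)" .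
qed

text \<open>Both sides are additive in \<open>a\<close> and in \<open>b\<close>, which extends the
  homogeneous case to all of \<open>A_+\<close>.\<close>

lemma comult_pos_pair:
  assumes X: "X .: Q" and a: "a .: AP" and b: "b .: AP"
  shows "pairQ a b (cmpQ X) = eQ X (a *[A] b)"
proof -
  note cX = comult_pos_closed(1)[OF X] and eX = ahom_add[OF eQ_right[OF X]]
  note pl = TQ.lift_ahom[OF Rg pairQ_bilin]
  note pp = TQ.lift_pure[OF Rg pairQ_bilin]
  have l: "pairQ (a +[A] a') b W = pairQ a b W +[R] pairQ a' b W"
    if a: "a .: AP" "a' .: AP" and b: "b .: AP" and W: "W .: TQ" for a a' b W
  proof (rule TQ.tensor_eqI[OF Rg pl ahom_plus[OF Rg pl[OF a(1) b] pl[OF a(2) b]] _ W])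
    show s: "a +[A] a' .: AP" "b .: AP" using P.M.a_closed[OF a] b by (simp_all add: pos_simps)
    show "pairQ (a +[A] a') b (tensor_pure (op_ring R) Q Q y z) =
        pairQ a b (tensor_pure (op_ring R) Q Q y z) +[R] pairQ a' b (tensor_pure (op_ring R) Q Q y z)"
      if yz: "y .: Q" "z .: Q" for y z
      using ahom_add[OF eQ_right[OF yz(1)] AP_rscale[OF a(1)] AP_rscale[OF a(2)]] eQ_closed[OF yz(2) b] a b s yz
      by (simp add: pp rsmult_l_distr pos_closed pos_simps)
  qed
  have r: "pairQ a (b +[A] b') W = pairQ a b W +[R] pairQ a b' W"
    if a: "a .: AP" and b: "b .: AP" "b' .: AP" and W: "W .: TQ" for a b b' W
  proof (rule TQ.tensor_eqI[OF Rg pl ahom_plus[OF Rg pl[OF a b(1)] pl[OF a b(2)]] _ W])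
    show s: "a .: AP" "b +[A] b' .: AP" using P.M.a_closed[OF b] a by (simp_all add: pos_simps)
    show "pairQ a (b +[A] b') (tensor_pure (op_ring R) Q Q y z) =
        pairQ a b (tensor_pure (op_ring R) Q Q y z) +[R] pairQ a b' (tensor_pure (op_ring R) Q Q y z)"
      if yz: "y .: Q" "z .: Q" for y z
      using ahom_add[OF eQ_right[OF yz(1)] AP_rscale[OF a] AP_rscale[OF a]] ahom_add[OF eQ_right[OF yz(2)] b]
        eQ_closed[OF yz(2)] a b s yz by (simp add: pp rsmult_r_distr pos_closed pos_simps)
  qed
  from a show ?thesis proof (induction rule: pos_induct)
    case (homog i a)
    from b show ?case proof (induction rule: pos_induct)
      case (homog j b)
      then show ?case using comult_pos_closed(2)[OF X \<open>a \<in> hcomp A i\<close> \<open>0 < i\<close>] by blast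
    next
      case (add b b')
      have a: "a .: AP" using homog hcomp_pos by blast
      show ?case
        using add a r[OF a add(1,2) cX] eX[of "a *[A] b" "a *[A] b'"] mult_pos[OF a add(1)] mult_pos[OF a add(2)]
        by (simp add: pos_simps A.r_distr pos_closed)
    qed
  next
    case (add a a')
    then show ?case
      using l[OF add(1,2) b cX] eX[of "a *[A] b" "a' *[A] b"] mult_pos[OF add(1) b] mult_pos[OF add(2) b] b
      by (simp add: pos_simps A.l_distr pos_closed)
  qed
qed

lemma bar_pairing_Q: "bar_pairing R A Q eQ Ix snd qx cmpQ"
  by (intro bar_pairing.intro connected_graded_rring_axioms paired_Q bar_pairing_axioms.intro
      comult_pos_closed(1) comult_pos_pair)

lemma cobar_diff_eq: "cobar_diff (op_ring R) D = bar_pairing.codiff R Q cmpQ"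
  by (simp add: fun_eq_iff cobar_diff_def bar_pairing.codiff_def[OF bar_pairing_Q] Let_def)

lemma eQ_vanishes:
  assumes "X .: Q"
  shows "\<exists>N. \<forall>k>N. \<forall>a\<in>hcomp A k. eQ X a = 0[R]"
proof -
  obtain x where x: "x .: D" "X = \<pi> x" using assms by (rule QE)
  obtain N where N: "\<And>k. N \<le> k ==> x k = 0[V k]" using D_bound[OF x(1)] by blast
  have "eQ X a = 0[R]" if k: "N < k" and a: "a \<in> hcomp A k" for k a
    using eQ_pi[OF x(1) hcomp_pos[OF a]] evD_homog[OF x(1) a] N[of k] V_zero[OF a] k x(2) by simp
  then show ?thesis by blast
qed

end

section \<open>The comparison applied to the graded dual\<close>

theorem corollary2p4:
  fixes R :: "'r ring"
    and A :: "('r, 'a) graded_bimodule"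
    and C :: "('r, 'c) graded_coring"
    and \<theta> :: "'c \<Rightarrow> 'a"
  assumes "semisimple_ring R"
    and "connected_graded_rring R A" and "left_locally_finite R A"
    and "connected_graded_coring R C" and "left_locally_finite R C"
    and "koszul_pair R A C \<theta>"
  shows "\<exists>\<phi>. \<phi> \<in> graded_ring_iso (ext_ring R A) (coring_ext_ring (op_ring R) (gr_dual R A))"
proof -
  interpret F: finite_rring R A
    using assms(1-3) by (intro finite_rring.intro finite_rring_axioms.intro)
  interpret K: koszul R A C \<theta> using assms by (intro koszul.intro koszul_axioms.intro)
  \<comment> \<open>The bimodule paired with \<open>A_+\<close> is the quotient of the graded dual
    by its degree 0 part, with the dual bases of the homogeneous components and the reduced
    comultiplication.\<close>
  interpret B: koszul_bar_pairing R A C \<theta> "coring_pos (gr_dual R A)" F.eQ F.Ix snd F.qx "comult_pos (op_ring R) (gr_dual R A)"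
    by (intro koszul_bar_pairing.intro K.koszul_axioms F.bar_pairing_Q koszul_bar_pairing_axioms.intro
        F.basis_proj F.eQ_vanishes)
  show ?thesis unfolding ext_ring_def coring_ext_ring_def F.cobar_diff_eq op_ring_simps
    by (rule cochain_ring_comparison.cohomology_ring_iso[OF B.comparison])
qed

end
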